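(* Let $p,q\ge 1$ and $r\ge 2$ be integers and let $\Lambda$ be a dynamically natural slice for the family $\mathcal{M}_{p,q,r}$ of meromorphic functions of the form $f_\lambda=P\circ g\circ Q$ ($g\in\mathcal{N}_r$, $P,Q$ polynomials of degrees $p,q$) all of whose asymptotic values are finite. Let $\lambda^*\in\Lambda$ be a virtual cycle parameter of order $k$. Then $\lambda^*$ lies on the boundary of a shell component of period $k$ in $\Lambda$. That is, in any neighborhood of $\lambda^*$ there exists $\lambda\in\Lambda$ such that $f_\lambda$ has an attracting cycle of period $k$.
   Context: Meromorphic functions are transcendental, $f:\mathbb{C}\to\widehat{\mathbb{C}}$, with essential singularity at $\infty$. A singular value of $f$ is a critical value or an asymptotic value (a point $v=\lim_{t\to\infty}f(\gamma(t))$ for some path $\gamma$ with $\gamma(t)\to\infty$), or an accumulation point of these. For an isolated asymptotic value $v$, an asymptotic tract is a simply connected unbounded domain $V$ on which $f:V\to D\setminus\{v\}$ is a universal covering, $D$ a small disk about $v$; the multiplicity of $v$ is its number of distinct asymptotic tracts. Asymptotic values are counted with multiplicity. $\mathcal{N}_r$ is the set of meromorphic functions with exactly $r<\infty$ asymptotic values and no critical values. $\widetilde{\mathcal{M}}_{p,q,r}=\{P\circ g\circ Q : g\in\mathcal{N}_r,\ P,Q \text{ polynomials of degrees } p,q\}$, and $\mathcal{M}_{p,q,r}\subset\widetilde{\mathcal{M}}_{p,q,r}$ is the subset of functions for which $\infty$ is not an asymptotic value. It is regarded as a holomorphic family over a complex manifold $X$: $(x,z)\mapsto f_x(z)$ is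 meromorphic in $z$ and holomorphic in $x$. A periodic cycle of period $k$ with multiplier $\mu$ (the derivative of $f^k$ at a point of the cycle) is attracting if $0<|\mu|<1$ and super-attracting if $\mu=0$. A parameter $x_0$ is $J$-stable if the number of attracting cycles of $f_x$ is locally constant near $x_0$ (equivalently, there is a holomorphic motion of the Julia set over a neighborhood of $x_0$ respecting the dynamics). The bifurcation locus is the set of non-$J$-stable parameters. For a holomorphically parametrized singular value $s(x)$, $\mathcal{B}_X(s)$ is the set of $x_0$ such that $\{x\mapsto f_x^n(s(x))\}_n$ is not normal in any neighborhood of $x_0$. Dynamically natural slice: a one-dimensional subset $\Lambda\subset X$ such that (a) $\Lambda$ is holomorphically isomorphic to $\mathbb{C}$ punctured at the points where the function is not in the family (e.g. where the number of singular values drops); the removed points are called parameter singularities. $\Lambda$ is identified with its image in $\mathbb{C}$, with variable $\lambda$. (b) The singular values are given by distinct holomorphic functions $s_i(\lambda)$, $i=1,\dots,N-1$, and an asymptotic value $v_\lambda$ that is an affine function of $\lambda$, called the free asymptotic value; and $\mathcal{B}_\Lambda(v_\lambda)\neq\emptyset$. (c) The poles are given by distinct holomorphic functions $p_i(\lambda)$, $i\in\mathbb{Z}$. (d) The critical values and some of the asymptotic values are attracted to an attracting (possibly super-attracting) or parabolic cycle whose period and multiplier are constant for all $\lambda\in\Lambda$; these are the dynamically fixed singular values. The remaining singular values include $v_\lambda$; if there is more than one remaining, they satisfy a relation persisting throughout $\Lambda$, so that the remaining dynamical behavior is controlled by that of $v_\lambda$. (e) If $v_{\lambda_0}$ is attracted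 to the basin $\mathcal{A}_{\lambda_0}$ of an attracting cycle that attracts none of the dynamically fixed singular values, then $\Lambda$ contains, up to affine conjugacy, all meromorphic maps $\mathbb{C}\to\widehat{\mathbb{C}}$ that are quasiconformally conjugate to $f_{\lambda_0}$ in $\mathbb{C}$ and conformally conjugate to $f_{\lambda_0}$ on $\mathbb{C}\setminus\mathcal{A}_{\lambda_0}$. (f) $\Lambda$ is maximal: adding a parameter singularity to $\Lambda$ makes at least one of the conditions above fail. Shell component: a connected component $\Omega$ of the complement of the bifurcation locus in $\Lambda$ in which $v_\lambda$ is attracted to an attracting cycle that attracts none of the dynamically fixed singular values. The period of this cycle is constant on $\Omega$ and is called the period of $\Omega$. Virtual cycle parameter of order $k$ ($k\geq 2$): a parameter $\lambda\in\Lambda$ for which there are points $a_1=v_\lambda,a_2,\dots,a_{k-1}\in\mathbb{C}$ and $a_0=\infty$ with $f_\lambda(a_i)=a_{i+1}$ for $i=1,\dots,k-1$ (indices mod $k$); i.e. $f_\lambda^{k-1}(v_\lambda)=\infty$, with $v_\lambda$ a prepole of order $k-1$. *)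

theory Defs
  imports "HOL-Complex_Analysis.Complex_Analysis"
begin

text \<open>
  The Riemann sphere is \<open>complex option\<close>, with \<open>None\<close> the point at infinity. Its topology and
  its (chordal) metric are those of the unit sphere of \<open>complex \<times> real\<close>, to which it is
  identified by stereographic projection; all limits, covering maps and uniform limits of
  sphere-valued functions are taken after composing with \<open>stereo\<close>.
\<close>

fun stereo :: "complex option \<Rightarrow> complex \<times> real" where
  "stereo None = (0, 1)"
| "stereo (Some z) =
     ((2 / (1 + (cmod z)\<^sup>2)) *\<^sub>R z, ((cmod z)\<^sup>2 - 1) / ((cmod z)\<^sup>2 + 1))"

definition sph :: "(complex \<Rightarrow> complex) \<Rightarrow> complex \<Rightarrow> complex option" where
  "sph f z = (if is_pole f z then None else Some (f z))"

text \<open>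
  \<open>nicely_meromorphic_on\<close> removes all removable singularities, and fixes the value 0 at poles, so
  such an \<open>f\<close> is determined by \<open>sph f\<close>. The condition at infinity also covers the case in which
  poles accumulate at infinity: then \<open>\<lambda>z. f (1 / z)\<close> has no isolated singularity at 0.
\<close>

definition transcendental_meromorphic :: "(complex \<Rightarrow> complex) \<Rightarrow> bool" where
  "transcendental_meromorphic f \<longleftrightarrow>
     f nicely_meromorphic_on UNIV \<and> \<not> (\<lambda>z. f (1 / z)) meromorphic_on {0}"

text \<open>Critical points of the map into the sphere: multiple poles are included.\<close>

definition critical_point :: "(complex \<Rightarrow> complex) \<Rightarrow> complex \<Rightarrow> bool" where
  "critical_point f z \<longleftrightarrow> (if is_pole f z then zorder f z < -1 else deriv f z = 0)"

definition critical_values :: "(complex \<Rightarrow> complex) \<Rightarrow> complex option set" where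
  "critical_values f = sph f ` {z. critical_point f z}"

definition asymptotic_values :: "(complex \<Rightarrow> complex) \<Rightarrow> complex option set" where
  "asymptotic_values f =
     {v. \<exists>\<gamma> :: real \<Rightarrow> complex. continuous_on {0..} \<gamma> \<and> filterlim \<gamma> at_infinity at_top \<and>
           ((\<lambda>t. stereo (sph f (\<gamma> t))) \<longlongrightarrow> stereo v) at_top}"

definition singular_values :: "(complex \<Rightarrow> complex) \<Rightarrow> complex option set" where
  "singular_values f = critical_values f \<union> asymptotic_values f \<union>
     {w. stereo w islimpt stereo ` (critical_values f \<union> asymptotic_values f)}"

definition asymptotic_tract ::
  "(complex \<Rightarrow> complex) \<Rightarrow> complex option \<Rightarrow> real \<Rightarrow> complex set \<Rightarrow> bool" where
  "asymptotic_tract f v \<epsilon> V \<longleftrightarrow>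
     open V \<and> connected V \<and> simply_connected V \<and> \<not> bounded V \<and>
     covering_space V (stereo \<circ> sph f)
       (stereo ` {w. w \<noteq> v \<and> dist (stereo w) (stereo v) < \<epsilon>})"

text \<open>
  For a fixed disk the tracts are components of the preimage of the punctured disk, hence
  pairwise disjoint; their number does not depend on the disk once it is small.
\<close>

definition has_asymptotic_multiplicity ::
  "(complex \<Rightarrow> complex) \<Rightarrow> complex option \<Rightarrow> nat \<Rightarrow> bool" where
  "has_asymptotic_multiplicity f v m \<longleftrightarrow>
     (\<forall>\<^sub>F \<epsilon> in at_right 0.
        finite {V. asymptotic_tract f v \<epsilon> V} \<and> card {V. asymptotic_tract f v \<epsilon> V} = m)"

definition class_N :: "nat \<Rightarrow> (complex \<Rightarrow> complex) set" where
  "class_N r =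
     {g. transcendental_meromorphic g \<and> critical_values g = {} \<and>
         finite (asymptotic_values g) \<and>
         (\<exists>m. (\<forall>v\<in>asymptotic_values g. has_asymptotic_multiplicity g v (m v)) \<and>
              (\<Sum>v\<in>asymptotic_values g. m v) = r)}"

definition class_M_tilde :: "nat \<Rightarrow> nat \<Rightarrow> nat \<Rightarrow> (complex \<Rightarrow> complex) set" where
  "class_M_tilde p q r =
     {f. transcendental_meromorphic f \<and>
         (\<exists>P g Q. degree P = p \<and> degree Q = q \<and> g \<in> class_N r \<and>
            (\<forall>z. sph f z = map_option (poly P) (sph g (poly Q z))))}"

definition class_M :: "nat \<Rightarrow> nat \<Rightarrow> nat \<Rightarrow> (complex \<Rightarrow> complex) set" where
  "class_M p q r = {f \<in> class_M_tilde p q r. None \<notin> asymptotic_values f}"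

text \<open>
  \<open>(x, z) \<mapsto> sph (f x) z\<close> is a holomorphic map from \<open>X \<times> \<complex>\<close> to the sphere, expressed in its two
  charts: locally, either the map or its reciprocal is finite-valued and holomorphic in \<open>x\<close>
  (in \<open>z\<close> it is meromorphic by the first conjunct).
  At a pole \<open>inverse (f x z) = inverse 0 = 0\<close>, which is the value of the reciprocal there.
\<close>

definition holomorphic_family ::
  "complex set \<Rightarrow> (complex \<Rightarrow> complex \<Rightarrow> complex) \<Rightarrow> bool" where
  "holomorphic_family X f \<longleftrightarrow>
     (\<forall>x\<in>X. f x nicely_meromorphic_on UNIV) \<and>
     (\<forall>x\<^sub>0\<in>X. \<forall>z\<^sub>0. \<exists>U W. open U \<and> x\<^sub>0 \<in> U \<and> U \<subseteq> X \<and> open W \<and> z\<^sub>0 \<in> W \<and>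
        ((\<forall>x\<in>U. \<forall>z\<in>W. \<not> is_pole (f x) z) \<and>
           (\<forall>z\<in>W. (\<lambda>x. f x z) holomorphic_on U) \<or>
         (\<forall>x\<in>U. \<forall>z\<in>W. is_pole (f x) z \<or> f x z \<noteq> 0) \<and>
           (\<forall>z\<in>W. (\<lambda>x. inverse (f x z)) holomorphic_on U)))"

text \<open>
  A cycle avoids the poles, so near its points the iterates \<open>f ^^ n\<close> of the complex-valued
  function are the iterates of the meromorphic map.
\<close>

definition cycle :: "(complex \<Rightarrow> complex) \<Rightarrow> nat \<Rightarrow> complex set \<Rightarrow> bool" where
  "cycle f k C \<longleftrightarrow>
     k \<ge> 1 \<and> (\<forall>z\<in>C. \<not> is_pole f z) \<and>
     (\<exists>z. (f ^^ k) z = z \<and> inj_on (\<lambda>j. (f ^^ j) z) {..<k} \<and> C = (\<lambda>j. (f ^^ j) z) ` {..<k})"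

text \<open>By the chain rule the multiplier does not depend on the point of the cycle.\<close>

definition has_multiplier ::
  "(complex \<Rightarrow> complex) \<Rightarrow> nat \<Rightarrow> complex set \<Rightarrow> complex \<Rightarrow> bool" where
  "has_multiplier f k C \<mu> \<longleftrightarrow> cycle f k C \<and> (\<forall>z\<in>C. deriv (f ^^ k) z = \<mu>)"

definition attracting_cycle :: "(complex \<Rightarrow> complex) \<Rightarrow> nat \<Rightarrow> complex set \<Rightarrow> bool" where
  "attracting_cycle f k C \<longleftrightarrow> (\<exists>\<mu>. has_multiplier f k C \<mu> \<and> 0 < cmod \<mu> \<and> cmod \<mu> < 1)"

definition superattracting_cycle :: "(complex \<Rightarrow> complex) \<Rightarrow> nat \<Rightarrow> complex set \<Rightarrow> bool" where
  "superattracting_cycle f k C \<longleftrightarrow> has_multiplier f k C 0"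

text \<open>
  Locally uniform convergence of the iterates to the cycle. For (super-)attracting cycles this
  is the same as pointwise convergence; for parabolic cycles it excludes the points of the
  Julia set that are eventually mapped onto the cycle.
\<close>

definition basin :: "(complex \<Rightarrow> complex) \<Rightarrow> complex set \<Rightarrow> complex set" where
  "basin f C =
     {z. \<exists>U. open U \<and> z \<in> U \<and> (\<forall>n. \<forall>w\<in>U. \<not> is_pole f ((f ^^ n) w)) \<and>
           uniform_limit U (\<lambda>n w. infdist ((f ^^ n) w) C) (\<lambda>_. 0) sequentially}"

text \<open>
  Superattracting cycles are counted too: otherwise the number would change at every parameter
  at which an attracting cycle becomes superattracting, although the Julia set moves
  holomorphically there.
\<close>

definition J_stable :: "complex set \<Rightarrow> (complex \<Rightarrow> complex \<Rightarrow> complex) \<Rightarrow> complex \<Rightarrow> bool" where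
  "J_stable X f x\<^sub>0 \<longleftrightarrow>
     (\<exists>U n. open U \<and> x\<^sub>0 \<in> U \<and> U \<subseteq> X \<and>
        (\<forall>x\<in>U. let A = {C. \<exists>k. attracting_cycle (f x) k C \<or> superattracting_cycle (f x) k C}
                in finite A \<and> card A = n))"

definition bifurcation_locus :: "complex set \<Rightarrow> (complex \<Rightarrow> complex \<Rightarrow> complex) \<Rightarrow> complex set" where
  "bifurcation_locus X f = {x \<in> X. \<not> J_stable X f x}"

text \<open>
  The image of infinity is undefined. Here an orbit that reaches infinity stays there, so that
  the sequence of iterates of a singular value that is mapped to infinity after \<open>m\<close> steps on
  a whole open set (really a finite sequence) counts as normal there.
  If a singular value reaches infinity only at an isolated parameter, then the following iterate
  has an essential singularity at it, so is not continuous, and normality fails.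
\<close>

definition orbit :: "(complex \<Rightarrow> complex) \<Rightarrow> complex \<Rightarrow> nat \<Rightarrow> complex option" where
  "orbit f z n = ((\<lambda>w. Option.bind w (sph f)) ^^ n) (Some z)"

definition normal_sequence_on :: "complex set \<Rightarrow> (nat \<Rightarrow> complex \<Rightarrow> complex option) \<Rightarrow> bool" where
  "normal_sequence_on U F \<longleftrightarrow>
     (\<forall>n. continuous_on U (stereo \<circ> F n)) \<and>
     (\<forall>a :: nat \<Rightarrow> nat. strict_mono a \<longrightarrow>
        (\<exists>(b :: nat \<Rightarrow> nat) h. strict_mono b \<and>
           (\<forall>K. compact K \<and> K \<subseteq> U \<longrightarrow>
              uniform_limit K (\<lambda>n. stereo \<circ> F (a (b n))) h sequentially)))"

definition activity_locus ::
  "complex set \<Rightarrow> (complex \<Rightarrow> complex \<Rightarrow> complex) \<Rightarrow> (complex \<Rightarrow> complex) \<Rightarrow> complex set" where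
  "activity_locus X f s =
     {x\<^sub>0 \<in> X. \<not> (\<exists>U. open U \<and> x\<^sub>0 \<in> U \<and> U \<subseteq> X \<and>
                   normal_sequence_on U (\<lambda>n x. orbit (f x) (s x) n))}"

definition absolutely_continuous_on_interval ::
  "real \<Rightarrow> real \<Rightarrow> (real \<Rightarrow> complex) \<Rightarrow> bool" where
  "absolutely_continuous_on_interval a b g \<longleftrightarrow>
     (\<forall>\<epsilon>>0. \<exists>\<delta>>0. \<forall>(n::nat) (l :: nat \<Rightarrow> real) (u :: nat \<Rightarrow> real).
        (\<forall>i<n. a \<le> l i \<and> l i \<le> u i \<and> u i \<le> b) \<and>
        (\<forall>i<n. \<forall>j<n. i \<noteq> j \<longrightarrow> {l i<..<u i} \<inter> {l j<..<u j} = {}) \<and>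
        (\<Sum>i<n. u i - l i) < \<delta>
        \<longrightarrow> (\<Sum>i<n. cmod (g (u i) - g (l i))) < \<epsilon>)"

definition absolutely_continuous_on_lines :: "(complex \<Rightarrow> complex) \<Rightarrow> bool" where
  "absolutely_continuous_on_lines \<phi> \<longleftrightarrow>
     (AE y in lborel. \<forall>a b. absolutely_continuous_on_interval a b (\<lambda>t. \<phi> (Complex t y))) \<and>
     (AE x in lborel. \<forall>a b. absolutely_continuous_on_interval a b (\<lambda>t. \<phi> (Complex x t)))"

definition dx :: "(complex \<Rightarrow> complex) \<Rightarrow> complex \<Rightarrow> complex" where
  "dx \<phi> z = vector_derivative (\<lambda>t. \<phi> (z + of_real t)) (at 0)"

definition dy :: "(complex \<Rightarrow> complex) \<Rightarrow> complex \<Rightarrow> complex" where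
  "dy \<phi> z = vector_derivative (\<lambda>t. \<phi> (z + \<i> * of_real t)) (at 0)"

definition dz :: "(complex \<Rightarrow> complex) \<Rightarrow> complex \<Rightarrow> complex" where
  "dz \<phi> z = (dx \<phi> z - \<i> * dy \<phi> z) / 2"

definition dzbar :: "(complex \<Rightarrow> complex) \<Rightarrow> complex \<Rightarrow> complex" where
  "dzbar \<phi> z = (dx \<phi> z + \<i> * dy \<phi> z) / 2"

text \<open>The analytic definition; such a homeomorphism preserves the orientation.\<close>

definition quasiconformal :: "(complex \<Rightarrow> complex) \<Rightarrow> bool" where
  "quasiconformal \<phi> \<longleftrightarrow>
     (\<exists>\<psi>. homeomorphism UNIV UNIV \<phi> \<psi>) \<and> absolutely_continuous_on_lines \<phi> \<and>
     (\<exists>\<kappa><1. AE z in lborel. cmod (dzbar \<phi> z) \<le> \<kappa> * cmod (dz \<phi> z))"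

text \<open>
  A set such as the complement of a basin need not be open, so conformality of a quasiconformal
  map on it means that the Beltrami coefficient vanishes almost everywhere on it.
\<close>

definition conformal_ae_on :: "complex set \<Rightarrow> (complex \<Rightarrow> complex) \<Rightarrow> bool" where
  "conformal_ae_on S \<phi> \<longleftrightarrow> (AE z in lborel. z \<in> S \<longrightarrow> dzbar \<phi> z = 0)"

definition conjugates ::
  "(complex \<Rightarrow> complex) \<Rightarrow> (complex \<Rightarrow> complex) \<Rightarrow> (complex \<Rightarrow> complex) \<Rightarrow> bool" where
  "conjugates \<phi> f h \<longleftrightarrow> (\<forall>z. sph h (\<phi> z) = map_option \<phi> (sph f z))"

definition affinely_conjugate :: "(complex \<Rightarrow> complex) \<Rightarrow> (complex \<Rightarrow> complex) \<Rightarrow> bool" where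
  "affinely_conjugate f h \<longleftrightarrow> (\<exists>a b. a \<noteq> 0 \<and> conjugates (\<lambda>z. a * z + b) f h)"

text \<open>
  Throughout, \<open>s i\<close> for \<open>1 \<le> i < N\<close> and \<open>v\<close> parametrize the (finite) singular values of the maps
  \<open>f x\<close>, \<open>x \<in> \<Lambda>\<close>, where \<open>v\<close> is the free asymptotic value; \<open>F\<close> is the set of those \<open>i\<close> for which
  \<open>s i\<close> is dynamically fixed.
\<close>

definition attracted_away_from_fixed ::
  "(complex \<Rightarrow> complex \<Rightarrow> complex) \<Rightarrow> (nat \<Rightarrow> complex \<Rightarrow> complex) \<Rightarrow> (complex \<Rightarrow> complex) \<Rightarrow>
   nat set \<Rightarrow> complex \<Rightarrow> nat \<Rightarrow> complex set \<Rightarrow> bool" where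
  "attracted_away_from_fixed f s v F x k C \<longleftrightarrow>
     attracting_cycle (f x) k C \<and> v x \<in> basin (f x) C \<and> (\<forall>i\<in>F. s i x \<notin> basin (f x) C)"

definition slice_family ::
  "nat \<Rightarrow> nat \<Rightarrow> nat \<Rightarrow> complex set \<Rightarrow> (complex \<Rightarrow> complex \<Rightarrow> complex) \<Rightarrow> bool" where
  "slice_family p q r \<Lambda> f \<longleftrightarrow>
     open \<Lambda> \<and> (- \<Lambda>) sparse_in UNIV \<and> holomorphic_family \<Lambda> f \<and> (\<forall>x\<in>\<Lambda>. f x \<in> class_M p q r)"

text \<open>
  Infinity is left out of the singular values here: it is a critical value of every map in
  \<open>class_M p q r\<close> with \<open>p \<ge> 2\<close> (the poles are multiple), but it has no forward orbit.
\<close>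

definition slice_singular_values ::
  "complex set \<Rightarrow> (complex \<Rightarrow> complex \<Rightarrow> complex) \<Rightarrow> nat \<Rightarrow> (nat \<Rightarrow> complex \<Rightarrow> complex) \<Rightarrow>
   (complex \<Rightarrow> complex) \<Rightarrow> bool" where
  "slice_singular_values \<Lambda> f N s v \<longleftrightarrow>
     N \<ge> 1 \<and> (\<forall>i\<in>{1..<N}. s i holomorphic_on \<Lambda>) \<and>
     (\<exists>a b. \<forall>x\<in>\<Lambda>. v x = a * x + b) \<and>
     (\<forall>x\<in>\<Lambda>. Some (v x) \<in> asymptotic_values (f x) \<and>
        {w. Some w \<in> singular_values (f x)} = insert (v x) ((\<lambda>i. s i x) ` {1..<N}) \<and>
        inj_on (\<lambda>i. s i x) {1..<N} \<and> v x \<notin> (\<lambda>i. s i x) ` {1..<N}) \<and>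
     activity_locus \<Lambda> f v \<noteq> {}"

definition slice_poles :: "complex set \<Rightarrow> (complex \<Rightarrow> complex \<Rightarrow> complex) \<Rightarrow> bool" where
  "slice_poles \<Lambda> f \<longleftrightarrow>
     (\<exists>\<pi> :: int \<Rightarrow> complex \<Rightarrow> complex. (\<forall>i. \<pi> i holomorphic_on \<Lambda>) \<and>
        (\<forall>x\<in>\<Lambda>. bij_betw (\<lambda>i. \<pi> i x) UNIV {z. is_pole (f x) z}))"

text \<open>
  The last conjunct says that \<open>v\<close> controls the remaining singular values throughout \<open>\<Lambda>\<close>: wherever
  the orbit of \<open>v\<close> is passive, so are their orbits. Any persistent relation such as a symmetry
  of the maps or an orbit relation implies it.
\<close>

definition slice_fixed_values ::
  "complex set \<Rightarrow> (complex \<Rightarrow> complex \<Rightarrow> complex) \<Rightarrow> nat \<Rightarrow> (nat \<Rightarrow> complex \<Rightarrow> complex) \<Rightarrow>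
   (complex \<Rightarrow> complex) \<Rightarrow> nat set \<Rightarrow> bool" where
  "slice_fixed_values \<Lambda> f N s v F \<longleftrightarrow>
     F \<subseteq> {1..<N} \<and>
     (\<forall>x\<in>\<Lambda>. \<forall>c. Some c \<in> critical_values (f x) \<longrightarrow> (\<exists>i\<in>F. c = s i x)) \<and>
     (\<forall>i\<in>F. \<exists>k \<mu>. (cmod \<mu> < 1 \<or> (\<exists>n\<ge>1. \<mu> ^ n = 1)) \<and>
        (\<forall>x\<in>\<Lambda>. \<exists>C. has_multiplier (f x) k C \<mu> \<and> s i x \<in> basin (f x) C)) \<and>
     (\<forall>j\<in>{1..<N} - F. activity_locus \<Lambda> f (s j) \<subseteq> activity_locus \<Lambda> f v)"

definition slice_deformations ::
  "complex set \<Rightarrow> (complex \<Rightarrow> complex \<Rightarrow> complex) \<Rightarrow> (nat \<Rightarrow> complex \<Rightarrow> complex) \<Rightarrow>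
   (complex \<Rightarrow> complex) \<Rightarrow> nat set \<Rightarrow> bool" where
  "slice_deformations \<Lambda> f s v F \<longleftrightarrow>
     (\<forall>x\<^sub>0\<in>\<Lambda>. \<forall>k C. attracted_away_from_fixed f s v F x\<^sub>0 k C \<longrightarrow>
        (\<forall>h \<phi>. transcendental_meromorphic h \<and> quasiconformal \<phi> \<and> conjugates \<phi> (f x\<^sub>0) h \<and>
               conformal_ae_on (- basin (f x\<^sub>0) C) \<phi> \<longrightarrow>
           (\<exists>x\<in>\<Lambda>. affinely_conjugate h (f x))))"

definition slice_conditions ::
  "nat \<Rightarrow> nat \<Rightarrow> nat \<Rightarrow> complex set \<Rightarrow> (complex \<Rightarrow> complex \<Rightarrow> complex) \<Rightarrow> nat \<Rightarrow>
   (nat \<Rightarrow> complex \<Rightarrow> complex) \<Rightarrow> (complex \<Rightarrow> complex) \<Rightarrow> nat set \<Rightarrow> bool" where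
  "slice_conditions p q r \<Lambda> f N s v F \<longleftrightarrow>
     slice_family p q r \<Lambda> f \<and> slice_singular_values \<Lambda> f N s v \<and> slice_poles \<Lambda> f \<and>
     slice_fixed_values \<Lambda> f N s v F \<and> slice_deformations \<Lambda> f s v F"

text \<open>
  Maximality: at a puncture \<open>\<sigma>\<close> no choice of a map and of singular values extends the slice to
  \<open>\<Lambda> \<union> {\<sigma>}\<close>. The values of \<open>f\<close>, \<open>s\<close> and \<open>v\<close> outside \<open>\<Lambda>\<close> are irrelevant.
\<close>

definition dynamically_natural_slice ::
  "nat \<Rightarrow> nat \<Rightarrow> nat \<Rightarrow> complex set \<Rightarrow> (complex \<Rightarrow> complex \<Rightarrow> complex) \<Rightarrow> nat \<Rightarrow>
   (nat \<Rightarrow> complex \<Rightarrow> complex) \<Rightarrow> (complex \<Rightarrow> complex) \<Rightarrow> nat set \<Rightarrow> bool" where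
  "dynamically_natural_slice p q r \<Lambda> f N s v F \<longleftrightarrow>
     slice_conditions p q r \<Lambda> f N s v F \<and>
     (\<forall>\<sigma>. \<sigma> \<notin> \<Lambda> \<longrightarrow>
        \<not> (\<exists>f' s' v'. (\<forall>x\<in>\<Lambda>. f' x = f x \<and> v' x = v x \<and> (\<forall>i\<in>{1..<N}. s' i x = s i x)) \<and>
              slice_conditions p q r (insert \<sigma> \<Lambda>) f' N s' v' F))"

definition shell_component ::
  "complex set \<Rightarrow> (complex \<Rightarrow> complex \<Rightarrow> complex) \<Rightarrow> (nat \<Rightarrow> complex \<Rightarrow> complex) \<Rightarrow>
   (complex \<Rightarrow> complex) \<Rightarrow> nat set \<Rightarrow> nat \<Rightarrow> complex set \<Rightarrow> bool" where
  "shell_component \<Lambda> f s v F k \<Omega> \<longleftrightarrow>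
     \<Omega> \<in> components (\<Lambda> - bifurcation_locus \<Lambda> f) \<and>
     (\<forall>x\<in>\<Omega>. \<exists>C. attracted_away_from_fixed f s v F x k C)"

definition virtual_cycle_parameter ::
  "complex set \<Rightarrow> (complex \<Rightarrow> complex \<Rightarrow> complex) \<Rightarrow> (complex \<Rightarrow> complex) \<Rightarrow> nat \<Rightarrow> complex \<Rightarrow>
   bool" where
  "virtual_cycle_parameter \<Lambda> f v k x \<longleftrightarrow>
     k \<ge> 2 \<and> x \<in> \<Lambda> \<and>
     (\<exists>a :: nat \<Rightarrow> complex option. a 0 = None \<and> a 1 = Some (v x) \<and>
        (\<forall>i\<in>{1..k - 1}. \<exists>z. a i = Some z \<and> sph (f x) z = a ((i + 1) mod k)))"

end

theory Submission
  imports Defs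
begin

text \<open>
  Let \<open>x0\<close> be a virtual cycle parameter. The function \<open>c x = f\<^bsub>x\<^esub>\<^sup>k\<^sup>-\<^sup>1 (v x)\<close> has a pole at \<open>x0\<close>, while the
  asymptotic tract of \<open>v x\<close> is parametrized by a univalent map \<open>H x\<close> of a left half-plane with
  \<open>f x (H x u) = v x + exp u\<close>. The parameters with \<open>c x = H x u\<close>, \<open>Re u\<close> very negative, form open sets
  accumulating at \<open>x0\<close> by the maximum principle. For such \<open>x\<close> the map \<open>f\<^bsub>x\<^esub>\<^sup>k\<close> contracts a disk about \<open>v x\<close>
  by the factor \<open>exp (Re u)\<close>, up to distortion, into itself, so that \<open>v x\<close> is attracted to a cycle of
  period \<open>k\<close> with a point near infinity.

  Attracting cycles capture singular values; a passive singular value that is attracted at one parameter is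
  attracted nearby. Hence these parameters are \<open>J\<close>-stable. Conversely \<open>v\<close> is passive at a \<open>J\<close>-stable parameter:
  near an active one there would be virtual cycle parameters, hence attracting cycles with points near infinity.
  So the condition that \<open>v\<close> is attracted to a cycle of period \<open>k\<close> is open and closed on the \<open>J\<close>-stable set.
\<close>

text \<open>Three obstacles shape the proof. A holomorphic family is given as holomorphic in the
  parameter and meromorphic in the variable separately; the joint continuity behind every
  perturbation argument has to come from Hartogs's theorem, which is why the proof opens with
  subharmonicity estimates. Secondly, open sets of parameters that merely accumulate at
  \<open>x0\<close> could lie in infinitely many components, none with \<open>x0\<close> on its
  boundary. A single connected set ending at \<open>x0\<close> is obtained by a Phragmen-Lindelof
  type argument. Thirdly, the new cycle must not attract a dynamically fixed value. A fixed value in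
  an attracting basin near \<open>x0\<close> is in an attracting basin at \<open>x0\<close> already,
  since its multiplier is constant, so its cycle is a continuation of one of finitely many old
  cycles. These stay bounded, whereas the new cycle has a point near infinity. Univalence of the
  lift \<open>H x\<close> is open in the parameter because of a dichotomy: a lift is univalent or it
  factors through \<open>exp\<close>, and then it has period 2 pi i, which can be refuted at two
  points.\<close>

abbreviation (input) seq_lim (infixr "---->" 60) where "X ----> L \<equiv> X \<longlonglongrightarrow> L"

abbreviation (input) fun_lim (infixr "--->" 55) where "(g ---> l) F \<equiv> (g \<longlongrightarrow> l) F"

section \<open>Separate and joint holomorphy\<close>

text \<open>On the unit circle \<open>cnj z\<close> is 1/z, and conjugating a term does not change
  its real part, so negative powers can be traded for positive ones. This closes the real parts of
  polynomials under multiplication.\<close>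

lemma Re_mult_cnj_poly_on_circle:
 "EX T. ALL z. cmod z = 1 --> Re (poly P z * cnj (poly Q z)) = Re (poly T z)"
proof (induction P arbitrary: Q)
 case 0
 show ?case by (intro exI[of _ 0]) auto
next
 case (pCons a P)
 obtain b Q' where Q: "Q = pCons b Q'" by (cases Q) auto
 obtain T where T: "!!z. cmod z = 1 ==> Re (poly P z * cnj (poly Q' z)) = Re (poly T z)"
  using pCons.IH by blast
 have "Re (poly (pCons a P) z * cnj (poly Q z))
    = Re (poly (smult (cnj a) Q + smult (cnj b) (pCons 0 P) + T) z)" if z: "cmod z = 1" for z
 proof -
  have zz: "z * cnj z = 1" using z by (simp add: complex_norm_square[symmetric])
  have "poly (pCons a P) z * cnj (poly Q z)
     = a * cnj (poly Q z) + z * poly P z * cnj b + (z * cnj z) * (poly P z * cnj (poly Q' z))"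
   by (simp add: Q algebra_simps)
  also have "Re ... = Re (cnj a * poly Q z) + Re (cnj b * (z * poly P z)) + Re (poly T z)"
   unfolding zz using T[OF z] by simp
  finally show ?thesis by (simp add: algebra_simps)
 qed
 thus ?case by blast
qed

text \<open>Stone-Weierstrass for the algebra of real parts of polynomials. It replaces the
  Dirichlet problem: the approximant is already harmonic in the disc and is the real part of an
  explicit holomorphic function.\<close>

lemma circle_approx_Re_poly:
 fixes ph :: "complex => real"
 assumes "continuous_on (sphere 0 1) ph" "0 < e"
 obtains P where "!!z. cmod z = 1 ==> \<bar>ph z - Re (poly P z)\<bar> < e"
proof -
 define A where "A = (%g::complex => real. EX P. ALL z:sphere 0 1. g z = Re (poly P z))"
 have "EX g. A g & (ALL z:sphere 0 1. \<bar>ph z - g z\<bar> < e)"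
 proof (rule Stone_Weierstrass_HOL)
  show "A (%x. c)" for c unfolding A_def by (intro exI[of _ "[:of_real c:]"]) auto
  show "continuous_on (sphere 0 1) f" if f: "A f" for f
  proof -
   obtain P where P: "!!z. z : sphere 0 1 ==> f z = Re (poly P z)" using f unfolding A_def by blast
   have "continuous_on (sphere 0 1) (%z. Re (poly P z))" by (intro continuous_intros)
   thus ?thesis using P continuous_on_cong by (metis (mono_tags, lifting))
  qed
  show "A (%x. f x + g x)" if fg: "A f & A g" for f g
  proof -
   obtain P Q where "ALL z:sphere 0 1. f z = Re (poly P z)" "ALL z:sphere 0 1. g z = Re (poly Q z)"
    using fg unfolding A_def by blast
   thus ?thesis unfolding A_def by (intro exI[of _ "P + Q"]) auto
  qed
  show "A (%x. f x * g x)" if fg: "A f & A g" for f g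
  proof -
   obtain P Q where PQ: "ALL z:sphere 0 1. f z = Re (poly P z)" "ALL z:sphere 0 1. g z = Re (poly Q z)"
    using fg unfolding A_def by blast
   obtain T where T: "!!z. cmod z = 1 ==> Re (poly P z * cnj (poly Q z)) = Re (poly T z)"
    using Re_mult_cnj_poly_on_circle by blast
   have "f z * g z = Re (poly (smult (1/2) (P * Q + T)) z)" if z: "z : sphere 0 1" for z
   proof -
    have "Re (poly P z) * Re (poly Q z)
       = (Re (poly P z * poly Q z) + Re (poly P z * cnj (poly Q z))) / 2"
     by simp
    thus ?thesis using PQ T[of z] z by (simp add: field_simps)
   qed
   thus ?thesis unfolding A_def by blast
  qed
  show "EX f. A f & f x ~= f y" if xy: "x : sphere 0 1 & y : sphere 0 1 & x ~= y" for x y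
  proof (cases "Re x = Re y")
   case True
   hence "Im x ~= Im y" using xy complex_eqI by blast
   moreover have "A Im" unfolding A_def by (intro exI[of _ "[:0, -\<i>:]"]) auto
   ultimately show ?thesis by blast
  next
   case False
   moreover have "A Re" unfolding A_def by (intro exI[of _ "[:0, 1:]"]) auto
   ultimately show ?thesis by blast
  qed
 qed (use assms in auto)
 then obtain g where g: "A g" "!!z. z : sphere 0 1 ==> \<bar>ph z - g z\<bar> < e" by blast
 then obtain P where "ALL z:sphere 0 1. g z = Re (poly P z)" unfolding A_def by blast
 thus ?thesis using g that[of P] by fastforce
qed

text \<open>Cauchy's formula; the factor 2 bounds the kernel, as \<open>x\<close> is at distance at
  least 1/2 from the circle. Such constant factors are later absorbed by taking high powers.\<close>

lemma norm_le_circle_mean: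
 fixes h :: "complex => complex"
 assumes "h holomorphic_on cball 0 1" "cmod x < 1/2"
  and \<psi>: "continuous_on (sphere 0 1) \<psi>"
  and le: "!!z. cmod z = 1 ==> cmod (h z) <= \<psi> z"
 shows "cmod (h x) <= 2 * integral {0..1} (%t. \<psi> (exp (2 * of_real pi * \<i> * of_real t)))"
proof -
 let ?e = "%t::real. exp (2 * of_real pi * \<i> * of_real t)"
 have e1: "cmod (?e t) = 1" for t by (simp add: norm_exp_i_times[of "2*pi*t", simplified] algebra_simps)
 have "((%u. h u/(u-x)) has_contour_integral (2 * of_real pi * \<i> * h x)) (circlepath 0 1)"
  by (rule Cauchy_integral_circlepath_simple) (use assms in auto)
 hence int: "((%t. h (?e t) / (?e t - x) * (2 * pi * \<i> * ?e t)) has_integral (2 * of_real pi * \<i> * h x)) {0..1}"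
  unfolding has_contour_integral_def
  by (rule has_integral_eq[rotated]) (simp add: vector_derivative_circlepath01, simp add: circlepath)
 have cpsi: "continuous_on {0..1} (%t. \<psi> (?e t))"
  by (rule continuous_on_compose2[OF \<psi>]) (auto intro!: continuous_intros simp: e1)
 have "cmod (integral {0..1} (%t. h (?e t) / (?e t - x) * (2 * pi * \<i> * ?e t)))
    <= integral {0..1} (%t. (4 * pi) * \<psi> (?e t))"
 proof (rule integral_norm_bound_integral)
  show "(%t. h (?e t) / (?e t - x) * (2 * pi * \<i> * ?e t)) integrable_on {0..1}" using int by blast
  show "(%t. (4 * pi) * \<psi> (?e t)) integrable_on {0..1}"
   by (intro integrable_continuous_real continuous_intros cpsi)
  fix t :: real
  have "cmod (?e t - x) >= 1/2" using norm_triangle_ineq2[of "?e t" x] e1[of t] assms(2) by linarith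
  moreover have "cmod (h (?e t)) <= \<psi> (?e t)" using le e1 by blast
  ultimately have "cmod (h (?e t)) / cmod (?e t - x) <= \<psi> (?e t) / (1/2)"
   by (intro frac_le) (auto intro: order_trans[OF norm_ge_zero])
  hence "cmod (h (?e t)) / cmod (?e t - x) * (2*pi) <= (\<psi> (?e t) / (1/2)) * (2 * pi)"
   by (intro mult_right_mono) auto
  thus "cmod (h (?e t) / (?e t - x) * (2 * pi * \<i> * ?e t)) <= (4 * pi) * \<psi> (?e t)"
   by (simp add: norm_mult norm_divide e1 algebra_simps)
 qed
 hence "cmod (2 * of_real pi * \<i> * h x) <= (4 * pi) * integral {0..1} (%t. \<psi> (?e t))"
  using int by (simp add: integral_unique)
 thus ?thesis by (simp add: norm_mult)
qed

text \<open>Up to the constant, the mean value inequality for the subharmonic function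
  \<open>s * ln (cmod c)\<close>: replace the majorant \<open>ph\<close> of \<open>ln (cmod c)\<close> on the circle by the real part
  of a polynomial.\<close>

lemma exp_ln_norm_le_circle_mean:
 fixes c :: "complex => complex"
 assumes c: "c holomorphic_on cball 0 1" and x: "cmod x < 1/2" "c x ~= 0" and s: "0 < s"
  and ph: "continuous_on (sphere 0 1) ph"
  and le: "!!z. cmod z = 1 ==> cmod (c z) <= exp (ph z)"
 shows "exp (s * ln (cmod (c x)))
    <= 4 * integral {0..1} (%t. exp (s * ph (exp (2 * of_real pi * \<i> * of_real t))))"
proof -
 \<comment> \<open>An error \<open>eps\<close> in the exponent then costs a factor 2. Approximating
   \<open>ph + eps/2\<close> to within \<open>eps/2\<close> puts the polynomial above
   \<open>ph\<close> and below \<open>ph + eps\<close>.\<close>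
 define eps where "eps = ln 2 / s"
 have eps: "eps > 0" using s by (simp add: eps_def)
 have "continuous_on (sphere 0 1) (%z. ph z + eps/2)" by (intro continuous_intros ph)
 then obtain P where P: "!!z. cmod z = 1 ==> \<bar>(ph z + eps/2) - Re (poly P z)\<bar> < eps/2"
  using circle_approx_Re_poly[of "%z. ph z + eps/2" "eps/2"] eps by (meson half_gt_zero)
 have P1: "ph z <= Re (poly P z)" "Re (poly P z) <= ph z + eps" if "cmod z = 1" for z
  using P[OF that] by linarith+
 have Phol: "(%z. poly P z) holomorphic_on S" for S by (intro holomorphic_intros)
 \<comment> \<open>This compares the subharmonic function ln |c| with the harmonic Re P; the maximum
   principle for the product handles the zeros of \<open>c\<close> as well.\<close>
 have "cmod (c x * exp (- poly P x)) <= 1"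
 proof (rule maximum_modulus_frontier[of "%z. c z * exp (- poly P z)" "cball 0 1"])
  show "(%z. c z * exp (- poly P z)) holomorphic_on interior (cball 0 1)"
   by (intro holomorphic_intros holomorphic_on_subset[OF c]) auto
  show "continuous_on (closure (cball 0 1)) (%z. c z * exp (- poly P z))"
   using holomorphic_on_imp_continuous_on[OF c] by (auto intro!: continuous_intros)
  fix z :: complex assume "z : frontier (cball 0 1)"
  hence z: "cmod z = 1" by auto
  have "cmod (c z) * exp (- Re (poly P z)) <= exp (ph z) * exp (- Re (poly P z))"
   using le[OF z] by (intro mult_right_mono) auto
  also have "... <= 1" using P1(1)[OF z] by (simp add: exp_add[symmetric])
  finally show "cmod (c z * exp (- poly P z)) <= 1" by (simp add: norm_mult)
 qed (use x in auto)
 hence "cmod (c x) <= exp (Re (poly P x))"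
  by (simp add: norm_mult norm_divide exp_minus field_simps)
 hence "ln (cmod (c x)) <= Re (poly P x)" using x by (metis ln_exp ln_mono zero_less_norm_iff)
 hence "exp (s * ln (cmod (c x))) <= cmod (exp (of_real s * poly P x))" using s by simp
 also have "... <= 2 * integral {0..1} (%t. 2 * exp (s * ph (exp (2 * of_real pi * \<i> * of_real t))))"
 proof (rule norm_le_circle_mean[where \<psi> = "%z. 2 * exp (s * ph z)" and h = "%z. exp (of_real s * poly P z)"])
  show "(%z. exp (of_real s * poly P z)) holomorphic_on cball 0 1" by (intro holomorphic_intros)
  show "continuous_on (sphere 0 1) (%z. 2 * exp (s * ph z))" by (intro continuous_intros ph)
  fix z assume z: "cmod z = 1"
  have "s * Re (poly P z) <= s * (ph z + eps)" using P1(2)[OF z] s by simp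
  also have "... = s * ph z + ln 2" using s by (simp add: eps_def field_simps)
  finally have "exp (s * Re (poly P z)) <= exp (s * ph z + ln 2)" by simp
  thus "cmod (exp (of_real s * poly P z)) <= 2 * exp (s * ph z)" by (simp add: exp_add)
 qed (use x in auto)
 finally show ?thesis by simp
qed

text \<open>The functions ln |c n| / n are subharmonic and bounded above on the circle, and
  eventually at most ln q at each of its points. The mean value inequality and dominated convergence
  make the bound uniform inside, at the cost of enlarging q.\<close>

lemma hartogs_lemma:
 fixes c :: "nat => complex => complex"
 assumes c: "!!n. c n holomorphic_on cball 0 1" and q: "0 < q" "q < q'"
  and A: "!!n z. n >= 1 ==> cmod z = 1 ==> cmod (c n z) <= A ^ n"
  and pt: "!!z. cmod z = 1 ==> \<forall>\<^sub>F n in sequentially. cmod (c n z) <= q ^ n"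
 shows "\<forall>\<^sub>F n in sequentially. ALL x. cmod x < 1/2 --> cmod (c n x) <= q' ^ n"
proof -
 let ?e = "%t::real. exp (2 * of_real pi * \<i> * of_real t)"
 have e1: "cmod (?e t) = 1" for t by (simp add: norm_exp_i_times[of "2*pi*t", simplified] algebra_simps)
 define A' where "A' = max A q"
 have A': "A' > 0" using q by (simp add: A'_def)
 \<comment> \<open>The K-th power of the gap between \<open>q\<close> and \<open>q'\<close> beats
   the constant 4 of the mean value inequality, with a factor 2 to spare for the limit.\<close>
 have "EX K::nat. (q'/q) ^ K > 8" using q by (intro real_arch_pow) auto
 then obtain K where K: "(q'/q) ^ K > 8" by blast
 have K0: "K > 0" using K by (cases K) auto
 \<comment> \<open>The maximum with \<open>q ^ n\<close> keeps the logarithm continuous at zeros of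
   \<open>c n\<close>, and makes the majorant eventually equal to \<open>q ^ n\<close> at every
   point of the circle.\<close>
 define ph where "ph n z = ln (max (cmod (c n z)) (q ^ n))" for n z
 define \<psi> where "\<psi> n t = exp (real K / real n * ph n (?e t))" for n t
 have mpos: "max (cmod (c n z)) (q ^ n) > 0" for n z using q by (simp add: less_max_iff_disj)
 have cphi: "continuous_on (sphere 0 1) (ph n)" for n
  unfolding ph_def
  by (intro continuous_intros holomorphic_on_imp_continuous_on holomorphic_on_subset[OF c]) (use mpos in "auto simp: less_imp_neq[symmetric]")
 have cpsi: "continuous_on {0..1} (\<psi> n)" for n
  unfolding \<psi>_def
  by (intro continuous_intros continuous_on_compose2[OF cphi]) (auto simp: e1)
 have base: "exp (real K / real n * ln (y ^ n)) = y ^ K" if "n >= 1" "y > 0" for n and y :: real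
 proof -
  have "real K / real n * ln (y ^ n) = real K * ln y" using that by (simp add: ln_realpow)
  thus ?thesis using that by (simp add: exp_of_nat_mult)
 qed
 have bound: "\<psi> n t <= A' ^ K" if n: "n >= 1" for n t
 proof -
  have "max (cmod (c n (?e t))) (q ^ n) <= A' ^ n"
  proof -
   have A0: "A >= 0" using A[of 1 "?e t"] e1[of t] order_trans[OF norm_ge_zero] by fastforce
   have "A ^ n <= A' ^ n" "q ^ n <= A' ^ n" using A0 q by (auto simp: A'_def intro!: power_mono)
   thus ?thesis using A[OF n e1[of t]] by simp
  qed
  hence "ph n (?e t) <= ln (A' ^ n)" unfolding ph_def using mpos A' by (intro ln_mono) auto
  hence "\<psi> n t <= exp (real K / real n * ln (A' ^ n))"
   unfolding \<psi>_def by (simp add: mult_left_mono divide_right_mono)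
  thus ?thesis using base[OF n A'] by simp
 qed
 have lim: "(%n. \<psi> n t) ----> q ^ K" for t
 proof (rule tendsto_eventually)
  show "\<forall>\<^sub>F n in sequentially. \<psi> n t = q ^ K"
   using pt[OF e1[of t]] eventually_ge_at_top[of 1]
  proof eventually_elim
   case (elim n)
   thus ?case using base[of n q] q by (simp add: \<psi>_def ph_def max_absorb2)
  qed
 qed
 \<comment> \<open>The index is shifted because the domination by \<open>A' ^ K\<close> holds from n
   = 1 on.\<close>
 have "(%n. integral {0..1} (\<psi> (Suc n))) ----> integral {0..1} (%t::real. q ^ K)"
 proof (rule dominated_convergence(2)[where h = "%t. A' ^ K"])
  show "\<psi> (Suc n) integrable_on {0..1}" for n by (intro integrable_continuous_real cpsi)
  show "norm (\<psi> (Suc n) t) <= A' ^ K" for n t using bound[of "Suc n" t] by (simp add: \<psi>_def)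
  show "(%n. \<psi> (Suc n) t) ----> q ^ K" for t using lim by (rule LIMSEQ_Suc)
 qed auto
 hence "(%n. integral {0..1} (\<psi> (Suc n))) ----> q ^ K" by simp
 hence "(%n. integral {0..1} (\<psi> n)) ----> q ^ K" by (rule LIMSEQ_imp_Suc)
 moreover have "q ^ K < q' ^ K / 4" 
 proof -
  have "q ^ K * 8 < q' ^ K" "0 < q ^ K" using K q by (simp_all add: power_divide field_simps)
  thus ?thesis by linarith
 qed
 ultimately have "\<forall>\<^sub>F n in sequentially. integral {0..1} (\<psi> n) < q' ^ K / 4"
  by (rule order_tendstoD(2))
 thus ?thesis using eventually_ge_at_top[of 1]
 proof eventually_elim
  case (elim n)
  show ?case
  proof (intro allI impI)
   fix x :: complex assume x: "cmod x < 1/2"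
   show "cmod (c n x) <= q' ^ n"
   proof (cases "c n x = 0")
    case True thus ?thesis using q by simp
   next
    case False
    have n: "n >= 1" using elim by simp
    have "exp (real K / real n * ln (cmod (c n x))) <= 4 * integral {0..1} (\<psi> n)"
     unfolding \<psi>_def
    proof (rule exp_ln_norm_le_circle_mean[OF c x False _ cphi])
     show "0 < real K / real n" using K0 n by simp
     show "cmod (c n z) <= exp (ph n z)" for z using mpos[of n z] by (simp add: ph_def)
    qed
    also have "... < q' ^ K" using elim by simp
    also have "... = exp (real K / real n * ln (q' ^ n))" using base[OF n, of q'] q by simp
    finally have "ln (cmod (c n x)) < ln (q' ^ n)" using K0 n by (auto simp: divide_less_cancel mult_less_cancel_left)
    thus ?thesis using False q by (simp add: ln_less_cancel_iff less_imp_le)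
   qed
  qed
 qed
qed

section \<open>Taylor coefficients depending on a parameter, and Hartogs's theorem\<close>

text \<open>By Montel's theorem a subsequence converges to a holomorphic function, which must be the
  pointwise limit.\<close>

lemma pointwise_limit_holomorphic:
 fixes F :: "nat => complex => complex"
 assumes "open S" "!!n. F n holomorphic_on S"
  and bd: "!!K. compact K ==> K <= S ==> EX B. ALL n. ALL z:K. cmod (F n z) <= B"
  and lim: "!!z. z : S ==> (%n. F n z) ----> g z"
 shows "g holomorphic_on S"
proof -
 obtain h r where h: "h holomorphic_on S" "strict_mono (r :: nat => nat)"
  "!!x. x : S ==> (%n. F (r n) x) ----> h x"
  by (rule Montel[of S "range F" F]) (use assms in auto)
 have "h x = g x" if "x : S" for x
  using LIMSEQ_unique[OF h(3)[OF that]] LIMSEQ_subseq_LIMSEQ[OF lim[OF that] h(2)]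
  by (simp add: o_def)
 thus ?thesis using h(1) holomorphic_cong by metis
qed

text \<open>Cauchy's inequality on circles of radius t < r, with t tending to r because
  \<open>f\<close> is given on the open disc.\<close>

lemma deriv_le_of_bound:
 fixes f :: "complex => complex"
 assumes "f holomorphic_on ball a r" "0 < r" "!!z. z : ball a r ==> cmod (f z) <= B"
 shows "cmod (deriv f a) <= B / r"
proof -
 have "cmod (deriv f a) <= B / t" if t: "0 < t" "t < r" for t
 proof -
  have "cmod ((deriv ^^ 1) f a) <= fact 1 * B / t ^ 1"
  proof (rule Cauchy_inequality)
   show "f holomorphic_on ball a t" by (rule holomorphic_on_subset[OF assms(1)]) (use t in auto)
   show "continuous_on (cball a t) f"
    by (rule holomorphic_on_imp_continuous_on, rule holomorphic_on_subset[OF assms(1)]) (use t in auto)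
   show "cmod (f x) <= B" if "cmod (a - x) = t" for x using assms(3) that t by (simp add: dist_norm)
  qed (use t in auto)
  thus ?thesis by simp
 qed
 moreover have "((%t. B / t) ---> B / r) (at_left r)" using assms(2) by (auto intro!: tendsto_eq_intros)
 moreover have "\<forall>\<^sub>F t in at_left r. 0 < t & t < r"
  using assms(2) by (auto simp: eventually_at_left_field intro!: exI[of _ 0])
 ultimately show ?thesis
  using tendsto_lowerbound[of "%t. B / t" "B / r" "at_left r" "cmod (deriv f a)"]
  by (smt (verit, best) eventually_mono trivial_limit_at_left_real)
qed

lemma lipschitz_of_bound:
 fixes f :: "complex => complex"
 assumes "f holomorphic_on ball a (2*r)" "0 < r" "!!z. z : ball a (2*r) ==> cmod (f z) <= B"
  and "z : ball a r" "w : ball a r"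
 shows "cmod (f z - f w) <= B / r * cmod (z - w)"
proof (rule field_differentiable_bound[where S = "ball a r" and f' = "deriv f"])
 fix u assume u: "u : ball a r"
 show "(f has_field_derivative deriv f u) (at u within ball a r)"
  using holomorphic_derivI[OF assms(1), of u] u assms(2) by (auto intro: has_field_derivative_at_within)
 have sub: "ball u r <= ball a (2*r)"
 proof
  fix y assume "y : ball u r"
  thus "y : ball a (2*r)" using u dist_triangle[of a y u] by auto
 qed
 show "cmod (deriv f u) <= B / r"
  by (rule deriv_le_of_bound) (use sub assms holomorphic_on_subset in auto)
qed (use assms in auto)

lemma difference_quotient_LIMSEQ:
 fixes f :: "complex => complex"
 assumes "(f has_field_derivative D) (at z)" "0 < dl"
 shows "(%n. (f (z + of_real (dl / real (Suc n))) - f z) / of_real (dl / real (Suc n))) ----> D"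
proof -
 have lim: "((%h. (f (z + h) - f z) / h) ---> D) (at 0)" using assms(1) by (simp add: DERIV_def)
 have "(%n. dl / real (Suc n)) ----> 0"
  using LIMSEQ_Suc[OF lim_const_over_n[of dl]] by simp
 hence "(%n. complex_of_real (dl / real (Suc n))) ----> 0" by (metis of_real_0 tendsto_of_real)
 hence "filterlim (%n. complex_of_real (dl / real (Suc n))) (at 0) sequentially"
  using assms(2) by (auto simp: filterlim_at simp del: of_real_divide)
 from filterlim_compose[OF lim this] show ?thesis by simp
qed

lemma deriv_parameter_holomorphic:
 fixes g :: "complex => complex => complex"
 assumes "open U" "!!x. x : U ==> g x holomorphic_on ball z (2*r)" "0 < r"
  and gx: "!!w. w : ball z r ==> (%x. g x w) holomorphic_on U"
  and B: "!!x w. x : U ==> w : ball z (2*r) ==> cmod (g x w) <= B"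
 shows "(%x. deriv (g x) z) holomorphic_on U"
proof (rule pointwise_limit_holomorphic[OF assms(1)])
 let ?d = "%n. complex_of_real (r/2 / real (Suc n))"
 have d: "?d n ~= 0" "z + ?d n : ball z r" for n
 proof -
  show "?d n ~= 0" using assms(3) by (simp del: of_nat_Suc)
  have "cmod (?d n) = r/2 / real (Suc n)" using assms(3) by (simp add: norm_divide del: of_nat_Suc)
  also have "... <= r / 2 / 1" using assms(3) by (intro divide_left_mono) auto
  finally show "z + ?d n : ball z r" using assms(3) by (simp add: dist_norm)
 qed
 fix n
 show "(%x. (g x (z + ?d n) - g x z) / ?d n) holomorphic_on U"
  by (intro holomorphic_intros gx d) (use assms(3) in auto)
next
 let ?d = "%n. complex_of_real (r/2 / real (Suc n))"
 fix K assume K: "compact K" "K <= U"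
 have "cmod ((g x (z + ?d n) - g x z) / ?d n) <= B / r" if "x : K" for x n
 proof -
  have x: "x : U" using that K by auto
  have "cmod (?d n) = r/2 / real (Suc n)" using assms(3) by (simp add: norm_divide del: of_nat_Suc)
  also have "... <= r / 2 / 1" using assms(3) by (intro divide_left_mono) auto
  finally have d2: "z + ?d n : ball z r" using assms(3) by (simp add: dist_norm)
  have "cmod (g x (z + ?d n) - g x z) <= B / r * cmod (z + ?d n - z)"
   by (rule lipschitz_of_bound[OF assms(2)[OF x] assms(3) B[OF x] d2]) (use assms(3) in auto)
  hence "cmod (g x (z + ?d n) - g x z) <= B / r * cmod (?d n)" by simp
  moreover have "?d n ~= 0" using assms(3) by (simp del: of_nat_Suc)
  ultimately show ?thesis by (metis norm_divide pos_divide_le_eq zero_less_norm_iff)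
 qed
 thus "EX B. ALL n. ALL x:K. cmod ((g x (z + ?d n) - g x z) / ?d n) <= B" by blast
next
 fix x assume x: "x : U"
 show "(%n. (g x (z + of_real (r/2 / real (Suc n))) - g x z) / of_real (r/2 / real (Suc n)))
     ----> deriv (g x) z"
  by (rule difference_quotient_LIMSEQ, rule holomorphic_derivI[OF assms(2)[OF x]]) (use assms(3) in auto)
qed

lemma iterated_deriv_parameter_holomorphic:
 fixes g :: "complex => complex => complex"
 assumes "open U" "!!x. x : U ==> g x holomorphic_on ball a r" "0 < r"
  and "!!w. w : ball a r ==> (%x. g x w) holomorphic_on U"
  and B: "!!x w. x : U ==> w : ball a r ==> cmod (g x w) <= B"
 shows "w : ball a r ==> (%x. (deriv ^^ n) (g x) w) holomorphic_on U"
proof (induction n arbitrary: w)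
 case 0
 thus ?case using assms by simp
next
 case (Suc n)
 define t where "t = (r - dist a w) / 4"
 have t: "t > 0" using Suc.prems by (simp add: t_def)
 have sub: "y : ball w (2*t) ==> ball y (2*t) <= ball a r" for y
 proof
  fix u assume "y : ball w (2*t)" "u : ball y (2*t)"
  hence "dist w y < 2*t" "dist y u < 2*t" by auto
  thus "u : ball a r"
   using dist_triangle[of a u y] dist_triangle[of a y w] unfolding t_def mem_ball by argo
 qed
 have hol: "(deriv ^^ n) (g x) holomorphic_on ball w (2*t)" if "x : U" for x
 proof (rule holomorphic_on_subset[of _ "ball a r"])
  show "(deriv ^^ n) (g x) holomorphic_on ball a r" by (rule holomorphic_higher_deriv[OF assms(2)[OF that]]) auto
  show "ball w (2*t) <= ball a r" using sub[of w] t by auto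
 qed
 have "(%x. deriv ((deriv ^^ n) (g x)) w) holomorphic_on U"
 proof (rule deriv_parameter_holomorphic[OF assms(1) hol t])
  show "(%x. (deriv ^^ n) (g x) y) holomorphic_on U" if "y : ball w t" for y
  proof (rule Suc.IH)
   show "y : ball a r" using sub[of w] that t by (simp add: subset_iff)
  qed
  fix x y assume x: "x : U" and y: "y : ball w (2*t)"
  show "cmod ((deriv ^^ n) (g x) y) <= fact n * B / t ^ n"
  proof (rule Cauchy_inequality)
   have "cball y t <= ball a r" using sub[OF y] t by fastforce
   thus "g x holomorphic_on ball y t" "continuous_on (cball y t) (g x)"
    using assms(2)[OF x] holomorphic_on_subset ball_subset_cball holomorphic_on_imp_continuous_on
    by (meson order_trans)+
   show "cmod (g x u) <= B" if "cmod (y - u) = t" for u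
    using \<open>cball y t <= ball a r\<close> that B[OF x] by (auto simp: dist_norm)
  qed (use t in auto)
 qed
 thus ?case by simp
qed

text \<open>Baire's theorem yields a small disc about some \<open>w0\<close> near \<open>z0\<close>
  where \<open>g\<close> is bounded. The Taylor coefficients at \<open>w0\<close> are therefore
  holomorphic in \<open>x\<close> and grow at most geometrically, and for each fixed
  \<open>x\<close> they decay as the full disc of holomorphy in \<open>W\<close> dictates. Hartogs's
  lemma makes this decay uniform in \<open>x\<close>, so the series converges uniformly on a bidisc
  that contains (x0, z0).\<close>

theorem separately_holomorphic_imp_continuous:
 fixes g :: "complex => complex => complex"
 assumes U: "open U" "x0 : U" and W: "open W" "z0 : W"
  and gx: "!!z. z : W ==> (%x. g x z) holomorphic_on U"
  and gz: "!!x. x : U ==> g x holomorphic_on W"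
 obtains e where "0 < e" "ball x0 e <= U" "ball z0 e <= W"
  "continuous_on (ball x0 e \<times> ball z0 e) (%(x, z). g x z)"
proof -
 obtain a where a: "0 < a" "cball x0 (2*a) <= U"
  using open_contains_cball[of U] U by (metis field_sum_of_halves mult_2 half_gt_zero)
 obtain b where b: "0 < b" "cball z0 b <= W" using open_contains_cball[of W] W by blast
 define S where "S = cball z0 (b/4)"
 define T where "T M = {z : S. ALL x:cball x0 (2*a). cmod (g x z) <= real M}" for M
 have SW: "S <= W" using b by (auto simp: S_def)
 have Tcl: "closedin (top_of_set S) (T M)" for M
 proof -
  have eq: "T M = S \<inter> (\<Inter>x\<in>cball x0 (2*a). {z : S. cmod (g x z) <= real M})" by (auto simp: T_def)
  have "closedin (top_of_set S) {z : S. cmod (g x z) <= real M}" if "x : cball x0 (2*a)" for x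
  proof -
   have "continuous_on S (%z. cmod (g x z))"
    using that a gz SW by (intro continuous_intros holomorphic_on_imp_continuous_on holomorphic_on_subset[OF gz]) auto
   from continuous_closedin_preimage[OF this, of "{..real M}"] show ?thesis
    by (simp add: vimage_def Int_def)
  qed
  hence "closedin (top_of_set S) (\<Inter>x\<in>cball x0 (2*a). {z : S. cmod (g x z) <= real M})"
   using a by (intro closedin_Inter) auto
  thus ?thesis unfolding eq by (intro closedin_Int) auto
 qed
 have Tun: "EX M. z : T M" if "z : S" for z
 proof -
  have "compact ((%x. g x z) ` cball x0 (2*a))"
   by (intro compact_continuous_image holomorphic_on_imp_continuous_on holomorphic_on_subset[OF gx])
    (use that SW a in auto)
  from compact_imp_bounded[OF this] obtain B where "!!x. x : cball x0 (2*a) ==> cmod (g x z) <= B"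
   unfolding bounded_iff by (meson imageI)
  moreover obtain M::nat where "B <= real M" using real_arch_simple by blast
  ultimately have "z : T M" using that by (force simp: T_def)
  thus ?thesis by blast
 qed
 \<comment> \<open>The closed sets \<open>T M\<close> exhaust \<open>S\<close>, so by Baire's
   theorem one of them has interior.\<close>
 have "EX M. ~ S <= closure (S - T M)"
 proof (rule ccontr)
  assume "~ ?thesis"
  hence "S <= closure (\<Inter>(range (%M. S - T M)))"
   by (intro Baire) (auto simp: S_def intro!: openin_diff Tcl[unfolded S_def])
  moreover have "\<Inter>(range (%M. S - T M)) = {}" using Tun by fastforce
  ultimately have "S <= {}" by (metis closure_empty)
  moreover have "z0 : S" using b by (simp add: S_def)
  ultimately show False by blast
 qed
 then obtain M z1 where z1: "z1 : S" "z1 ~: closure (S - T M)" by blast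
 then obtain e where e: "e > 0" "ball z1 e \<inter> (S - T M) = {}"
  using closure_approachable[of z1 "S - T M"] by (auto simp: dist_commute disjoint_iff)
 have "z1 : closure (ball z0 (b/4))" using z1 b by (simp add: S_def)
 then obtain w0 where w0: "w0 : ball z0 (b/4)" "dist w0 z1 < e"
  using e closure_approachable by blast
 hence "w0 : ball z0 (b/4) \<inter> ball z1 e" by (simp add: dist_commute)
 then obtain r0 where r0: "r0 > 0" "ball w0 r0 <= ball z0 (b/4) \<inter> ball z1 e"
  by (meson open_Int open_ball open_contains_ball)
 have bd: "cmod (g x z) <= real M" if "x : cball x0 (2*a)" "z : ball w0 r0" for x z
  using that r0 e by (auto simp: T_def S_def disjoint_iff subset_iff less_imp_le)
 define c where "c n x = (deriv ^^ n) (g x) w0 / fact n" for n x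
 \<comment> \<open>For fixed \<open>x\<close> the disc of radius 5b/8 about \<open>w0\<close> lies
   in \<open>W\<close>, so the coefficients are O((8/(5b))^n), and 8/(5b) = (9/10) q: eventually
   they are at most q^n. Since q < 2/b, Hartogs's lemma gives (2/b)^n uniformly, which sums on |z -
   w0| <= 3b/8 with ratio 3/4.\<close>
 define q where "q = 16 / (9 * b)"
 have holc: "(c n) holomorphic_on ball x0 (2*a)" for n
  unfolding c_def
 proof (intro holomorphic_intros, rule iterated_deriv_parameter_holomorphic[where a = w0 and r = r0 and B = "real M"])
  show "g x holomorphic_on ball w0 r0" if "x : ball x0 (2*a)" for x
   by (rule holomorphic_on_subset[OF gz]) (use that a r0 b in "auto simp: subset_iff")
  show "(%x. g x w) holomorphic_on ball x0 (2*a)" if "w : ball w0 r0" for w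
   by (rule holomorphic_on_subset[OF gx]) (use that a r0 b in "auto simp: subset_iff")
 qed (use r0 bd in auto)
 have "\<forall>\<^sub>F n in sequentially. ALL y. cmod y < 1/2 --> cmod (c n (x0 + of_real a * y)) <= (2/b) ^ n"
 proof (rule hartogs_lemma[where q = q and A = "max 1 (real M) * (max 1 (2/r0))"])
  have "(%y. c n (x0 + of_real a * y)) = c n \<circ> (%y. x0 + of_real a * y)" for n by auto
  thus "(%y. c n (x0 + of_real a * y)) holomorphic_on cball 0 1" for n
   using a by (simp del: o_apply, intro holomorphic_on_compose_gen[OF _ holc] holomorphic_intros)
    (auto simp: dist_norm norm_mult)
  show "0 < q" "q < 2/b" using b by (auto simp: q_def field_simps)
 next
  fix n :: nat and y :: complex assume n: "n >= 1" and y: "cmod y = 1"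
  let ?x = "x0 + of_real a * y"
  have x: "?x : cball x0 (2*a)" using y a by (simp add: dist_norm norm_mult)
  have "cmod ((deriv ^^ n) (g ?x) w0) <= fact n * real M / (r0/2) ^ n"
  proof (rule Cauchy_inequality)
   have "cball w0 (r0/2) <= W"
   proof
    fix t assume "t : cball w0 (r0/2)"
    hence "t : ball w0 r0" using r0(1) by simp
    hence "dist z0 t < b/4" using r0(2) by auto
    thus "t : W" using b by auto
   qed
   thus "g ?x holomorphic_on ball w0 (r0/2)" "continuous_on (cball w0 (r0/2)) (g ?x)"
    using gz x a holomorphic_on_subset ball_subset_cball holomorphic_on_imp_continuous_on
    by (meson order_trans subsetD)+
   show "cmod (g ?x u) <= real M" if "cmod (w0 - u) = r0/2" for u
    using that bd[OF x] r0 by (auto simp: dist_norm)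
  qed (use r0 in auto)
  hence "cmod (c n ?x) <= real M * (2/r0) ^ n"
   by (simp add: c_def norm_divide field_simps power_divide)
  also have "... <= max 1 (real M) ^ n * (max 1 (2/r0)) ^ n"
  proof (rule mult_mono)
   have "real M <= max 1 (real M)" by simp
   also have "... <= max 1 (real M) ^ n" using n by (intro self_le_power) auto
   finally show "real M <= max 1 (real M) ^ n" .
   show "(2/r0) ^ n <= (max 1 (2/r0)) ^ n" using r0 by (intro power_mono) auto
  qed (use r0 in auto)
  finally show "cmod (c n ?x) <= (max 1 (real M) * (max 1 (2/r0))) ^ n" by (simp add: power_mult_distrib)
 next
  fix y :: complex assume y: "cmod y = 1"
  let ?x = "x0 + of_real a * y"
  have x: "?x : cball x0 (2*a)" using y a by (simp add: dist_norm norm_mult)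
  have sub: "cball w0 (5*b/8) <= W"
  proof
   fix u assume "u : cball w0 (5*b/8)"
   hence "dist z0 u <= b" using dist_triangle[of z0 u w0] w0 b by simp
   thus "u : W" using b by auto
  qed
  hence cont: "continuous_on (cball w0 (5*b/8)) (g ?x)" and hol: "g ?x holomorphic_on ball w0 (5*b/8)"
    using gz x a holomorphic_on_subset ball_subset_cball holomorphic_on_imp_continuous_on
    by (meson order_trans subsetD)+
  obtain B where B: "!!u. u : cball w0 (5*b/8) ==> cmod (g ?x u) <= B"
   using compact_imp_bounded[OF compact_continuous_image[OF cont compact_cball]] unfolding bounded_iff by (meson imageI)
  have est: "cmod (c n ?x) <= max 1 B * (8/(5*b)) ^ n" for n
  proof -
   have "cmod ((deriv ^^ n) (g ?x) w0) <= fact n * max 1 B / (5*b/8) ^ n"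
    by (rule Cauchy_inequality[OF hol cont]) (use b B in "auto simp: dist_norm le_max_iff_disj")
   thus ?thesis using b by (simp add: c_def norm_divide field_simps power_divide power_mult_distrib)
  qed
  have "(%n. max 1 B * (9/10) ^ n) ----> max 1 B * 0"
   by (intro tendsto_intros) auto
  from order_tendstoD(2)[OF this, of 1] have "\<forall>\<^sub>F n in sequentially. max 1 B * (9/10) ^ n < 1" by simp
  thus "\<forall>\<^sub>F n in sequentially. cmod (c n ?x) <= q ^ n"
  proof eventually_elim
   case (elim n)
   have eq: "8/(5*b) = (9/10) * q" using b by (simp add: q_def field_simps)
   have "cmod (c n ?x) <= (max 1 B * (9/10) ^ n) * q ^ n" using est[of n] unfolding eq power_mult_distrib by (simp add: mult.assoc)
   also have "... <= 1 * q ^ n" using elim b by (intro mult_right_mono) (auto simp: q_def)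
   finally show ?case by simp
  qed
 qed
 hence ev: "\<forall>\<^sub>F n in sequentially. ALL p:ball x0 (a/2) \<times> ball z0 (b/8).
   norm (case p of (x, z) => c n x * (z - w0) ^ n) <= (3/4) ^ n"
 proof eventually_elim
  case (elim n)
  show ?case
  proof clarify
   fix x z assume x: "x : ball x0 (a/2)" and z: "z : ball z0 (b/8)"
   have "cmod ((x - x0) / of_real a) < 1/2" using x a by (simp add: norm_divide dist_norm norm_minus_commute field_simps)
   moreover have "x0 + of_real a * ((x - x0) / of_real a) = x" using a by simp
   ultimately have "cmod (c n x) <= (2/b) ^ n" using elim by metis
   moreover have "cmod (z - w0) <= 3*b/8"
    using z w0 dist_triangle[of w0 z z0] by (simp add: dist_norm norm_minus_commute)
   hence "cmod (z - w0) ^ n <= (3*b/8) ^ n" by (intro power_mono) auto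
   ultimately have "cmod (c n x) * cmod (z - w0) ^ n <= (2/b) ^ n * (3*b/8) ^ n"
    using b by (intro mult_mono) auto
   also have "... = (3/4) ^ n" using b by (simp add: power_mult_distrib[symmetric])
   finally show "norm (c n x * (z - w0) ^ n) <= (3/4) ^ n" by (simp add: norm_mult norm_power)
  qed
 qed
 have ul: "uniform_limit (ball x0 (a/2) \<times> ball z0 (b/8))
   (%n p. \<Sum>i<n. (case p of (x, z) => c i x * (z - w0) ^ i))
   (%p. suminf (%i. case p of (x, z) => c i x * (z - w0) ^ i)) sequentially"
  by (rule Weierstrass_m_test_ev[OF ev]) (auto intro: summable_geometric)
 have "continuous_on (ball x0 (a/2) \<times> ball z0 (b/8)) (%p. suminf (%i. case p of (x, z) => c i x * (z - w0) ^ i))"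
 proof (rule uniform_limit_theorem[OF _ ul])
  show "\<forall>\<^sub>F n in sequentially. continuous_on (ball x0 (a/2) \<times> ball z0 (b/8))
     (%p. \<Sum>i<n. (case p of (x, z) => c i x * (z - w0) ^ i))"
  proof (rule always_eventually, intro allI continuous_on_sum)
   fix n i
   have "continuous_on (ball x0 (2*a)) (c i)" by (rule holomorphic_on_imp_continuous_on[OF holc])
   hence "continuous_on (ball x0 (a/2) \<times> ball z0 (b/8)) (%p. c i (fst p))"
    by (rule continuous_on_compose2) (use a in "auto intro!: continuous_intros")
   thus "continuous_on (ball x0 (a/2) \<times> ball z0 (b/8)) (%p. case p of (x, z) => c i x * (z - w0) ^ i)"
    unfolding case_prod_beta by (intro continuous_intros)
  qed
 qed auto
 moreover have "suminf (%i. c i x * (z - w0) ^ i) = g x z" if x: "x : ball x0 (a/2)" and z: "z : ball z0 (b/8)" for x z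
 proof -
  have "ball w0 (3*b/4) <= W"
  proof
   fix u assume "u : ball w0 (3*b/4)"
   hence "dist z0 u < b" using dist_triangle[of z0 u w0] w0 by simp
   thus "u : W" using b by auto
  qed
  hence "g x holomorphic_on ball w0 (3*b/4)" using gz x a holomorphic_on_subset[of "g x" W]
   by (auto simp: subset_iff)
  moreover have "z : ball w0 (3*b/4)" using z w0 b(1) dist_triangle[of w0 z z0] by (simp add: dist_commute)
  ultimately have "(%n. (deriv ^^ n) (g x) w0 / fact n * (z - w0) ^ n) sums g x z"
   by (rule holomorphic_power_series)
  thus ?thesis unfolding c_def by (rule sums_unique[symmetric])
 qed
 ultimately have cg: "continuous_on (ball x0 (a/2) \<times> ball z0 (b/8)) (%(x, z). g x z)"
  by (subst continuous_on_cong[OF refl]) auto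
 show ?thesis
 proof (rule that[of "min (a/2) (b/8)"])
  show "ball x0 (min (a/2) (b/8)) <= U" "ball z0 (min (a/2) (b/8)) <= W"
   using a b by (auto simp: subset_iff)
  show "continuous_on (ball x0 (min (a/2) (b/8)) \<times> ball z0 (min (a/2) (b/8))) (%(x, z). g x z)"
   by (rule continuous_on_subset[OF cg]) auto
 qed (use a b in auto)
qed

text \<open>Expand at \<open>z1\<close>: the coefficients are holomorphic in \<open>x\<close> by the
  previous lemmas. They are estimated on the circle of radius r/2, while \<open>zt\<close> stays
  within r/4, so the terms are dominated by a geometric series of ratio 1/2.\<close>

lemma joint_compose_holomorphic:
 fixes g :: "complex => complex => complex"
 assumes U: "open U" and r: "0 < r"
  and gz: "!!x. x : U ==> g x holomorphic_on ball z1 r"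
  and gx: "!!w. w : ball z1 r ==> (%x. g x w) holomorphic_on U"
  and B: "!!x w. x : U ==> w : ball z1 r ==> cmod (g x w) <= B"
  and zt: "zt holomorphic_on U" "!!x. x : U ==> zt x : ball z1 (r/4)"
 shows "(%x. g x (zt x)) holomorphic_on U"
proof (cases "U = {}")
 case False
 define c where "c n x = (deriv ^^ n) (g x) z1 / fact n" for n x
 have B0: "B >= 0" using False B[of _ z1] r order_trans[OF norm_ge_zero] by fastforce
 have holc: "c n holomorphic_on U" for n
  unfolding c_def
  by (intro holomorphic_intros, rule iterated_deriv_parameter_holomorphic[OF U gz r gx B]) (use r in auto)
 have est: "cmod (c n x) <= B / (r/2) ^ n" if x: "x : U" for n x
 proof -
  have "cmod ((deriv ^^ n) (g x) z1) <= fact n * B / (r/2) ^ n"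
  proof (rule Cauchy_inequality)
   show "g x holomorphic_on ball z1 (r/2)" by (rule holomorphic_on_subset[OF gz[OF x]]) (use r in auto)
   show "continuous_on (cball z1 (r/2)) (g x)"
    by (rule holomorphic_on_imp_continuous_on, rule holomorphic_on_subset[OF gz[OF x]]) (use r in auto)
   show "cmod (g x u) <= B" if "cmod (z1 - u) = r/2" for u
    using that B[OF x] r by (auto simp: dist_norm)
  qed (use r in auto)
  thus ?thesis by (simp add: c_def norm_divide field_simps)
 qed
 show ?thesis
 proof (rule pointwise_limit_holomorphic[OF U])
  show "(%x. \<Sum>i<n. c i x * (zt x - z1) ^ i) holomorphic_on U" for n
   by (intro holomorphic_intros holc zt)
  fix K assume K: "compact K" "K <= U"
  have "cmod (\<Sum>i<n. c i x * (zt x - z1) ^ i) <= B * 2" if "x : K" for n x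
  proof -
   have x: "x : U" using that K by auto
   have "cmod (c i x * (zt x - z1) ^ i) <= B * (1/2) ^ i" for i
   proof -
    have "cmod (zt x - z1) <= r/4" using zt(2)[OF x] by (simp add: dist_norm norm_minus_commute)
    hence "cmod (zt x - z1) ^ i <= (r/4) ^ i" by (intro power_mono) auto
    hence "cmod (c i x) * cmod (zt x - z1) ^ i <= (B / (r/2) ^ i) * (r/4) ^ i"
     using est[OF x, of i] B0 r by (intro mult_mono) auto
    also have "... = B * (1/2) ^ i"
     proof -
      have "(r/4) ^ i = (r/2) ^ i * (1/2) ^ i" by (simp add: power_mult_distrib[symmetric])
      thus ?thesis using r by simp
     qed
    finally show ?thesis by (simp add: norm_mult norm_power)
   qed
   hence "cmod (\<Sum>i<n. c i x * (zt x - z1) ^ i) <= (\<Sum>i<n. B * (1/2) ^ i)"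
    by (intro sum_norm_le) auto
   also have "... = B * (\<Sum>i<n. (1/2) ^ i)" by (simp add: sum_distrib_left)
   also have "... <= B * 2"
   proof (rule mult_left_mono[OF _ B0])
    show "(\<Sum>i<n. (1/2::real) ^ i) <= 2" by (simp add: sum_gp_strict)
   qed
   finally show ?thesis .
  qed
  thus "EX B. ALL n. ALL x:K. cmod (\<Sum>i<n. c i x * (zt x - z1) ^ i) <= B" by blast
 next
  fix x assume x: "x : U"
  have "zt x : ball z1 r" using zt(2)[OF x] r by auto
  from holomorphic_power_series[OF gz[OF x] this]
  show "(%n. \<Sum>i<n. c i x * (zt x - z1) ^ i) ----> g x (zt x)"
   by (simp add: c_def sums_def)
 qed
qed (simp add: holomorphic_on_def)

section \<open>Holomorphic families of meromorphic functions\<close>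

locale meromorphic_family =
 fixes \<Lambda> :: "complex set" and f :: "complex => complex => complex"
 assumes open_params: "open \<Lambda>" and family: "holomorphic_family \<Lambda> f"
begin

lemma nicely: "x : \<Lambda> ==> f x nicely_meromorphic_on UNIV"
 using family by (auto simp: holomorphic_family_def)

lemma zero_at_pole: "x : \<Lambda> ==> is_pole (f x) z ==> f x z = 0"
 using nicely[of x] unfolding nicely_meromorphic_on_def is_pole_def
 by (metis UNIV_I at_neq_bot not_tendsto_and_filterlim_at_infinity)

lemma analytic_at_nonpole: "x : \<Lambda> ==> ~ is_pole (f x) z ==> f x analytic_on {z}"
 using nicely_meromorphic_on_imp_analytic_at[OF nicely] by blast

lemma differentiable_at_nonpole: "x : \<Lambda> ==> ~ is_pole (f x) z ==> f x field_differentiable at z"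
 using analytic_at_nonpole analytic_on_imp_differentiable_at by blast

lemma holomorphic_off_poles:
 "x : \<Lambda> ==> (!!z. z : S ==> ~ is_pole (f x) z) ==> f x holomorphic_on S"
 unfolding holomorphic_on_def by (blast intro: field_differentiable_at_within differentiable_at_nonpole)

lemma family_alternative:
 assumes "x0 : \<Lambda>"
 obtains U W where "open U" "x0 : U" "U <= \<Lambda>" "open W" "z0 : W"
  "(ALL x:U. ALL z:W. ~ is_pole (f x) z) & (ALL z:W. (%x. f x z) holomorphic_on U) |
  (ALL x:U. ALL z:W. is_pole (f x) z | f x z ~= 0) & (ALL z:W. (%x. inverse (f x z)) holomorphic_on U)"
 using conjunct2[OF family[unfolded holomorphic_family_def], rule_format, OF assms, of z0]
 by (elim exE conjE) (rule that)

lemma inverse_analytic: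
 assumes "x : \<Lambda>" "is_pole (f x) z | f x z ~= 0"
 shows "(%z. inverse (f x z)) analytic_on {z}"
proof (cases "is_pole (f x) z")
 case True
 have "f x meromorphic_on {z}" using nicely[OF assms(1)] meromorphic_on_subset
  unfolding nicely_meromorphic_on_def by blast
 hence "(%z. inverse (f x z)) meromorphic_on {z}" by (intro meromorphic_intros)
 moreover have "((%z. inverse (f x z)) ---> 0) (at z)"
  using True unfolding is_pole_def by (rule filterlim_compose[OF tendsto_inverse_0])
 hence "isCont (%z. inverse (f x z)) z"
  using zero_at_pole[OF assms(1) True] by (simp add: isCont_def)
 ultimately show ?thesis by (rule meromorphic_at_isCont_imp_analytic)
next
 case False
 thus ?thesis using analytic_at_nonpole[OF assms(1) False] assms(2)
  by (intro analytic_on_inverse) auto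
qed

section \<open>Charts and the implicit function theorem\<close>

abbreviation pole :: "complex => complex => bool" where
 "pole x z \<equiv> is_pole (f x) z"

text \<open>Used with \<open>g\<close> the family itself near a finite value and with its reciprocal
  near a pole. Joint continuity and boundedness on the bidisc are what Hartogs's theorem adds to the
  definition of a holomorphic family.\<close>

definition chart :: "(complex => complex => complex) => complex => complex => real => bool" where
 "chart g x0 z0 e \<longleftrightarrow> 0 < e & ball x0 e <= \<Lambda> &
  continuous_on (ball x0 e \<times> ball z0 e) (%(x, z). g x z) &
  (ALL z:ball z0 e. (%x. g x z) holomorphic_on ball x0 e) &
  (ALL x:ball x0 e. g x holomorphic_on ball z0 e) &
  (EX B. ALL x:ball x0 e. ALL z:ball z0 e. cmod (g x z) <= B)"

lemma chartI:
 assumes U: "open U" "x0 : U" "U <= \<Lambda>" and W: "open W" "z0 : W"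
  and gx: "!!z. z : W ==> (%x. g x z) holomorphic_on U"
  and gz: "!!x. x : U ==> g x holomorphic_on W"
 obtains e where "chart g x0 z0 e" "ball x0 e <= U" "ball z0 e <= W"
proof -
 obtain e where e: "0 < e" "ball x0 e <= U" "ball z0 e <= W"
  "continuous_on (ball x0 e \<times> ball z0 e) (%(x, z). g x z)"
  by (rule separately_holomorphic_imp_continuous[OF U(1,2) W gx gz]) auto
 let ?e = "e/2"
 have "compact ((%(x, z). g x z) ` (cball x0 ?e \<times> cball z0 ?e))"
  by (rule compact_continuous_image[OF continuous_on_subset[OF e(4)] compact_Times]) (use e in auto)
 then obtain B where B: "ALL y:(%(x, z). g x z) ` (cball x0 ?e \<times> cball z0 ?e). cmod y <= B"
  using compact_imp_bounded bounded_iff by metis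
 show ?thesis
 proof (rule that[of ?e])
  show "chart g x0 z0 ?e"
   unfolding chart_def
  proof (intro conjI ballI)
   show "continuous_on (ball x0 ?e \<times> ball z0 ?e) (%(x, z). g x z)"
    by (rule continuous_on_subset[OF e(4)]) (use e in auto)
   show "(%x. g x z) holomorphic_on ball x0 ?e" if "z : ball z0 ?e" for z
    by (rule holomorphic_on_subset[OF gx]) (use that e in auto)
   show "g x holomorphic_on ball z0 ?e" if "x : ball x0 ?e" for x
    by (rule holomorphic_on_subset[OF gz]) (use that e in auto)
   show "EX B. ALL x:ball x0 ?e. ALL z:ball z0 ?e. cmod (g x z) <= B"
    using B by (intro exI[of _ B]) force
   show "0 < ?e" using e by simp
   have "ball x0 ?e <= ball x0 e" using e by auto
   thus "ball x0 ?e <= \<Lambda>" using e U by blast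
  qed
  have "ball x0 ?e <= ball x0 e" "ball z0 ?e <= ball z0 e" using e by auto
  thus "ball x0 ?e <= U" "ball z0 ?e <= W" using e by auto
 qed
qed

lemma chart_subset:
 assumes "chart g x0 z0 e" "0 < e'" "ball x1 e' <= ball x0 e" "ball z1 e' <= ball z0 e"
 shows "chart g x1 z1 e'"
 unfolding chart_def
proof (intro conjI ballI)
 have c: "continuous_on (ball x0 e \<times> ball z0 e) (%(x, z). g x z)"
  "!!z. z:ball z0 e ==> (%x. g x z) holomorphic_on ball x0 e"
  "!!x. x:ball x0 e ==> g x holomorphic_on ball z0 e"
  "ball x0 e <= \<Lambda>" "EX B. ALL x:ball x0 e. ALL z:ball z0 e. cmod (g x z) <= B"
  using assms(1) unfolding chart_def by auto
 show "continuous_on (ball x1 e' \<times> ball z1 e') (%(x, z). g x z)"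
  using c(1) by (rule continuous_on_subset) (use assms in auto)
 show "(%x. g x z) holomorphic_on ball x1 e'" if "z : ball z1 e'" for z
  using c(2) that assms by (meson holomorphic_on_subset subsetD)
 show "g x holomorphic_on ball z1 e'" if "x : ball x1 e'" for x
  using c(3) that assms by (meson holomorphic_on_subset subsetD)
 show "EX B. ALL x:ball x1 e'. ALL z:ball z1 e'. cmod (g x z) <= B" using c(5) assms by (meson subsetD)
 show "ball x1 e' <= \<Lambda>" using c(4) assms by blast
qed (use assms in auto)

text \<open>At a point that is not a pole the definition of the family may still offer the
  reciprocal only. Its value there is non-zero and stays so on a smaller bidisc by joint continuity,
  so it can be inverted.\<close>

lemma finite_chart:
 assumes "x0 : \<Lambda>" "~ pole x0 z0"
 obtains e where "chart f x0 z0 e" "!!x z. x : ball x0 e ==> z : ball z0 e ==> ~ pole x z"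
proof -
 obtain U W where UW: "open U" "x0 : U" "U <= \<Lambda>" "open W" "z0 : W"
  and alt: "(ALL x:U. ALL z:W. ~ pole x z) & (ALL z:W. (%x. f x z) holomorphic_on U) |
    (ALL x:U. ALL z:W. pole x z | f x z ~= 0) & (ALL z:W. (%x. inverse (f x z)) holomorphic_on U)"
  by (rule family_alternative[OF assms(1), of z0])
 have "EX U' W'. open U' & x0 : U' & U' <= \<Lambda> & open W' & z0 : W' &
    (ALL x:U'. ALL z:W'. ~ pole x z) & (ALL z:W'. (%x. f x z) holomorphic_on U')"
  using alt
 proof
  assume "(ALL x:U. ALL z:W. ~ pole x z) & (ALL z:W. (%x. f x z) holomorphic_on U)"
  thus ?thesis using UW by blast
 next
  assume A: "(ALL x:U. ALL z:W. pole x z | f x z ~= 0) & (ALL z:W. (%x. inverse (f x z)) holomorphic_on U)"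
  obtain e where e: "chart (%x z. inverse (f x z)) x0 z0 e" "ball x0 e <= U" "ball z0 e <= W"
  proof (rule chartI[OF UW(1-5)])
   show "(%z. inverse (f x z)) holomorphic_on W" if "x : U" for x
    using inverse_analytic[of x] A that UW(3)
    by (intro analytic_imp_holomorphic) (auto simp: analytic_on_analytic_at[of _ W])
  qed (use A in auto)
  have cont: "continuous_on (ball x0 e \<times> ball z0 e) (%(x, z). inverse (f x z))" and "e > 0"
   using e unfolding chart_def by auto
  have "f x0 z0 ~= 0" using A UW assms by auto
  have "open ((ball x0 e \<times> ball z0 e) \<inter> (%(x, z). inverse (f x z)) -` (- {0}))"
   by (rule continuous_open_preimage[OF cont]) (auto intro: open_Times)
  moreover have "(x0, z0) : (ball x0 e \<times> ball z0 e) \<inter> (%(x, z). inverse (f x z)) -` (- {0})"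
   using \<open>f x0 z0 ~= 0\<close> \<open>e > 0\<close> by auto
  ultimately obtain A' B' where AB: "open A'" "open B'" "(x0, z0) : A' \<times> B'"
    "A' \<times> B' <= (ball x0 e \<times> ball z0 e) \<inter> (%(x, z). inverse (f x z)) -` (- {0})"
   by (rule open_prod_elim)
  have AB': "A' <= ball x0 e" "B' <= ball z0 e" using AB by auto
  have np: "f x z ~= 0" if "x : A'" "z : B'" for x z using AB(4) that by auto
  have "~ pole x z" if "x : A'" "z : B'" for x z
   using np[OF that] zero_at_pole[of x z] that AB' e(2) UW(3) by blast
  moreover have "(%x. f x z) holomorphic_on A'" if "z : B'" for z
  proof -
   have "(%x. inverse (inverse (f x z))) holomorphic_on A'"
   proof (rule holomorphic_on_inverse)
    show "(%x. inverse (f x z)) holomorphic_on A'"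
     by (rule holomorphic_on_subset[of _ U]) (use A that AB' e in auto)
    show "inverse (f x z) ~= 0" if "x : A'" for x using np that \<open>z : B'\<close> by simp
   qed
   thus ?thesis by simp
  qed
  ultimately show ?thesis using AB AB' e UW by (intro exI[of _ A'] exI[of _ B']) auto
 qed
 then obtain U' W' where UW': "open U'" "x0 : U'" "U' <= \<Lambda>" "open W'" "z0 : W'"
  "ALL x:U'. ALL z:W'. ~ pole x z" "ALL z:W'. (%x. f x z) holomorphic_on U'" by blast
 obtain e where "chart f x0 z0 e" "ball x0 e <= U'" "ball z0 e <= W'"
 proof (rule chartI[OF UW'(1-5)])
  show "(%x. f x z) holomorphic_on U'" if "z : W'" for z using UW' that by blast
  show "f x holomorphic_on W'" if "x : U'" for x
   by (rule holomorphic_off_poles) (use UW' that in auto)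
 qed
 thus ?thesis using UW' by (intro that) (auto simp: subset_iff)
qed

lemma pole_chart:
 assumes "x0 : \<Lambda>" "pole x0 z0"
 obtains e where "chart (%x z. inverse (f x z)) x0 z0 e"
  "!!x z. x : ball x0 e ==> z : ball z0 e ==> pole x z \<longleftrightarrow> f x z = 0"
proof -
 obtain U W where UW: "open U" "x0 : U" "U <= \<Lambda>" "open W" "z0 : W"
  and alt: "(ALL x:U. ALL z:W. ~ pole x z) & (ALL z:W. (%x. f x z) holomorphic_on U) |
    (ALL x:U. ALL z:W. pole x z | f x z ~= 0) & (ALL z:W. (%x. inverse (f x z)) holomorphic_on U)"
  by (rule family_alternative[OF assms(1), of z0])
 hence A: "ALL x:U. ALL z:W. pole x z | f x z ~= 0" "ALL z:W. (%x. inverse (f x z)) holomorphic_on U"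
  using assms by auto
 show ?thesis
 proof (rule chartI[OF UW(1-5)])
  show "(%z. inverse (f x z)) holomorphic_on W" if "x : U" for x
   using inverse_analytic[of x] A that UW(3)
   by (intro analytic_imp_holomorphic) (auto simp: analytic_on_analytic_at[of _ W])
  fix e assume e: "chart (%x z. inverse (f x z)) x0 z0 e" "ball x0 e <= U" "ball z0 e <= W"
  show thesis
  proof (rule that[OF e(1)])
   fix x z assume "x : ball x0 e" "z : ball z0 e"
   hence "x : U" "z : W" using e by auto
   thus "pole x z \<longleftrightarrow> f x z = 0" using A zero_at_pole[of x z] UW(3) by blast
  qed
 qed (use A in auto)
qed

lemma chart_compose:
 assumes g: "chart g x0 z0 e" and A: "open A" "x0 : A" "zt holomorphic_on A" "zt x0 = z0"
 obtains d where "0 < d" "ball x0 d <= A" "ball x0 d <= ball x0 e" "zt ` ball x0 d <= ball z0 e"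
  "(%x. g x (zt x)) holomorphic_on ball x0 d"
proof -
 have e: "e > 0" using g by (simp add: chart_def)
 have "isCont zt x0"
  by (rule field_differentiable_imp_continuous_at[OF holomorphic_on_imp_differentiable_at[OF A(3,1,2)]])
 from this[unfolded continuous_at_eps_delta, rule_format, of "e/4"]
 obtain d1 where d1: "d1 > 0" "!!x. dist x x0 < d1 ==> dist (zt x) z0 < e/4"
  using e A(4) by auto
 obtain d2 where d2: "d2 > 0" "ball x0 d2 <= A" using A open_contains_ball by blast
 define d where "d = min e (min d1 d2)"
 have d: "d > 0" "ball x0 d <= A" "ball x0 d <= ball x0 e" "zt ` ball x0 d <= ball z0 (e/4)"
  using e d1 d2 by (auto simp: d_def dist_commute subset_iff)
 obtain B where B: "!!x z. x : ball x0 e ==> z : ball z0 e ==> cmod (g x z) <= B"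
  using g unfolding chart_def by blast
 have "(%x. g x (zt x)) holomorphic_on ball x0 d"
 proof (rule joint_compose_holomorphic[where g = g and U = "ball x0 d" and zt = zt and r = e and ?z1.0 = z0 and B = B])
  show "g x holomorphic_on ball z0 e" if "x : ball x0 d" for x using g d that unfolding chart_def by blast
  show "(%x. g x w) holomorphic_on ball x0 d" if "w : ball z0 e" for w
   using g d that holomorphic_on_subset unfolding chart_def by blast
  show "zt holomorphic_on ball x0 d" using A d holomorphic_on_subset by blast
  show "zt x : ball z0 (e/4)" if "x : ball x0 d" for x using d(4) that by blast
  show "cmod (g x w) <= B" if "x : ball x0 d" "w : ball z0 e" for x w using B d(3) that by blast
 qed (use e in auto)
 moreover have "zt ` ball x0 d <= ball z0 e" using d e by force
 ultimately show ?thesis using that d by blast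
qed

lemma deriv_chart:
 assumes "chart g x0 z0 e"
 obtains e' where "chart (%x. deriv (g x)) x0 z0 e'" "e' <= e"
proof -
 have e: "e > 0" using assms by (simp add: chart_def)
 obtain B where B: "!!x z. x : ball x0 e ==> z : ball z0 e ==> cmod (g x z) <= B"
  using assms unfolding chart_def by blast
 obtain e' where e': "chart (%x. deriv (g x)) x0 z0 e'" "ball x0 e' <= ball x0 e" "ball z0 e' <= ball z0 (e/2)"
 proof (rule chartI[of "ball x0 e" x0 "ball z0 (e/2)" z0 "%x. deriv (g x)"])
  show "ball x0 e <= \<Lambda>" using assms by (simp add: chart_def)
  show "deriv (g x) holomorphic_on ball z0 (e/2)" if "x : ball x0 e" for x
  proof (rule holomorphic_on_subset[of _ "ball z0 e"])
   show "deriv (g x) holomorphic_on ball z0 e"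
    using assms that unfolding chart_def by (intro holomorphic_deriv) auto
  qed (use e in auto)
  show "(%x. deriv (g x) z) holomorphic_on ball x0 e" if z: "z : ball z0 (e/2)" for z
  proof -
   have sub: "ball z (2 * (e/4)) <= ball z0 e"
   proof
    fix y assume "y : ball z (2 * (e/4))"
    thus "y : ball z0 e" using z dist_triangle[of z0 y z] by auto
   qed
   have sub': "ball z (e/4) <= ball z0 e" using sub e by (auto simp: subset_iff)
   show ?thesis
   proof (rule deriv_parameter_holomorphic[where r = "e/4" and B = B])
    show "g x holomorphic_on ball z (2 * (e / 4))" if "x : ball x0 e" for x
     using assms that sub holomorphic_on_subset unfolding chart_def by blast
    show "(%x. g x w) holomorphic_on ball x0 e" if "w : ball z (e/4)" for w
     using assms that sub' unfolding chart_def by blast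
    show "cmod (g x w) <= B" if "x : ball x0 e" "w : ball z (2 * (e/4))" for x w
     using B that sub by blast
   qed (use e in auto)
  qed
 qed (use e in auto)
 have "e' > 0" using e' by (simp add: chart_def)
 show ?thesis
 proof (rule that[of "min e' e"])
  show "chart (%x. deriv (g x)) x0 z0 (min e' e)"
   by (rule chart_subset[OF e'(1)]) (use e \<open>e' > 0\<close> in auto)
 qed auto
qed

lemma holomorphic_apply:
 assumes "open A" "A <= \<Lambda>" "zt holomorphic_on A" "!!x. x : A ==> ~ pole x (zt x)"
 shows "(%x. f x (zt x)) holomorphic_on A"
  and "(%x. deriv (f x) (zt x)) holomorphic_on A"
proof -
 have *: "(%x. f x (zt x)) field_differentiable at x & (%x. deriv (f x) (zt x)) field_differentiable at x"
  if x: "x : A" for x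
 proof -
  have xL: "x : \<Lambda>" using x assms(2) by blast
  obtain e where e: "chart f x (zt x) e" by (rule finite_chart[OF xL assms(4)[OF x]])
  obtain e' where e': "chart (%x. deriv (f x)) x (zt x) e'" by (rule deriv_chart[OF e])
  have fd: "0 < d ==> h holomorphic_on ball x d ==> h field_differentiable at x" for h d
   by (rule holomorphic_on_imp_differentiable_at[OF _ open_ball]) auto
  obtain d where d: "0 < d" "(%x. f x (zt x)) holomorphic_on ball x d"
   by (rule chart_compose[OF e assms(1) x assms(3) refl])
  obtain d' where d': "0 < d'" "(%x. deriv (f x) (zt x)) holomorphic_on ball x d'"
   by (rule chart_compose[OF e' assms(1) x assms(3) refl])
  show ?thesis using fd[OF d] fd[OF d'] by blast
 qed
 thus "(%x. f x (zt x)) holomorphic_on A" "(%x. deriv (f x) (zt x)) holomorphic_on A"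
  by (auto simp: holomorphic_on_def field_differentiable_at_within)
qed

text \<open>Mean value inequality for \<open>f x z\<close> minus its linear part at the centre; the
  derivative is jointly continuous, so one radius serves all nearby parameters.\<close>

lemma linearization:
 assumes x1: "x1 : \<Lambda>" "~ pole x1 z1" and "0 < et"
 obtains e where "chart f x1 z1 e" "!!x z. x : ball x1 e ==> z : ball z1 e ==> ~ pole x z"
  "!!x z w. x : ball x1 e ==> z : ball z1 e ==> w : ball z1 e ==>
    cmod (f x z - f x w - deriv (f x1) z1 * (z - w)) <= et * cmod (z - w)"
  "!!x z. x : ball x1 e ==> z : ball z1 e ==> cmod (deriv (f x) z - deriv (f x1) z1) <= et"
proof -
 obtain e where e: "chart f x1 z1 e" and np: "!!x z. x : ball x1 e ==> z : ball z1 e ==> ~ pole x z"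
  by (rule finite_chart[OF x1]) blast
 obtain e' where e': "chart (%x. deriv (f x)) x1 z1 e'" "e' <= e" by (rule deriv_chart[OF e])
 have pos: "e' > 0" using e' by (simp add: chart_def)
 have "isCont (%(x, z). deriv (f x) z) (x1, z1)"
  using e' pos unfolding chart_def
  by (simp add: continuous_on_eq_continuous_at[OF open_Times[OF open_ball open_ball]])
 from this[unfolded continuous_at_eps_delta, rule_format, OF \<open>0 < et\<close>]
 obtain d where d: "d > 0" "!!p. dist p (x1, z1) < d ==> dist (case p of (x,z) => deriv (f x) z) (deriv (f x1) z1) < et"
  by auto
 define t where "t = min e' (d/2)"
 have t: "t > 0" using pos d by (simp add: t_def)
 have der: "cmod (deriv (f x) z - deriv (f x1) z1) <= et" if "x : ball x1 t" "z : ball z1 t" for x z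
 proof -
  have "dist (x, z) (x1, z1) <= dist x x1 + dist z z1"
   by (simp add: dist_Pair_Pair sqrt_sum_squares_le_sum)
  also have "... < d" using that by (simp add: t_def dist_commute)
  finally show ?thesis using d(2)[of "(x, z)"] by (simp add: dist_norm)
 qed
 have ch: "chart f x1 z1 t" by (rule chart_subset[OF e]) (use t e' in "auto simp: t_def")
 show ?thesis
 proof (rule that[OF ch _ _ der])
  show "~ pole x z" if "x : ball x1 t" "z : ball z1 t" for x z
   using np that e' by (simp add: t_def)
  fix x z w assume x: "x : ball x1 t" and zw: "z : ball z1 t" "w : ball z1 t"
  have "cmod ((f x z - deriv (f x1) z1 * z) - (f x w - deriv (f x1) z1 * w)) <= et * cmod (z - w)"
  proof (rule field_differentiable_bound[where S = "ball z1 t" and f' = "%u. deriv (f x) u - deriv (f x1) z1"])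
   fix u assume u: "u : ball z1 t"
   have D: "(f x has_field_derivative deriv (f x) u) (at u)"
    using ch x u unfolding chart_def by (meson holomorphic_derivI open_ball)
   show "((%z. f x z - deriv (f x1) z1 * z) has_field_derivative (deriv (f x) u - deriv (f x1) z1)) (at u within ball z1 t)"
    by (rule has_field_derivative_at_within) (use D in "auto intro!: derivative_eq_intros")
  qed (use zw der x in auto)
  thus "cmod (f x z - f x w - deriv (f x1) z1 * (z - w)) <= et * cmod (z - w)"
   by (simp add: algebra_simps)
 qed
qed

lemma local_injectivity:
 assumes x1: "x1 : \<Lambda>" "~ pole x1 z1" "deriv (f x1) z1 ~= 0"
 obtains e where "chart f x1 z1 e" "!!x z. x : ball x1 e ==> z : ball z1 e ==> ~ pole x z"
  "!!x. x : ball x1 e ==> inj_on (f x) (ball z1 e)"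
  "!!x z. x : ball x1 e ==> z : ball z1 e ==> deriv (f x) z ~= 0"
proof -
 let ?a = "deriv (f x1) z1"
 obtain e where e: "chart f x1 z1 e" "!!x z. x : ball x1 e ==> z : ball z1 e ==> ~ pole x z"
  "!!x z w. x : ball x1 e ==> z : ball z1 e ==> w : ball z1 e ==>
    cmod (f x z - f x w - ?a * (z - w)) <= cmod ?a / 2 * cmod (z - w)"
  "!!x z. x : ball x1 e ==> z : ball z1 e ==> cmod (deriv (f x) z - ?a) <= cmod ?a / 2"
  by (rule linearization[OF x1(1,2), of "cmod ?a / 2"]) (use x1(3) in auto)
 show ?thesis
 proof (rule that[OF e(1,2)])
  show "inj_on (f x) (ball z1 e)" if x: "x : ball x1 e" for x
  proof (rule inj_onI, rule ccontr)
   fix z w assume zw: "z : ball z1 e" "w : ball z1 e" "f x z = f x w" "z ~= w"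
   hence "cmod ?a * cmod (z - w) <= cmod ?a / 2 * cmod (z - w)"
    using e(3)[OF x zw(1,2)] by (simp add: norm_mult)
   thus False using zw x1 by simp
  qed
  show "deriv (f x) z ~= 0" if "x : ball x1 e" "z : ball z1 e" for x z
   using e(4)[OF that] x1 by auto
 qed auto
qed

text \<open>Newton's iteration with the derivative frozen at (x1, z1) is a contraction with factor
  1/2 on a disc that does not depend on \<open>x\<close> and \<open>w\<close>.\<close>

lemma local_solution:
 assumes x1: "x1 : \<Lambda>" "~ pole x1 z1" "deriv (f x1) z1 ~= 0" and eps: "0 < eps"
 obtains dl where "0 < dl" "ball x1 dl <= \<Lambda>"
  "!!x w. x : ball x1 dl ==> w : ball (f x1 z1) dl ==> EX z:ball z1 eps. ~ pole x z & f x z = w"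
proof -
 let ?a = "deriv (f x1) z1"
 obtain e where e: "chart f x1 z1 e" "!!x z. x : ball x1 e ==> z : ball z1 e ==> ~ pole x z"
  "!!x z w. x : ball x1 e ==> z : ball z1 e ==> w : ball z1 e ==>
    cmod (f x z - f x w - ?a * (z - w)) <= cmod ?a / 2 * cmod (z - w)"
  by (rule linearization[OF x1(1,2), of "cmod ?a / 2"]) (use x1(3) in auto)
 have e0: "e > 0" using e by (simp add: chart_def)
 define r where "r = min e eps / 2"
 have r: "r > 0" "r < e" "r < eps" using e0 eps by (auto simp: r_def)
 have a0: "cmod ?a > 0" using x1 by simp
 have "isCont (%x. f x z1) x1"
  using e(1) e0 unfolding chart_def
  by (meson centre_in_ball continuous_on_eq_continuous_at holomorphic_on_imp_continuous_on open_ball)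
 from this[unfolded continuous_at_eps_delta, rule_format, of "cmod ?a * r / 4"]
 obtain d where d: "d > 0" "!!x. dist x x1 < d ==> dist (f x z1) (f x1 z1) < cmod ?a * r / 4"
  using a0 r by auto
 define dl where "dl = min (min e d) (cmod ?a * r / 4)"
 show ?thesis
 proof (rule that[of dl])
  show "0 < dl" using e0 d a0 r by (simp add: dl_def)
  show "ball x1 dl <= \<Lambda>" using e(1) by (auto simp: chart_def dl_def subset_iff)
  fix x w assume x: "x : ball x1 dl" and w: "w : ball (f x1 z1) dl"
  have xe: "x : ball x1 e" using x by (simp add: dl_def)
  define T where "T z = z - (f x z - w) / ?a" for z
  have contr: "cmod (T z - T z') <= 1/2 * cmod (z - z')" if "z : ball z1 e" "z' : ball z1 e" for z z'
  proof -
   have "T z - T z' = - (f x z - f x z' - ?a * (z - z')) / ?a"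
    using x1 by (simp add: T_def field_simps)
   hence "cmod (T z - T z') = cmod (f x z - f x z' - ?a * (z - z')) / cmod ?a"
    by (simp add: norm_divide norm_minus_commute)
   also have "... <= (cmod ?a / 2 * cmod (z - z')) / cmod ?a"
    using e(3)[OF xe that] by (intro divide_right_mono) auto
   finally show ?thesis using a0 by simp
  qed
  have T1: "cmod (T z1 - z1) <= r / 2"
  proof -
   have "dist (f x z1) w <= dist (f x z1) (f x1 z1) + dist (f x1 z1) w" by (rule dist_triangle)
   also have "... <= cmod ?a * r / 4 + cmod ?a * r / 4"
    using d(2)[of x] x w by (intro add_mono) (auto simp: dl_def dist_commute)
   finally have "cmod (f x z1 - w) <= cmod ?a * r / 2" by (simp add: dist_norm mult.commute)
   hence "cmod (f x z1 - w) / cmod ?a <= r / 2" using a0 by (simp add: field_simps)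
   thus ?thesis by (simp add: T_def norm_divide)
  qed
  have "EX! z. z : cball z1 r & T z = z"
  proof (rule Banach_fix[where c = "1/2"])
   show "T ` cball z1 r <= cball z1 r"
   proof (rule image_subsetI)
    fix z assume z: "z : cball z1 r"
    have "cmod (T z - T z1) <= 1/2 * cmod (z - z1)" using z r e0 by (intro contr) auto
    also have "... <= r/2" using z by (simp add: dist_norm norm_minus_commute)
    finally have "cmod (T z - z1) <= r" using T1 norm_triangle_ineq[of "T z - T z1" "T z1 - z1"] by simp
    thus "T z : cball z1 r" by (simp add: dist_norm norm_minus_commute)
   qed
   show "dist (T z) (T z') <= 1/2 * dist z z'" if "z : cball z1 r" "z' : cball z1 r" for z z'
    using contr[of z z'] that r by (auto simp: dist_norm)
  qed (use r in "auto simp: complete_eq_closed")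
  then obtain z where z: "z : cball z1 r" "T z = z" by blast
  hence "f x z = w" using x1 by (simp add: T_def)
  moreover have "z : ball z1 eps" "z : ball z1 e" using z r by auto
  ultimately show "EX z:ball z1 eps. ~ pole x z & f x z = w" using e(2)[OF xe] by blast
 qed
qed

text \<open>Implicit differentiation. The increment of \<open>zt\<close> times \<open>Q\<close>
  equals an increment of known functions, and \<open>Q\<close> tends to the non-zero z-derivative.
  Where the increment of \<open>zt\<close> vanishes, \<open>Q\<close> is given that derivative as
  its value, so the identity persists there.\<close>

lemma continuous_solution_holomorphic:
 assumes A: "open A" "A <= \<Lambda>" and zt: "continuous_on A zt"
  and np: "!!x. x : A ==> ~ pole x (zt x)" "!!x. x : A ==> deriv (f x) (zt x) ~= 0"
  and w: "w holomorphic_on A" "!!x. x : A ==> f x (zt x) = w x"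
 shows "zt holomorphic_on A"
proof -
 have "zt field_differentiable at x1" if x1: "x1 : A" for x1
 proof -
  let ?z = "zt x1" and ?a = "deriv (f x1) (zt x1)"
  have x1L: "x1 : \<Lambda>" using A x1 by auto
  define Q where "Q x = (if zt x = ?z then ?a else (f x (zt x) - f x ?z) / (zt x - ?z))" for x
  have cont: "isCont zt x1" using zt A x1 by (simp add: continuous_on_eq_continuous_at)
  have Qlim: "(Q ---> ?a) (at x1)"
  proof (rule tendstoI)
   fix eps :: real assume eps: "eps > 0"
   obtain e where e: "chart f x1 ?z e" 
    "!!x z w. x : ball x1 e ==> z : ball ?z e ==> w : ball ?z e ==>
     cmod (f x z - f x w - ?a * (z - w)) <= eps/2 * cmod (z - w)"
    by (rule linearization[OF x1L np(1)[OF x1], of "eps/2"]) (use eps in auto)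
   have e0: "e > 0" using e by (simp add: chart_def)
   have "\<forall>\<^sub>F x in at x1. dist (zt x) ?z < e" using cont e0 unfolding isCont_def by (rule tendstoD)
   moreover have "\<forall>\<^sub>F x in at x1. dist x x1 < e" using e0 eventually_at by blast
   ultimately show "\<forall>\<^sub>F x in at x1. dist (Q x) ?a < eps"
   proof eventually_elim
    case (elim x)
    show ?case
    proof (cases "zt x = ?z")
     case False
     have "Q x - ?a = (f x (zt x) - f x ?z - ?a * (zt x - ?z)) / (zt x - ?z)"
      using False by (simp add: Q_def field_simps)
     moreover have "cmod (f x (zt x) - f x ?z - ?a * (zt x - ?z)) <= eps/2 * cmod (zt x - ?z)"
      using elim e0 by (intro e(2)) (auto simp: dist_commute)
     ultimately have "cmod (Q x - ?a) <= eps/2" using False by (simp add: norm_divide pos_divide_le_eq)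
     thus ?thesis using eps by (simp add: dist_norm)
    qed (use eps in "auto simp: Q_def")
   qed
  qed
  obtain e where e: "chart f x1 ?z e" by (rule finite_chart[OF x1L np(1)[OF x1]])
  have e0: "e > 0" using e by (simp add: chart_def)
  obtain D1 where D1: "((%x. f x ?z) has_field_derivative D1) (at x1)"
   using e e0 unfolding chart_def by (meson centre_in_ball holomorphic_derivI open_ball)
  obtain D2 where D2: "(w has_field_derivative D2) (at x1)"
   using w(1) A x1 by (meson holomorphic_derivI)
  have "((%x. w x - f x ?z) has_field_derivative (D2 - D1)) (at x1)"
   using D1 D2 by (intro derivative_intros)
  hence m: "((%x. ((w x - f x ?z) - (w x1 - f x1 ?z)) / (x - x1)) ---> D2 - D1) (at x1)"
   by (simp add: has_field_derivative_iff)
  have "((%x. ((w x - f x ?z) - (w x1 - f x1 ?z)) / (x - x1) / Q x) ---> (D2 - D1) / ?a) (at x1)"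
   by (intro tendsto_divide m Qlim np x1)
  moreover have "\<forall>\<^sub>F x in at x1. ((w x - f x ?z) - (w x1 - f x1 ?z)) / (x - x1) / Q x = (zt x - ?z) / (x - x1)"
  proof -
   have "\<forall>\<^sub>F x in at x1. Q x ~= 0" using Qlim np x1 by (auto intro: tendsto_imp_eventually_ne)
   moreover have "\<forall>\<^sub>F x in at x1. x : A" using A x1 by (simp add: eventually_at_in_open')
   ultimately show ?thesis
   proof eventually_elim
    case (elim x)
    have "w x - f x ?z = (zt x - ?z) * Q x" using w(2)[OF elim(2)] by (auto simp: Q_def)
    thus ?case using elim w(2)[OF x1] by simp
   qed
  qed
  ultimately have "((%x. (zt x - ?z) / (x - x1)) ---> (D2 - D1) / ?a) (at x1)"
   by (rule Lim_transform_eventually)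
  thus ?thesis unfolding field_differentiable_def has_field_derivative_iff by blast
 qed
 thus ?thesis by (auto simp: holomorphic_on_def field_differentiable_at_within)
qed

end

section \<open>Attracting cycles and traps\<close>

text \<open>The tube lemma in terms of filters; it turns pointwise persistence on a compact disc
  into persistence for all nearby parameters.\<close>

lemma eventually_compact_tube:
 fixes x1 :: "'a::topological_space" and K :: "'b::topological_space set"
 assumes "compact K" and ev: "!!z. z : K ==> \<forall>\<^sub>F p in nhds (x1, z). P (fst p) (snd p)"
 shows "\<forall>\<^sub>F x in nhds x1. ALL z:K. P x z"
proof -
 let ?C = "{B. open B & (\<forall>\<^sub>F x in nhds x1. ALL y:B. P x y)}"
 have "K <= \<Union>?C"
 proof
  fix z assume z: "z : K"
  obtain S where S: "open S" "(x1, z) : S" "ALL p:S. P (fst p) (snd p)"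
   using ev[OF z] unfolding eventually_nhds by blast
  obtain A B where AB: "open A" "open B" "(x1, z) : A \<times> B" "A \<times> B <= S"
   by (rule open_prod_elim[OF S(1,2)])
  have "ALL x:A. ALL y:B. P x y" using S(3) AB(4) by force
  hence "\<forall>\<^sub>F x in nhds x1. ALL y:B. P x y" unfolding eventually_nhds using AB by blast
  thus "z : \<Union>?C" using AB by blast
 qed
 from compactE[OF assms(1) this] obtain D where D: "D <= ?C" "finite D" "K <= \<Union>D"
  by auto
 have "\<forall>\<^sub>F x in nhds x1. ALL B:D. ALL y:B. P x y"
  using D by (intro eventually_ball_finite) auto
 thus ?thesis by eventually_elim (use D(3) in blast)
qed

lemma funpow_deriv_fixed_point:
 assumes "ph field_differentiable at z" "ph z = z"
 shows "((ph ^^ n) has_field_derivative (deriv ph z) ^ n) (at z)"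
proof (induction n)
 case 0
 thus ?case by (simp add: DERIV_ident id_def)
next
 case (Suc n)
 have fix_n: "(ph ^^ n) z = z" using assms(2) by (induction n) auto
 have "(ph has_field_derivative deriv ph z) (at ((ph ^^ n) z))"
  using assms(1) by (simp add: fix_n DERIV_deriv_iff_field_differentiable)
 from DERIV_chain[OF this Suc] show ?case by (simp add: o_def)
qed

text \<open>The Schwarz--Pick lemma at the fixed point makes the map a strict contraction towards it.\<close>

lemma self_map_fixed_point:
 fixes ph :: "complex => complex"
 assumes r: "0 < r" and hol: "ph holomorphic_on ball a r" and cont: "continuous_on (cball a r) ph"
  and sub: "ph ` cball a r <= ball a r"
 obtains z where "z : ball a r" "ph z = z" "cmod (deriv ph z) < 1"
  "!!eps. eps > 0 ==> EX N. ALL n>=N. ALL w:cball a r. dist ((ph ^^ n) w) z < eps"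
proof -
 obtain z where z: "z : cball a r" "ph z = z"
  by (rule brouwer_ball[OF r cont]) (use sub in auto)
 have zb: "z : ball a r" using z sub by force
 define c where "c = (z - a) / of_real r"
 define u where "u w = (w - a) / of_real r" for w
 define m where "m w = Moebius_function 0 c (u w)" for w
 have c1: "cmod c < 1" using zb r by (simp add: c_def norm_divide dist_norm norm_minus_commute)
 have u1: "cmod (u w) < 1 \<longleftrightarrow> w : ball a r" for w
  using r by (auto simp: u_def norm_divide dist_norm norm_minus_commute)
 have "compact (ph ` cball a r)" by (intro compact_continuous_image cont) auto
 have "continuous_on (ph ` cball a r) u" unfolding u_def using r by (intro continuous_intros) auto
 hence cm: "compact (u ` ph ` cball a r)"
  by (rule compact_continuous_image) fact
 have su: "u ` ph ` cball a r <= ball 0 1" using sub u1 by auto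
 have cM: "continuous_on (ball 0 1) (%t. cmod (Moebius_function 0 c t))"
  using Moebius_function_holomorphic[OF c1] holomorphic_on_imp_continuous_on by (intro continuous_on_norm) auto
 obtain t0 where t0: "t0 : u ` ph ` cball a r"
   "!!t. t : u ` ph ` cball a r ==> cmod (Moebius_function 0 c t) <= cmod (Moebius_function 0 c t0)"
  using continuous_attains_sup[OF cm _ continuous_on_subset[OF cM su]] r by auto
 \<comment> \<open>The image of the closed disc is compact in the open disc, so in the Moebius
   coordinate its modulus stays below some \<open>kp\<close> < 1. Dividing by \<open>kp\<close>
   before applying Schwarz's lemma improves the weak contraction to the factor
   \<open>kp\<close>.\<close>
 define kp where "kp = (cmod (Moebius_function 0 c t0) + 1) / 2"
 have "cmod (Moebius_function 0 c t0) < 1" using subsetD[OF su t0(1)] by (intro Moebius_function_norm_lt_1[OF c1]) simp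
 hence kp: "0 < kp" "kp < 1" "cmod (Moebius_function 0 c t0) < kp"
  by (auto simp: kp_def intro: add_nonneg_pos)
 have less: "cmod (m (ph w)) < kp" if "w : cball a r" for w
  using t0(2)[of "u (ph w)"] kp that by (auto simp: m_def)
 define b where "b t = a + of_real r * Moebius_function 0 (-c) t" for t
 have b_in: "b t : ball a r" if "cmod t < 1" for t
 proof -
  have "cmod (Moebius_function 0 (-c) t) < 1" by (rule Moebius_function_norm_lt_1) (use c1 that in auto)
  thus ?thesis using r by (simp add: b_def dist_norm norm_mult)
 qed
 have mb: "m (b t) = t" if "cmod t < 1" for t
 proof -
  have "u (b t) = Moebius_function 0 (-c) t" using r by (simp add: u_def b_def)
  thus ?thesis using Moebius_function_compose[of c "-c" t] c1 that by (simp add: m_def)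
 qed
 have bm: "b (m w) = w" if "w : ball a r" for w
 proof -
  have "Moebius_function 0 (-c) (Moebius_function 0 c (u w)) = u w"
   by (rule Moebius_function_compose) (use c1 that u1 in auto)
  thus ?thesis using r by (simp add: b_def m_def) (simp add: u_def)
 qed
 have m1: "cmod (m w) < 1" if "w : ball a r" for w
  unfolding m_def by (rule Moebius_function_norm_lt_1[OF c1]) (use that u1 in auto)
 have mz: "m z = 0" by (simp add: m_def u_def c_def Moebius_function_eq_zero)
 have step: "cmod (m (ph w)) <= kp * cmod (m w)" if w: "w : ball a r" for w
 proof -
  have "cmod ((%t. m (ph (b t)) / of_real kp) (m w)) <= cmod (m w)"
  proof (rule Schwarz_Lemma(1))
   have "b holomorphic_on ball 0 1"
    unfolding b_def by (intro holomorphic_intros Moebius_function_holomorphic) (use c1 in auto)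
   hence "(ph \<circ> b) holomorphic_on ball 0 1"
    by (rule holomorphic_on_compose_gen[OF _ hol]) (use b_in in auto)
   hence "(%t. u (ph (b t))) holomorphic_on ball 0 1"
    unfolding u_def o_def using r by (intro holomorphic_intros) auto
   hence "(Moebius_function 0 c \<circ> (%t. u (ph (b t)))) holomorphic_on ball 0 1"
   proof (rule holomorphic_on_compose_gen[OF _ Moebius_function_holomorphic[OF c1]])
    show "(%t. u (ph (b t))) ` ball 0 1 <= ball 0 1"
    proof (rule image_subsetI)
     fix t :: complex assume "t : ball 0 1"
     hence "b t : cball a r" using b_in[of t] by auto
     hence "ph (b t) : ball a r" using sub by blast
     thus "u (ph (b t)) : ball 0 1" using u1 by simp
    qed
   qed
   thus "(%t. m (ph (b t)) / of_real kp) holomorphic_on ball 0 1"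
    unfolding m_def o_def using kp by (intro holomorphic_intros) auto
   have "b 0 = z" using bm[OF zb] mz by simp
   thus "m (ph (b 0)) / of_real kp = 0" using z mz by simp
   fix t :: complex assume "cmod t < 1"
   hence "cmod (m (ph (b t))) < kp" using less[of "b t"] b_in[of t] by auto
   thus "cmod (m (ph (b t)) / of_real kp) < 1" using kp by (simp add: norm_divide)
  qed (use m1 w in auto)
  thus ?thesis using bm[OF w] kp by (simp add: norm_divide field_simps)
 qed
 have stay: "ph w : cball a r" if "w : cball a r" for w
  using subsetD[OF sub imageI[OF that]] by simp
 have it: "(ph ^^ n) w : cball a r" if "w : cball a r" for n w
  by (induction n) (use that stay in simp_all)
 have itb: "(ph ^^ Suc n) w : ball a r" if "w : cball a r" for n w
  using it[OF that, of n] sub by (auto simp: image_subset_iff)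
 have small: "cmod (m ((ph ^^ Suc n) w)) <= kp ^ n" if w: "w : cball a r" for n w
 proof (induction n)
  case 0
  have "ph w : ball a r" using itb[OF w, of 0] by simp
  thus ?case using m1[of "ph w"] by simp
 next
  case (Suc n)
  have "cmod (m ((ph ^^ Suc (Suc n)) w)) <= kp * cmod (m ((ph ^^ Suc n) w))"
   using step[OF itb[OF w, of n]] by simp
  also have "... <= kp * kp ^ n" using Suc kp by (intro mult_left_mono) auto
  finally show ?case by simp
 qed
 have bk: "cmod (w - z) <= 2 * r * cmod (m w)" if w: "w : ball a r" for w
 proof -
  have uw: "cmod (u w) < 1" using u1 w by simp
  have "cmod (cnj c * u w) < 1" using norm_mult_less[of "cnj c" 1 "u w" 1] c1 uw by simp
  hence nz: "1 - cnj c * u w ~= 0" by auto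
  have "cmod (1 - cnj c * u w) <= 2"
   using norm_triangle_ineq4[of 1 "cnj c * u w"] \<open>cmod (cnj c * u w) < 1\<close> by simp
  moreover have "u w - c = m w * (1 - cnj c * u w)" using nz by (simp add: m_def Moebius_function_simple)
  ultimately have "cmod (u w - c) <= cmod (m w) * 2" by (simp add: norm_mult mult_left_mono)
  moreover have "w - z = of_real r * (u w - c)" using r by (simp add: u_def c_def field_simps)
  ultimately show ?thesis using r by (simp add: norm_mult)
 qed
 have unif: "EX N. ALL n>=N. ALL w:cball a r. dist ((ph ^^ n) w) z < eps" if "eps > 0" for eps
 proof -
  have "(%n. 2 * r * kp ^ n) ----> 2 * r * 0" using kp by (intro tendsto_intros LIMSEQ_power_zero) auto
  hence "\<forall>\<^sub>F n in sequentially. 2 * r * kp ^ n < eps" using that by (intro order_tendstoD(2)) auto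
  then obtain N where N: "!!n. n >= N ==> 2 * r * kp ^ n < eps"
   unfolding eventually_sequentially by blast
  have "dist ((ph ^^ n) w) z < eps" if n: "n >= Suc N" and w: "w : cball a r" for n w
  proof -
   obtain k where k: "n = Suc k" "k >= N" using n by (cases n) auto
   have "cmod ((ph ^^ n) w - z) <= 2 * r * cmod (m ((ph ^^ n) w))"
    using bk[OF itb[OF w, of k]] k by simp
   also have "... <= 2 * r * kp ^ k" using small[OF w, of k] r k by (intro mult_left_mono) auto
   finally show ?thesis using N[OF k(2)] by (simp add: dist_norm)
  qed
  thus ?thesis by blast
 qed
 \<comment> \<open>Otherwise all iterates have derivative of modulus at least 1 at \<open>z\<close>,
   but a late iterate is so close to the constant \<open>z\<close> that Cauchy's estimate bounds it
   by 1/2.\<close>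
 have "cmod (deriv ph z) < 1"
 proof (rule ccontr)
  assume ge: "~ cmod (deriv ph z) < 1"
  obtain dl where dl: "dl > 0" "ball z dl <= ball a r" using zb by (meson open_ball open_contains_ball)
  have hn: "(ph ^^ n) holomorphic_on ball a r" for n
  proof (induction n)
   case 0
   thus ?case by (simp add: id_def holomorphic_on_ident)
  next
   case (Suc n)
   have "(ph ^^ n) ` ball a r <= ball a r"
   proof (cases n)
    case (Suc k)
    thus ?thesis using itb by (auto simp del: funpow.simps)
   qed auto
   from holomorphic_on_compose_gen[OF Suc hol this] show ?case by (simp add: o_def)
  qed
  obtain N where N: "ALL n>=N. ALL w:cball a r. dist ((ph ^^ n) w) z < dl / 2"
   using unif[of "dl/2"] dl by auto
  have fd: "ph field_differentiable at z" using hol zb holomorphic_on_imp_differentiable_at by blast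
  have "((%w. (ph ^^ N) w - z) has_field_derivative (deriv ph z) ^ N) (at z)"
   using funpow_deriv_fixed_point[OF fd z(2), of N] by (auto intro!: derivative_eq_intros)
  hence "deriv (%w. (ph ^^ N) w - z) z = (deriv ph z) ^ N" by (rule DERIV_imp_deriv)
  moreover have "cmod (deriv (%w. (ph ^^ N) w - z) z) <= (dl/2) / dl"
  proof (rule deriv_le_of_bound)
   show "(%w. (ph ^^ N) w - z) holomorphic_on ball z dl"
    by (intro holomorphic_intros holomorphic_on_subset[OF hn] dl)
   fix w assume "w : ball z dl"
   hence "w : cball a r" using dl by auto
   thus "cmod ((ph ^^ N) w - z) <= dl/2" using N by (force simp: dist_norm)
  qed (use dl in auto)
  moreover have "1 <= cmod (deriv ph z) ^ N" using ge by (intro one_le_power) auto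
  ultimately show False using dl by (simp add: norm_power)
 qed
 thus ?thesis using that zb z(2) unif by blast
qed

section \<open>Periodic cycles and their basins\<close>

text \<open>By the chain rule this is the independence of the multiplier of the base point.
  Cancelling \<open>c j\<close> requires it to be non-zero; if it vanishes, so do both
  products.\<close>

lemma prod_periodic_shift:
 fixes c :: "nat => 'a::idom"
 assumes "!!i. c (i + k) = c i"
 shows "(\<Prod>i<k. c (i + j)) = (\<Prod>i<k. c i)"
proof (induction j)
 case (Suc j)
 show ?case
 proof (cases "k = 0")
  case False
  have eq: "c j * (\<Prod>i<k. c (Suc i + j)) = (\<Prod>i<k. c (i + j)) * c (k + j)"
   using prod.lessThan_Suc_shift[of "%i. c (i + j)" k] prod.lessThan_Suc[of "%i. c (i + j)" k] by simp
  have kj: "c (k + j) = c j" using assms[of j] by (simp add: add.commute)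
  show ?thesis
  proof (cases "c j = 0")
   case True
   have "(\<Prod>i<k. c (i + j)) = 0" using True False by (intro prod_zero) (auto intro!: bexI[of _ 0])
   moreover have "(\<Prod>i<k. c (i + Suc j)) = 0"
    using True False kj by (intro prod_zero) (auto intro!: bexI[of _ "k - 1"])
   ultimately show ?thesis using Suc by metis
  next
   case False
   thus ?thesis using eq kj Suc by simp
  qed
 qed simp
qed simp

lemma cycle_orbit:
 assumes "cycle g k C" "c : C"
 shows "(g ^^ k) c = c" "C = range (%j. (g ^^ j) c)" "C = (%j. (g ^^ j) c) ` {..<k}"
  "inj_on (%j. (g ^^ j) c) {..<k}" "finite C" "card C = k" "k >= 1"
proof -
 obtain z where z: "(g ^^ k) z = z" "inj_on (%j. (g ^^ j) z) {..<k}" "C = (%j. (g ^^ j) z) ` {..<k}"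
  and k: "k >= 1" using assms(1) unfolding cycle_def by blast
 obtain i where i: "i < k" "c = (g ^^ i) z" using assms(2) z(3) by blast
 show c: "(g ^^ k) c = c" using z(1) i by (metis add.commute comp_apply funpow_add)
 show "finite C" "card C = k" using z by (auto simp: card_image)
 show "k >= 1" by (fact k)
 have inC: "(g ^^ j) z : C" for j
  using z(3) k funpow_mod_eq[OF z(1), of j] mod_less_divisor[of k j] by (metis image_eqI lessThan_iff less_le_trans zero_less_one)
 show C: "C = range (%j. (g ^^ j) c)"
 proof
  show "range (%j. (g ^^ j) c) <= C" using inC i by (auto simp: funpow_add[symmetric, THEN fun_cong, unfolded o_apply])
  show "C <= range (%j. (g ^^ j) c)"
  proof
   fix y assume "y : C"
   then obtain m where m: "y = (g ^^ m) z" using z(3) by blast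
   have "(m + i * (k - 1) + i) mod k = m mod k"
   proof -
    have "m + i * (k - 1) + i = m + i * k" using k by (cases k) auto
    thus ?thesis by (metis mod_mult_self1)
   qed
   hence "(g ^^ (m + i * (k - 1) + i)) z = (g ^^ m) z"
    using funpow_mod_eq[OF z(1)] by metis
   hence "y = (g ^^ (m + i * (k - 1))) c" using m i by (metis comp_apply funpow_add)
   thus "y : range (%j. (g ^^ j) c)" by blast
  qed
 qed
 show C': "C = (%j. (g ^^ j) c) ` {..<k}"
 proof
  show "C <= (%j. (g ^^ j) c) ` {..<k}"
  proof
   fix y assume "y : C"
   then obtain j where "y = (g ^^ j) c" using C by blast
   hence "y = (g ^^ (j mod k)) c" using funpow_mod_eq[OF c] by metis
   moreover have "j mod k < k" using k by simp
   ultimately show "y : (%j. (g ^^ j) c) ` {..<k}" by blast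
  qed
 qed (use C in auto)
 show "inj_on (%j. (g ^^ j) c) {..<k}"
  using \<open>card C = k\<close> C' by (intro eq_card_imp_inj_on) auto
qed

lemma cycle_unique:
 assumes "cycle g k C" "cycle g k' C'" "C \<inter> C' ~= {}"
 shows "C = C'" "k = k'"
proof -
 obtain c where "c : C" "c : C'" using assms(3) by blast
 thus "C = C'" using cycle_orbit(2)[OF assms(1)] cycle_orbit(2)[OF assms(2)] by metis
 thus "k = k'" using cycle_orbit(6)[OF assms(1) \<open>c : C\<close>] cycle_orbit(6)[OF assms(2) \<open>c : C'\<close>] by simp
qed

lemma infdist_less_obtain:
 assumes "infdist x A < dl" "A ~= {}"
 obtains a where "a : A" "dist x a < dl"
 using assms unfolding infdist_def by (auto dest!: cInf_lessD[rotated])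

lemma basin_converges:
 assumes "z : basin g C" "0 < dl"
 shows "\<forall>\<^sub>F n in sequentially. infdist ((g ^^ n) z) C < dl"
proof -
 obtain U where U: "z : U" "uniform_limit U (%n w. infdist ((g ^^ n) w) C) (%_. 0) sequentially"
  using assms(1) unfolding basin_def by blast
 from uniform_limitD[OF U(2) assms(2)] show ?thesis
  by eventually_elim (use U(1) in "auto simp: infdist_nonneg")
qed

lemma basin_no_pole: "z : basin g C ==> ~ is_pole g ((g ^^ n) z)"
 unfolding basin_def by blast

lemma basin_unique:
 assumes C: "cycle g k C" "cycle g k' C'" and z: "z : basin g C" "z : basin g C'"
 shows "C = C'"
proof (rule ccontr)
 assume ne: "C ~= C'"
 have nonempty: "C ~= {}" "C' ~= {}" using C by (auto simp: cycle_def lessThan_empty_iff)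
 hence fin: "finite C" "finite C'" using cycle_orbit(5) C by blast+
 have "C \<inter> C' = {}" using cycle_unique(1)[OF C] ne by blast
 hence "setdist C C' > 0"
  using fin nonempty by (simp add: setdist_gt_0_compact_closed finite_imp_compact finite_imp_closed)
 then obtain n where n: "infdist ((g ^^ n) z) C < setdist C C' / 2" "infdist ((g ^^ n) z) C' < setdist C C' / 2"
  using eventually_happens'[OF sequentially_bot eventually_conj[OF basin_converges[OF z(1), of "setdist C C' / 2"] basin_converges[OF z(2), of "setdist C C' / 2"]]]
  by auto
 obtain c where c: "c : C" "dist ((g ^^ n) z) c < setdist C C' / 2" using infdist_less_obtain[OF n(1) nonempty(1)] .
 obtain c' where c': "c' : C'" "dist ((g ^^ n) z) c' < setdist C C' / 2" using infdist_less_obtain[OF n(2) nonempty(2)] .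
 have "setdist C C' <= dist c c'" using c c' by (intro setdist_le_dist)
 thus False using c c' dist_triangle3[of c c' "(g ^^ n) z"] by simp
qed


lemma finite_separation:
 fixes P :: "'a::metric_space set"
 assumes "finite P"
 obtains et where "et > 0" "!!p q. p : P ==> q : P ==> p ~= q ==> ball p et \<inter> ball q et = {}"
proof -
 let ?D = "insert 1 ((%(p, q). dist p q) ` {(p, q) : P \<times> P. p ~= q})"
 have "finite {(p, q) : P \<times> P. p ~= q}" by (rule finite_subset[of _ "P \<times> P"]) (use assms in auto)
 hence fin: "finite ?D" by simp
 have pos: "Min ?D > 0" using fin by (subst Min_gr_iff) auto
 show ?thesis
 proof (rule that[of "Min ?D / 2"])
  show "Min ?D / 2 > 0" using pos by simp
  fix p q assume pq: "p : P" "q : P" "p ~= q"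
  have le: "Min ?D <= dist p q" using pq by (intro Min_le fin) force
  show "ball p (Min ?D / 2) \<inter> ball q (Min ?D / 2) = {}"
   by (rule disjoint_ballI) (use le in simp)
 qed
qed

text \<open>An open condition on a compact disc, hence stable under small changes of the map, which
  nevertheless forces an attracting or superattracting cycle. The sets \<open>W j\<close> tell the
  steps apart: if they are disjoint, the period is \<open>k\<close> and not a proper
  divisor.\<close>

definition trap :: "(complex => complex) => nat => complex => real => (nat => complex set) => bool" where
 "trap g k a r W \<longleftrightarrow> 1 <= k & 0 < r &
  (ALL w:cball a r. (ALL j<k. ~ is_pole g ((g ^^ j) w) & (g ^^ j) w : W j) & (g ^^ k) w : ball a r)"

context meromorphic_family
begin

section \<open>Iterates that avoid the poles\<close>

text \<open>The function has the default value 0 at its poles, so \<open>f x ^^ j\<close> keeps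
  producing numbers after a pole. It is an iterate of the meromorphic map only as long as this
  predicate holds.\<close>

definition regular :: "nat => complex => complex => bool" where
 "regular n x z \<longleftrightarrow> (ALL j<n. ~ pole x ((f x ^^ j) z))"

lemma regular_0 [simp]: "regular 0 x z"
 by (simp add: regular_def)

lemma regular_Suc: "regular (Suc n) x z \<longleftrightarrow> regular n x z & ~ pole x ((f x ^^ n) z)"
 by (auto simp: regular_def less_Suc_eq)

lemma regular_add: "regular (m + n) x z \<longleftrightarrow> regular m x z & regular n x ((f x ^^ m) z)"
proof (induction n)
 case (Suc n)
 thus ?case by (simp add: regular_Suc add.commute[of m] funpow_add)
qed simp

lemma regular_Suc': "regular (Suc n) x z \<longleftrightarrow> ~ pole x z & regular n x (f x z)"
 using regular_add[of 1 n x z] by (simp add: regular_Suc)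

lemma regular_mono: "regular n x z ==> m <= n ==> regular m x z"
 by (auto simp: regular_def)

lemma near_nonpole:
 assumes "x1 : \<Lambda>" "~ pole x1 z1"
 shows "\<forall>\<^sub>F p in nhds (x1, z1). fst p : \<Lambda> & ~ pole (fst p) (snd p)"
  and "((%p. f (fst p) (snd p)) ---> f x1 z1) (nhds (x1, z1))"
proof -
 obtain e where e: "chart f x1 z1 e" and np: "!!x z. x : ball x1 e ==> z : ball z1 e ==> ~ pole x z"
  by (rule finite_chart[OF assms]) blast
 have o: "open (ball x1 e \<times> ball z1 e)" "(x1, z1) : ball x1 e \<times> ball z1 e"
  using e by (auto simp: chart_def intro: open_Times)
 show "\<forall>\<^sub>F p in nhds (x1, z1). fst p : \<Lambda> & ~ pole (fst p) (snd p)"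
  unfolding eventually_nhds using o np e by (intro exI[of _ "ball x1 e \<times> ball z1 e"]) (auto simp: chart_def)
 have "isCont (%(x, z). f x z) (x1, z1)"
  using e o continuous_on_eq_continuous_at unfolding chart_def by blast
 thus "((%p. f (fst p) (snd p)) ---> f x1 z1) (nhds (x1, z1))"
  unfolding isCont_def case_prod_beta'
  using tendsto_at_iff_tendsto_nhds[of "%p. f (fst p) (snd p)" "(x1, z1)"] by simp
qed

text \<open>Near a pole the genuine values are large, so the value 0 can only be the default one and
  identifies the poles.\<close>

lemma near_pole:
 assumes "x1 : \<Lambda>" "pole x1 z1"
 shows "\<forall>\<^sub>F p in nhds (x1, z1). fst p : \<Lambda> & (pole (fst p) (snd p) \<longleftrightarrow> f (fst p) (snd p) = 0)"
  and "((%p. inverse (f (fst p) (snd p))) ---> 0) (nhds (x1, z1))"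
proof -
 obtain e where e: "chart (%x z. inverse (f x z)) x1 z1 e"
  and np: "!!x z. x : ball x1 e ==> z : ball z1 e ==> pole x z \<longleftrightarrow> f x z = 0"
  by (rule pole_chart[OF assms]) blast
 have o: "open (ball x1 e \<times> ball z1 e)" "(x1, z1) : ball x1 e \<times> ball z1 e"
  using e by (auto simp: chart_def intro: open_Times)
 show "\<forall>\<^sub>F p in nhds (x1, z1). fst p : \<Lambda> & (pole (fst p) (snd p) \<longleftrightarrow> f (fst p) (snd p) = 0)"
  unfolding eventually_nhds using o np e by (intro exI[of _ "ball x1 e \<times> ball z1 e"]) (auto simp: chart_def)
 have "isCont (%(x, z). inverse (f x z)) (x1, z1)"
  using e o continuous_on_eq_continuous_at unfolding chart_def by blast
 thus "((%p. inverse (f (fst p) (snd p))) ---> 0) (nhds (x1, z1))"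
  unfolding isCont_def case_prod_beta'
  using tendsto_at_iff_tendsto_nhds[of "%p. inverse (f (fst p) (snd p))" "(x1, z1)"] zero_at_pole[OF assms] by simp
qed

lemma near_regular:
 assumes "x1 : \<Lambda>" "regular n x1 z1"
 shows "\<forall>\<^sub>F p in nhds (x1, z1). fst p : \<Lambda> & regular n (fst p) (snd p)"
  and "((%p. (f (fst p) ^^ n) (snd p)) ---> (f x1 ^^ n) z1) (nhds (x1, z1))"
proof -
 have "(\<forall>\<^sub>F p in nhds (x1, z1). fst p : \<Lambda> & regular n (fst p) (snd p)) &
  ((%p. (f (fst p) ^^ n) (snd p)) ---> (f x1 ^^ n) z1) (nhds (x1, z1))"
  using assms(2)
 proof (induction n)
  case 0
  have "((%p. snd p) ---> z1) (nhds (x1, z1))" "((%p. fst p) ---> x1) (nhds (x1, z1))"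
   using tendsto_snd[OF filterlim_ident[of "nhds (x1, z1)"]] tendsto_fst[OF filterlim_ident[of "nhds (x1, z1)"]] by auto
  thus ?case using topological_tendstoD[of fst x1 "nhds (x1, z1)" \<Lambda>] open_params assms(1) by simp
 next
  case (Suc n)
  have IH: "\<forall>\<^sub>F p in nhds (x1, z1). fst p : \<Lambda> & regular n (fst p) (snd p)"
   "((%p. (f (fst p) ^^ n) (snd p)) ---> (f x1 ^^ n) z1) (nhds (x1, z1))"
   using Suc by (auto simp: regular_Suc)
  have "((%p. fst p) ---> x1) (nhds (x1, z1))"
   using tendsto_fst[OF filterlim_ident[of "nhds (x1, z1)"]] by auto
  hence lim: "((%p. (fst p, (f (fst p) ^^ n) (snd p))) ---> (x1, (f x1 ^^ n) z1)) (nhds (x1, z1))"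
   using IH(2) by (rule tendsto_Pair)
  have np: "~ pole x1 ((f x1 ^^ n) z1)" using Suc.prems by (simp add: regular_Suc)
  have "\<forall>\<^sub>F p in nhds (x1, z1). fst p : \<Lambda> & ~ pole (fst p) ((f (fst p) ^^ n) (snd p))"
   using eventually_compose_filterlim[OF near_nonpole(1)[OF assms(1) np] lim] by simp
  with IH(1) have "\<forall>\<^sub>F p in nhds (x1, z1). fst p : \<Lambda> & regular (Suc n) (fst p) (snd p)"
   by eventually_elim (simp add: regular_Suc)
  moreover have "((%p. (f (fst p) ^^ Suc n) (snd p)) ---> (f x1 ^^ Suc n) z1) (nhds (x1, z1))"
   using filterlim_compose[OF near_nonpole(2)[OF assms(1) np] lim] by simp
  ultimately show ?case by blast
 qed
 thus "\<forall>\<^sub>F p in nhds (x1, z1). fst p : \<Lambda> & regular n (fst p) (snd p)"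
  and "((%p. (f (fst p) ^^ n) (snd p)) ---> (f x1 ^^ n) z1) (nhds (x1, z1))" by blast+
qed

lemma regular_along:
 assumes "x1 : \<Lambda>" "regular n x1 (h x1)" "isCont h x1"
 shows "\<forall>\<^sub>F x in nhds x1. x : \<Lambda> & regular n x (h x)"
  and "((%x. (f x ^^ n) (h x)) ---> (f x1 ^^ n) (h x1)) (nhds x1)"
proof -
 have "(h ---> h x1) (nhds x1)" using assms(3) by (simp add: isCont_def tendsto_at_iff_tendsto_nhds)
 hence lim: "((%x. (x, h x)) ---> (x1, h x1)) (nhds x1)" by (intro tendsto_Pair) (auto intro: filterlim_ident)
 show "\<forall>\<^sub>F x in nhds x1. x : \<Lambda> & regular n x (h x)"
  using eventually_compose_filterlim[OF near_regular(1)[OF assms(1,2)] lim] by simp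
 show "((%x. (f x ^^ n) (h x)) ---> (f x1 ^^ n) (h x1)) (nhds x1)"
  using filterlim_compose[OF near_regular(2)[OF assms(1,2)] lim] by simp
qed

lemma iterate_tendsto:
 assumes "x : \<Lambda>" "regular n x z"
 shows "\<forall>\<^sub>F w in nhds z. regular n x w" "(((f x ^^ n)) ---> (f x ^^ n) z) (nhds z)"
proof -
 have lim: "((%w. (x, w)) ---> (x, z)) (nhds z)" by (intro tendsto_Pair) (auto intro: filterlim_ident)
 show "\<forall>\<^sub>F w in nhds z. regular n x w"
  by (rule eventually_mono[OF eventually_compose_filterlim[OF near_regular(1)[OF assms(1,2)] lim]]) simp
 show "((f x ^^ n) ---> (f x ^^ n) z) (nhds z)"
  using filterlim_compose[OF near_regular(2)[OF assms(1,2)] lim] by simp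
qed

lemma iterate_differentiable:
 assumes "x : \<Lambda>" "regular n x z"
 shows "((f x ^^ n) has_field_derivative (\<Prod>j<n. deriv (f x) ((f x ^^ j) z))) (at z)"
 using assms(2)
proof (induction n)
 case 0
 thus ?case by (simp add: DERIV_ident id_def)
next
 case (Suc n)
 have "(f x has_field_derivative deriv (f x) ((f x ^^ n) z)) (at ((f x ^^ n) z))"
  using Suc.prems differentiable_at_nonpole[OF assms(1)]
  by (simp add: regular_Suc DERIV_deriv_iff_field_differentiable)
 moreover have "((f x ^^ n) has_field_derivative (\<Prod>j<n. deriv (f x) ((f x ^^ j) z))) (at z)"
  using Suc by (simp add: regular_Suc)
 ultimately have "(f x \<circ> (f x ^^ n) has_field_derivative
   deriv (f x) ((f x ^^ n) z) * (\<Prod>j<n. deriv (f x) ((f x ^^ j) z))) (at z)"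
  by (rule DERIV_chain)
 thus ?case by (simp add: o_def mult.commute)
qed

lemma iterate_holomorphic:
 assumes "x : \<Lambda>" "!!z. z : S ==> regular n x z"
 shows "(f x ^^ n) holomorphic_on S"
 unfolding holomorphic_on_def field_differentiable_def
 using iterate_differentiable[OF assms] has_field_derivative_at_within by blast

lemma deriv_iterate:
 assumes "x : \<Lambda>" "regular n x z"
 shows "deriv (f x ^^ n) z = (\<Prod>j<n. deriv (f x) ((f x ^^ j) z))"
 by (rule DERIV_imp_deriv[OF iterate_differentiable[OF assms]])

lemma iterate_parameter_holomorphic:
 assumes "open A" "A <= \<Lambda>" "zt holomorphic_on A" "!!x. x : A ==> regular n x (zt x)"
 shows "(%x. (f x ^^ n) (zt x)) holomorphic_on A"
 using assms(4)
proof (induction n)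
 case (Suc n)
 have "(%x. f x ((f x ^^ n) (zt x))) holomorphic_on A"
  by (rule holomorphic_apply(1)[OF assms(1,2) Suc.IH]) (use Suc.prems in "auto simp: regular_Suc")
 thus ?case by simp
qed (use assms in simp)

section \<open>Traps and attracting cycles under perturbation\<close>

lemma trap_persists:
 assumes "x1 : \<Lambda>" "trap (f x1) k a r W" "!!j. open (W j)"
 shows "\<forall>\<^sub>F x in nhds x1. x : \<Lambda> & trap (f x) k a r W"
proof -
 have T: "1 <= k" "0 < r" "!!w j. w : cball a r ==> j < k ==> (f x1 ^^ j) w : W j"
   "!!w. w : cball a r ==> regular k x1 w" "!!w. w : cball a r ==> (f x1 ^^ k) w : ball a r"
  using assms(2) by (auto simp: trap_def regular_def)
 have "\<forall>\<^sub>F x in nhds x1. ALL w:cball a r. x : \<Lambda> & regular k x w & (ALL j:{..<k}. (f x ^^ j) w : W j) & (f x ^^ k) w : ball a r"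
 proof (rule eventually_compact_tube)
  fix w assume w: "w : cball a r"
  have "\<forall>\<^sub>F p in nhds (x1, w). (f (fst p) ^^ j) (snd p) : W j" if "j < k" for j
   using near_regular(2)[OF assms(1) regular_mono[OF T(4)[OF w], of j]] T(3)[OF w that] assms(3) that
   by (auto dest: topological_tendstoD)
  hence "\<forall>\<^sub>F p in nhds (x1, w). ALL j:{..<k}. (f (fst p) ^^ j) (snd p) : W j"
   by (intro eventually_ball_finite) auto
  moreover have "\<forall>\<^sub>F p in nhds (x1, w). (f (fst p) ^^ k) (snd p) : ball a r"
   using near_regular(2)[OF assms(1) T(4)[OF w]] T(5)[OF w] by (auto dest: topological_tendstoD[OF _ open_ball])
  moreover have "\<forall>\<^sub>F p in nhds (x1, w). fst p : \<Lambda> & regular k (fst p) (snd p)"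
   by (rule near_regular(1)[OF assms(1) T(4)[OF w]])
  ultimately show "\<forall>\<^sub>F p in nhds (x1, w). fst p : \<Lambda> & regular k (fst p) (snd p) &
   (ALL j:{..<k}. (f (fst p) ^^ j) (snd p) : W j) & (f (fst p) ^^ k) (snd p) : ball a r"
   by eventually_elim auto
 qed auto
 thus ?thesis
 proof eventually_elim
  case (elim x)
  have "a : cball a r" using T by simp
  with elim have "x : \<Lambda>" by blast
  with elim show ?case using T(1,2) by (auto simp: trap_def regular_def)
 qed
qed

lemma trap_iterates:
 assumes "trap (f x) k a r W" "w : cball a r"
 shows "(f x ^^ (k * n)) w : cball a r" "n > 0 ==> (f x ^^ (k * n)) w : ball a r" "regular m x w"
  "(f x ^^ (k * n)) w = ((f x ^^ k) ^^ n) w"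
proof -
 have T: "!!w. w : cball a r ==> regular k x w" "!!w. w : cball a r ==> (f x ^^ k) w : ball a r" "k >= 1"
  using assms(1) by (auto simp: trap_def regular_def)
 have both: "(f x ^^ (k * n)) w : cball a r & regular (k * n) x w" for n
 proof (induction n)
  case (Suc n)
  let ?y = "(f x ^^ (k * n)) w"
  have y: "?y : cball a r" "regular (k * n) x w" using Suc by auto
  have "(f x ^^ (k * Suc n)) w = (f x ^^ k) ?y" by (simp add: funpow_add)
  moreover have "regular (k * n + k) x w" unfolding regular_add using y T by blast
  moreover have "k * Suc n = k * n + k" by simp
  ultimately show ?case using T(2)[OF y(1)] by (metis ball_subset_cball subsetD)
 qed (use assms in auto)
 thus "(f x ^^ (k * n)) w : cball a r" by blast
 show "(f x ^^ (k * n)) w : ball a r" if n0: "n > 0"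
 proof -
  obtain l where "n = Suc l" using n0 by (cases n) auto
  hence "(f x ^^ (k * n)) w = (f x ^^ k) ((f x ^^ (k * l)) w)" by (simp add: funpow_add)
  thus ?thesis using both T by auto
 qed
 have "m <= k * m" using T(3) by simp
 thus "regular m x w" using both[of m] regular_mono by blast
 show "(f x ^^ (k * n)) w = ((f x ^^ k) ^^ n) w" by (simp add: funpow_mult)
qed

text \<open>The k-th iterate maps the closed disc into the open one and so has a fixed point
  attracting the disc uniformly; the disjoint sets \<open>W j\<close> keep its first k images
  distinct. Writing n = k (n div k) + n mod k transfers the uniform convergence from the k-th
  iterate to the whole orbit, as the definition of the basin demands.\<close>

lemma trap_cycle:
 assumes x: "x : \<Lambda>" and T: "trap (f x) k a r W"
  and disj: "!!i j. i < k ==> j < k ==> i ~= j ==> W i \<inter> W j = {}"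
 obtains z \<mu> where "z : ball a r" "(f x ^^ k) z = z" "cmod \<mu> < 1"
  "has_multiplier (f x) k ((%j. (f x ^^ j) z) ` {..<k}) \<mu>"
  "ball a r <= basin (f x) ((%j. (f x ^^ j) z) ` {..<k})"
  "!!j. j < k ==> (f x ^^ j) z : W j"
  "!!w. w : cball a r ==> (%n. (f x ^^ (k * n)) w) ----> z"
  "\<mu> = deriv (f x ^^ k) z"
proof -
 have T': "0 < r" "k >= 1" "!!w. w : cball a r ==> regular k x w" "!!w. w : cball a r ==> (f x ^^ k) w : ball a r"
   "!!w j. w : cball a r ==> j < k ==> (f x ^^ j) w : W j"
  using T by (auto simp: trap_def regular_def)
 have hol: "(f x ^^ k) holomorphic_on cball a r" by (rule iterate_holomorphic[OF x T'(3)])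
 obtain z where z: "z : ball a r" "(f x ^^ k) z = z" "cmod (deriv (f x ^^ k) z) < 1"
  and unif: "!!eps. eps > 0 ==> EX N. ALL n>=N. ALL w:cball a r. dist (((f x ^^ k) ^^ n) w) z < eps"
  by (rule self_map_fixed_point[OF T'(1) holomorphic_on_subset[OF hol] holomorphic_on_imp_continuous_on[OF hol]])
   (use T' in auto)
 have zc: "z : cball a r" using z by auto
 define C where "C = (%j. (f x ^^ j) z) ` {..<k}"
 have reg: "regular m x z" for m by (rule trap_iterates(3)[OF T zc])
 have inj: "inj_on (%j. (f x ^^ j) z) {..<k}"
 proof (rule inj_onI, rule ccontr)
  fix i j assume "i : {..<k}" "j : {..<k}" "(f x ^^ i) z = (f x ^^ j) z" "i ~= j"
  thus False using disj[of i j] T'(5)[OF zc, of i] T'(5)[OF zc, of j] by auto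
 qed
 have cyc: "cycle (f x) k C"
  unfolding cycle_def C_def using T'(2) z inj reg[of k] by (auto simp: regular_def)
 have mult: "deriv (f x ^^ k) ((f x ^^ j) z) = deriv (f x ^^ k) z" for j
 proof -
  have "regular k x ((f x ^^ j) z)" using reg[of "j + k"] by (simp add: regular_add)
  hence "deriv (f x ^^ k) ((f x ^^ j) z) = (\<Prod>i<k. deriv (f x) ((f x ^^ (i + j)) z))"
   by (simp add: deriv_iterate[OF x] funpow_add)
  also have "... = (\<Prod>i<k. deriv (f x) ((f x ^^ i) z))"
   by (rule prod_periodic_shift[of "%i. deriv (f x) ((f x ^^ i) z)"]) (simp add: funpow_add z(2))
  finally show ?thesis by (simp add: deriv_iterate[OF x reg])
 qed
 have hm: "has_multiplier (f x) k C (deriv (f x ^^ k) z)"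
  unfolding has_multiplier_def using cyc mult by (auto simp: C_def)
 have lim: "(%n. (f x ^^ (k * n)) w) ----> z" if "w : cball a r" for w
  unfolding LIMSEQ_def trap_iterates(4)[OF T that] using unif that by blast
 have "ball a r <= basin (f x) C"
 proof
  fix w assume w: "w : ball a r"
  have "uniform_limit (ball a r) (%n w. infdist ((f x ^^ n) w) C) (%_. 0) sequentially"
  proof (rule uniform_limitI)
   fix eps :: real assume eps: "eps > 0"
   have "\<forall>\<^sub>F w in nhds z. ALL j:{..<k}. dist ((f x ^^ j) w) ((f x ^^ j) z) < eps"
    by (intro eventually_ball_finite ballI tendstoD[OF iterate_tendsto(2)[OF x reg]] eps) auto
   then obtain dl where dl: "dl > 0" "!!w j. dist w z < dl ==> j < k ==> dist ((f x ^^ j) w) ((f x ^^ j) z) < eps"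
    unfolding eventually_nhds_metric by blast
   obtain N where N: "!!n w. n >= N ==> w : cball a r ==> dist (((f x ^^ k) ^^ n) w) z < dl"
    using unif[OF dl(1)] by blast
   have "dist (infdist ((f x ^^ n) w) C) 0 < eps" if n: "n >= k * N" and w: "w : ball a r" for n w
   proof -
    have wc: "w : cball a r" using w by auto
    have "n div k >= N" using n T'(2) by (simp add: less_eq_div_iff_mult_less_eq mult.commute)
    hence "dist ((f x ^^ (k * (n div k))) w) z < dl" using N[OF _ wc] trap_iterates(4)[OF T wc] by simp
    moreover have "n mod k < k" using T'(2) by simp
    ultimately have "dist ((f x ^^ (n mod k)) ((f x ^^ (k * (n div k))) w)) ((f x ^^ (n mod k)) z) < eps"
     by (rule dl(2))
    moreover have "(f x ^^ (n mod k)) ((f x ^^ (k * (n div k))) w) = (f x ^^ n) w"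
     by (simp add: funpow_add[symmetric, THEN fun_cong, unfolded o_apply])
    moreover have "(f x ^^ (n mod k)) z : C" using \<open>n mod k < k\<close> by (simp add: C_def)
    ultimately have "infdist ((f x ^^ n) w) C < eps" using infdist_le[of "(f x ^^ (n mod k)) z" C "(f x ^^ n) w"] by simp
    thus ?thesis by (simp add: infdist_nonneg)
   qed
   thus "\<forall>\<^sub>F n in sequentially. ALL w:ball a r. dist (infdist ((f x ^^ n) w) C) 0 < eps"
    unfolding eventually_sequentially by blast
  qed
  moreover have "~ pole x ((f x ^^ n) u)" if "u : ball a r" for n u
   using trap_iterates(3)[OF T, of u "Suc n"] that by (auto simp: regular_Suc)
  ultimately show "w : basin (f x) C" unfolding basin_def using w by blast
 qed
 thus ?thesis using that z hm lim T'(5)[OF zc] unfolding C_def by blast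
qed

lemma multiplier_trap:
 assumes x: "x : \<Lambda>" and hm: "has_multiplier (f x) k C \<mu>" "cmod \<mu> < 1" and c: "c : C" and et: "et > 0"
 obtains r where "0 < r" "r <= et" "trap (f x) k c r (%j. ball ((f x ^^ j) c) et)"
proof -
 have cyc: "cycle (f x) k C" using hm by (simp add: has_multiplier_def)
 have fixc: "(f x ^^ k) c = c" and k: "k >= 1" using cycle_orbit[OF cyc c] by auto
 have np: "~ pole x ((f x ^^ j) c)" for j
 proof -
  have "(f x ^^ j) c : C" using cycle_orbit(2)[OF cyc c] by blast
  thus ?thesis using cyc by (auto simp: cycle_def)
 qed
 have reg: "regular n x c" for n using np by (simp add: regular_def)
 have "deriv (f x ^^ k) c = \<mu>" using hm c by (simp add: has_multiplier_def)
 hence "((f x ^^ k) has_field_derivative \<mu>) (at c)"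
  using iterate_differentiable[OF x reg] deriv_iterate[OF x reg] by metis
 hence "((%w. ((f x ^^ k) w - c) / (w - c)) ---> \<mu>) (at c)"
  by (simp add: has_field_derivative_iff fixc)
 hence "\<forall>\<^sub>F w in at c. cmod (((f x ^^ k) w - c) / (w - c)) < 1"
  using hm(2) by (intro order_tendstoD(2)[OF tendsto_norm])
 hence "\<forall>\<^sub>F w in at c. cmod ((f x ^^ k) w - c) < cmod (w - c)"
  using eventually_neq_at_within[of c c UNIV]
  by eventually_elim (simp add: norm_divide divide_less_eq)
 then obtain d1 where d1: "d1 > 0" "!!w. w ~= c ==> dist w c < d1 ==> cmod ((f x ^^ k) w - c) < cmod (w - c)"
  unfolding eventually_at by blast
 have "\<forall>\<^sub>F w in nhds c. regular k x w & (ALL j:{..<k}. dist ((f x ^^ j) w) ((f x ^^ j) c) < et)"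
  by (intro eventually_conj iterate_tendsto(1)[OF x reg] eventually_ball_finite ballI tendstoD[OF iterate_tendsto(2)[OF x reg]] et) auto
 then obtain d2 where d2: "d2 > 0" "!!w. dist w c < d2 ==> regular k x w"
   "!!w j. dist w c < d2 ==> j < k ==> dist ((f x ^^ j) w) ((f x ^^ j) c) < et"
  unfolding eventually_nhds_metric by blast
 define r where "r = min et (min d1 d2) / 2"
 have r: "r > 0" "r <= et" "r < d1" "r < d2" using et d1 d2 by (auto simp: r_def)
 show ?thesis
 proof (rule that[OF r(1,2)])
  show "trap (f x) k c r (%j. ball ((f x ^^ j) c) et)"
   unfolding trap_def
  proof (intro conjI ballI allI impI)
   fix w assume w: "w : cball c r"
   hence wd: "dist w c < d1" "dist w c < d2" using r by (auto simp: dist_commute)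
   show "~ pole x ((f x ^^ j) w)" if "j < k" for j using d2(2)[OF wd(2)] that by (simp add: regular_def)
   show "(f x ^^ j) w : ball ((f x ^^ j) c) et" if "j < k" for j using d2(3)[OF wd(2) that] by (simp add: dist_commute)
   show "(f x ^^ k) w : ball c r"
   proof (cases "w = c")
    case True thus ?thesis using fixc r by simp
   next
    case False
    have "cmod ((f x ^^ k) w - c) < cmod (w - c)" by (rule d1(2)[OF False wd(1)])
    thus ?thesis using w by (simp add: dist_norm norm_minus_commute)
   qed
  qed (use k r in auto)
 qed
qed

text \<open>The orbit comes close to some point \<open>y\<close> of the cycle, from which
  \<open>J y\<close> further steps lead close to \<open>c\<close>; finitely many continuity moduli
  are combined into \<open>dl\<close>.\<close>

lemma basin_enters_ball:
 assumes x: "x : \<Lambda>" and cyc: "cycle (f x) k C" and c: "c : C" and z: "z : basin (f x) C" and rh: "rh > 0"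
 obtains n where "(f x ^^ n) z : ball c rh"
proof -
 have np: "~ pole x y" if "y : C" for y using cyc that by (auto simp: cycle_def)
 have "EX j. (f x ^^ j) y = c & regular j x y" if y: "y : C" for y
 proof -
  obtain j where "(f x ^^ j) y = c" using c cycle_orbit(2)[OF cyc y] by (metis imageE)
  moreover have "(f x ^^ i) y : C" for i using cycle_orbit(2)[OF cyc y] by blast
  ultimately show ?thesis using np by (auto simp: regular_def)
 qed
 then obtain J where "ALL y:C. (f x ^^ J y) y = c & regular (J y) x y"
  using bchoice[of C "%y j. (f x ^^ j) y = c & regular j x y"] by blast
 hence J: "!!y. y : C ==> (f x ^^ J y) y = c" "!!y. y : C ==> regular (J y) x y" by blast+
 have "EX d>0. ALL w. dist w y < d --> dist ((f x ^^ J y) w) c < rh" if y: "y : C" for y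
  using tendstoD[OF iterate_tendsto(2)[OF x J(2)[OF y]] rh] J(1)[OF y] unfolding eventually_nhds_metric by simp
 then obtain d where "ALL y:C. d y > 0 & (ALL w. dist w y < d y --> dist ((f x ^^ J y) w) c < rh)"
  using bchoice[of C "%y d. d > 0 & (ALL w. dist w y < d --> dist ((f x ^^ J y) w) c < rh)"] by blast
 hence d: "!!y. y : C ==> d y > 0" "!!y w. y : C ==> dist w y < d y ==> dist ((f x ^^ J y) w) c < rh"
  by blast+
 have fin: "finite C" using cycle_orbit(5)[OF cyc c] .
 define dl where "dl = Min (d ` C)"
 have "dl > 0" unfolding dl_def using fin c d(1) by (subst Min_gr_iff) auto
 moreover have "!!y. y : C ==> dl <= d y" using fin by (simp add: dl_def)
 ultimately have dl: "dl > 0" "!!y. y : C ==> dl <= d y" by blast+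
 obtain n where n: "infdist ((f x ^^ n) z) C < dl"
  using eventually_happens'[OF sequentially_bot basin_converges[OF z dl(1)]] by blast
 obtain y where y: "y : C" "dist ((f x ^^ n) z) y < dl" by (rule infdist_less_obtain[OF n]) (use c in auto)
 hence "dist ((f x ^^ J y) ((f x ^^ n) z)) c < rh" using d(2)[OF y(1)] dl(2)[OF y(1)] by simp
 hence "(f x ^^ (J y + n)) z : ball c rh" by (simp add: funpow_add dist_commute)
 thus ?thesis by (rule that)
qed

lemma basin_backward:
 assumes x: "x : \<Lambda>" and reg: "regular n x z" and b: "(f x ^^ n) z : basin (f x) C"
 shows "z : basin (f x) C"
proof -
 obtain U where U: "open U" "(f x ^^ n) z : U" "!!m w. w : U ==> ~ pole x ((f x ^^ m) w)"
   "uniform_limit U (%m w. infdist ((f x ^^ m) w) C) (%_. 0) sequentially"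
  using b unfolding basin_def by blast
 have "\<forall>\<^sub>F w in nhds z. regular n x w & (f x ^^ n) w : U"
  by (intro eventually_conj iterate_tendsto(1)[OF x reg] topological_tendstoD[OF iterate_tendsto(2)[OF x reg] U(1,2)])
 then obtain V where V: "open V" "z : V" "!!w. w : V ==> regular n x w" "!!w. w : V ==> (f x ^^ n) w : U"
  unfolding eventually_nhds by blast
 have np: "~ pole x ((f x ^^ m) w)" if w: "w : V" for m w
 proof (cases "m < n")
  case True
  thus ?thesis using V(3)[OF w] by (simp add: regular_def)
 next
  case False
  hence "(f x ^^ m) w = (f x ^^ (m - n)) ((f x ^^ n) w)" by (metis funpow_add comp_apply le_add_diff_inverse2 not_less)
  thus ?thesis using U(3)[OF V(4)[OF w]] by simp
 qed
 have "uniform_limit V (%m w. infdist ((f x ^^ m) w) C) (%_. 0) sequentially"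
 proof (rule uniform_limitI)
  fix eps :: real assume "eps > 0"
  then obtain N where N: "!!m w. m >= N ==> w : U ==> dist (infdist ((f x ^^ m) w) C) 0 < eps"
   using uniform_limitD[OF U(4)] unfolding eventually_sequentially by blast
  have "dist (infdist ((f x ^^ m) w) C) 0 < eps" if m: "m >= N + n" and w: "w : V" for m w
  proof -
   have "(f x ^^ m) w = (f x ^^ (m - n)) ((f x ^^ n) w)" using m by (metis add_leD2 funpow_add comp_apply le_add_diff_inverse2)
   thus ?thesis using N[of "m - n" "(f x ^^ n) w"] V(4)[OF w] m by simp
  qed
  thus "\<forall>\<^sub>F m in sequentially. ALL w:V. dist (infdist ((f x ^^ m) w) C) 0 < eps"
   unfolding eventually_sequentially by blast
 qed
 thus ?thesis unfolding basin_def using V np by blast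
qed

end

section \<open>Lifts through unramified values\<close>

lemma stereo_Some_tendsto:
 assumes "(g ---> l) F"
 shows "((%t. stereo (Some (g t))) ---> stereo (Some l)) F"
proof -
 have "1 + (cmod l)\<^sup>2 ~= 0" "(cmod l)\<^sup>2 + 1 ~= 0"
  using zero_le_power2[of "cmod l"] by linarith+
 thus ?thesis using assms by (auto intro!: tendsto_intros)
qed

lemma holomorphic_stereo: "h holomorphic_on S ==> continuous_on S (%y. stereo (Some (h y)))"
 using holomorphic_on_imp_continuous_on[of h S] unfolding continuous_on_def using stereo_Some_tendsto by blast

lemma holomorphic_isCont: "g holomorphic_on S ==> open S ==> z : S ==> isCont g z"
 using holomorphic_on_imp_continuous_on continuous_on_eq_continuous_at by blast

lemma field_differentiable_transform_within_open:
 assumes "g field_differentiable at z" "open S" "z : S" "!!w. w : S ==> g w = h w"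
 shows "h field_differentiable at z"
 using assms unfolding field_differentiable_def
 by (meson has_field_derivative_transform_within_open)

lemma filterlim_at_topD_norm:
 fixes gm :: "real => complex"
 assumes "~ filterlim gm at_infinity at_top"
 obtains R s where "filterlim (s :: nat => real) at_top sequentially" "!!n. cmod (gm (s n)) <= R" "!!n. s n >= 0"
proof -
 obtain R where "~ (\<forall>\<^sub>F t in at_top. R <= cmod (gm t))"
  using assms unfolding filterlim_at_infinity[OF order_refl] by blast
 hence "ALL n::nat. EX t>=real n. cmod (gm t) <= R"
  unfolding eventually_at_top_linorder by (metis linear)
 then obtain s where s: "!!n::nat. s n >= real n" "!!n. cmod (gm (s n)) <= R" by metis
 have "filterlim s at_top sequentially"
  by (rule filterlim_at_top_mono[OF filterlim_real_sequentially]) (use s in auto)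
 moreover have "s n >= 0" for n using s(1)[of n] by (meson of_nat_0_le_iff order_trans)
 ultimately show ?thesis using that s by blast
qed

context meromorphic_family
begin

section \<open>Path lifting and the monodromy argument\<close>

text \<open>These are the two ways in which continuing an inverse branch towards \<open>w\<close>
  can break down: the lift runs off to infinity, or it arrives at a critical point.\<close>

definition unramified :: "complex => complex => bool" where
 "unramified x w \<longleftrightarrow> Some w ~: asymptotic_values (f x) &
  (ALL zt. ~ pole x zt & f x zt = w --> deriv (f x) zt ~= 0)"

lemma local_inverse:
 assumes x: "x : \<Lambda>" and np: "~ pole x zt" "deriv (f x) zt ~= 0" and eps: "eps > 0"
 obtains e T g where "0 < e" "e <= eps" "open T" "f x zt : T" "g holomorphic_on T" "g ` T <= ball zt e"
  "!!w. w : T ==> ~ pole x (g w) & f x (g w) = w"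
  "!!z. z : ball zt e ==> f x z : T & g (f x z) = z"
  "inj_on (f x) (ball zt e)" "!!z. z : ball zt e ==> ~ pole x z"
proof -
 obtain e' where e': "chart f x zt e'" "!!y z. y : ball x e' ==> z : ball zt e' ==> ~ pole y z"
  "!!y. y : ball x e' ==> inj_on (f y) (ball zt e')"
  by (rule local_injectivity[OF x np]) blast
 define e where "e = min e' eps"
 have e: "0 < e" "e <= eps" "ball zt e <= ball zt e'" using e'(1) eps by (auto simp: e_def chart_def)
 have xin: "x : ball x e'" using e'(1) by (simp add: chart_def)
 have hol: "f x holomorphic_on ball zt e" by (rule holomorphic_off_poles[OF x]) (use e' e xin in blast)
 have inj: "inj_on (f x) (ball zt e)" using e'(3)[OF xin] e(3) inj_on_subset by blast
 obtain g where g: "g holomorphic_on f x ` ball zt e" "!!z. z : ball zt e ==> g (f x z) = z"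
  by (rule holomorphic_has_inverse[OF hol open_ball inj]) blast
 have "open (f x ` ball zt e)" by (rule open_mapping_thm3[OF hol open_ball inj])
 thus ?thesis
  by (rule that[OF e(1,2) _ _ g(1)]) (use g(2) e xin e'(2) inj in auto)
qed

lemma lift_unique:
 assumes x: "x : \<Lambda>" and S: "open S" "connected S" and H: "H1 holomorphic_on S" "H2 holomorphic_on S"
  and l: "!!w. w : S ==> f x (H1 w) = f x (H2 w)"
  and y: "y : S" "H1 y = H2 y" "~ pole x (H1 y)" "deriv (f x) (H1 y) ~= 0" and w: "w : S"
 shows "H1 w = H2 w"
proof -
 obtain e where e: "0 < e" "inj_on (f x) (ball (H1 y) e)"
  by (rule local_inverse[OF x y(3,4), of 1]) auto
 have "isCont H1 y" "isCont H2 y"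
  using H S y by (auto intro: holomorphic_isCont)
 hence "\<forall>\<^sub>F t in at y. dist (H1 t) (H1 y) < e" "\<forall>\<^sub>F t in at y. dist (H2 t) (H2 y) < e"
  using e(1) unfolding isCont_def by (auto dest: tendstoD)
 moreover have "\<forall>\<^sub>F t in at y. t : S" using S y by (simp add: eventually_at_in_open')
 ultimately have "\<forall>\<^sub>F t in at y. H1 t = H2 t"
 proof eventually_elim
  case (elim t)
  thus ?case using inj_onD[OF e(2) l[of t]] y(2) by (simp add: dist_commute)
 qed
 then obtain d where d: "d > 0" "!!t. t ~= y ==> dist t y < d ==> H1 t = H2 t"
  unfolding eventually_at by blast
 have "H1 w - H2 w = 0"
 proof (rule analytic_continuation_open[of "ball y d \<inter> S" S "%t. H1 t - H2 t" "%_. 0"])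
  have "y : ball y d \<inter> S" using y d by simp
  thus "ball y d \<inter> S ~= {}" by blast
  show "H1 t - H2 t = 0" if "t : ball y d \<inter> S" for t
   using d(2)[of t] that y(2) by (cases "t = y") (auto simp: dist_commute)
 qed (use S H w in "auto intro!: holomorphic_intros")
 thus ?thesis by simp
qed

text \<open>A lift along a path cannot run off to infinity, since its endpoint would then be an
  asymptotic value.\<close>

lemma lift_endpoint:
 fixes gm :: "real => complex"
 assumes x: "x : \<Lambda>" and gm: "continuous_on {0..} gm"
  and np: "!!s. s >= 0 ==> ~ pole x (gm s)"
  and lim: "((%s. f x (gm s)) ---> w) at_top" and w: "unramified x w"
 obtains zt where "~ pole x zt" "f x zt = w" "(gm ---> zt) at_top"
proof -
 have "~ filterlim gm at_infinity at_top"
 proof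
  assume inf: "filterlim gm at_infinity at_top"
  have "((%s. stereo (sph (f x) (gm s))) ---> stereo (Some w)) at_top"
  proof (rule Lim_transform_eventually[OF stereo_Some_tendsto[OF lim]])
   show "\<forall>\<^sub>F s in at_top. stereo (Some (f x (gm s))) = stereo (sph (f x) (gm s))"
    using eventually_ge_at_top[of 0] by eventually_elim (simp add: sph_def np)
  qed
  hence "Some w : asymptotic_values (f x)" unfolding asymptotic_values_def using gm inf by blast
  thus False using w by (simp add: unramified_def)
 qed
 then obtain R s where s: "filterlim (s :: nat => real) at_top sequentially" "!!n. cmod (gm (s n)) <= R" "!!n. s n >= 0"
  by (rule filterlim_at_topD_norm) blast
 have "ALL n. gm (s n) : cball 0 R" using s(2) by simp
 then obtain zt r where r: "strict_mono (r :: nat => nat)" "((%n. gm (s n)) \<circ> r) ----> zt"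
  using compact_cball[of "0::complex" R] unfolding compact_def by metis
 define t where "t = (%n. s (r n))"
 have t: "filterlim t at_top sequentially" "(%n. gm (t n)) ----> zt" "!!n. t n >= 0"
  using filterlim_compose[OF s(1) filterlim_subseq[OF r(1)]] r(2) s(3) by (auto simp: t_def o_def)
 have limt: "(%n. f x (gm (t n))) ----> w" by (rule filterlim_compose[OF lim t(1)])
 have lim2: "((%n. (x, gm (t n))) ---> (x, zt)) sequentially" by (intro tendsto_Pair tendsto_const t)
 have npz: "~ pole x zt"
 proof
  assume pole: "pole x zt"
  have "\<forall>\<^sub>F n in sequentially. f x (gm (t n)) ~= 0"
   using eventually_compose_filterlim[OF near_pole(1)[OF x pole] lim2] by eventually_elim (use np t in auto)
  hence "\<forall>\<^sub>F n in sequentially. inverse (f x (gm (t n))) * f x (gm (t n)) = 1" by eventually_elim simp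
  moreover have "(%n. inverse (f x (gm (t n)))) ----> 0"
   using filterlim_compose[OF near_pole(2)[OF x pole] lim2] by simp
  hence "(%n. inverse (f x (gm (t n))) * f x (gm (t n))) ----> 0 * w" by (intro tendsto_mult limt)
  ultimately have "(%n. 1 :: complex) ----> 0 * w" by (rule Lim_transform_eventually[rotated])
  thus False using LIMSEQ_unique[OF tendsto_const] by fastforce
 qed
 have fz: "f x zt = w"
  using LIMSEQ_unique[OF filterlim_compose[OF near_nonpole(2)[OF x npz] lim2]] limt by simp
 have dz: "deriv (f x) zt ~= 0" using w npz fz by (simp add: unramified_def)
 have "(gm ---> zt) at_top"
 proof (rule tendstoI)
  fix eps0 :: real assume eps0: "eps0 > 0"
  obtain e where e: "0 < e" "e <= eps0" "inj_on (f x) (ball zt e)" "!!z. z : ball zt e ==> ~ pole x z"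
   by (rule local_inverse[OF x npz dz eps0]) blast
  define eps where "eps = e / 2"
  have eps: "eps > 0" "eps < e" using e by (auto simp: eps_def)
  \<comment> \<open>On this circle \<open>f x\<close> keeps a positive distance from
    \<open>w\<close>, whereas along the path it tends to \<open>w\<close>. Hence the path, once
    inside at a late time, never leaves, and accumulation at \<open>zt\<close> becomes
    convergence.\<close>
  have "continuous_on (sphere zt eps) (%z. cmod (f x z - w))"
   by (intro continuous_intros holomorphic_on_imp_continuous_on holomorphic_off_poles[OF x])
    (use e eps in auto)
  moreover have "sphere zt eps ~= {}" using eps by simp
  ultimately obtain z0 where z0: "z0 : sphere zt eps" "!!z. z : sphere zt eps ==> cmod (f x z0 - w) <= cmod (f x z - w)"
   using continuous_attains_inf[OF compact_sphere] by blast
  have "f x z0 ~= w"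
   using inj_onD[OF e(3), of z0 zt] z0(1) fz eps e(1) by auto
  hence "cmod (f x z0 - w) > 0" by simp
  from tendstoD[OF lim this] have "\<forall>\<^sub>F s in at_top. dist (f x (gm s)) w < cmod (f x z0 - w)" .
  then obtain s0 where s0: "!!s. s >= s0 ==> dist (f x (gm s)) w < cmod (f x z0 - w)"
   unfolding eventually_at_top_linorder by blast
  have off: "dist (gm s) zt ~= eps" if "s >= s0" for s
   using s0[OF that] z0(2)[of "gm s"] by (auto simp: dist_norm dist_commute norm_minus_commute)
  have "\<forall>\<^sub>F n in sequentially. dist (gm (t n)) zt < eps" using tendstoD[OF t(2) eps(1)] .
  moreover have "\<forall>\<^sub>F n in sequentially. t n >= s0" using t(1) by (simp add: filterlim_at_top)
  ultimately obtain n where n: "dist (gm (t n)) zt < eps" "t n >= s0"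
   using eventually_happens'[OF sequentially_bot eventually_conj] by blast
  have "dist (gm s) zt < eps" if s: "s >= t n" for s
  proof (rule ccontr)
   assume "~ dist (gm s) zt < eps"
   hence "EX u>=t n. u <= s & dist (gm u) zt = eps"
    using n s t(3)[of n]
    by (intro IVT') (auto intro!: continuous_intros continuous_on_subset[OF gm])
   then obtain u where "u >= t n" "dist (gm u) zt = eps" by blast
   thus False using off[of u] n(2) by simp
  qed
  thus "\<forall>\<^sub>F s in at_top. dist (gm s) zt < eps0"
   unfolding eventually_at_top_linorder using eps e(2) by (intro exI[of _ "t n"]) force
 qed
 thus ?thesis using that npz fz by blast
qed

definition lift_on :: "complex => complex set => (complex => complex) => (complex => complex) => bool" where
 "lift_on x S h H \<longleftrightarrow> H holomorphic_on S & (ALL w:S. ~ pole x (H w) & f x (H w) = h w)"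

lemma lift_on_subset: "lift_on x S h H ==> T <= S ==> lift_on x T h H"
 unfolding lift_on_def using holomorphic_on_subset by blast

lemma lift_on_unique:
 assumes x: "x : \<Lambda>" and S: "open S" "connected S" and H: "lift_on x S h H1" "lift_on x S h H2"
  and y: "y : S" "H1 y = H2 y" "deriv (f x) (H1 y) ~= 0" and w: "w : S"
 shows "H1 w = H2 w"
proof (rule lift_unique[where S = S and x = x and ?H1.0 = H1 and ?H2.0 = H2 and y = y])
 show "f x (H1 w) = f x (H2 w)" if "w : S" for w using H that by (simp add: lift_on_def)
qed (use x S H y w in "auto simp: lift_on_def")

text \<open>The lift of the radius towards \<open>w1\<close> has a finite end point, and the local
  inverse there continues \<open>H\<close>. The centre \<open>b\<close> is exempt from being
  unramified because later it is the asymptotic value itself.\<close>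

lemma lift_extends_at_boundary:
 assumes x: "x : \<Lambda>" and rh: "0 < rh" and H: "lift_on x (ball b rh) h H"
  and h: "h holomorphic_on ball b R" "rh < R"
  and w1: "dist b w1 = rh" "unramified x (h w1)"
  and ur: "!!w. w : ball b R - {b} ==> unramified x (h w)"
 obtains eps G where "0 < eps" "lift_on x (ball w1 eps) h G" "!!w. w : ball w1 eps \<inter> ball b rh ==> G w = H w"
proof -
 \<comment> \<open>The radius is parametrized by [0, \<infinity>), as paths in the definition of
   asymptotic values are.\<close>
 define p where "p s = b + of_real (s / (s + 1)) * (w1 - b)" for s :: real
 have pd: "dist b (p s) = s / (s + 1) * rh" if "s >= 0" for s
 proof -
  have "dist b (p s) = cmod (of_real (s / (s + 1))) * cmod (w1 - b)"
   by (simp only: p_def dist_norm norm_mult[symmetric] norm_minus_commute[of b]) simp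
  also have "... = s / (s + 1) * rh"
   using w1(1) that by (simp only: norm_of_real) (simp add: dist_norm norm_minus_commute)
  finally show ?thesis .
 qed
 have pin: "p s : ball b rh" if "s >= 0" for s
  using pd[OF that] that rh by (simp add: divide_less_eq)
 have cp: "continuous_on {0..} p" unfolding p_def by (intro continuous_intros) auto
 have "((%s::real. s / (s + 1)) ---> 1) at_top" by real_asymp
 hence "((%s. b + of_real (s / (s + 1)) * (w1 - b)) ---> b + of_real 1 * (w1 - b)) at_top"
  by (intro tendsto_intros)
 hence plim: "(p ---> w1) at_top" unfolding p_def by simp
 have Hc: "continuous_on (ball b rh) H" using H by (simp add: lift_on_def holomorphic_on_imp_continuous_on)
 have w1in: "w1 : ball b R" using w1 h by simp
 have hcont: "isCont h w1" using h(1) w1in by (intro holomorphic_isCont) auto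
 obtain zt where zt: "~ pole x zt" "f x zt = h w1" "((%s. H (p s)) ---> zt) at_top"
 proof (rule lift_endpoint[OF x])
  show "continuous_on {0..} (%s. H (p s))"
   by (rule continuous_on_compose2[OF Hc cp]) (use pin in auto)
  show "~ pole x (H (p s))" if "s >= 0" for s using H pin[OF that] by (simp add: lift_on_def)
  have "((%s. h (p s)) ---> h w1) at_top" by (rule isCont_tendsto_compose[OF hcont plim])
  thus "((%s. f x (H (p s))) ---> h w1) at_top"
  proof (rule Lim_transform_eventually)
   show "\<forall>\<^sub>F s in at_top. h (p s) = f x (H (p s))"
    using eventually_ge_at_top[of 0] by eventually_elim (use H pin in "simp add: lift_on_def")
  qed
 qed (use w1 in auto)
 have dzt: "deriv (f x) zt ~= 0" using zt w1 by (simp add: unramified_def)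
 obtain e T g where g: "0 < e" "open T" "f x zt : T" "g holomorphic_on T"
  "!!w. w : T ==> ~ pole x (g w) & f x (g w) = w"
  "!!z. z : ball zt e ==> f x z : T & g (f x z) = z"
  by (rule local_inverse[OF x zt(1) dzt, of 1]) auto
 have "\<forall>\<^sub>F w in nhds w1. h w : T"
  using hcont g zt(2) unfolding isCont_def tendsto_at_iff_tendsto_nhds by (auto dest: topological_tendstoD)
 moreover have "\<forall>\<^sub>F w in nhds w1. w : ball b R" using w1in open_ball eventually_nhds by blast
 ultimately have "\<forall>\<^sub>F w in nhds w1. h w : T & w : ball b R" by eventually_elim auto
 then obtain eps where eps: "eps > 0" "!!w. dist w w1 < eps ==> h w : T & w : ball b R"
  unfolding eventually_nhds_metric by blast
 have G: "lift_on x (ball w1 eps) h (g \<circ> h)"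
  unfolding lift_on_def
 proof
  show "g \<circ> h holomorphic_on ball w1 eps"
  proof (rule holomorphic_on_compose_gen[OF _ g(4)])
   show "h holomorphic_on ball w1 eps"
    by (rule holomorphic_on_subset[OF h(1)]) (use eps in "auto simp: dist_commute")
  qed (use eps in "auto simp: dist_commute")
 qed (use g eps in "auto simp: dist_commute")
 have "\<forall>\<^sub>F s in at_top. dist (H (p s)) zt < e" "\<forall>\<^sub>F s in at_top. dist (p s) w1 < eps"
  using tendstoD[OF zt(3) g(1)] tendstoD[OF plim eps(1)] by auto
 hence "\<forall>\<^sub>F s in at_top. dist (H (p s)) zt < e & dist (p s) w1 < eps & s > 0"
  using eventually_gt_at_top[of 0] by eventually_elim auto
 then obtain s where s: "dist (H (p s)) zt < e" "dist (p s) w1 < eps" "s > 0"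
  using eventually_happens'[OF trivial_limit_at_top_linorder] by blast
 have ps: "p s : ball w1 eps \<inter> ball b rh" using s pin[of s] by (simp add: dist_commute)
 have "f x (H (p s)) = h (p s)" using H ps by (simp add: lift_on_def)
 hence eq: "(g \<circ> h) (p s) = H (p s)" using g(6)[of "H (p s)"] s by (simp add: dist_commute)
 have "p s ~= b" using pd[of s] s rh by auto
 hence "unramified x (h (p s))" using ur[of "p s"] ps h(2) by simp
 hence der: "deriv (f x) ((g \<circ> h) (p s)) ~= 0" using G ps by (auto simp: lift_on_def unramified_def)
 show ?thesis
 proof (rule that[OF eps(1) G])
  fix w assume w: "w : ball w1 eps \<inter> ball b rh"
  show "(g \<circ> h) w = H w"
   by (rule lift_on_unique[OF x _ _ lift_on_subset[OF G] lift_on_subset[OF H] ps eq der w])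
    (auto intro!: convex_connected convex_Int)
 qed
qed

text \<open>The extensions at boundary points are glued along nearest-point projection. Two
  overlapping discs centred on the circle also overlap inside the old disc, where both extensions
  equal \<open>H\<close>, so they agree by uniqueness of lifts.\<close>

lemma lift_extends_radius:
 assumes x: "x : \<Lambda>" and rh: "0 < rh" and H: "lift_on x (ball b rh) h H"
  and h: "h holomorphic_on ball b R" "rh < R"
  and ur: "!!w. w : ball b R - {b} ==> unramified x (h w)"
 obtains dl H' where "0 < dl" "lift_on x (ball b (rh + dl)) h H'" "!!w. w : ball b rh ==> H' w = H w"
proof -
 have "ALL w1:sphere b rh. EX eps G. 0 < eps & lift_on x (ball w1 eps) h G & (ALL w:ball w1 eps \<inter> ball b rh. G w = H w)"
 proof
  fix w1 assume "w1 : sphere b rh"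
  hence w1: "dist b w1 = rh" by simp
  have "w1 ~= b" using w1 rh by auto
  hence u: "unramified x (h w1)" using ur[of w1] w1 h by simp
  obtain eps G where "0 < eps" "lift_on x (ball w1 eps) h G" "!!w. w : ball w1 eps \<inter> ball b rh ==> G w = H w"
   by (rule lift_extends_at_boundary[OF x rh H h w1 u ur]) blast+
  thus "EX eps G. 0 < eps & lift_on x (ball w1 eps) h G & (ALL w:ball w1 eps \<inter> ball b rh. G w = H w)" by blast
 qed
 from bchoice[OF this] obtain E where "ALL w1:sphere b rh. EX G. 0 < E w1 & lift_on x (ball w1 (E w1)) h G & (ALL w:ball w1 (E w1) \<inter> ball b rh. G w = H w)" ..
 from bchoice[OF this] obtain K where
  "ALL w1:sphere b rh. 0 < E w1 & lift_on x (ball w1 (E w1)) h (K w1) & (ALL w:ball w1 (E w1) \<inter> ball b rh. K w1 w = H w)" ..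
 hence EK: "!!w1. w1 : sphere b rh ==> 0 < E w1"
  "!!w1. w1 : sphere b rh ==> lift_on x (ball w1 (E w1)) h (K w1)"
  "!!w1 w. w1 : sphere b rh ==> w : ball w1 (E w1) \<inter> ball b rh ==> K w1 w = H w"
  by blast+
 have "sphere b rh <= \<Union>((%w. ball w (E w)) ` sphere b rh)" using EK(1) by force
 \<comment> \<open>A Lebesgue number of the cover gives one radius for all boundary points.\<close>
 from Heine_Borel_lemma[OF compact_sphere this]
 obtain dl where dl: "dl > 0" "!!w. w : sphere b rh ==> EX G:(%w. ball w (E w)) ` sphere b rh. ball w dl <= G"
  by auto
 have "ALL w1:sphere b rh. EX G. lift_on x (ball w1 dl) h G & (ALL w:ball w1 dl \<inter> ball b rh. G w = H w)"
 proof
  fix w1 assume "w1 : sphere b rh"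
  then obtain w where w: "w : sphere b rh" "ball w1 dl <= ball w (E w)" using dl(2) by blast
  have "lift_on x (ball w1 dl) h (K w)" by (rule lift_on_subset[OF EK(2)[OF w(1)] w(2)])
  moreover have "ALL u:ball w1 dl \<inter> ball b rh. K w u = H u" using EK(3)[OF w(1)] w(2) by blast
  ultimately show "EX G. lift_on x (ball w1 dl) h G & (ALL w:ball w1 dl \<inter> ball b rh. G w = H w)" by blast
 qed
 from bchoice[OF this] obtain G where
  "ALL w1:sphere b rh. lift_on x (ball w1 dl) h (G w1) & (ALL w:ball w1 dl \<inter> ball b rh. G w1 w = H w)" ..
 hence G: "!!w1. w1 : sphere b rh ==> lift_on x (ball w1 dl) h (G w1)"
  "!!w1 w. w1 : sphere b rh ==> w : ball w1 dl \<inter> ball b rh ==> G w1 w = H w" by blast+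
 define P where "P w = closest_point (cball b rh) w" for w
 define H' where "H' w = (if w : ball b rh then H w else G (P w) w)" for w
 have Pfacts: "P w : sphere b rh & dist w (P w) < dl" if w: "w : ball b (rh + dl)" "w ~: ball b rh" for w
 proof -
  have Pc: "P w : cball b rh" unfolding P_def by (rule closest_point_in_set) (use rh in auto)
  have nz: "dist b w >= rh" "dist b w < rh + dl" using w by auto
  have bw: "b ~= w" using nz rh by auto
  define y where "y = b + of_real (rh / dist b w) * (w - b)"
  have y: "dist b y = rh" using nz rh bw by (simp add: y_def dist_norm norm_mult norm_divide norm_minus_commute)
  have "w - y = of_real (1 - rh / dist b w) * (w - b)" by (simp add: y_def algebra_simps)
  hence "dist w y = \<bar>1 - rh / dist b w\<bar> * dist b w"
   by (simp add: dist_norm norm_mult norm_minus_commute del: of_real_diff of_real_divide)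
  also have "... = dist b w - rh" using nz rh bw by (simp add: field_simps abs_if)
  finally have wy: "dist w y = dist b w - rh" .
  have "dist w (P w) <= dist w y" unfolding P_def by (rule closest_point_le) (use y in auto)
  hence "dist w (P w) <= dist b w - rh" using wy by simp
  moreover have "dist b w <= dist b (P w) + dist (P w) w" by (rule dist_triangle)
  ultimately have "dist b (P w) >= rh" by (simp add: dist_commute)
  thus ?thesis using Pc \<open>dist w (P w) <= dist b w - rh\<close> nz by simp
 qed
 have agree: "H' w = G c w" if c: "c : sphere b rh" and w: "w : ball c dl" "w : ball b (rh + dl)" for c w
 proof (cases "w : ball b rh")
  case True
  thus ?thesis using G(2)[OF c, of w] w by (simp add: H'_def)
 next
  case False
  have Pw: "P w : sphere b rh" "dist w (P w) < dl" using Pfacts[OF w(2) False] by auto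
  have "dist (P w) (P c) <= dist w c" unfolding P_def
   by (rule closest_point_lipschitz) (use rh in auto)
  moreover have "P c = c" unfolding P_def using c by (intro closest_point_self) auto
  \<comment> \<open>The projection does not increase distances and fixes \<open>c\<close>. So both
    discs contain the boundary point \<open>P w\<close>, and they meet inside
    \<open>ball b rh\<close>.\<close>
  ultimately have "P w : ball c dl" using w(1) by (simp add: dist_commute)
  hence "P w : ball c dl \<inter> ball (P w) dl" using dl by simp
  moreover have "P w : closure (ball b rh)" using Pw rh by simp
  ultimately have "ball c dl \<inter> ball (P w) dl \<inter> ball b rh ~= {}"
   using open_Int_closure_eq_empty[of "ball c dl \<inter> ball (P w) dl" "ball b rh"] by blast
  moreover have "open (ball c dl \<inter> ball (P w) dl \<inter> ball b rh)" by auto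
  \<comment> \<open>An open set has more than one point, so a common point other than
    \<open>b\<close> exists; off the centre the derivative is known to be non-zero.\<close>
  ultimately have "infinite (ball c dl \<inter> ball (P w) dl \<inter> ball b rh)" using finite_imp_not_open by blast
  hence "infinite (ball c dl \<inter> ball (P w) dl \<inter> ball b rh - {b})" by simp
  hence "ball c dl \<inter> ball (P w) dl \<inter> ball b rh - {b} ~= {}" by (metis finite.emptyI)
  then obtain y where y: "y : ball c dl" "y : ball (P w) dl" "y : ball b rh" "y ~= b" by blast
  have "unramified x (h y)" using ur[of y] y h by simp
  moreover have "~ pole x (G c y)" "f x (G c y) = h y" using G(1)[OF c] y by (auto simp: lift_on_def)
  ultimately have der: "deriv (f x) (G c y) ~= 0" by (simp add: unramified_def)
  have eq: "G c y = G (P w) y" using G(2)[OF c, of y] G(2)[OF Pw(1), of y] y by simp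
  have "G c w = G (P w) w"
  proof (rule lift_on_unique[OF x, of "ball c dl \<inter> ball (P w) dl" h "G c" "G (P w)" y])
   show "lift_on x (ball c dl \<inter> ball (P w) dl) h (G c)" by (rule lift_on_subset[OF G(1)[OF c]]) auto
   show "lift_on x (ball c dl \<inter> ball (P w) dl) h (G (P w))" by (rule lift_on_subset[OF G(1)[OF Pw(1)]]) auto
  qed (use y eq der w Pw in "auto intro!: convex_connected convex_Int simp: dist_commute")
  thus ?thesis using False by (simp add: H'_def)
 qed
 have "lift_on x (ball b (rh + dl)) h H'"
  unfolding lift_on_def
 proof (intro conjI ballI)
  show "H' holomorphic_on ball b (rh + dl)"
   unfolding holomorphic_on_open[OF open_ball] field_differentiable_def[symmetric]
  proof
   fix w assume w: "w : ball b (rh + dl)"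
   show "H' field_differentiable at w"
   proof (cases "w : ball b rh")
    case True
    have "H field_differentiable at w" using H True holomorphic_on_imp_differentiable_at[OF _ open_ball] by (auto simp: lift_on_def)
    thus ?thesis
     by (rule field_differentiable_transform_within_open[OF _ open_ball True]) (simp add: H'_def)
   next
    case False
    have Pw: "P w : sphere b rh" "w : ball (P w) dl" using Pfacts[OF w False] by (auto simp: dist_commute)
    have "G (P w) field_differentiable at w"
     using G(1)[OF Pw(1)] Pw(2) holomorphic_on_imp_differentiable_at[OF _ open_ball] by (auto simp: lift_on_def)
    moreover have "open (ball (P w) dl \<inter> ball b (rh + dl))" by auto
    ultimately show ?thesis
     by (rule field_differentiable_transform_within_open) (use Pw w agree[OF Pw(1)] in auto)
   qed
  qed
  fix w assume w: "w : ball b (rh + dl)"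
  have "~ pole x (H' w) & f x (H' w) = h w"
  proof (cases "w : ball b rh")
   case True
   thus ?thesis using H by (simp add: lift_on_def H'_def)
  next
   case False
   have Pw: "P w : sphere b rh" "w : ball (P w) dl" using Pfacts[OF w False] by (auto simp: dist_commute)
   thus ?thesis using G(1)[OF Pw(1)] False by (simp add: lift_on_def H'_def)
  qed
  thus "~ pole x (H' w)" "f x (H' w) = h w" by auto
 qed
 thus ?thesis using that[OF dl(1)] by (simp add: H'_def)
qed

text \<open>The supremum of the radii with a lift is attained, by uniqueness, and equals
  \<open>R\<close>, since a smaller one could be increased. Over the centre only the given regular
  preimage \<open>zt0\<close> is used, so \<open>h b\<close> may be an asymptotic value.\<close>

lemma lift_ball:
 assumes x: "x : \<Lambda>" and R: "0 < R" and h: "h holomorphic_on ball b R"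
  and zt0: "~ pole x zt0" "f x zt0 = h b" "deriv (f x) zt0 ~= 0"
  and ur: "!!w. w : ball b R - {b} ==> unramified x (h w)"
 obtains H where "lift_on x (ball b R) h H" "H b = zt0"
proof -
 define L where "L rh H \<longleftrightarrow> lift_on x (ball b rh) h H & H b = zt0" for rh H
 have uniq: "H1 w = H2 w" if "L rh1 H1" "L rh2 H2" "w : ball b rh1" "w : ball b rh2" for rh1 rh2 H1 H2 w
 proof (rule lift_on_unique[OF x, of "ball b (min rh1 rh2)" h H1 H2 b])
  have l: "lift_on x (ball b rh1) h H1" "lift_on x (ball b rh2) h H2" using that(1,2) by (simp_all add: L_def)
  show "lift_on x (ball b (min rh1 rh2)) h H1" by (rule lift_on_subset[OF l(1)]) auto
  show "lift_on x (ball b (min rh1 rh2)) h H2" by (rule lift_on_subset[OF l(2)]) auto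
  have "dist b w < rh1" "dist b w < rh2" using that(3,4) by simp_all
  hence "0 < rh1" "0 < rh2" using zero_le_dist[of b w] by linarith+
  thus "b : ball b (min rh1 rh2)" by simp
 qed (use that zt0 in "auto simp: L_def")
 have limit: "EX H. L rh H" if rh: "0 < rh" and each: "!!t. 0 < t ==> t < rh ==> EX H. L t H" for rh
 proof -
  have "ALL t:{0<..<rh}. EX H. L t H" using each by auto
  from bchoice[OF this] obtain K where "ALL t:{0<..<rh}. L t (K t)" ..
  hence K: "!!t. 0 < t ==> t < rh ==> L t (K t)" by simp
  \<comment> \<open>Each point uses the lift on the disc whose radius is halfway between its
    distance from \<open>b\<close> and \<open>rh\<close>; by uniqueness the choice is
    immaterial.\<close>
  define H where "H w = K ((dist b w + rh) / 2) w" for w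
  have Heq: "H w = K t w" if "0 < t" "t < rh" "w : ball b t" for t w
  proof -
   have d: "dist b w < (dist b w + rh) / 2" "0 < (dist b w + rh) / 2" "(dist b w + rh) / 2 < rh"
    using that by (auto intro: add_nonneg_pos)
   show ?thesis unfolding H_def by (rule uniq[OF K[OF d(2,3)] K[OF that(1,2)]]) (use d that in auto)
  qed
  have pt: "H field_differentiable at w & ~ pole x (H w) & f x (H w) = h w" if w: "w : ball b rh" for w
  proof -
   define t where "t = (dist b w + rh) / 2"
   have t: "0 < t" "t < rh" "w : ball b t" using w rh by (auto simp: t_def intro: add_nonneg_pos)
   have lt: "lift_on x (ball b t) h (K t)" using K[OF t(1,2)] by (simp add: L_def)
   hence "K t field_differentiable at w"
    using holomorphic_on_imp_differentiable_at[OF _ open_ball t(3)] by (simp add: lift_on_def)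
   hence "H field_differentiable at w"
    by (rule field_differentiable_transform_within_open[OF _ open_ball t(3)]) (use Heq t in simp)
   thus ?thesis using lt Heq[OF t] t(3) by (simp add: lift_on_def)
  qed
  have "H b = zt0" using Heq[of "rh/2" b] K[of "rh/2"] rh by (simp add: L_def)
  moreover have "H holomorphic_on ball b rh"
   using pt unfolding holomorphic_on_def by (blast intro: field_differentiable_at_within)
  ultimately have "L rh H" unfolding L_def lift_on_def using pt by auto
  thus ?thesis by blast
 qed
 obtain rh0 where rh0: "0 < rh0" "rh0 < R" "EX H. L rh0 H"
 proof -
  obtain e T g where g: "0 < e" "open T" "f x zt0 : T" "g holomorphic_on T"
  "!!w. w : T ==> ~ pole x (g w) & f x (g w) = w"
  "!!z. z : ball zt0 e ==> f x z : T & g (f x z) = z"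
   by (rule local_inverse[OF x zt0(1,3), of 1]) auto
  have "isCont h b" using h R by (intro holomorphic_isCont) auto
  hence "\<forall>\<^sub>F w in nhds b. h w : T"
   using g zt0(2) unfolding isCont_def tendsto_at_iff_tendsto_nhds by (auto dest: topological_tendstoD)
  then obtain eps where eps: "eps > 0" "!!w. dist w b < eps ==> h w : T"
   unfolding eventually_nhds_metric by blast
  let ?rh = "min eps (R/2)"
  have "lift_on x (ball b ?rh) h (g \<circ> h)"
   unfolding lift_on_def
  proof
   show "g \<circ> h holomorphic_on ball b ?rh"
   proof (rule holomorphic_on_compose_gen[OF _ g(4)])
    show "h holomorphic_on ball b ?rh" by (rule holomorphic_on_subset[OF h]) (use R in auto)
   qed (use eps in "auto simp: dist_commute")
  qed (use g eps in "auto simp: dist_commute")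
  moreover have "(g \<circ> h) b = zt0" using g(6)[of zt0] g(1) zt0 by simp
  ultimately have "L ?rh (g \<circ> h)" by (simp add: L_def)
  thus thesis using eps R by (intro that[of ?rh]) auto
 qed
 define P where "P = {rh. 0 < rh & rh <= R & (EX H. L rh H)}"
 have P: "rh0 : P" "bdd_above P" using rh0 by (auto simp: P_def bdd_above_def)
 define rh where "rh = Sup P"
 have "rh0 <= rh" unfolding rh_def by (rule cSup_upper[OF P])
 moreover have "rh <= R" unfolding rh_def by (rule cSup_least) (use P(1) in "auto simp: P_def")
 ultimately have rh: "0 < rh" "rh <= R" using rh0(1) by simp_all
 have "EX H. L t H" if t: "0 < t" "t < rh" for t
 proof -
  have "P ~= {}" using P(1) by blast
  then obtain t' where "t' : P" "t < t'" using t less_cSup_iff[of P t] P(2) unfolding rh_def by blast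
  then obtain H where "L t' H" by (auto simp: P_def)
  hence "lift_on x (ball b t') h H" "H b = zt0" by (simp_all add: L_def)
  moreover have "ball b t <= ball b t'" using \<open>t < t'\<close> by auto
  ultimately have "L t H" unfolding L_def using lift_on_subset by blast
  thus ?thesis by blast
 qed
 then obtain H where H: "L rh H" using limit[OF rh(1)] by blast
 have "rh = R"
 proof (rule ccontr)
  assume "rh ~= R"
  hence less: "rh < R" using rh by simp
  have HL: "lift_on x (ball b rh) h H" "H b = zt0" using H by (auto simp: L_def)
  obtain dl H' where dl: "0 < dl" "lift_on x (ball b (rh + dl)) h H'" "!!w. w : ball b rh ==> H' w = H w"
   by (rule lift_extends_radius[OF x rh(1) HL(1) h less ur]) blast+
  define t where "t = min (rh + dl) R"
  have "ball b t <= ball b (rh + dl)" by (auto simp: t_def)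
  hence "L t H'" using lift_on_subset[OF dl(2), of "ball b t"] dl(3)[of b] HL(2) rh(1) by (simp add: L_def)
  hence "t : P" using rh dl(1) less by (auto simp: P_def t_def)
  hence "t <= rh" unfolding rh_def using P(2) by (rule cSup_upper)
  thus False using dl(1) less by (simp add: t_def)
 qed
 thus ?thesis using H that by (auto simp: L_def)
qed

text \<open>A Moebius map carries the half-plane to the unit disc and \<open>u0\<close> to its
  centre, where \<open>lift_ball\<close> applies.\<close>

lemma lift_halfplane:
 assumes x: "x : \<Lambda>" and h: "h holomorphic_on {u. Re u < A}" and u0: "Re u0 < A"
  and zt0: "~ pole x zt0" "f x zt0 = h u0" "deriv (f x) zt0 ~= 0"
  and ur: "!!u. Re u < A ==> unramified x (h u)"
 obtains H where "lift_on x {u. Re u < A} h H" "H u0 = zt0"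
proof -
 define c where "c = A - Re u0"
 have c: "c > 0" using u0 by (simp add: c_def)
 define ph where "ph t = u0 - 2 * of_real c * t / (1 - t)" for t :: complex
 define \<psi> where "\<psi> u = ((u0 - u) / (2 * of_real c)) / (1 + (u0 - u) / (2 * of_real c))" for u
 \<comment> \<open>The points closer to 0 than to -1: hence s / (1 + s) maps the half-plane Re s >
   -1/2 onto the unit disc, and \<open>ph\<close> and \<open>\<psi>\<close> are mutually inverse in
   this coordinate.\<close>
 have key: "cmod s < cmod (1 + s) \<longleftrightarrow> Re s > - (1/2)" for s
 proof -
  have "cmod s < cmod (1 + s) \<longleftrightarrow> (cmod s)\<^sup>2 < (cmod (1 + s))\<^sup>2" 
   using power_mono_iff[of "cmod (1 + s)" "cmod s" 2] by (metis norm_ge_zero not_le zero_less_numeral)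
  also have "... \<longleftrightarrow> 0 < 1 + Re s * 2" unfolding cmod_power2 by (simp add: power2_eq_square algebra_simps)
  also have "... \<longleftrightarrow> Re s > - (1/2)" by linarith
  finally show ?thesis .
 qed
 have hp: "Re u < A \<longleftrightarrow> Re ((u0 - u) / (2 * of_real c)) > - (1/2)" for u
 proof -
  have "Re ((u0 - u) / (2 * of_real c)) = (Re u0 - Re u) / (2 * c)"
   using Re_divide_of_real[of "u0 - u" "2 * c"] by simp
  thus ?thesis using c by (auto simp: c_def field_simps)
 qed
 have \<psi>: "1 + (u0 - u) / (2 * of_real c) ~= 0" "\<psi> u : ball 0 1" if "Re u < A" for u
 proof -
  let ?s = "(u0 - u) / (2 * of_real c)"
  have less: "cmod ?s < cmod (1 + ?s)" using that key hp by blast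
  hence "cmod (1 + ?s) > 0" by (rule le_less_trans[OF norm_ge_zero])
  thus "1 + ?s ~= 0" using less by (metis norm_zero less_irrefl)
  have "cmod (?s / (1 + ?s)) = cmod ?s / cmod (1 + ?s)" by (rule norm_divide)
  also have "... < 1" using less \<open>cmod (1 + ?s) > 0\<close> by (simp only: divide_less_eq_1_pos)
  finally have "cmod (?s / (1 + ?s)) < 1" .
  thus "\<psi> u : ball 0 1" unfolding \<psi>_def by simp
 qed
 have ph\<psi>: "ph (\<psi> u) = u" if "Re u < A" for u
 proof -
  define s where "s = (u0 - u) / (2 * of_real c)"
  have s1: "1 + s ~= 0" using \<psi>(1)[OF that] by (simp add: s_def)
  have "1 - s / (1 + s) = 1 / (1 + s)" using s1 by (simp add: field_simps)
  hence "ph (\<psi> u) = u0 - 2 * of_real c * s" unfolding ph_def \<psi>_def s_def[symmetric] using s1 by simp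
  also have "... = u" using c by (simp add: s_def)
  finally show ?thesis .
 qed
 have phin: "Re (ph t) < A" if t: "t : ball 0 1" for t
 proof -
  have t1: "1 - t ~= 0" using t by auto
  define s where "s = t / (1 - t)"
  have "1 + s = 1 / (1 - t)" using t1 by (simp add: s_def field_simps)
  hence "cmod s < cmod (1 + s)" using t t1 by (simp add: s_def norm_divide divide_strict_right_mono)
  hence "Re s > - (1/2)" using key by simp
  moreover have "(u0 - ph t) / (2 * of_real c) = s" using c by (simp add: ph_def s_def)
  ultimately show ?thesis using hp[of "ph t"] by simp
 qed
 have phhol: "ph holomorphic_on ball 0 1" unfolding ph_def by (intro holomorphic_intros) auto
 have \<psi>hol: "\<psi> holomorphic_on {u. Re u < A}" unfolding \<psi>_def using c \<psi>(1) by (intro holomorphic_intros) auto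
 obtain H where H: "lift_on x (ball 0 1) (h \<circ> ph) H" "H 0 = zt0"
 proof (rule lift_ball[OF x, of 1 "h \<circ> ph" 0 zt0])
  show "(h \<circ> ph) holomorphic_on ball 0 1"
   by (rule holomorphic_on_compose_gen[OF phhol h]) (use phin in auto)
  show "f x zt0 = (h \<circ> ph) 0" using zt0 by (simp add: ph_def)
  show "unramified x ((h \<circ> ph) t)" if "t : ball 0 1 - {0}" for t using ur phin that by simp
 qed (use zt0 in auto)
 have "lift_on x {u. Re u < A} h (H \<circ> \<psi>)"
  unfolding lift_on_def
 proof
  show "H \<circ> \<psi> holomorphic_on {u. Re u < A}"
   by (rule holomorphic_on_compose_gen[OF \<psi>hol, of H "ball 0 1"]) (use H \<psi> in "auto simp: lift_on_def")
  show "ALL w:{u. Re u < A}. ~ pole x ((H \<circ> \<psi>) w) & f x ((H \<circ> \<psi>) w) = h w"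
   using H(1) \<psi>(2) ph\<psi> by (simp add: lift_on_def)
 qed
 moreover have "(H \<circ> \<psi>) u0 = zt0" using H(2) by (simp add: \<psi>_def)
 ultimately show ?thesis by (rule that)
qed

end

section \<open>Distortion of univalent functions\<close>

text \<open>If \<open>ph\<close> is univalent and omits \<open>w\<close>, then the square root of \<open>1 - ph / w\<close> omits both 0 and
  minus its value at the centre, so Schottky's theorem bounds it.\<close>

definition distortion_const :: real where
 "distortion_const = 64 * (1 + (exp (pi * exp (pi * 16)))\<^sup>2)"

lemma distortion_const_pos: "distortion_const > 0"
 unfolding distortion_const_def by (intro mult_pos_pos add_pos_nonneg) auto

lemma normalized_univalent_second_derivative:
 assumes hol: "ph holomorphic_on ball 0 1" and inj: "inj_on ph (ball 0 1)"
  and 0: "ph 0 = 0" "deriv ph 0 = 1"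
 shows "cmod (deriv (deriv ph) 0) <= distortion_const"
proof -
 \<comment> \<open>If the image contained the disc of radius 2, the inverse would map that disc into
   the unit disc with derivative 1 at 0, against Cauchy's bound 1/2.\<close>
 have "EX w. cmod w < 2 & w ~: ph ` ball 0 1"
 proof (rule ccontr)
  assume "~ ?thesis"
  hence sub: "ball 0 2 <= ph ` ball 0 1" by force
  obtain g where g: "g holomorphic_on ph ` ball 0 1" "!!z. z : ball 0 1 ==> deriv ph z * deriv g (ph z) = 1"
    "!!z. z : ball 0 1 ==> g (ph z) = z"
   by (rule holomorphic_has_inverse[OF hol open_ball inj]) blast
  have "cmod (deriv g 0) <= 1 / 2"
  proof (rule deriv_le_of_bound)
   show "g holomorphic_on ball 0 2" by (rule holomorphic_on_subset[OF g(1) sub])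
   fix z :: complex assume "z : ball 0 2"
   then obtain y where "y : ball 0 1" "z = ph y" using sub by blast
   thus "cmod (g z) <= 1" using g(3)[of y] by simp
  qed auto
  moreover have "deriv g 0 = 1" using g(2)[of 0] 0 by simp
  ultimately show False by simp
 qed
 then obtain w where w: "cmod w < 2" "w ~: ph ` ball 0 1" by blast
 have w0: "w ~= 0" using w 0 by (metis centre_in_ball image_eqI zero_less_one)
 have "(%t. 1 - ph t / w) holomorphic_on ball 0 1" using w0 by (intro holomorphic_intros hol)
 moreover have nz: "1 - ph t / w ~= 0" if "t : ball 0 1" for t using w w0 that by (auto simp: field_simps)
 moreover have "contractible (ball (0::complex) 1)" by (intro convex_imp_contractible) auto
 ultimately obtain g where g: "g holomorphic_on ball 0 1" "!!t. t : ball 0 1 ==> 1 - ph t / w = (g t)\<^sup>2"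
  using contractible_imp_holomorphic_sqrt[of "%t. 1 - ph t / w" "ball 0 1"] by blast
 have g0: "(g 0)\<^sup>2 = 1" using g(2)[of 0] 0 by simp
 hence g0': "g 0 ~= 0" by auto
 \<comment> \<open>This omits 0, as \<open>ph\<close> omits \<open>w\<close>. It omits 1 because g t
   = - g 0 would give ph t = 0, hence t = 0 by injectivity, and then g 0 = - g 0.\<close>
 define k where "k t = - g t / g 0" for t
 have k2: "(k t)\<^sup>2 = 1 - ph t / w" if "t : ball 0 1" for t using g(2)[OF that] g0 by (simp add: k_def power_divide)
 have k01: "k t ~= 0 & k t ~= 1" if t: "t : ball 0 1" for t
 proof
  show "k t ~= 0" using k2[OF t] nz[OF t] by auto
  show "k t ~= 1"
  proof
   assume k1: "k t = 1"
   hence "ph t = 0" using k2[OF t] w0 by simp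
   hence "t = 0" using inj_onD[OF inj, of t 0] 0 t by simp
   thus False using k1 g0' by (simp add: k_def)
  qed
 qed
 \<comment> \<open>Schottky's bound with r = 1 and t = 1/2 has 2 + 2 + 12 = 16 in the exponent. It
   is applied to k (t/2), so it holds on the disc of radius 1/4, and Cauchy's estimate there gives
   the factor 2 * 2 * 16 = 64.\<close>
 let ?M = "exp (pi * exp (pi * 16))"
 have kM: "cmod (k t) <= ?M" if t: "t : cball 0 (1/4)" for t
 proof -
  have "cmod ((%t. k (t/2)) (2 * t)) <= exp (pi * exp (pi * (2 + 2 * 1 + 12 * (1/2) / (1 - (1/2)))))"
  proof (rule Schottky[where f = "%t. k (t/2)" and r = 1 and t = "1/2" and z = "2 * t"])
   have "k holomorphic_on ball 0 1" unfolding k_def using g0' by (intro holomorphic_intros g)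
   hence "(k \<circ> (%t. t/2)) holomorphic_on cball 0 1"
    by (intro holomorphic_on_compose_gen[of _ _ k "ball 0 1"] holomorphic_intros) auto
   thus "(%t. k (t/2)) holomorphic_on cball 0 1" by (simp add: o_def)
   show "cmod (k (0/2)) <= 1" using g0' by (simp add: k_def norm_divide)
   show "~ (k (z/2) = 0 | k (z/2) = 1)" if "z : cball 0 1" for z using k01[of "z/2"] that by simp
   show "cmod (2 * t) <= 1/2" using t by (simp add: norm_mult)
  qed auto
  thus ?thesis by simp
 qed
 have phM: "cmod (ph t) <= 2 * (1 + ?M\<^sup>2)" if t: "t : cball 0 (1/4)" for t
 proof -
  have "ph t = w * (1 - (k t)\<^sup>2)" using k2[of t] t w0 by (simp add: field_simps)
  hence "cmod (ph t) <= cmod w * (1 + (cmod (k t))\<^sup>2)"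
   using norm_triangle_ineq4[of 1 "(k t)\<^sup>2"] by (simp add: norm_mult norm_power mult_left_mono)
  also have "... <= 2 * (1 + ?M\<^sup>2)"
   using w kM[OF t] by (intro mult_mono add_mono power_mono) auto
  finally show ?thesis .
 qed
 have "cmod ((deriv ^^ 2) ph 0) <= fact 2 * (2 * (1 + ?M\<^sup>2)) / (1/4) ^ 2"
 proof (rule Cauchy_inequality)
  show "ph holomorphic_on ball 0 (1/4)" by (rule holomorphic_on_subset[OF hol]) auto
  show "continuous_on (cball 0 (1/4)) ph"
   by (rule holomorphic_on_imp_continuous_on, rule holomorphic_on_subset[OF hol]) auto
 qed (use phM in auto)
 thus ?thesis by (simp add: distortion_const_def numeral_2_eq_2 power2_eq_square)
qed

text \<open>Affine rescaling of the normalized case. Any constant may stand in for Bieberbach's 4,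
  as the estimate is used deep inside a half-plane, where \<open>R\<close> is large.\<close>

lemma univalent_second_derivative:
 assumes R: "0 < R" and hol: "H holomorphic_on ball u R" and inj: "inj_on H (ball u R)"
 shows "cmod (deriv (deriv H) u) <= distortion_const * cmod (deriv H u) / R"
proof -
 have d: "deriv H u ~= 0"
  using holomorphic_injective_imp_regular[OF hol open_ball inj, of u] R by simp
 define ph where "ph t = (H (u + of_real R * t) - H u) / (of_real R * deriv H u)" for t
 have inb: "u + of_real R * t : ball u R" if "t : ball 0 1" for t
  using that R by (simp add: dist_norm norm_mult)
 have inb0: "u : ball u R" using R by simp
 have D1: "(ph has_field_derivative deriv H (u + of_real R * t) / deriv H u) (at t)" if "t : ball 0 1" for t
 proof -
  have "(H has_field_derivative deriv H (u + of_real R * t)) (at (u + of_real R * t))"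
   by (rule holomorphic_derivI[OF hol open_ball inb[OF that]])
  hence "((%t. H (u + of_real R * t)) has_field_derivative deriv H (u + of_real R * t) * of_real R) (at t)"
   by (rule DERIV_chain2) (auto intro!: derivative_eq_intros)
  thus ?thesis unfolding ph_def using R d by (auto intro!: derivative_eq_intros)
 qed
 have "cmod (deriv (deriv ph) 0) <= distortion_const"
 proof (rule normalized_univalent_second_derivative)
  show "ph holomorphic_on ball 0 1" unfolding holomorphic_on_open[OF open_ball] using D1 by blast
  show "inj_on ph (ball 0 1)"
  proof (rule inj_onI)
   fix s t assume st: "s : ball 0 1" "t : ball 0 1" "ph s = ph t"
   hence "H (u + of_real R * s) = H (u + of_real R * t)" using R d by (simp add: ph_def)
   hence "u + of_real R * s = u + of_real R * t" by (rule inj_onD[OF inj]) (use st inb in auto)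
   thus "s = t" using R by simp
  qed
  show "ph 0 = 0" by (simp add: ph_def)
  show "deriv ph 0 = 1" using DERIV_imp_deriv[OF D1[of 0]] d by simp
 qed
 moreover have "deriv (deriv ph) 0 = of_real R * deriv (deriv H) u / deriv H u"
 proof (rule DERIV_imp_deriv)
  have "(deriv H has_field_derivative deriv (deriv H) u) (at (u + of_real R * 0))"
   using holomorphic_derivI[OF holomorphic_deriv[OF hol open_ball] open_ball inb0] by simp
  hence "((%t. deriv H (u + of_real R * t)) has_field_derivative deriv (deriv H) u * of_real R) (at 0)"
   by (rule DERIV_chain2) (auto intro!: derivative_eq_intros)
  hence "((%t. deriv H (u + of_real R * t) / deriv H u) has_field_derivative of_real R * deriv (deriv H) u / deriv H u) (at 0)"
   using d by (auto intro!: derivative_eq_intros)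
  thus "(deriv ph has_field_derivative of_real R * deriv (deriv H) u / deriv H u) (at 0)"
  proof (rule has_field_derivative_transform_within_open[OF _ open_ball[of 0 1]])
   show "deriv H (u + of_real R * t) / deriv H u = deriv ph t" if "t : ball 0 1" for t
    using DERIV_imp_deriv[OF D1[OF that]] by simp
  qed auto
 qed
 ultimately have "R * cmod (deriv (deriv H) u) / cmod (deriv H u) <= distortion_const"
  using R by (simp add: norm_mult norm_divide)
 thus ?thesis using R d by (simp add: field_simps)
qed

text \<open>The logarithmic derivative of H' at \<open>w\<close> is at most a constant over the
  distance A - Re w to the boundary. Far enough to the left it is below any prescribed
  \<open>\<tau>\<close>, so H' varies at an exponential rate as small as desired. This is what lets
  the factor exp (Re u) win later.\<close>

lemma halfplane_distortion:
 assumes hol: "H holomorphic_on {u. Re u < A}" and inj: "inj_on H {u. Re u < A}"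
  and \<tau>: "0 < \<tau>" and b: "Re b <= A - distortion_const / \<tau>" and u: "Re u <= Re b"
 shows "cmod (deriv H u) <= cmod (deriv H b) * exp (\<tau> * cmod (u - b))"
  and "cmod (deriv H u) >= cmod (deriv H b) * exp (- \<tau> * cmod (u - b))"
proof -
 let ?P = "{u. Re u < A}"
 have oP: "open ?P" "convex ?P" by (auto simp: open_halfspace_Re_lt convex_halfspace_Re_lt)
 have nz: "deriv H w ~= 0" if "w : ?P" for w
  by (rule holomorphic_injective_imp_regular[OF hol oP(1) inj that])
 have dh: "deriv H holomorphic_on ?P" by (rule holomorphic_deriv[OF hol oP(1)])
 obtain L where L: "L holomorphic_on ?P" "!!w. w : ?P ==> deriv H w = exp (L w)"
  using contractible_imp_holomorphic_log[OF dh convex_imp_contractible[OF oP(2)]] nz by blast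
 have sub: "w : ?P" if "Re w <= Re b" for w
 proof -
  have "0 < distortion_const / \<tau>" using distortion_const_pos \<tau> by (rule divide_pos_pos)
  hence "Re w < A" using that b by linarith
  thus ?thesis by simp
 qed
 have "cmod (L u - L b) <= \<tau> * cmod (u - b)"
 proof (rule field_differentiable_bound[where S = "{w. Re w <= Re b}" and f' = "deriv L"])
  show "convex {w. Re w <= Re b}" by (rule convex_halfspace_Re_le)
  fix w assume w: "w : {w. Re w <= Re b}"
  hence wP: "w : ?P" using sub by simp
  show "(L has_field_derivative deriv L w) (at w within {w. Re w <= Re b})"
   by (rule has_field_derivative_at_within, rule holomorphic_derivI[OF L(1) oP(1) wP])
  have "((%w. exp (L w)) has_field_derivative exp (L w) * deriv L w) (at w)"
   using holomorphic_derivI[OF L(1) oP(1) wP] by (rule DERIV_fun_exp)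
  hence "(deriv H has_field_derivative exp (L w) * deriv L w) (at w)"
   by (rule has_field_derivative_transform_within_open[OF _ oP(1) wP]) (simp add: L(2))
  hence e: "deriv (deriv H) w = deriv H w * deriv L w" using L(2)[OF wP] by (simp add: DERIV_imp_deriv)
  have sb: "ball w (A - Re w) <= ?P"
  proof
   fix y assume "y : ball w (A - Re w)"
   hence "\<bar>Re (y - w)\<bar> < A - Re w" using abs_Re_le_cmod[of "y - w"] by (simp add: dist_norm norm_minus_commute)
   thus "y : ?P" by simp
  qed
  have "cmod (deriv (deriv H) w) <= distortion_const * cmod (deriv H w) / (A - Re w)"
   by (rule univalent_second_derivative) (use wP sb holomorphic_on_subset[OF hol] inj_on_subset[OF inj] in auto)
  hence le: "cmod (deriv L w) <= distortion_const / (A - Re w)"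
  proof -
   have "cmod (deriv H w) * cmod (deriv L w) <= cmod (deriv H w) * (distortion_const / (A - Re w))"
    using \<open>cmod (deriv (deriv H) w) <= _\<close> unfolding e by (simp add: norm_mult mult.commute)
   moreover have "cmod (deriv H w) > 0" using nz[OF wP] by simp
   ultimately show ?thesis by (rule mult_left_le_imp_le)
  qed
  have "distortion_const / \<tau> <= A - Re w" using w b by simp
  hence "distortion_const / (A - Re w) <= \<tau>" using wP \<tau> by (simp add: field_simps)
  thus "cmod (deriv L w) <= \<tau>" using le by simp
 qed (use u in auto)
 hence "\<bar>Re (L u) - Re (L b)\<bar> <= \<tau> * cmod (u - b)"
  using abs_Re_le_cmod[of "L u - L b"] by simp
 hence "Re (L u) <= Re (L b) + \<tau> * cmod (u - b)" "Re (L u) >= Re (L b) - \<tau> * cmod (u - b)" by linarith+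
 moreover have "cmod (deriv H u) = exp (Re (L u))" "cmod (deriv H b) = exp (Re (L b))"
  using L(2) sub[of u] sub[of b] u by auto
 ultimately show "cmod (deriv H u) <= cmod (deriv H b) * exp (\<tau> * cmod (u - b))"
  "cmod (deriv H u) >= cmod (deriv H b) * exp (- \<tau> * cmod (u - b))"
  by (auto simp: exp_add[symmetric])
qed

lemma halfplane_growth:
 assumes hol: "H holomorphic_on {u. Re u < A}" and inj: "inj_on H {u. Re u < A}"
  and \<tau>: "0 < \<tau>" and b: "Re b <= A - distortion_const / \<tau>" and u: "Re u <= Re b"
 shows "cmod (H u - H b) <= cmod (deriv H b) * exp (\<tau> * cmod (u - b)) * cmod (u - b)"
proof (rule field_differentiable_bound[where S = "closed_segment b u" and f' = "deriv H"])
 fix w assume w: "w : closed_segment b u"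
 have "closed_segment b u <= {w. Re w <= Re b}"
  by (rule closed_segment_subset) (use u in "auto simp: convex_halfspace_Re_le")
 hence wb: "Re w <= Re b" using w by auto
 have "0 < distortion_const / \<tau>" using distortion_const_pos \<tau> by (rule divide_pos_pos)
 hence "Re w < A" using wb b by linarith
 hence wA: "w : {u. Re u < A}" by simp
 show "(H has_field_derivative deriv H w) (at w within closed_segment b u)"
  by (rule has_field_derivative_at_within, rule holomorphic_derivI[OF hol open_halfspace_Re_lt wA])
 have "cmod (w - b) <= cmod (u - b)" using segment_bound(1)[OF w] by (simp add: norm_minus_commute)
 hence "cmod (deriv H b) * exp (\<tau> * cmod (w - b)) <= cmod (deriv H b) * exp (\<tau> * cmod (u - b))"
  using \<tau> by (intro mult_left_mono) auto
 thus "cmod (deriv H w) <= cmod (deriv H b) * exp (\<tau> * cmod (u - b))"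
  using halfplane_distortion(1)[OF hol inj \<tau> b wb] by simp
qed auto

section \<open>Asymptotic tracts\<close>

lemma stereo_Some_inverse:
 "snd (stereo (Some z)) < 1" "(1 / (1 - snd (stereo (Some z)))) *\<^sub>R fst (stereo (Some z)) = z"
proof -
 have pos: "1 + (cmod z)\<^sup>2 > 0" by (simp add: add_pos_nonneg)
 show "snd (stereo (Some z)) < 1" using pos by (simp add: divide_less_eq)
 define d where "d = 1 - snd (stereo (Some z))"
 have d: "d = 2 / (1 + (cmod z)\<^sup>2)" using pos by (simp add: d_def field_simps)
 hence fs: "fst (stereo (Some z)) = d *\<^sub>R z" "d ~= 0" using pos by auto
 show "(1 / (1 - snd (stereo (Some z)))) *\<^sub>R fst (stereo (Some z)) = z"
  unfolding d_def[symmetric] fs(1) using fs(2) by simp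
qed

lemma stereo_injective: "stereo a = stereo b \<longleftrightarrow> a = b"
proof (cases a; cases b)
 fix z w assume "a = Some z" "b = Some w"
 thus ?thesis using stereo_Some_inverse(2)[of z] stereo_Some_inverse(2)[of w] by metis
next
 fix z assume "a = None" "b = Some z"
 thus ?thesis using stereo_Some_inverse(1)[of z] by (metis less_irrefl option.distinct(1) snd_conv stereo.simps(1))
next
 fix z assume "a = Some z" "b = None"
 thus ?thesis using stereo_Some_inverse(1)[of z] by (metis less_irrefl option.distinct(1) snd_conv stereo.simps(1))
qed auto

lemma stereo_tendsto_Some:
 assumes "((%t. stereo (g t)) ---> stereo (Some l)) F"
 shows "\<forall>\<^sub>F t in F. g t ~= None" "((%t. the (g t)) ---> l) F"
proof -
 let ?h = "snd (stereo (Some l))"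
 note inv = stereo_Some_inverse(2)
 have h1: "?h < 1" by (rule stereo_Some_inverse(1))
 have "((%t. snd (stereo (g t))) ---> ?h) F" by (rule tendsto_snd[OF assms])
 hence less: "\<forall>\<^sub>F t in F. snd (stereo (g t)) < 1" using h1 by (rule order_tendstoD)
 thus ev: "\<forall>\<^sub>F t in F. g t ~= None" by eventually_elim (metis less_irrefl snd_conv stereo.simps(1))
 have "((%t. (1 / (1 - snd (stereo (g t)))) *\<^sub>R fst (stereo (g t))) --->
   (1 / (1 - snd (stereo (Some l)))) *\<^sub>R fst (stereo (Some l))) F"
  using h1 by (intro tendsto_scaleR tendsto_divide tendsto_diff tendsto_const tendsto_snd tendsto_fst assms) auto
 hence "((%t. (1 / (1 - snd (stereo (g t)))) *\<^sub>R fst (stereo (g t))) ---> l) F" unfolding inv .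
 thus "((%t. the (g t)) ---> l) F"
 proof (rule Lim_transform_eventually)
  show "\<forall>\<^sub>F t in F. (1 / (1 - snd (stereo (g t)))) *\<^sub>R fst (stereo (g t)) = the (g t)"
   using ev by eventually_elim (metis inv option.collapse)
 qed
qed

text \<open>H (n Ln t) does not depend on the branch of the logarithm, by periodicity, and is
  therefore holomorphic across the cut as well.\<close>

lemma periodic_descends:
 fixes H :: "complex => complex"
 assumes H: "H holomorphic_on {u. Re u < A}" and n: "n >= (1::nat)"
  and per: "!!u. Re u < A ==> H (u + 2 * of_real pi * \<i> * of_nat n) = H u"
 obtains g where "g holomorphic_on ball 0 (exp (A / n)) - {0}"
  "!!u. Re u < A ==> g (exp (u / of_nat n)) = H u"
proof -
 let ?r = "exp (A / n)"
 have perk: "Re u < A ==> H (u + 2 * of_real pi * \<i> * of_nat n * of_nat k) = H u" for u and k :: nat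
 proof (induction k)
  case (Suc k)
  have "H (u + 2 * of_real pi * \<i> * of_nat n * of_nat (Suc k))
    = H ((u + 2 * of_real pi * \<i> * of_nat n * of_nat k) + 2 * of_real pi * \<i> * of_nat n)"
   by (simp add: algebra_simps)
  also have "... = H u" using per[of "u + 2 * of_real pi * \<i> * of_nat n * of_nat k"] Suc by simp
  finally show ?case .
 qed simp
 have peri: "H (u + 2 * of_real pi * \<i> * of_nat n * of_int k) = H u" if "Re u < A" for u and k :: int
 proof (cases "k >= 0")
  case True
  thus ?thesis using perk[OF that, of "nat k"] by (simp add: of_nat_nat)
 next
  case False
  hence "H ((u + 2 * of_real pi * \<i> * of_nat n * of_int k) + 2 * of_real pi * \<i> * of_nat n * of_nat (nat (-k))) = H (u + 2 * of_real pi * \<i> * of_nat n * of_int k)"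
   using that by (intro perk) simp
  thus ?thesis using False by (simp add: of_nat_nat)
 qed
 define g where "g t = H (of_nat n * Ln t)" for t
 have eq: "g (exp y) = H (of_nat n * y)" if y: "Re (of_nat n * y) < A" for y
 proof -
  obtain k :: int where k: "Ln (exp y) = y + (of_int k * 2) * of_real pi * \<i>"
   using exp_eq[of "Ln (exp y)" y] by (auto simp: algebra_simps)
  have "g (exp y) = H (of_nat n * y + 2 * of_real pi * \<i> * of_nat n * of_int k)"
   unfolding g_def k by (simp add: algebra_simps)
  thus ?thesis using peri[OF y] by simp
 qed
 have "g field_differentiable at t0" if t0: "t0 : ball 0 ?r - {0}" for t0
 proof -
  have t0': "t0 ~= 0" "cmod t0 < ?r" using t0 by auto
  \<comment> \<open>A branch of the logarithm that is holomorphic near \<open>t0\<close> even if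
    \<open>t0\<close> lies on the cut of \<open>Ln\<close>.\<close>
  define L where "L t = Ln (t / t0) + Ln t0" for t
  have eL: "exp (L t) = t" if "t ~= 0" for t using that t0' by (simp add: L_def exp_add)
  have ReL: "Re (of_nat n * L t) < A" if "t ~= 0" "cmod t < ?r" for t
  proof -
   have "exp (Re (L t)) = cmod t" using eL[OF that(1)] by (metis norm_exp_eq_Re)
   hence "exp (Re (L t)) < exp (A / n)" using that(2) by simp
   thus ?thesis using n by (simp add: field_simps)
  qed
  have cp: "t / t0 ~: \<real>\<^sub>\<le>\<^sub>0" if "t : ball t0 (cmod t0)" for t
  proof
   assume "t / t0 : \<real>\<^sub>\<le>\<^sub>0"
   then obtain a where a: "t / t0 = of_real a" "a <= 0" by (auto elim!: nonpos_Reals_cases)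
   have "cmod (t / t0 - 1) < 1"
   proof -
    have "t / t0 - 1 = (t - t0) / t0" using t0' by (simp add: field_simps)
    thus ?thesis using that t0' by (simp add: norm_divide dist_norm norm_minus_commute)
   qed
   hence "cmod (of_real (a - 1)) < 1" using a by simp
   thus False using a(2) unfolding norm_of_real by simp
  qed
  let ?S = "ball t0 (cmod t0) \<inter> ball 0 ?r"
  have tS: "t ~= 0 & cmod t < ?r" if "t : ?S" for t using that by (auto simp: dist_norm)
  have "(H \<circ> (%t. of_nat n * L t)) holomorphic_on ?S"
  proof (rule holomorphic_on_compose_gen[OF _ H])
   show "(%t. of_nat n * L t) holomorphic_on ?S"
    unfolding L_def using cp t0' by (intro holomorphic_intros) auto
  qed (use tS ReL in auto)
  hence "(%t. H (of_nat n * L t)) field_differentiable at t0"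
   using t0' by (intro holomorphic_on_imp_differentiable_at[of _ ?S]) (auto simp: o_def)
  thus ?thesis
  proof (rule field_differentiable_transform_within_open[of _ _ ?S])
   show "H (of_nat n * L t) = g t" if "t : ?S" for t
    using eq[OF ReL] eL tS[OF that] by metis
  qed (use t0' in auto)
 qed
 hence "g holomorphic_on ball 0 ?r - {0}"
  by (auto simp: holomorphic_on_def field_differentiable_at_within)
 moreover have "g (exp (u / of_nat n)) = H u" if "Re u < A" for u
  using eq[of "u / of_nat n"] that n by simp
 ultimately show ?thesis by (rule that)
qed

context meromorphic_family
begin

section \<open>Logarithmic lifts over an isolated singular value\<close>

text \<open>Near a pole the reciprocals tend to 0 jointly in parameter and variable, so bounded
  finite values cannot be taken along a sequence tending to a pole.\<close>

lemma limit_value: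
 assumes x: "x1 : \<Lambda>" "(X ---> x1) G" and Z: "(Z ---> zt) G" and G: "G ~= bot"
  and np: "\<forall>\<^sub>F n in G. ~ pole (X n) (Z n)" and lim: "((%n. f (X n) (Z n)) ---> w) G"
 shows "~ pole x1 zt" "f x1 zt = w"
proof -
 have lim2: "((%n. (X n, Z n)) ---> (x1, zt)) G" by (intro tendsto_Pair x Z)
 show npz: "~ pole x1 zt"
 proof
  assume pole: "pole x1 zt"
  have "\<forall>\<^sub>F n in G. inverse (f (X n) (Z n)) * f (X n) (Z n) = 1"
   using eventually_compose_filterlim[OF near_pole(1)[OF x(1) pole] lim2] np by eventually_elim auto
  moreover have "((%n. inverse (f (X n) (Z n))) ---> 0) G"
   using filterlim_compose[OF near_pole(2)[OF x(1) pole] lim2] by simp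
  hence "((%n. inverse (f (X n) (Z n)) * f (X n) (Z n)) ---> 0 * w) G" by (intro tendsto_mult lim)
  ultimately have "((%n. 1 :: complex) ---> 0 * w) G" by (rule Lim_transform_eventually[rotated])
  thus False using tendsto_unique[OF G tendsto_const] by fastforce
 qed
 show "f x1 zt = w"
  using tendsto_unique[OF G filterlim_compose[OF near_nonpole(2)[OF x(1) npz] lim2]] lim by simp
qed

text \<open>Lifts of \<open>a + exp u\<close> to a left half-plane, where \<open>a\<close> is an isolated singular value.\<close>

definition isolated_value :: "complex => complex => real => bool" where
 "isolated_value x a A \<longleftrightarrow> (ALL w:ball a (exp A) - {a}. unramified x w) &
  (ALL zt. ~ pole x zt & f x zt = a --> deriv (f x) zt ~= 0)"

lemma isolated_value_deriv:
 assumes "isolated_value x a A" "w : ball a (exp A)" "~ pole x zt" "f x zt = w"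
 shows "deriv (f x) zt ~= 0"
 using assms unfolding isolated_value_def unramified_def by (cases "w = a") auto

lemma exp_in_ball: "Re u < A ==> a + exp u : ball a (exp A) - {a}"
 by (simp add: dist_norm)

text \<open>One half of the dichotomy: if the lift converges to a finite point along one horizontal
  ray, then it is an ordinary inverse branch about \<open>a\<close> composed with a + exp u, and so
  has period 2 pi i.\<close>

lemma tract_finite_end:
 assumes x: "x : \<Lambda>" and iso: "isolated_value x a A"
  and H: "lift_on x {u. Re u < A} (%u. a + exp u) H"
  and u: "Re u < A" and lim: "((%t. H (u - of_real t)) ---> zt) at_top"
 obtains G where "lift_on x (ball a (exp A)) (%w. w) G" "!!u. Re u < A ==> H u = G (a + exp u)"
proof -
 have in_hp: "Re (u - of_real t) < A" if "t >= 0" for t using u that by simp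
 have n0: "((%t::real. exp (Re u - t)) ---> 0) at_top" by real_asymp
 have "((%t. exp (u - of_real t)) ---> 0) at_top" by (rule tendsto_norm_zero_cancel) (use n0 in simp)
 hence lw: "((%t. a + exp (u - of_real t)) ---> a + 0) at_top" by (intro tendsto_intros)
 have ev: "\<forall>\<^sub>F t in at_top. ~ pole x (H (u - of_real t)) & f x (H (u - of_real t)) = a + exp (u - of_real t)"
  using eventually_ge_at_top[of 0] by eventually_elim (use H in_hp in "simp add: lift_on_def")
 have lf: "((%t. f x (H (u - of_real t))) ---> a) at_top"
 proof (rule Lim_transform_eventually)
  show "((%t. a + exp (u - of_real t)) ---> a) at_top" using lw by simp
  show "\<forall>\<^sub>F t in at_top. a + exp (u - of_real t) = f x (H (u - of_real t))" using ev by eventually_elim simp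
 qed
 have np: "\<forall>\<^sub>F t in at_top. ~ pole x (H (u - of_real t))" using ev by eventually_elim simp
 have zt: "~ pole x zt" "f x zt = a"
  using limit_value[OF x tendsto_const lim _ np lf] trivial_limit_at_top_linorder by blast+
 have dzt: "deriv (f x) zt ~= 0" using iso zt by (simp add: isolated_value_def)
 obtain G where G: "lift_on x (ball a (exp A)) (%w. w) G" "G a = zt"
  by (rule lift_ball[OF x, of "exp A" "%w. w" a zt]) (use iso zt dzt in "auto simp: isolated_value_def")
 have GH: "lift_on x {u. Re u < A} (%u. a + exp u) (%u. G (a + exp u))"
  unfolding lift_on_def
 proof
  have "(G \<circ> (%u. a + exp u)) holomorphic_on {u. Re u < A}"
  proof (rule holomorphic_on_compose_gen[of _ _ G "ball a (exp A)"])
   show "(%u. a + exp u) holomorphic_on {u. Re u < A}" by (intro holomorphic_intros)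
  qed (use G exp_in_ball in "auto simp: lift_on_def")
  thus "(%u. G (a + exp u)) holomorphic_on {u. Re u < A}" by (simp add: o_def)
  show "ALL u:{u. Re u < A}. ~ pole x (G (a + exp u)) & f x (G (a + exp u)) = a + exp u"
  proof
   fix u assume "u : {u. Re u < A}"
   hence "a + exp u : ball a (exp A)" using exp_in_ball[of u A a] by simp
   thus "~ pole x (G (a + exp u)) & f x (G (a + exp u)) = a + exp u"
    using G(1) unfolding lift_on_def by blast
  qed
 qed
 obtain e T g where e: "0 < e" "inj_on (f x) (ball zt e)"
  by (rule local_inverse[OF x zt(1) dzt, of 1]) auto
 have "isCont G a" using G by (intro holomorphic_isCont[of G "ball a (exp A)"]) (auto simp: lift_on_def)
 hence "((%t. G (a + exp (u - of_real t))) ---> G a) at_top"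
  using lw by (intro isCont_tendsto_compose[of a G]) auto
 hence "\<forall>\<^sub>F t in at_top. dist (G (a + exp (u - of_real t))) zt < e" using e G(2) by (auto dest: tendstoD)
 moreover have "\<forall>\<^sub>F t in at_top. dist (H (u - of_real t)) zt < e" using tendstoD[OF lim e(1)] .
 ultimately have "\<forall>\<^sub>F t in at_top. dist (G (a + exp (u - of_real t))) zt < e & dist (H (u - of_real t)) zt < e & t > 0"
  using eventually_gt_at_top[of 0] by eventually_elim auto
 then obtain t where t: "dist (G (a + exp (u - of_real t))) zt < e" "dist (H (u - of_real t)) zt < e" "t > 0"
  using eventually_happens'[OF trivial_limit_at_top_linorder] by blast
 define y where "y = u - of_real t"
 have y: "Re y < A" using u t by (simp add: y_def)
 have fH: "~ pole x (H y)" "f x (H y) = a + exp y" using H y by (auto simp: lift_on_def)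
 have fG: "f x (G (a + exp y)) = a + exp y" using GH y by (auto simp: lift_on_def)
 have eqy: "H y = G (a + exp y)"
  by (rule inj_onD[OF e(2)]) (use fH fG t in "auto simp: y_def dist_commute")
 have dy: "deriv (f x) (H y) ~= 0"
  by (rule isolated_value_deriv[OF iso _ fH]) (use exp_in_ball[OF y, of a] in blast)
 have "H w = G (a + exp w)" if "Re w < A" for w
  by (rule lift_on_unique[OF x _ _ H GH, of y])
   (use y eqy dy that in "auto simp: open_halfspace_Re_lt intro: convex_connected convex_halfspace_Re_lt")
 thus ?thesis using that G(1) by blast
qed

lemma poles_unbounded:
 assumes x: "x : \<Lambda>" and inf: "infinite {z. pole x z}"
 obtains p where "pole x p" "cmod p > B"
proof -
 have "f x meromorphic_on UNIV" using nicely[OF x] by (simp add: nicely_meromorphic_on_def)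
 have "finite ({z. pole x z} \<inter> cball 0 B)"
 proof (rule ccontr)
  assume "infinite ({z. pole x z} \<inter> cball 0 B)"
  then obtain z where z: "z islimpt ({z. pole x z} \<inter> cball 0 B)"
   using compact_cball[of "0::complex" B] unfolding compact_eq_Bolzano_Weierstrass by (meson inf_le2)
  hence "z islimpt {z. pole x z}" using islimpt_subset by blast
  moreover have "\<forall>\<^sub>F w in at z. ~ pole x w"
   using \<open>f x meromorphic_on UNIV\<close> eventually_not_pole meromorphic_onE by (metis UNIV_I)
  ultimately show False by (simp add: islimpt_iff_eventually)
 qed
 hence "~ {z. pole x z} <= cball 0 B" using inf by (metis inf.absorb1)
 then obtain p where "pole x p" "p ~: cball 0 B" by blast
 thus ?thesis by (intro that) auto
qed

text \<open>A lift that is not injective is periodic and descends to a function \<open>g\<close> on a punctured disc.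
  A finite limit of \<open>g\<close> at 0 is excluded by assumption, a pole because \<open>g\<close> would then assume large
  poles of \<open>f x\<close>, an essential singularity because \<open>g\<close> would accumulate at a pole.\<close>

lemma tract_injective:
 assumes x: "x : \<Lambda>" and iso: "isolated_value x a A" and inf: "infinite {z. pole x z}"
  and H: "lift_on x {u. Re u < A} (%u. a + exp u) H"
  and nofin: "!!u zt. Re u < A ==> ~ ((%t. H (u - of_real t)) ---> zt) at_top"
 shows "inj_on H {u. Re u < A}"
proof (rule ccontr)
 assume "~ inj_on H {u. Re u < A}"
 then obtain u1 u2 where u12: "Re u1 < A" "Re u2 < A" "H u1 = H u2" "u1 ~= u2" by (auto simp: inj_on_def)
 have fH: "~ pole x (H u)" "f x (H u) = a + exp u" if "Re u < A" for u
  using H that by (auto simp: lift_on_def)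
 have "exp u1 = exp u2" using fH(2)[OF u12(1)] fH(2)[OF u12(2)] u12(3) by simp
 then obtain k :: int where k: "u1 = u2 + (of_int (2 * k) * of_real pi) * \<i>" unfolding exp_eq by auto
 have per: "EX u. Re u < A & H (u + 2 * of_real pi * \<i> * of_nat n) = H u & n >= 1" if n: "n = nat \<bar>k\<bar>" for n
 proof -
  have k0: "k ~= 0" using k u12(4) by auto
  show ?thesis
  proof (cases "k > 0")
   case True
   hence "u1 = u2 + 2 * of_real pi * \<i> * of_nat n" using k n by (simp add: of_nat_nat)
   thus ?thesis using u12 True n by (intro exI[of _ u2]) auto
  next
   case False
   hence "u2 = u1 + 2 * of_real pi * \<i> * of_nat n" using k n by (simp add: of_nat_nat)
   thus ?thesis using u12 False k0 n by (intro exI[of _ u1]) auto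
  qed
 qed
 define n where "n = nat \<bar>k\<bar>"
 obtain y where y: "Re y < A" "H (y + 2 * of_real pi * \<i> * of_nat n) = H y" "n >= 1"
  using per[OF n_def] by blast
 let ?P = "2 * of_real pi * \<i> * of_nat n"
 have eP: "exp (u + ?P) = exp u" for u
  using exp_plus_2pin[of u "int n"] by (simp add: algebra_simps)
 have H': "lift_on x {u. Re u < A} (%u. a + exp u) (%u. H (u + ?P))"
  unfolding lift_on_def
 proof
  have "(H \<circ> (%u. u + ?P)) holomorphic_on {u. Re u < A}"
   by (rule holomorphic_on_compose_gen[of _ _ H "{u. Re u < A}"]) (use H in "auto simp: lift_on_def intro!: holomorphic_intros")
  thus "(%u. H (u + ?P)) holomorphic_on {u. Re u < A}" by (simp add: o_def)
 qed (use fH eP in simp)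
 have dy: "deriv (f x) (H y) ~= 0"
  by (rule isolated_value_deriv[OF iso _ fH[OF y(1)]]) (use exp_in_ball[OF y(1), of a] in blast)
 have perH: "H (u + ?P) = H u" if "Re u < A" for u
  using lift_on_unique[OF x _ _ H' H, of y u] y dy that
  by (auto simp: open_halfspace_Re_lt intro: convex_connected convex_halfspace_Re_lt)
 have hol: "H holomorphic_on {u. Re u < A}" using H by (simp add: lift_on_def)
 let ?r = "exp (A / n)"
 obtain g where g: "g holomorphic_on ball 0 ?r - {0}" "!!u. Re u < A ==> g (exp (u / of_nat n)) = H u"
 proof (rule periodic_descends[OF hol y(3) perH])
  fix g assume "g holomorphic_on ball 0 ?r - {0}" "!!u. Re u < A ==> g (exp (u / of_nat n)) = H u"
  thus thesis by (rule that)
 qed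
 have gH: "EX u. Re u < A & g t = H u & exp u = t ^ n" if t: "t : ball 0 ?r - {0}" for t
 proof -
  have t': "t ~= 0" "cmod t < ?r" using t by auto
  have "exp (Re (Ln t)) < exp (A / n)" using t' by simp
  hence "Re (of_nat n * Ln t) < A" using y(3) by (simp add: field_simps)
  moreover from g(2)[OF this] have "g t = H (of_nat n * Ln t)" using t' y(3) by simp
  moreover have "exp (of_nat n * Ln t) = t ^ n" using t' by (simp add: exp_of_nat_mult)
  ultimately show ?thesis by blast
 qed
 have bound: "cmod (f x (g t) - a) <= exp A & ~ pole x (g t)" if "t : ball 0 ?r - {0}" for t
 proof -
  obtain u where "Re u < A" "g t = H u" using gH[OF \<open>t : ball 0 ?r - {0}\<close>] by blast
  thus ?thesis using fH[of u] by simp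
 qed
 obtain p where p: "pole x p" using inf not_finite_existsD by blast
 \<comment> \<open>The lift stays where |f x| < |a| + exp A, which excludes a whole neighbourhood of
   the pole \<open>p\<close>.\<close>
 let ?B = "cmod a + exp A + 1"
 have "ALL r>0. \<forall>\<^sub>F z in at p. r <= cmod (f x z)"
  using p unfolding is_pole_def filterlim_at_infinity[OF order_refl] by blast
 moreover have "?B > 0" by (intro add_nonneg_pos add_nonneg_nonneg) auto
 ultimately have "\<forall>\<^sub>F z in at p. ?B <= cmod (f x z)" by blast
 then obtain d where d: "d > 0" "!!z. z ~= p ==> dist z p < d ==> ?B <= cmod (f x z)"
  unfolding eventually_at by blast
 have far: "g t ~= p & cmod (g t - p) >= d" if t: "t : ball 0 ?r - {0}" for t
 proof
  show "g t ~= p" using bound[OF t] p by auto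
  show "cmod (g t - p) >= d"
  proof (rule ccontr)
   assume "~ cmod (g t - p) >= d"
   hence "?B <= cmod (f x (g t))" using d(2)[of "g t"] \<open>g t ~= p\<close> by (simp add: dist_norm)
   moreover have "cmod (f x (g t)) <= cmod (f x (g t) - a) + cmod a" using norm_triangle_ineq[of "f x (g t) - a" a] by simp
   ultimately show False using bound[OF t] by simp
  qed
 qed
 \<comment> \<open>Bounded, hence with a removable singularity at 0: \<open>g\<close> has a finite
   limit there or a pole, according to \<open>G 0\<close>.\<close>
 have "(%t. inverse (g t - p)) holomorphic_on ball 0 ?r - {0}"
  using far by (intro holomorphic_intros g(1)) auto
 moreover have "\<forall>\<^sub>F t in at 0. cmod (inverse (g t - p)) <= inverse d"
 proof -
  have "\<forall>\<^sub>F t in at 0. t : ball 0 ?r - {0}" unfolding eventually_at by (intro exI[of _ ?r]) (auto simp: dist_commute)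
  thus ?thesis
  proof eventually_elim
   case (elim t)
   thus ?case using far[of t] d(1) by (simp add: norm_inverse le_imp_inverse_le del: inverse_inverse_eq)
  qed
 qed
 ultimately obtain G where G: "G holomorphic_on ball 0 ?r" "!!t. t : ball 0 ?r - {0} ==> G t = inverse (g t - p)"
  using holomorphic_on_extend_bounded[of "%t. inverse (g t - p)" "ball 0 ?r" 0] by auto
 have Gc: "isCont G 0" by (rule holomorphic_isCont[OF G(1)]) auto
 have gt: "g t = p + inverse (G t)" if "t : ball 0 ?r - {0}" for t using G(2)[OF that] by simp
 show False
 proof (cases "G 0 = 0")
  case False
  have n0: "((%t::real. exp ((Re y - t) / n)) ---> 0) at_top" using y(3) by real_asymp
  have n1: "cmod (exp ((y - of_real t) / of_nat n)) = exp ((Re y - t) / n)" for t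
   using Re_divide_of_nat[of "y - of_real t" n] by simp
  have "((%t. exp ((y - of_real t) / of_nat n)) ---> 0) at_top"
   by (rule tendsto_norm_zero_cancel) (use n0 n1 in simp)
  hence "((%t. G (exp ((y - of_real t) / of_nat n))) ---> G 0) at_top"
   by (rule isCont_tendsto_compose[OF Gc])
  hence "((%t. p + inverse (G (exp ((y - of_real t) / of_nat n)))) ---> p + inverse (G 0)) at_top"
   using False by (intro tendsto_intros)
  hence "((%t. H (y - of_real t)) ---> p + inverse (G 0)) at_top"
  proof (rule Lim_transform_eventually)
   show "\<forall>\<^sub>F t in at_top. p + inverse (G (exp ((y - of_real t) / of_nat n))) = H (y - of_real t)"
    using eventually_ge_at_top[of 0]
   proof eventually_elim
    case (elim t)
    have Ret: "Re (y - of_real t) < A" using elim y(1) by simp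
    have "cmod (exp ((y - of_real t) / of_nat n)) < ?r"
     using Ret y(3) Re_divide_of_nat[of "y - of_real t" n] by (simp add: divide_strict_right_mono)
    hence "g (exp ((y - of_real t) / of_nat n)) = p + inverse (G (exp ((y - of_real t) / of_nat n)))"
     by (intro gt) simp
    thus ?case using g(2)[OF Ret] by simp
   qed
  qed
  thus False using nofin y(1) by blast
 next
  case True
  have r0: "?r / 2 : {0<..<?r}" by simp
  have nc: "~ G constant_on ball 0 ?r"
  proof
   assume "G constant_on ball 0 ?r"
   then obtain c where c: "!!t. t : ball 0 ?r ==> G t = c" unfolding constant_on_def by blast
   have "of_real (?r/2) : ball (0::complex) ?r - {0}" by simp
   hence "G (of_real (?r/2)) ~= 0" using G(2) far by fastforce
   moreover have "G (of_real (?r/2)) = c" "G 0 = c" by (intro c, simp)+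
   ultimately show False using True by simp
  qed
  have "open (G ` ball 0 ?r)" by (rule open_mapping_thm[OF G(1) open_ball _ open_ball order_refl nc]) auto
  moreover have "0 : G ` ball 0 ?r" using True by (intro image_eqI[of _ _ 0]) auto
  \<comment> \<open>\<open>G\<close> covers a disc about 0, so \<open>g\<close> takes all values far
    from \<open>p\<close>. Among these is another pole of \<open>f x\<close>, at which a lift can
    have no value.\<close>
  ultimately obtain eps where eps: "eps > 0" "ball 0 eps <= G ` ball 0 ?r" by (meson open_contains_ball)
  obtain p' where p': "pole x p'" "cmod p' > cmod p + 1 / eps" by (rule poles_unbounded[OF x inf])
  have big: "cmod (p' - p) > 1 / eps" using p'(2) norm_triangle_ineq[of "p' - p" p] by simp
  hence ne: "p' ~= p" using eps(1) by (auto simp: divide_less_0_iff)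
  have "1 < eps * cmod (p' - p)" using big eps(1) by (simp add: field_simps)
  hence "inverse (cmod (p' - p)) < eps" using ne by (simp add: field_simps)
  hence "inverse (p' - p) : ball 0 eps" by (simp add: norm_inverse)
  then obtain t where t: "t : ball 0 ?r" "G t = inverse (p' - p)" using eps(2) by (metis (no_types, lifting) imageE subsetD)
  hence t0: "t : ball 0 ?r - {0}" using True ne by auto
  hence "g t = p'" using gt[OF t0] t(2) by simp
  thus False using bound[OF t0] p'(1) by simp
 qed
qed

end

section \<open>Tracts over a slice\<close>

text \<open>The two moving poles are the omitted values in the Montel and Schottky arguments, the
  infinitely many poles force lifts to be univalent, and \<open>control\<close> transfers passivity
  from \<open>v\<close> to the singular values that are not dynamically fixed.\<close>

locale natural_slice = meromorphic_family +
 fixes N :: nat and s :: "nat => complex => complex" and v :: "complex => complex" and F :: "nat set"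
 assumes connected_params: "connected \<Lambda>"
  and s_holomorphic: "i : {1..<N} ==> s i holomorphic_on \<Lambda>"
  and v_holomorphic: "v holomorphic_on \<Lambda>"
  and free_asymptotic: "x : \<Lambda> ==> Some (v x) : asymptotic_values (f x)"
  and asymptotic_cases: "x : \<Lambda> ==> Some w : asymptotic_values (f x) ==> w = v x | (EX i:{1..<N}. w = s i x)"
  and s_ne_v: "x : \<Lambda> ==> i : {1..<N} ==> s i x ~= v x"
  and critical_cases: "x : \<Lambda> ==> ~ is_pole (f x) z ==> deriv (f x) z = 0 ==> EX i:F. f x z = s i x"
  and F_subset: "F <= {1..<N}"
  and F_cycles: "i : F ==> EX k \<mu>. (cmod \<mu> < 1 | (EX n>=1. \<mu> ^ n = 1)) &
    (ALL x:\<Lambda>. EX C. has_multiplier (f x) k C \<mu> & s i x : basin (f x) C)"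
  and pole_functions: "EX \<pi>0 \<pi>1. \<pi>0 holomorphic_on \<Lambda> & \<pi>1 holomorphic_on \<Lambda> &
    (ALL x:\<Lambda>. is_pole (f x) (\<pi>0 x) & is_pole (f x) (\<pi>1 x) & \<pi>0 x ~= \<pi>1 x)"
  and infinite_poles: "x : \<Lambda> ==> infinite {z. is_pole (f x) z}"
  and control: "j : {1..<N} - F ==> activity_locus \<Lambda> f (s j) <= activity_locus \<Lambda> f v"
  and active: "activity_locus \<Lambda> f v ~= {}"
begin

lemma v_isCont: "x : \<Lambda> ==> isCont v x"
 by (rule holomorphic_isCont[OF v_holomorphic open_params])

lemma s_isCont: "x : \<Lambda> ==> i : {1..<N} ==> isCont (s i) x"
 using holomorphic_isCont[OF s_holomorphic open_params] by blast

lemma unramifiedI: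
 assumes "x : \<Lambda>" "w ~= v x" "!!i. i : {1..<N} ==> w ~= s i x"
 shows "unramified x w"
 unfolding unramified_def
proof (intro conjI allI impI)
 show "Some w ~: asymptotic_values (f x)" using asymptotic_cases[OF assms(1)] assms(2,3) by blast
 fix zt assume "~ pole x zt & f x zt = w"
 thus "deriv (f x) zt ~= 0" using critical_cases[OF assms(1)] assms(3) F_subset by blast
qed

lemma v_not_critical:
 assumes "x : \<Lambda>" "~ pole x zt" "f x zt = v x"
 shows "deriv (f x) zt ~= 0"
proof
 assume "deriv (f x) zt = 0"
 then obtain i where "i : F" "f x zt = s i x" using critical_cases[OF assms(1,2)] by blast
 thus False using s_ne_v[OF assms(1), of i] F_subset assms(3) by auto
qed

lemma isolated_near:
 assumes x1: "x1 : \<Lambda>"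
 obtains rh A where "0 < rh" "ball x1 rh <= \<Lambda>" "!!x. x : ball x1 rh ==> isolated_value x (v x) A"
proof -
 define dl where "dl = Min (insert 1 ((%i. dist (s i x1) (v x1)) ` {1..<N})) / 2"
 have "Min (insert 1 ((%i. dist (s i x1) (v x1)) ` {1..<N})) > 0"
  using s_ne_v[OF x1] by (subst Min_gr_iff) auto
 hence dl: "dl > 0" by (simp add: dl_def)
 have le: "2 * dl <= dist (s i x1) (v x1)" if "i : {1..<N}" for i
 proof -
  have "Min (insert 1 ((%i. dist (s i x1) (v x1)) ` {1..<N})) <= dist (s i x1) (v x1)"
   by (rule Min_le) (use that in auto)
  thus ?thesis by (simp add: dl_def)
 qed
 have "\<forall>\<^sub>F x in nhds x1. ALL i:{1..<N}. dl < dist (s i x) (v x)"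
 proof (intro eventually_ball_finite ballI)
  fix i assume i: "i : {1..<N}"
  have "((%x. dist (s i x) (v x)) ---> dist (s i x1) (v x1)) (nhds x1)"
   using s_isCont[OF x1 i] v_isCont[OF x1]
   by (intro tendsto_dist) (simp_all add: isCont_def tendsto_at_iff_tendsto_nhds)
  moreover have "dl < dist (s i x1) (v x1)" using le[OF i] dl by simp
  ultimately show "\<forall>\<^sub>F x in nhds x1. dl < dist (s i x) (v x)" by (rule order_tendstoD(1))
 qed auto
 moreover have "\<forall>\<^sub>F x in nhds x1. x : \<Lambda>" using open_params x1 eventually_nhds by blast
 ultimately have "\<forall>\<^sub>F x in nhds x1. x : \<Lambda> & (ALL i:{1..<N}. dl < dist (s i x) (v x))" by eventually_elim blast
 then obtain rh where rh: "rh > 0" "!!x. dist x x1 < rh ==> x : \<Lambda> & (ALL i:{1..<N}. dl < dist (s i x) (v x))"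
  unfolding eventually_nhds_metric by blast
 show ?thesis
 proof (rule that[OF rh(1), of "ln dl"])
  show "ball x1 rh <= \<Lambda>" using rh(2) by (auto simp: dist_commute)
  fix x assume "x : ball x1 rh"
  hence x: "x : \<Lambda>" "!!i. i : {1..<N} ==> dl < dist (s i x) (v x)" using rh(2)[of x] by (auto simp: dist_commute)
  show "isolated_value x (v x) (ln dl)"
   unfolding isolated_value_def
  proof (intro conjI ballI allI impI)
   fix w assume w: "w : ball (v x) (exp (ln dl)) - {v x}"
   hence wd: "dist (v x) w < dl" "w ~= v x" using dl by auto
   show "unramified x w"
   proof (rule unramifiedI[OF x(1) wd(2)])
    fix i assume "i : {1..<N}"
    thus "w ~= s i x" using x(2)[of i] wd(1) by (auto simp: dist_commute)
   qed
  qed (use v_not_critical[OF x(1)] in auto)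
 qed
qed

text \<open>The lift starts on a late point of an asymptotic path. Were it not univalent, it would
  come from an inverse branch about \<open>v x\<close>, and that branch would bring the path to a
  finite limit.\<close>

lemma tract_at_parameter:
 assumes x: "x : \<Lambda>" and iso: "isolated_value x (v x) A"
 obtains H u0 where "Re u0 < A" "lift_on x {u. Re u < A} (%u. v x + exp u) H" "inj_on H {u. Re u < A}"
proof -
 obtain gm :: "real => complex" where gm: "continuous_on {0..} gm" "filterlim gm at_infinity at_top"
   "((%t. stereo (sph (f x) (gm t))) ---> stereo (Some (v x))) at_top"
  using free_asymptotic[OF x] unfolding asymptotic_values_def by blast
 have np: "\<forall>\<^sub>F t in at_top. ~ pole x (gm t)"
  using stereo_tendsto_Some(1)[OF gm(3)] by eventually_elim (auto simp: sph_def)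
 have lim: "((%t. f x (gm t)) ---> v x) at_top"
  by (rule Lim_transform_eventually[OF stereo_tendsto_Some(2)[OF gm(3)]]) (use np in eventually_elim, simp add: sph_def)
 have "\<forall>\<^sub>F t in at_top. t >= 0 & ~ pole x (gm t) & dist (f x (gm t)) (v x) < exp A"
  using eventually_conj[OF eventually_conj[OF np tendstoD[OF lim, of "exp A"]] eventually_ge_at_top[of 0]]
  by (auto elim!: eventually_mono)
 then obtain T where T: "!!t. t >= T ==> t >= 0 & ~ pole x (gm t) & dist (f x (gm t)) (v x) < exp A"
  unfolding eventually_at_top_linorder by blast
 have Tnp: "~ pole x (gm t)" and Tb: "f x (gm t) : ball (v x) (exp A)" and T0: "t >= 0" if "t >= T" for t
  using T[OF that] by (auto simp: dist_commute)
 have cgm: "continuous_on {T..} gm" by (rule continuous_on_subset[OF gm(1)]) (use T0 in auto)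
 have cfgm: "continuous_on {T..} (%t. f x (gm t))"
  by (rule continuous_on_compose2[OF _ cgm, of "{z. ~ pole x z}"])
   (use Tnp in "auto intro!: holomorphic_on_imp_continuous_on holomorphic_off_poles[OF x]")
 \<comment> \<open>An inverse branch \<open>G\<close> on the full disc that agrees with the path
   once agrees with it at all later times, by connectedness; the path would then converge to
   \<open>G (v x)\<close> instead of infinity.\<close>
 have noG: False if G: "lift_on x (ball (v x) (exp A)) (%w. w) G" "G (f x (gm T)) = gm T" for G
 proof -
  have Gc: "continuous_on (ball (v x) (exp A)) G" using G(1) by (auto simp: lift_on_def intro: holomorphic_on_imp_continuous_on)
  have cG: "continuous_on {T..} (%t. G (f x (gm t)))"
   by (rule continuous_on_compose2[OF Gc cfgm]) (use Tb in auto)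
  have eqG: "gm t = G (f x (gm t))" if t: "t >= T" for t
  proof (rule connected_induction_simple[where S = "{T..}" and P = "%t. gm t = G (f x (gm t))" and a = T and b = t])
   show "connected {T..}" by simp
   fix a assume a: "a : {T..}"
   have fG: "~ pole x (G (f x (gm a)))" "f x (G (f x (gm a))) = f x (gm a)"
    using G(1) Tb[of a] a unfolding lift_on_def by auto
   have d: "deriv (f x) (G (f x (gm a))) ~= 0" by (rule isolated_value_deriv[OF iso Tb fG]) (use a in auto)
   obtain e where e: "0 < e" "inj_on (f x) (ball (G (f x (gm a))) e)"
    by (rule local_inverse[OF x fG(1) d, of 1]) auto
   show "EX U. openin (top_of_set {T..}) U & a : U & (ALL r:U. ALL t:U. gm r = G (f x (gm r)) --> gm t = G (f x (gm t)))"
   proof (cases "gm a = G (f x (gm a))")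
    case True
    let ?U = "({T..} \<inter> gm -` ball (gm a) e) \<inter> ({T..} \<inter> (%t. G (f x (gm t))) -` ball (gm a) e)"
    have "openin (top_of_set {T..}) ?U"
     by (intro openin_Int continuous_openin_preimage_gen cgm cG open_ball)
    moreover have "a : ?U" using a e(1) True by auto
    moreover have "gm t = G (f x (gm t))" if "t : ?U" for t
    proof (rule inj_onD[OF e(2)])
     show "f x (gm t) = f x (G (f x (gm t)))" using G(1) Tb[of t] that unfolding lift_on_def by auto
    qed (use that True in auto)
    ultimately show ?thesis by blast
   next
    case False
    let ?U = "{T..} \<inter> (%t. gm t - G (f x (gm t))) -` (- {0})"
    have "openin (top_of_set {T..}) ?U"
     by (intro continuous_openin_preimage_gen continuous_on_diff cgm cG) auto
    thus ?thesis using a False by (intro exI[of _ ?U]) auto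
   qed
  qed (use t G(2) in auto)
  have "\<forall>\<^sub>F t in at_top. G (f x (gm t)) = gm t" using eventually_ge_at_top[of T] by eventually_elim (use eqG in simp)
  moreover have "isCont G (v x)" using G(1) by (intro holomorphic_isCont[of G "ball (v x) (exp A)"]) (auto simp: lift_on_def)
  hence "((%t. G (f x (gm t))) ---> G (v x)) at_top" using lim by (rule isCont_tendsto_compose)
  ultimately have "(gm ---> G (v x)) at_top" by (rule Lim_transform_eventually[rotated])
  thus False using gm(2) not_tendsto_and_filterlim_at_infinity[OF trivial_limit_at_top_linorder] by blast
 qed
 have dT: "deriv (f x) (gm T) ~= 0" by (rule isolated_value_deriv[OF iso Tb Tnp refl]) auto
 have ne: "f x (gm T) ~= v x"
 proof
  assume eq: "f x (gm T) = v x"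
  obtain G where "lift_on x (ball (v x) (exp A)) (%w. w) G" "G (v x) = gm T"
   by (rule lift_ball[OF x, of "exp A" "%w. w" "v x" "gm T"])
    (use iso Tnp[of T] eq dT in "auto simp: isolated_value_def")
  thus False using noG eq by simp
 qed
 define u0 where "u0 = Ln (f x (gm T) - v x)"
 have eu0: "v x + exp u0 = f x (gm T)" using ne by (simp add: u0_def)
 have "exp (Re u0) = cmod (f x (gm T) - v x)" using ne by (simp add: u0_def)
 also have "... < exp A" using Tb[of T] by (simp add: dist_norm norm_minus_commute)
 finally have u0: "Re u0 < A" by simp
 obtain H where H: "lift_on x {u. Re u < A} (%u. v x + exp u) H" "H u0 = gm T"
 proof (rule lift_halfplane[OF x _ u0 Tnp])
  show "(%u. v x + exp u) holomorphic_on {u. Re u < A}" by (intro holomorphic_intros)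
  show "unramified x (v x + exp u)" if "Re u < A" for u
   using iso exp_in_ball[OF that, of "v x"] unfolding isolated_value_def by blast
 qed (use eu0 dT in auto)
 have "inj_on H {u. Re u < A}"
 proof (rule tract_injective[OF x iso infinite_poles[OF x] H(1)])
  fix u zt assume u: "Re u < A"
  show "~ ((%t. H (u - of_real t)) ---> zt) at_top"
  proof
   assume l: "((%t. H (u - of_real t)) ---> zt) at_top"
   obtain G where G: "lift_on x (ball (v x) (exp A)) (%w. w) G" "!!u. Re u < A ==> H u = G (v x + exp u)"
    by (rule tract_finite_end[OF x iso H(1) u l]) blast
   show False using noG[OF G(1)] G(2)[OF u0] H(2) eu0 by simp
  qed
 qed
 thus ?thesis using that[OF u0 H(1)] by blast
qed

end

context meromorphic_family
begin

section \<open>Dependence of the lifts on the parameter\<close>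

text \<open>Nearby equations have solutions close to \<open>z2\<close>; a solution known to lie in a
  set of injectivity must be that one.\<close>

lemma solution_tendsto:
 assumes x2: "x2 : \<Lambda>" "~ pole x2 z2" "deriv (f x2) z2 ~= 0" and W: "open W" "z2 : W"
  and X: "(X ---> x2) G" and w: "(w ---> f x2 z2) G"
  and ev: "\<forall>\<^sub>F p in G. Z p : W & inj_on (f (X p)) W & f (X p) (Z p) = w p"
 shows "(Z ---> z2) G"
proof (rule tendstoI)
 fix eps :: real assume eps: "eps > 0"
 obtain r where r: "r > 0" "ball z2 r <= W" using W open_contains_ball by blast
 obtain dl where dl: "0 < dl" "!!x w. x : ball x2 dl ==> w : ball (f x2 z2) dl ==>
   EX z:ball z2 (min r eps). ~ pole x z & f x z = w"
  by (rule local_solution[OF x2, of "min r eps"]) (use r eps in auto)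
 have "\<forall>\<^sub>F p in G. dist (X p) x2 < dl" "\<forall>\<^sub>F p in G. dist (w p) (f x2 z2) < dl"
  using tendstoD[OF X dl(1)] tendstoD[OF w dl(1)] by auto
 thus "\<forall>\<^sub>F p in G. dist (Z p) z2 < eps"
  using ev
 proof eventually_elim
  case (elim p)
  hence "EX z:ball z2 (min r eps). ~ pole (X p) z & f (X p) z = w p"
   by (intro dl(2)) (auto simp: dist_commute)
  then obtain z where z: "z : ball z2 (min r eps)" "f (X p) z = w p" by blast
  hence "z : W" using r(2) by auto
  hence "Z p = z" using inj_onD[of "f (X p)" W "Z p" z] elim z(2) by simp
  thus ?case using z(1) by (simp add: dist_commute)
 qed
qed

lemma inverse_on_injective_ball:
 assumes x: "x : \<Lambda>" and inj: "inj_on (f x) (ball zt e)" and np: "!!z. z : ball zt e ==> ~ pole x z"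
  and h: "h holomorphic_on S" "!!u. u : S ==> h u : f x ` ball zt e"
 obtains L where "lift_on x S h L" "L ` S <= ball zt e"
proof -
 have hol: "f x holomorphic_on ball zt e" by (rule holomorphic_off_poles[OF x np])
 obtain g where g: "g holomorphic_on f x ` ball zt e" "!!z. z : ball zt e ==> g (f x z) = z"
  by (rule holomorphic_has_inverse[OF hol open_ball inj]) blast
 have g': "g w : ball zt e & f x (g w) = w" if "w : f x ` ball zt e" for w
  using that g(2) by auto
 have "(g \<circ> h) holomorphic_on S" by (rule holomorphic_on_compose_gen[OF h(1) g(1)]) (use h(2) in auto)
 hence "lift_on x S h (g \<circ> h)" unfolding lift_on_def using g' h(2) np by auto
 moreover have "(g \<circ> h) ` S <= ball zt e" using g' h(2) by auto
 ultimately show ?thesis by (rule that)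
qed

end

text \<open>The lifts are chosen for each parameter separately, so nothing is assumed about their
  dependence on \<open>x\<close>; continuity at one point \<open>u0\<close> will propagate through
  the half-plane.\<close>

locale lift_family = meromorphic_family +
 fixes v :: "complex => complex" and B :: "complex set" and A :: real and H :: "complex => complex => complex"
 assumes B: "open B" "B <= \<Lambda>" and v_hol: "v holomorphic_on B"
  and iso: "!!x. x : B ==> isolated_value x (v x) A"
  and lift: "!!x. x : B ==> lift_on x {u. Re u < A} (%u. v x + exp u) (H x)"
begin

definition jointly_continuous_at :: "complex => complex => bool" where
 "jointly_continuous_at x u \<longleftrightarrow> ((%p. H (fst p) (snd p)) ---> H x u) (nhds (x, u))"

definition parameter_continuous_at :: "complex => complex => bool" where
 "parameter_continuous_at x u \<longleftrightarrow> ((%y. H y u) ---> H x u) (nhds x)"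

lemma params: "x : B ==> x : \<Lambda>"
 using B by blast

lemma liftD: "x : B ==> Re u < A ==> ~ pole x (H x u) & f x (H x u) = v x + exp u"
 using lift[of x] by (simp add: lift_on_def)

lemma lift_deriv: "x : B ==> Re u < A ==> deriv (f x) (H x u) ~= 0"
 using isolated_value_deriv[OF iso, of x "v x + exp u" "H x u"] liftD[of x u] exp_in_ball[of u A "v x"] by auto

lemma target_tendsto:
 assumes "x : B"
 shows "((%p. v (fst p) + exp (snd p)) ---> v x + exp u) (nhds (x, u))"
proof -
 have v: "(v ---> v x) (nhds x)"
  using holomorphic_isCont[OF v_hol B(1) assms] by (simp add: isCont_def tendsto_at_iff_tendsto_nhds)
 have "((%p. fst p) ---> x) (nhds (x, u))" "((%p. snd p) ---> u) (nhds (x, u))"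
  using tendsto_fst[OF filterlim_ident[of "nhds (x, u)"]] tendsto_snd[OF filterlim_ident[of "nhds (x, u)"]] by auto
 thus ?thesis by (intro tendsto_add tendsto_exp filterlim_compose[OF v])
qed

lemma joint_imp_parameter: "jointly_continuous_at x u ==> parameter_continuous_at x u"
 unfolding jointly_continuous_at_def parameter_continuous_at_def
proof -
 assume a: "((%p. H (fst p) (snd p)) ---> H x u) (nhds (x, u))"
 have "((%y. (y, u)) ---> (x, u)) (nhds x)" by (intro tendsto_Pair) (auto intro: filterlim_ident)
 from filterlim_compose[OF a this] show "((%y. H y u) ---> H x u) (nhds x)" by simp
qed

text \<open>For parameters near \<open>x2\<close> there is an inverse branch into one fixed ball
  over all of v x + exp u with u near \<open>us\<close>. If the lift enters the ball at a single
  \<open>u'\<close>, it coincides with this branch on the whole disc.\<close>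

lemma joint_continuity_spreads:
 assumes x2: "x2 : B" and us: "Re us < A"
 obtains d where "0 < d" "ball us d <= {u. Re u < A}"
  "!!u' u. u' : ball us d ==> u : ball us d ==> parameter_continuous_at x2 u' ==> jointly_continuous_at x2 u"
proof -
 let ?P = "{u. Re u < A}"
 let ?zt = "H x2 us"
 have P: "open ?P" by (simp add: open_halfspace_Re_lt)
 have x2L: "x2 : \<Lambda>" by (rule params[OF x2])
 have z: "~ pole x2 ?zt" "f x2 ?zt = v x2 + exp us" "deriv (f x2) ?zt ~= 0"
  using liftD[OF x2 us] lift_deriv[OF x2 us] by auto
 obtain e where e: "chart f x2 ?zt e" "!!x z. x : ball x2 e ==> z : ball ?zt e ==> ~ pole x z"
  "!!x. x : ball x2 e ==> inj_on (f x) (ball ?zt e)"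
  by (rule local_injectivity[OF x2L z(1,3)]) blast
 have e0: "e > 0" using e(1) by (simp add: chart_def)
 obtain dl where dl: "0 < dl" "!!x w. x : ball x2 dl ==> w : ball (f x2 ?zt) dl ==>
   EX z:ball ?zt e. ~ pole x z & f x z = w"
  by (rule local_solution[OF x2L z(1,3) e0]) blast
 have "\<forall>\<^sub>F p in nhds (x2, us). dist (v (fst p) + exp (snd p)) (v x2 + exp us) < dl"
  by (rule tendstoD[OF target_tendsto[OF x2] dl(1)])
 then obtain Px Pu where PP: "\<forall>\<^sub>F x in nhds x2. Px x" "\<forall>\<^sub>F u in nhds us. Pu u"
   "!!x u. Px x ==> Pu u ==> dist (v x + exp u) (v x2 + exp us) < dl"
  unfolding nhds_prod eventually_prod_filter by auto
 have "isCont (H x2) us"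
  using lift[OF x2] us P by (intro holomorphic_isCont[of _ ?P]) (auto simp: lift_on_def)
 hence "\<forall>\<^sub>F u in nhds us. dist (H x2 u) ?zt < e"
  using e0 by (auto simp: isCont_def tendsto_at_iff_tendsto_nhds dest: tendstoD)
 moreover have "\<forall>\<^sub>F u in nhds us. u : ?P" using P us eventually_nhds by blast
 ultimately have "\<forall>\<^sub>F u in nhds us. dist (H x2 u) ?zt < e & u : ?P & Pu u" using PP(2) by eventually_elim auto
 then obtain d where d: "d > 0" "!!u. dist u us < d ==> dist (H x2 u) ?zt < e & u : ?P & Pu u"
  unfolding eventually_nhds_metric by blast
 have near: "\<forall>\<^sub>F x in nhds x2. Px x & x : ball x2 e & x : ball x2 dl & x : B"
  using PP(1) eventually_nhds_in_open[OF open_ball, of x2 x2 e] eventually_nhds_in_open[OF open_ball, of x2 x2 dl]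
   eventually_nhds_in_open[OF B(1) x2] e0 dl(1)
  by (auto intro!: eventually_conj)
 show ?thesis
 proof (rule that[OF d(1)])
  show sub: "ball us d <= ?P" using d(2) by (auto simp: dist_commute)
  fix u' u assume u': "u' : ball us d" and u: "u : ball us d" and Q: "parameter_continuous_at x2 u'"
  have "H x2 u' : ball ?zt e" using d(2)[of u'] u' by (simp add: dist_commute)
  hence "\<forall>\<^sub>F x in nhds x2. H x u' : ball ?zt e"
   using Q unfolding parameter_continuous_at_def by (auto dest: topological_tendstoD[OF _ open_ball])
  with near have EV: "\<forall>\<^sub>F x in nhds x2. (ALL y:ball us d. H x y : ball ?zt e) & inj_on (f x) (ball ?zt e) & x : B"
  proof eventually_elim
   case (elim x)
   hence xB: "x : B" and xe: "x : ball x2 e" by auto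
   have xL: "x : \<Lambda>" by (rule params[OF xB])
   obtain L where L: "lift_on x (ball us d) (%u. v x + exp u) L" "L ` ball us d <= ball ?zt e"
   proof (rule inverse_on_injective_ball[OF xL e(3)[OF xe] e(2)[OF xe], of "%u. v x + exp u" "ball us d"])
    show "(%u. v x + exp u) holomorphic_on ball us d" by (intro holomorphic_intros)
    fix y assume "y : ball us d"
    hence "dist (v x + exp y) (v x2 + exp us) < dl" using PP(3)[of x y] elim d(2)[of y] by (simp add: dist_commute)
    hence "v x + exp y : ball (f x2 ?zt) dl" using z(2) by (simp add: dist_commute)
    hence "EX z:ball ?zt e. ~ pole x z & f x z = v x + exp y" using dl(2)[of x "v x + exp y"] elim by simp
    thus "v x + exp y : f x ` ball ?zt e" by (metis image_eqI)
   qed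
   have "Re u' < A" using sub u' by auto
   have eq: "H x u' = L u'"
   proof (rule inj_onD[OF e(3)[OF xe]])
    show "f x (H x u') = f x (L u')" using liftD[OF xB \<open>Re u' < A\<close>] L(1) u' by (simp add: lift_on_def)
    show "L u' : ball ?zt e" using L(2) u' by blast
   qed (use elim in auto)
   have "H x y = L y" if "y : ball us d" for y
    by (rule lift_on_unique[OF xL open_ball _ lift_on_subset[OF lift[OF xB] sub] L(1) u' eq lift_deriv[OF xB \<open>Re u' < A\<close>] that]) simp
   hence "ALL y:ball us d. H x y : ball ?zt e" using L(2) by (metis image_subset_iff)
   thus ?case using xB e(3)[OF xe] by blast
  qed
  have uA: "Re u < A" using sub u by auto
  have fu: "f x2 (H x2 u) = v x2 + exp u" using liftD[OF x2 uA] by simp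
  have fst_lim: "((%p. fst p) ---> x2) (nhds (x2, u))"
   using tendsto_fst[OF filterlim_ident[of "nhds (x2, u)"]] by simp
  have snd_lim: "((%p. snd p) ---> u) (nhds (x2, u))"
   using tendsto_snd[OF filterlim_ident[of "nhds (x2, u)"]] by simp
  show "jointly_continuous_at x2 u"
   unfolding jointly_continuous_at_def
  proof (rule solution_tendsto[OF x2L _ _ open_ball[of ?zt e] _ fst_lim])
   show "~ pole x2 (H x2 u)" using liftD[OF x2 uA] by simp
   show "deriv (f x2) (H x2 u) ~= 0" by (rule lift_deriv[OF x2 uA])
   show "H x2 u : ball ?zt e" using d(2)[of u] u by (simp add: dist_commute)
   show "((%p. v (fst p) + exp (snd p)) ---> f x2 (H x2 u)) (nhds (x2, u))"
    unfolding fu by (rule target_tendsto[OF x2])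
   have "\<forall>\<^sub>F p in nhds (x2, u). snd p : ball us d" by (rule topological_tendstoD[OF snd_lim open_ball u])
   moreover have "\<forall>\<^sub>F p in nhds (x2, u). (ALL y:ball us d. H (fst p) y : ball ?zt e) & inj_on (f (fst p)) (ball ?zt e) & fst p : B"
    by (rule eventually_compose_filterlim[OF EV fst_lim])
   ultimately show "\<forall>\<^sub>F p in nhds (x2, u). H (fst p) (snd p) : ball ?zt e & inj_on (f (fst p)) (ball ?zt e) &
     f (fst p) (H (fst p) (snd p)) = v (fst p) + exp (snd p)"
   proof eventually_elim
    case (elim p)
    hence "Re (snd p) < A" using sub by auto
    thus ?case using elim liftD[of "fst p" "snd p"] by auto
   qed
  qed
 qed
qed

lemma joint_continuity:
 assumes x2: "x2 : B" and u0: "Re u0 < A" "parameter_continuous_at x2 u0" and u: "Re u < A"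
 shows "jointly_continuous_at x2 u"
proof -
 have "parameter_continuous_at x2 u"
 proof (rule connected_induction_simple[where S = "{u. Re u < A}" and P = "parameter_continuous_at x2" and a = u0 and b = u])
  show "connected {u. Re u < A}" by (intro convex_connected convex_halfspace_Re_lt)
  fix us assume "us : {u. Re u < A}"
  hence us: "Re us < A" by simp
  obtain d where d: "0 < d" "ball us d <= {u. Re u < A}"
   "!!u' u. u' : ball us d ==> u : ball us d ==> parameter_continuous_at x2 u' ==> jointly_continuous_at x2 u"
   by (rule joint_continuity_spreads[OF x2 us]) blast
  show "EX T. openin (top_of_set {u. Re u < A}) T & us : T &
     (ALL x:T. ALL y:T. parameter_continuous_at x2 x --> parameter_continuous_at x2 y)"
  proof (intro exI conjI ballI impI)
   show "openin (top_of_set {u. Re u < A}) (ball us d)" using d(2) by (simp add: openin_open_eq open_halfspace_Re_lt)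
   show "us : ball us d" using d(1) by simp
   show "parameter_continuous_at x2 y" if "x : ball us d" "y : ball us d" "parameter_continuous_at x2 x" for x y
    by (rule joint_imp_parameter[OF d(3)[OF that]])
  qed
 qed (use u0 u in simp_all)
 moreover obtain d where d: "0 < d"
  "!!u' y. u' : ball u d ==> y : ball u d ==> parameter_continuous_at x2 u' ==> jointly_continuous_at x2 y"
  by (rule joint_continuity_spreads[OF x2 u]) blast
 ultimately show ?thesis using d(1) d(2)[of u u] by simp
qed

lemma parameter_holomorphic:
 assumes "!!x. x : B ==> parameter_continuous_at x u" "Re u < A"
 shows "(%x. H x u) holomorphic_on B"
proof (rule continuous_solution_holomorphic[OF B])
 show "continuous_on B (%x. H x u)"
  using assms(1) unfolding continuous_on_eq_continuous_at[OF B(1)] parameter_continuous_at_def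
  by (auto simp: isCont_def tendsto_at_iff_tendsto_nhds[of "%x. H x u"])
 show "(%x. v x + exp u) holomorphic_on B" by (intro holomorphic_intros v_hol)
qed (use liftD lift_deriv assms(2) in auto)

text \<open>Otherwise points H x u with u tending to infinity would accumulate at a finite
  \<open>zt\<close>, with exp u tending to some \<open>E\<close>. Uniform injectivity of the maps
  near \<open>zt\<close> then makes the lift take the same value at distinct points, or bounds u, in
  both cases against univalence.\<close>

lemma escapes:
 assumes inj: "!!x. x : B ==> inj_on (H x) {u. Re u < A}"
  and cont: "!!x u. x : B ==> Re u < A ==> parameter_continuous_at x u"
  and K: "compact K" "K <= B"
 shows "EX M. ALL x:K. ALL u. Re u <= A - 1 & cmod u > M --> cmod (H x u) > R"
proof (rule ccontr)
 assume "~ ?thesis"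
 hence "ALL n::nat. EX x u. x : K & Re u <= A - 1 & cmod u > real n & cmod (H x u) <= R"
  by (meson not_less)
 then obtain X U where XU0: "!!n::nat. X n : K & Re (U n) <= A - 1 & cmod (U n) > real n & cmod (H (X n) (U n)) <= R"
  by metis
 let ?C = "K \<times> cball (0::complex) R \<times> cball (0::complex) (exp (A - 1))"
 have "seq_compact ?C" by (intro compact_imp_seq_compact compact_Times K compact_cball)
 moreover have "ALL n. (X n, H (X n) (U n), exp (U n)) : ?C" using XU0 by auto
 ultimately obtain l r where l: "l : ?C" "strict_mono (r :: nat => nat)" "((%n. (X n, H (X n) (U n), exp (U n))) \<circ> r) ----> l"
  by (rule seq_compactE)
 obtain xs zt E where lE: "l = (xs, zt, E)" by (cases l) auto
 define Y where "Y = X \<circ> r"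
 define V where "V = U \<circ> r"
 have lim3: "(%n. (Y n, H (Y n) (V n), exp (V n))) ----> (xs, zt, E)"
  using l(3) by (simp add: Y_def V_def lE o_def)
 have Ylim: "Y ----> xs" using tendsto_fst[OF lim3] by simp
 have Zlim: "(%n. H (Y n) (V n)) ----> zt" using tendsto_fst[OF tendsto_snd[OF lim3]] by simp
 have Elim: "(%n. exp (V n)) ----> E" using tendsto_snd[OF tendsto_snd[OF lim3]] by simp
 have YV: "Y n : B" "Re (V n) < A" "Re (V n) <= A - 1" "cmod (V n) > real n" for n
 proof -
  show "Y n : B" using XU0 K(2) by (auto simp: Y_def)
  show R: "Re (V n) <= A - 1" using XU0 by (simp add: V_def)
  thus "Re (V n) < A" by simp
  have "real n <= real (r n)" using seq_suble[OF l(2), of n] by simp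
  thus "cmod (V n) > real n" using XU0[of "r n"] by (simp add: V_def)
 qed
 have xs: "xs : B" "xs : \<Lambda>" using l(1) lE K(2) B(2) by auto
 have E: "cmod E <= exp (A - 1)" using l(1) lE by simp
 have vlim: "(%n. v (Y n)) ----> v xs"
  by (rule isCont_tendsto_compose[OF holomorphic_isCont[OF v_hol B(1) xs(1)] Ylim])
 have flim: "(%n. f (Y n) (H (Y n) (V n))) ----> v xs + E"
  using tendsto_add[OF vlim Elim] liftD[OF YV(1,2)] by simp
 have zt: "~ pole xs zt" "f xs zt = v xs + E"
  using limit_value[OF xs(2) Ylim Zlim sequentially_bot _ flim] liftD[OF YV(1,2)] by auto
 \<comment> \<open>The margin 1 in the bound on Re u is spent here: the limit value lies in the open
   disc, where the map is locally injective at all preimages.\<close>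
 have "exp (A - 1) < exp A" by simp
 hence "cmod E < exp A" using E by linarith
 hence "v xs + E : ball (v xs) (exp A)" by (simp add: dist_norm)
 hence dzt: "deriv (f xs) zt ~= 0" by (rule isolated_value_deriv[OF iso[OF xs(1)] _ zt])
 obtain e where e: "chart f xs zt e" "!!x z. x : ball xs e ==> z : ball zt e ==> ~ pole x z"
  "!!x. x : ball xs e ==> inj_on (f x) (ball zt e)"
  "!!x z. x : ball xs e ==> z : ball zt e ==> deriv (f x) z ~= 0"
  by (rule local_injectivity[OF xs(2) zt(1) dzt]) blast
 have e0: "e > 0" using e(1) by (simp add: chart_def)
 obtain dl where dl: "0 < dl" "!!x w. x : ball xs dl ==> w : ball (f xs zt) dl ==>
   EX z:ball zt e. ~ pole x z & f x z = w"
  by (rule local_solution[OF xs(2) zt(1) dzt e0]) blast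
 have "(v ---> v xs) (nhds xs)"
  using holomorphic_isCont[OF v_hol B(1) xs(1)] by (simp add: isCont_def tendsto_at_iff_tendsto_nhds)
 hence "\<forall>\<^sub>F x in nhds xs. dist (v x) (v xs) < dl/2" using dl(1) by (intro tendstoD) auto
 moreover have "\<forall>\<^sub>F x in nhds xs. x : B" using B(1) xs(1) eventually_nhds by blast
 ultimately have "\<forall>\<^sub>F x in nhds xs. dist (v x) (v xs) < dl/2 & x : B" by eventually_elim auto
 then obtain et0 where et0: "et0 > 0" "!!x. dist x xs < et0 ==> dist (v x) (v xs) < dl/2 & x : B"
  unfolding eventually_nhds_metric by blast
 define et where "et = min et0 (min e dl)"
 have et: "et > 0" using et0(1) e0 dl(1) by (simp add: et_def)
 have sol: "v x + t : f x ` ball zt e" if "x : ball xs et" "dist t E < dl/2" for x t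
 proof -
  have "dist (v x + t) (v xs + E) <= dist (v x) (v xs) + dist t E" by (rule dist_triangle_add)
  also have "... < dl" using et0(2)[of x] that by (simp add: et_def dist_commute)
  finally have "v x + t : ball (f xs zt) dl" using zt(2) by (simp add: dist_commute)
  moreover have "x : ball xs dl" using that by (simp add: et_def)
  ultimately obtain z where "z : ball zt e" "f x z = v x + t" using dl(2) by blast
  thus ?thesis by (metis image_eqI)
 qed
 have etaD: "x : B" "x : \<Lambda>" "x : ball xs e" if "x : ball xs et" for x
  using that et0(2)[of x] params[of x] by (auto simp: et_def dist_commute)
 have ev: "\<forall>\<^sub>F n in sequentially. Y n : ball xs et & H (Y n) (V n) : ball zt e & dist (exp (V n)) E < dl/2"
  using tendstoD[OF Ylim et] tendstoD[OF Zlim e0] tendstoD[OF Elim, of "dl/2"] dl(1)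
  by (auto simp: dist_commute elim: eventually_elim2 intro: eventually_conj)
 show False
 proof (cases "E = 0")
  case True
  obtain n where n: "Y n : ball xs et" "H (Y n) (V n) : ball zt e" "dist (exp (V n)) E < dl/2"
   using eventually_happens'[OF sequentially_bot ev] by blast
  let ?x = "Y n"
  \<comment> \<open>For Re u < \<open>A'\<close> all values v x + exp u are taken inside the ball of
    injectivity. The lift, being there at \<open>V n\<close>, is there at V n + 2 pi i too and takes
    the same value.\<close>
  define A' where "A' = min A (ln (dl/2))"
  let ?S = "{u. Re u < A'}"
  have S: "open ?S" "connected ?S" by (auto simp: open_halfspace_Re_lt intro: convex_connected convex_halfspace_Re_lt)
  have "exp (Re (V n)) < dl/2" using n(3) True by (simp add: dist_norm)
  hence "Re (V n) < ln (dl/2)" using dl(1) by (metis exp_ln exp_less_cancel_iff half_gt_zero)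
  hence Vn: "V n : ?S" using YV(2)[of n] by (simp add: A'_def)
  obtain L where L: "lift_on ?x ?S (%u. v ?x + exp u) L" "L ` ?S <= ball zt e"
  proof (rule inverse_on_injective_ball[OF etaD(2)[OF n(1)] e(3)[OF etaD(3)[OF n(1)]] e(2)[OF etaD(3)[OF n(1)]], of "%u. v ?x + exp u" ?S])
   show "(%u. v ?x + exp u) holomorphic_on ?S" by (intro holomorphic_intros)
   fix u assume "u : ?S"
   hence "exp (Re u) < exp (ln (dl/2))" by (simp add: A'_def)
   hence "dist (exp u) E < dl/2" using dl(1) True by (simp add: dist_norm)
   thus "v ?x + exp u : f ?x ` ball zt e" by (rule sol[OF n(1)])
  qed
  have inS: "Re u < A" if "u : ?S" for u using that by (simp add: A'_def)
  have HL: "H ?x u = L u" if u: "u : ?S" for u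
  proof (rule inj_onD[OF e(3)[OF etaD(3)[OF n(1)]]])
   show "f ?x (H ?x u) = f ?x (L u)" using liftD[OF YV(1) inS[OF u]] L(1) u by (simp add: lift_on_def)
   show "L u : ball zt e" using L(2) u by blast
   have eq: "H ?x (V n) = L (V n)"
    by (rule inj_onD[OF e(3)[OF etaD(3)[OF n(1)]]])
     (use liftD[OF YV(1,2)] L Vn n(2) in "auto simp: lift_on_def")
   have "H ?x u = L u"
    by (rule lift_on_unique[OF etaD(2)[OF n(1)] S lift_on_subset[OF lift[OF YV(1)]] L(1) Vn eq lift_deriv[OF YV(1,2)] u])
     (use inS in auto)
   thus "H ?x u : ball zt e" using \<open>L u : ball zt e\<close> by simp
  qed
  have VP: "V n + 2 * of_real pi * \<i> : ?S" using Vn by simp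
  have eqexp: "exp (V n + 2 * of_real pi * \<i>) = exp (V n)" by (simp add: exp_add)
  have "H ?x (V n + 2 * of_real pi * \<i>) = H ?x (V n)"
  proof (rule inj_onD[OF e(3)[OF etaD(3)[OF n(1)]]])
   show "f ?x (H ?x (V n + 2 * of_real pi * \<i>)) = f ?x (H ?x (V n))"
    using liftD[OF YV(1) inS[OF VP], of n] liftD[OF YV(1) inS[OF Vn], of n] eqexp by simp
   have "L (V n + 2 * of_real pi * \<i>) : ball zt e" using L(2) VP by blast
   thus "H ?x (V n + 2 * of_real pi * \<i>) : ball zt e" using HL[OF VP] by simp
  qed (rule n(2))
  hence "V n + 2 * of_real pi * \<i> = V n"
   using inj_onD[OF inj[OF YV(1)[of n]]] inS[OF Vn] inS[OF VP] by blast
  thus False by simp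
 next
  case False
  \<comment> \<open>Now \<open>V n\<close> is close to a translate of \<open>w0\<close> by 2 pi i
    times an integer \<open>k n\<close>; the point is that \<open>k n\<close> is eventually
    constant, so \<open>V n\<close> is bounded.\<close>
  define w0 where "w0 = Ln E"
  have ew0: "exp w0 = E" using False by (simp add: w0_def)
  have Rew0: "Re w0 <= A - 1"
  proof -
   have "exp (Re w0) <= exp (A - 1)" using E ew0 by (metis norm_exp_eq_Re)
   thus ?thesis by simp
  qed
  define y where "y n = Ln (exp (V n) / E)" for n
  have "(%n. exp (V n) / E) ----> E / E" by (intro tendsto_divide Elim tendsto_const False)
  hence "(%n. Ln (exp (V n) / E)) ----> Ln 1" using False by (intro tendsto_Ln) auto
  hence ylim: "y ----> 0" by (simp add: y_def[abs_def])
  have "EX k::int. V n = w0 + y n + 2 * of_real pi * \<i> * of_int k" for n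
  proof -
   have "exp (V n) = exp (w0 + y n)" using False ew0 by (simp add: y_def exp_add)
   thus ?thesis unfolding exp_eq by (auto simp: algebra_simps)
  qed
  then obtain k :: "nat => int" where k: "!!n. V n = w0 + y n + 2 * of_real pi * \<i> * of_int (k n)" by metis
  have "isCont exp w0" by simp
  then obtain d0 where d0: "d0 > 0" "!!u. dist u w0 < d0 ==> dist (exp u) E < dl/2"
   unfolding continuous_at_eps_delta using dl(1) ew0 by (metis half_gt_zero)
  define d where "d = min d0 (1/2)"
  have d: "d > 0" "d <= 1/2" "!!u. dist u w0 < d ==> dist (exp u) E < dl/2" using d0 by (auto simp: d_def)
  have dP: "Re (u + 2 * of_real pi * \<i> * of_int j) < A" if "u : ball w0 d" for u and j :: int
  proof -
   have "Re (u - w0) <= cmod (u - w0)" by (rule complex_Re_le_cmod)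
   hence "Re u - Re w0 < 1/2" using that d(2) by (simp add: dist_norm norm_minus_commute)
   thus ?thesis using Rew0 by simp
  qed
  have w0in: "w0 : ball w0 d" using d by simp
  have eper: "exp (u + 2 * of_real pi * \<i> * of_int j) = exp u" for u and j :: int
   using exp_plus_2pin[of u j] by (simp add: algebra_simps)
  have "ALL x:ball xs et. EX z. z : ball zt e & f x z = v x + E"
  proof
   fix x assume "x : ball xs et"
   hence "v x + E : f x ` ball zt e" using dl(1) by (intro sol) auto
   thus "EX z. z : ball zt e & f x z = v x + E" by (metis imageE)
  qed
  then obtain Z where Z: "ALL x:ball xs et. Z x : ball zt e & f x (Z x) = v x + E" using bchoice[of "ball xs et" "%x z. z : ball zt e & f x z = v x + E"] by blast
  have Zhol: "Z holomorphic_on ball xs et"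
  proof (rule continuous_solution_holomorphic[where w = "%x. v x + E"])
   show "open (ball xs et)" "ball xs et <= \<Lambda>" using etaD by auto
   show "(%x. v x + E) holomorphic_on ball xs et"
    using etaD(1) by (intro holomorphic_intros holomorphic_on_subset[OF v_hol]) auto
   show "~ pole x (Z x)" "deriv (f x) (Z x) ~= 0" "f x (Z x) = v x + E" if "x : ball xs et" for x
    using Z that e(2,4)[OF etaD(3)[OF that]] by auto
   show "continuous_on (ball xs et) Z"
    unfolding continuous_on_eq_continuous_at[OF open_ball]
   proof
    fix x assume x: "x : ball xs et"
    have Zx: "Z x : ball zt e" "f x (Z x) = v x + E" using Z x by auto
    have "(Z ---> Z x) (nhds x)"
    proof (rule solution_tendsto[OF etaD(2)[OF x] e(2)[OF etaD(3)[OF x] Zx(1)] e(4)[OF etaD(3)[OF x] Zx(1)] open_ball Zx(1) filterlim_ident])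
     have "(v ---> v x) (nhds x)"
      using holomorphic_isCont[OF v_hol B(1) etaD(1)[OF x]] by (simp add: isCont_def tendsto_at_iff_tendsto_nhds)
     thus "((%x. v x + E) ---> f x (Z x)) (nhds x)" unfolding Zx(2) by (intro tendsto_intros)
     have "\<forall>\<^sub>F p in nhds x. p : ball xs et" using x open_ball eventually_nhds by blast
     thus "\<forall>\<^sub>F p in nhds x. Z p : ball zt e & inj_on (f p) (ball zt e) & f p (Z p) = v p + E"
      by eventually_elim (use Z e(3)[OF etaD(3)] in auto)
    qed
    thus "isCont Z x" by (simp add: isCont_def tendsto_at_iff_tendsto_nhds)
   qed
  qed
  \<comment> \<open>At the parameter \<open>Y n\<close> the translated lift agrees with the local
    solution \<open>Z\<close>. Both are holomorphic in the parameter, so they still agree at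
    \<open>xs\<close>, where the value is \<open>zt\<close> for every such n.\<close>
  have key: "H xs (w0 + 2 * of_real pi * \<i> * of_int (k n)) = zt"
   if n: "Y n : ball xs et" "H (Y n) (V n) : ball zt e" "dist (exp (V n)) E < dl/2" "dist (y n) 0 < d" for n
  proof -
   let ?x = "Y n" and ?Q = "2 * of_real pi * \<i> * of_int (k n)"
   have xB: "?x : B" and xL: "?x : \<Lambda>" and xe: "?x : ball xs e" using etaD[OF n(1)] by auto
   obtain L where L: "lift_on ?x (ball w0 d) (%u. v ?x + exp u) L" "L ` ball w0 d <= ball zt e"
   proof (rule inverse_on_injective_ball[OF xL e(3)[OF xe] e(2)[OF xe], of "%u. v ?x + exp u" "ball w0 d"])
    show "(%u. v ?x + exp u) holomorphic_on ball w0 d" by (intro holomorphic_intros)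
    fix u assume "u : ball w0 d"
    thus "v ?x + exp u : f ?x ` ball zt e" by (intro sol[OF n(1)] d(3)) (simp add: dist_commute)
   qed
   have HQ: "lift_on ?x (ball w0 d) (%u. v ?x + exp u) (%u. H ?x (u + ?Q))"
    unfolding lift_on_def
   proof
    have "(H ?x \<circ> (%u. u + ?Q)) holomorphic_on ball w0 d"
     by (rule holomorphic_on_compose_gen[of _ _ "H ?x" "{u. Re u < A}"])
      (use lift[OF xB] dP in "auto simp: lift_on_def intro!: holomorphic_intros")
    thus "(%u. H ?x (u + ?Q)) holomorphic_on ball w0 d" by (simp add: o_def)
    show "ALL u:ball w0 d. ~ pole ?x (H ?x (u + ?Q)) & f ?x (H ?x (u + ?Q)) = v ?x + exp u"
     using liftD[OF xB dP] eper by auto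
   qed
   have yin: "w0 + y n : ball w0 d" using n(4) by (simp add: dist_norm)
   have kn: "w0 + y n + ?Q = V n" using k by simp
   have eq: "H ?x (w0 + y n + ?Q) = L (w0 + y n)"
   proof (rule inj_onD[OF e(3)[OF xe]])
    show "f ?x (H ?x (w0 + y n + ?Q)) = f ?x (L (w0 + y n))" using HQ L(1) yin by (simp add: lift_on_def)
    show "H ?x (w0 + y n + ?Q) : ball zt e" unfolding kn by (rule n(2))
    show "L (w0 + y n) : ball zt e" using L(2) yin by blast
   qed
   have "H ?x (w0 + ?Q) = L w0"
    by (rule lift_on_unique[OF xL open_ball _ HQ L(1) yin eq lift_deriv[OF xB dP[OF yin]] w0in]) simp
   moreover have "L w0 : ball zt e" using L(2) w0in by blast
   ultimately have inb: "H ?x (w0 + ?Q) : ball zt e" by simp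
   have RQ: "Re (w0 + ?Q) < A" by (rule dP[OF w0in])
   have Hhol: "(%x. H x (w0 + ?Q)) holomorphic_on ball xs et"
    by (rule holomorphic_on_subset[OF parameter_holomorphic]) (use cont RQ etaD(1) in auto)
   have "isCont (%x. H x (w0 + ?Q)) ?x" by (rule holomorphic_isCont[OF Hhol open_ball n(1)])
   hence "((%x. H x (w0 + ?Q)) ---> H ?x (w0 + ?Q)) (nhds ?x)"
    by (simp only: isCont_def tendsto_at_iff_tendsto_nhds[of "%x. H x (w0 + ?Q)"])
   hence "\<forall>\<^sub>F x in nhds ?x. H x (w0 + ?Q) : ball zt e" by (rule topological_tendstoD[OF _ open_ball inb])
   moreover have "\<forall>\<^sub>F x in nhds ?x. x : ball xs et" using n(1) open_ball eventually_nhds by blast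
   ultimately have "\<forall>\<^sub>F x in nhds ?x. H x (w0 + ?Q) = Z x & x : ball xs et"
   proof eventually_elim
    case (elim x)
    have "H x (w0 + ?Q) = Z x"
    proof (rule inj_onD[OF e(3)[OF etaD(3)[OF elim(2)]]])
     show "f x (H x (w0 + ?Q)) = f x (Z x)"
      using liftD[OF etaD(1)[OF elim(2)] RQ] Z elim(2) eper[of w0 "k n"] ew0 by simp
    qed (use elim Z in auto)
    thus ?case using elim by simp
   qed
   then obtain S where S: "open S" "?x : S" "!!x. x : S ==> H x (w0 + ?Q) = Z x & x : ball xs et"
    unfolding eventually_nhds by blast
   have "H xs (w0 + ?Q) - Z xs = 0"
    by (rule analytic_continuation_open[of S "ball xs et" "%x. H x (w0 + ?Q) - Z x" "%_. 0"])
     (use S et Hhol Zhol in "auto intro!: holomorphic_intros")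
   hence "H xs (w0 + ?Q) = Z xs" by simp
   moreover have "Z xs = zt"
    by (rule inj_onD[OF e(3), of xs]) (use e0 et Z zt in auto)
   ultimately show ?thesis by simp
  qed
  have "\<forall>\<^sub>F n in sequentially. dist (y n) 0 < d" using ylim d(1) by (rule tendstoD)
  with ev have ev2: "\<forall>\<^sub>F n in sequentially. H xs (w0 + 2 * of_real pi * \<i> * of_int (k n)) = zt & dist (y n) 0 < d"
   by eventually_elim (use key in blast)
  then obtain N where N: "!!n. n >= N ==> H xs (w0 + 2 * of_real pi * \<i> * of_int (k n)) = zt & dist (y n) 0 < d"
   unfolding eventually_sequentially by blast
  \<comment> \<open>Univalence at the limit parameter: the common value \<open>zt\<close> is taken
    once.\<close>
  have kc: "k n = k N" if "n >= N" for n
  proof -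
   have "w0 + 2 * of_real pi * \<i> * of_int (k n) = w0 + 2 * of_real pi * \<i> * of_int (k N)"
    by (rule inj_onD[OF inj[OF xs(1)]]) (use N[of n] N[of N] that dP[OF w0in] in auto)
   thus ?thesis by simp
  qed
  define M where "M = cmod w0 + 1 + cmod (2 * of_real pi * \<i> * of_int (k N))"
  obtain m :: nat where m: "M < real m" using reals_Archimedean2 by blast
  define n where "n = max m N"
  have "cmod (V n) <= cmod w0 + cmod (y n) + cmod (2 * of_real pi * \<i> * of_int (k n))"
   unfolding k[of n] by (intro order_trans[OF norm_triangle_ineq] add_mono norm_triangle_ineq order_refl)
  also have "... <= M" using N[of n] kc[of n] d(2) by (simp add: M_def n_def)
  also have "... < real n" using m by (simp add: n_def)
  finally show False using YV(4)[of n] by simp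
 qed
qed

end

context natural_slice
begin

text \<open>The logarithmic coordinate of an asymptotic tract of the free asymptotic value, moving
  holomorphically with the parameter; the last clause is the escape to infinity, uniform in the
  parameter.\<close>

definition tract :: "complex => real => real => (complex => complex => complex) => bool" where
 "tract x1 rh A H \<longleftrightarrow> 0 < rh & ball x1 rh <= \<Lambda> &
  (ALL x:ball x1 rh. ALL u. Re u < A --> ~ pole x (H x u) & f x (H x u) = v x + exp u & deriv (f x) (H x u) ~= 0) &
  (ALL x:ball x1 rh. H x holomorphic_on {u. Re u < A} & inj_on (H x) {u. Re u < A}) &
  (ALL x:ball x1 rh. ALL u. Re u < A --> ((%p. H (fst p) (snd p)) ---> H x u) (nhds (x, u))) &
  (ALL u. Re u < A --> (%x. H x u) holomorphic_on ball x1 rh) &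
  (ALL R. EX M. ALL x:ball x1 rh. ALL u. Re u <= A - 1 & cmod u > M --> cmod (H x u) > R)"

text \<open>At \<open>x1\<close> univalence comes from an asymptotic path. At nearby parameters the
  lift is started at a nearby preimage, not on a path; a non-univalent one would have period 2 pi i,
  which continuity of \<open>H x\<close> at just two points forbids.\<close>

lemma tract_exists:
 assumes x1: "x1 : \<Lambda>"
 obtains rh A H where "tract x1 rh A H"
proof -
 obtain rh0 A where rh0: "0 < rh0" "ball x1 rh0 <= \<Lambda>" "!!x. x : ball x1 rh0 ==> isolated_value x (v x) A"
  by (rule isolated_near[OF x1]) blast
 have x1in: "x1 : ball x1 rh0" using rh0 by simp
 let ?P = "{u. Re u < A}"
 obtain H1 u0 where H1: "Re u0 < A" "lift_on x1 ?P (%u. v x1 + exp u) H1" "inj_on H1 ?P"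
  by (rule tract_at_parameter[OF x1 rh0(3)[OF x1in]]) blast
 let ?zt = "H1 u0"
 have zt: "~ pole x1 ?zt" "f x1 ?zt = v x1 + exp u0" using H1 by (auto simp: lift_on_def)
 have dz: "deriv (f x1) ?zt ~= 0"
  using isolated_value_deriv[OF rh0(3)[OF x1in] _ zt] exp_in_ball[OF H1(1), of "v x1"] by blast
 obtain e where e: "chart f x1 ?zt e" "!!x z. x : ball x1 e ==> z : ball ?zt e ==> ~ pole x z"
  "!!x. x : ball x1 e ==> inj_on (f x) (ball ?zt e)"
  "!!x z. x : ball x1 e ==> z : ball ?zt e ==> deriv (f x) z ~= 0"
  by (rule local_injectivity[OF x1 zt(1) dz]) blast
 have e0: "e > 0" using e(1) by (simp add: chart_def)
 obtain dl where dl: "0 < dl" "!!x w. x : ball x1 dl ==> w : ball (f x1 ?zt) dl ==>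
   EX z:ball ?zt e. ~ pole x z & f x z = w"
  by (rule local_solution[OF x1 zt(1) dz e0]) blast
 have vt: "(v ---> v x) (nhds x)" if "x : \<Lambda>" for x
  using v_isCont[OF that] by (simp add: isCont_def tendsto_at_iff_tendsto_nhds)
 obtain rh1 where rh1: "rh1 > 0" "!!x. dist x x1 < rh1 ==> dist (v x) (v x1) < dl"
  using tendstoD[OF vt[OF x1] dl(1)] unfolding eventually_nhds_metric by blast
 define rh2 where "rh2 = min (min rh0 rh1) (min e dl)"
 let ?B = "ball x1 rh2"
 have rh2: "rh2 > 0" using rh0 rh1 e0 dl by (simp add: rh2_def)
 have BD: "x : ball x1 rh0" "x : \<Lambda>" "x : ball x1 e" "x : ball x1 dl" "dist (v x) (v x1) < dl" if "x : ?B" for x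
  using that rh0(2) rh1(2)[of x] by (auto simp: rh2_def dist_commute)
 have "ALL x:?B. EX Hx. lift_on x ?P (%u. v x + exp u) Hx & Hx u0 : ball ?zt e"
 proof
  fix x assume x: "x : ?B"
  have "v x + exp u0 : ball (f x1 ?zt) dl" using BD(5)[OF x] zt(2) by (simp add: dist_commute)
  then obtain z where z: "z : ball ?zt e" "f x z = v x + exp u0" using dl(2)[OF BD(4)[OF x]] by blast
  obtain Hx where "lift_on x ?P (%u. v x + exp u) Hx" "Hx u0 = z"
  proof (rule lift_halfplane[where h = "%u. v x + exp u", OF BD(2)[OF x] _ H1(1) e(2)[OF BD(3)[OF x] z(1)] z(2) e(4)[OF BD(3)[OF x] z(1)]])
   show "(%u. v x + exp u) holomorphic_on ?P" by (intro holomorphic_intros)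
   show "unramified x (v x + exp u)" if "Re u < A" for u
    using rh0(3)[OF BD(1)[OF x]] exp_in_ball[OF that, of "v x"] unfolding isolated_value_def by blast
  qed
  thus "EX Hx. lift_on x ?P (%u. v x + exp u) Hx & Hx u0 : ball ?zt e" using z(1) by blast
 qed
 from bchoice[OF this] obtain H where H: "!!x. x : ?B ==> lift_on x ?P (%u. v x + exp u) (H x)" "!!x. x : ?B ==> H x u0 : ball ?zt e"
  by blast
 interpret L: lift_family \<Lambda> f v ?B A H
 proof
  show "v holomorphic_on ?B" by (rule holomorphic_on_subset[OF v_holomorphic]) (use BD in auto)
 qed (use BD H rh0(3) in auto)
 have Q0: "L.parameter_continuous_at x u0" if x: "x : ?B" for x
  unfolding L.parameter_continuous_at_def
 proof (rule solution_tendsto[OF BD(2)[OF x] _ L.lift_deriv[OF x H1(1)] open_ball H(2)[OF x] filterlim_ident])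
  show "~ pole x (H x u0)" using L.liftD[OF x H1(1)] by simp
  have fx: "f x (H x u0) = v x + exp u0" using L.liftD[OF x H1(1)] by simp
  show "((%x. v x + exp u0) ---> f x (H x u0)) (nhds x)" unfolding fx by (intro tendsto_intros vt BD(2)[OF x])
  have "\<forall>\<^sub>F p in nhds x. p : ?B" using x open_ball eventually_nhds by blast
  thus "\<forall>\<^sub>F p in nhds x. H p u0 : ball ?zt e & inj_on (f p) (ball ?zt e) & f p (H p u0) = v p + exp u0"
   by eventually_elim (use H(2) e(3)[OF BD(3)] L.liftD[OF _ H1(1)] in auto)
 qed
 have J: "L.jointly_continuous_at x u" if "x : ?B" "Re u < A" for x u
  by (rule L.joint_continuity[OF that(1) H1(1) Q0[OF that(1)] that(2)])
 have Q: "L.parameter_continuous_at x u" if "x : ?B" "Re u < A" for x u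
  by (rule L.joint_imp_parameter[OF J[OF that]])
 have x1B: "x1 : ?B" using rh2 by simp
 have P: "open ?P" "connected ?P" by (auto simp: open_halfspace_Re_lt intro: convex_connected convex_halfspace_Re_lt)
 \<comment> \<open>The values at \<open>u0\<close> and \<open>?u1\<close> differ at
   \<open>x1\<close>, hence also for x near \<open>x1\<close>; this excludes the periodic
   alternative.\<close>
 let ?u1 = "u0 + 2 * of_real pi * \<i>"
 have u1: "Re ?u1 < A" using H1(1) by simp
 have eq0: "H x1 u0 = H1 u0"
  by (rule inj_onD[OF e(3)[of x1]]) (use e0 H(2)[OF x1B] L.liftD[OF x1B H1(1)] zt in auto)
 have "H x1 u = H1 u" if "Re u < A" for u
  by (rule lift_on_unique[OF x1 P H(1)[OF x1B] H1(2) _ eq0 L.lift_deriv[OF x1B H1(1)]]) (use H1(1) that in auto)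
 hence "H x1 ?u1 ~= H x1 u0" using inj_onD[OF H1(3), of ?u1 u0] H1(1) u1 by auto
 moreover have "((%x. H x ?u1 - H x u0) ---> H x1 ?u1 - H x1 u0) (nhds x1)"
  using Q[OF x1B u1] Q[OF x1B H1(1)] unfolding L.parameter_continuous_at_def by (intro tendsto_diff)
 ultimately have "\<forall>\<^sub>F x in nhds x1. H x ?u1 - H x u0 ~= 0" by (intro tendsto_imp_eventually_ne) auto
 then obtain rh3 where rh3: "rh3 > 0" "!!x. dist x x1 < rh3 ==> H x ?u1 ~= H x u0"
  unfolding eventually_nhds_metric by auto
 define rh4 where "rh4 = min rh2 rh3"
 have rh4: "rh4 > 0" "ball x1 rh4 <= ?B" using rh2 rh3 by (auto simp: rh4_def)
 have inj: "inj_on (H x) ?P" if x: "x : ball x1 rh4" for x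
 proof -
  have xB: "x : ?B" using x rh4 by blast
  note iso = rh0(3)[OF BD(1)[OF xB]]
  show ?thesis
  proof (rule tract_injective[OF BD(2)[OF xB] iso infinite_poles[OF BD(2)[OF xB]] H(1)[OF xB]])
   fix u zt' assume u: "Re u < A"
   show "~ ((%t. H x (u - of_real t)) ---> zt') at_top"
   proof
    assume l: "((%t. H x (u - of_real t)) ---> zt') at_top"
    obtain G where G: "!!u. Re u < A ==> H x u = G (v x + exp u)"
     by (rule tract_finite_end[OF BD(2)[OF xB] iso H(1)[OF xB] u l]) blast
    have "exp ?u1 = exp u0" by (simp add: exp_add)
    hence "H x ?u1 = H x u0" using G[OF u1] G[OF H1(1)] by simp
    thus False using rh3(2)[of x] x by (simp add: rh4_def dist_commute)
   qed
  qed
 qed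
 interpret L4: lift_family \<Lambda> f v "ball x1 rh4" A H
 proof
  show "v holomorphic_on ball x1 rh4" by (rule holomorphic_on_subset[OF v_holomorphic]) (use BD rh4 in auto)
 qed (use BD H rh0(3) rh4 in auto)
 \<comment> \<open>The radius is halved once more because uniform escape is proved for compact sets
   of parameters.\<close>
 have sub5: "cball x1 (rh4/2) <= ball x1 rh4" using rh4 by auto
 show ?thesis
 proof (rule that[of "rh4/2" A H])
  show "tract x1 (rh4/2) A H"
   unfolding tract_def
  proof (intro conjI ballI allI impI)
   show "0 < rh4/2" using rh4 by simp
   show "ball x1 (rh4/2) <= \<Lambda>" using sub5 rh4 BD(2) by force
   show "(%x. H x u) holomorphic_on ball x1 (rh4/2)" if "Re u < A" for u
    by (rule holomorphic_on_subset[OF L.parameter_holomorphic[OF Q]]) (use that rh4 sub5 in force)+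
   fix R
   have "L4.parameter_continuous_at x u" if "x : ball x1 rh4" "Re u < A" for x u
    using Q[of x u] that rh4(2) unfolding L.parameter_continuous_at_def L4.parameter_continuous_at_def by blast
   then obtain M where "ALL x:cball x1 (rh4/2). ALL u. Re u <= A - 1 & cmod u > M --> cmod (H x u) > R"
    using L4.escapes[OF inj _ compact_cball sub5] by blast
   thus "EX M. ALL x:ball x1 (rh4/2). ALL u. Re u <= A - 1 & cmod u > M --> cmod (H x u) > R"
    by (intro exI[of _ M]) auto
  next
   fix x assume x: "x : ball x1 (rh4/2)"
   hence x4: "x : ball x1 rh4" using sub5 by force
   hence xB: "x : ?B" using rh4 by blast
   show "H x holomorphic_on ?P" using H(1)[OF xB] by (simp add: lift_on_def)
   show "inj_on (H x) ?P" by (rule inj[OF x4])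
   fix u assume u: "Re u < A"
   show "~ pole x (H x u)" "f x (H x u) = v x + exp u" using L.liftD[OF xB u] by auto
   show "deriv (f x) (H x u) ~= 0" by (rule L.lift_deriv[OF xB u])
   show "((%p. H (fst p) (snd p)) ---> H x u) (nhds (x, u))"
    using J[OF xB u] by (simp add: L.jointly_continuous_at_def)
  qed
 qed
qed

end

section \<open>Essential singularities in the parameter\<close>

lemma analytic_germ_alternative:
 assumes "kp holomorphic_on ball a e" "0 < e"
 shows "(ALL y:ball a e. kp y = 0) | (EX r. 0 < r & r <= e & (ALL y:ball a r - {a}. kp y ~= 0))"
proof (cases "ALL y:ball a e. kp y = 0")
 case False
 then obtain b where b: "b : ball a e" "kp b ~= 0" by blast
 have "EX r>0. ALL y:ball a r - {a}. kp y ~= 0"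
 proof (cases "kp a = 0")
  case True
  obtain r where "0 < r" "!!z. z : ball a r - {a} ==> kp z ~= 0"
   by (rule isolated_zeros[OF assms(1) open_ball connected_ball _ True b]) (use assms(2) in auto)
  thus ?thesis by blast
 next
  case False
  have "isCont kp a" by (rule holomorphic_isCont[OF assms(1) open_ball]) (use assms(2) in auto)
  hence "\<forall>\<^sub>F y in at a. kp y ~= 0" using False by (auto simp: isCont_def intro: tendsto_imp_eventually_ne)
  thus ?thesis unfolding eventually_at by (force simp: dist_commute)
 qed
 then obtain r where "r > 0" "ALL y:ball a r - {a}. kp y ~= 0" by blast
 thus ?thesis using assms(2) by (intro disjI2 exI[of _ "min r e"]) auto
qed auto

lemma countable_discrete:
 fixes S :: "complex set"
 assumes "!!x. x : S ==> EX e>0. ball x e \<inter> S <= {x}"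
 shows "countable S"
proof -
 from assms have "ALL x:S. EX e. e > 0 & ball x e \<inter> S <= {x}" by blast
 from bchoice[OF this] obtain e where e: "!!x. x : S ==> e x > 0 & ball x (e x) \<inter> S <= {x}" by blast
 let ?D = "\<Union>x\<in>S. ball x (e x)"
 have D: "open ?D" by blast
 have "~ y islimpt S" if "y : ?D" for y
 proof
  assume lim: "y islimpt S"
  obtain x where x: "x : S" "y : ball x (e x)" using \<open>y : ?D\<close> by blast
  have op: "open (ball x (e x) - ({x} - {y}))" by (intro open_Diff open_ball finite_imp_closed) auto
  have "y : ball x (e x) - ({x} - {y})" using x(2) by blast
  then obtain z where "z : S" "z : ball x (e x) - ({x} - {y})" "z ~= y"
   by (rule islimptE[OF lim _ op])
  thus False using e[OF x(1)] by blast
 qed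
 hence "S sparse_in ?D" using sparse_in_open[OF D] by blast
 hence "countable (?D \<inter> S)" using sparse_imp_countable[OF D] by blast
 moreover have "?D \<inter> S = S" using e centre_in_ball by blast
 ultimately show ?thesis by simp
qed

context natural_slice
begin

lemma tractD:
 assumes "tract x1 rh A H"
 shows "0 < rh" "ball x1 rh <= \<Lambda>"
  "x : ball x1 rh ==> Re u < A ==> ~ pole x (H x u)"
  "x : ball x1 rh ==> Re u < A ==> f x (H x u) = v x + exp u"
  "x : ball x1 rh ==> Re u < A ==> deriv (f x) (H x u) ~= 0"
  "x : ball x1 rh ==> H x holomorphic_on {u. Re u < A}"
  "x : ball x1 rh ==> inj_on (H x) {u. Re u < A}"
  "x : ball x1 rh ==> Re u < A ==> ((%p. H (fst p) (snd p)) ---> H x u) (nhds (x, u))"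
  "Re u < A ==> (%x. H x u) holomorphic_on ball x1 rh"
  "EX M. ALL x:ball x1 rh. ALL u. Re u <= A - 1 & cmod u > M --> cmod (H x u) > R"
 using assms unfolding tract_def by blast+

text \<open>If \<open>1 / kp\<close> missed \<open>H _ u\<close> near its pole, the maximum principle would bound
  \<open>1 / (kp - 1 / H _ u)\<close> at the centre, where it is \<open>- H x1 u\<close>.\<close>

lemma tract_hits_pole:
 assumes tr: "tract x1 rh A H" and kp: "kp holomorphic_on ball x1 r" "0 < r" "kp x1 = 0"
  "!!x. x : ball x1 r - {x1} ==> kp x ~= 0" and eps: "0 < eps"
 obtains M where "!!u. Re u <= A - 1 ==> cmod u > M ==>
   EX x. x ~= x1 & dist x x1 < eps & x : ball x1 r & x : ball x1 rh & inverse (kp x) = H x u"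
proof -
 define dl where "dl = min eps (min r rh) / 2"
 have dl: "0 < dl" "dl < eps" "dl < r" "dl < rh" using eps kp(2) tractD(1)[OF tr] by (auto simp: dl_def)
 have sub: "cball x1 dl <= ball x1 r" "cball x1 dl <= ball x1 rh" using dl by auto
 have ckp: "continuous_on (sphere x1 dl) kp"
  by (rule holomorphic_on_imp_continuous_on[OF holomorphic_on_subset[OF kp(1)]]) (use dl in auto)
 have "continuous_on (sphere x1 dl) (%x. cmod (kp x))" by (intro continuous_intros ckp)
 moreover have ne: "sphere x1 dl ~= {}" using dl(1) by simp
 ultimately obtain y where y: "y : sphere x1 dl" "!!x. x : sphere x1 dl ==> cmod (kp y) <= cmod (kp x)"
  using continuous_attains_inf[OF compact_sphere, of x1 dl "%x. cmod (kp x)"] by blast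
 \<comment> \<open>On the circle |kp| is at least \<open>m\<close>; once |H| > 2/m the reciprocal
   1/H is below m/2 and cannot cancel \<open>kp\<close> there.\<close>
 define m where "m = cmod (kp y)"
 have m: "m > 0" using kp(4)[of y] y(1) dl by (auto simp: m_def)
 obtain M where M: "!!x u. x : ball x1 rh ==> Re u <= A - 1 ==> cmod u > M ==> cmod (H x u) > 2 / m"
  using tractD(10)[OF tr, of "2/m"] by blast
 show ?thesis
 proof (rule that[of M])
  fix u assume u: "Re u <= A - 1" "cmod u > M"
  have uA: "Re u < A" using u by simp
  have big: "cmod (H x u) > 2/m" if "x : cball x1 dl" for x using M[OF _ u] sub that by blast
  have nz: "H x u ~= 0" if "x : cball x1 dl" for x using big[OF that] m by fastforce
  have Hh: "(%x. H x u) holomorphic_on cball x1 dl" using tractD(9)[OF tr uA] sub(2) by (rule holomorphic_on_subset)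
  have kph: "kp holomorphic_on cball x1 dl" using kp(1) sub(1) by (rule holomorphic_on_subset)
  have "EX x:cball x1 dl. kp x - inverse (H x u) = 0"
  proof (rule ccontr)
   assume a: "~ ?thesis"
   define g where "g x = inverse (kp x - inverse (H x u))" for x
   have gh: "g holomorphic_on cball x1 dl" unfolding g_def by (intro holomorphic_intros Hh kph) (use nz a in auto)
   have "cmod (g x1) <= 2/m"
   proof (rule maximum_modulus_frontier[of g "cball x1 dl"])
    show "g holomorphic_on interior (cball x1 dl)" by (rule holomorphic_on_subset[OF gh]) auto
    show "continuous_on (closure (cball x1 dl)) g" using holomorphic_on_imp_continuous_on[OF gh] by simp
    fix z assume "z : frontier (cball x1 dl)"
    hence z: "z : sphere x1 dl" by (simp add: frontier_cball)
    hence zc: "z : cball x1 dl" by auto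
    have "cmod (inverse (H z u)) < m/2"
     using less_imp_inverse_less[OF big[OF zc]] m by (simp add: norm_inverse)
    moreover have "m <= cmod (kp z)" using y(2)[OF z] by (simp add: m_def)
    moreover have "cmod (kp z) - cmod (inverse (H z u)) <= cmod (kp z - inverse (H z u))" by (rule norm_triangle_ineq2)
    ultimately have "m/2 <= cmod (kp z - inverse (H z u))" by linarith
    hence "inverse (cmod (kp z - inverse (H z u))) <= inverse (m/2)" using m by (intro le_imp_inverse_le) auto
    thus "cmod (g z) <= 2/m" by (simp add: g_def norm_inverse)
   qed (use dl in auto)
   moreover have "g x1 = - H x1 u" using kp(3) by (simp add: g_def)
   ultimately show False using big[of x1] dl(1) by simp
  qed
  then obtain x where x: "x : cball x1 dl" "kp x = inverse (H x u)" by auto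
  have "x ~= x1" using x(2) kp(3) nz[OF x(1)] by auto
  thus "EX x. x ~= x1 & dist x x1 < eps & x : ball x1 r & x : ball x1 rh & inverse (kp x) = H x u"
   using x dl sub by (intro exI[of _ x]) (auto simp: dist_commute)
 qed
qed

text \<open>Replacing u by u + 2 pi i n leaves exp u unchanged and makes |u| as large as
  \<open>tract_hits_pole\<close> requires. So every value v x + exp u with Re u small enough recurs
  arbitrarily close to \<open>x1\<close>.\<close>

lemma essential_singularity:
 assumes x1: "x1 : \<Lambda>" and kp: "kp holomorphic_on ball x1 r" "0 < r" "kp x1 = 0"
  "!!x. x : ball x1 r - {x1} ==> kp x ~= 0"
 obtains A where "!!u eps. Re u <= A ==> 0 < eps ==> EX x. x ~= x1 & dist x x1 < eps & x : ball x1 r &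
   ~ pole x (inverse (kp x)) & f x (inverse (kp x)) = v x + exp u"
proof -
 obtain rh A H where tr: "tract x1 rh A H" by (rule tract_exists[OF x1])
 show ?thesis
 proof (rule that[of "A - 1"])
  fix u :: complex and eps :: real assume u: "Re u <= A - 1" and eps: "0 < eps"
  obtain M where M: "!!u. Re u <= A - 1 ==> cmod u > M ==>
   EX x. x ~= x1 & dist x x1 < eps & x : ball x1 r & x : ball x1 rh & inverse (kp x) = H x u"
   by (rule tract_hits_pole[OF tr kp eps]) blast+
  obtain n :: nat where n: "cmod u + M < real n" using reals_Archimedean2 by blast
  define w where "w = u + of_int (int n) * (of_real (2 * pi) * \<i>)"
  have "real n <= 2 * pi * real n" using pi_gt3 by (simp add: mult_le_cancel_right1)
  also have "... = cmod (w - u)" by (simp add: w_def norm_mult)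
  also have "... <= cmod w + cmod u" by (rule norm_triangle_ineq4)
  finally have "cmod w > M" using n by linarith
  moreover have "Re w <= A - 1" using u by (simp add: w_def)
  ultimately obtain x where x: "x ~= x1" "dist x x1 < eps" "x : ball x1 r" "x : ball x1 rh" "inverse (kp x) = H x w"
   using M by blast
  have "w = u + \<i> * (of_int (int n) * (of_real pi * 2))" by (simp add: w_def algebra_simps)
  hence "exp w = exp u" by (simp only: exp_plus_2pin)
  hence "~ pole x (inverse (kp x)) & f x (inverse (kp x)) = v x + exp u"
   using tractD(3,4)[OF tr x(4), of w] \<open>Re w <= A - 1\<close> x(5) by simp
  thus "EX x. x ~= x1 & dist x x1 < eps & x : ball x1 r &
   ~ pole x (inverse (kp x)) & f x (inverse (kp x)) = v x + exp u" using x(1-3) by blast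
 qed
qed

section \<open>Holomorphic maps into the sphere\<close>

definition sphere_holomorphic :: "complex set => (complex => complex option) => bool" where
 "sphere_holomorphic D G \<longleftrightarrow> (ALL x:D. EX e>0. EX kp. ball x e <= D & kp holomorphic_on ball x e &
  ((ALL y:ball x e. G y = Some (kp y)) |
   (ALL y:ball x e. G y = (if kp y = 0 then None else Some (inverse (kp y))))))"

lemma sphere_holomorphic_alternative:
 assumes "sphere_holomorphic D G" "x : D"
 obtains e where "e > 0" "ball x e <= D" "!!y. y : ball x e ==> G y ~= None"
 | e where "e > 0" "ball x e <= D" "!!y. y : ball x e ==> G y = None"
 | e kp where "e > 0" "ball x e <= D" "kp holomorphic_on ball x e" "kp x = 0" "G x = None"
   "!!y. y : ball x e - {x} ==> kp y ~= 0 & G y = Some (inverse (kp y))"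
proof -
 obtain e kp where e: "e > 0" "ball x e <= D" and kp: "kp holomorphic_on ball x e"
  and alt: "(ALL y:ball x e. G y = Some (kp y)) |
   (ALL y:ball x e. G y = (if kp y = 0 then None else Some (inverse (kp y))))"
  using assms unfolding sphere_holomorphic_def by blast
 from alt show ?thesis
 proof
  assume "ALL y:ball x e. G y = Some (kp y)"
  thus ?thesis using that(1)[OF e] by simp
 next
  assume G: "ALL y:ball x e. G y = (if kp y = 0 then None else Some (inverse (kp y)))"
  from analytic_germ_alternative[OF kp e(1)] show ?thesis
  proof
   assume "ALL y:ball x e. kp y = 0"
   thus ?thesis using that(2)[OF e] G by simp
  next
   assume "EX r. 0 < r & r <= e & (ALL y:ball x r - {x}. kp y ~= 0)"
   then obtain r where r: "0 < r" "r <= e" "ALL y:ball x r - {x}. kp y ~= 0" by blast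
   have sub: "ball x r <= ball x e" using r(2) by auto
   show ?thesis
   proof (cases "kp x = 0")
    case True
    show ?thesis
    proof (rule that(3)[of r kp])
     show "kp holomorphic_on ball x r" using kp sub by (rule holomorphic_on_subset)
     show "G x = None" using G e(1) True by simp
     show "kp y ~= 0 & G y = Some (inverse (kp y))" if "y : ball x r - {x}" for y
      using that r(3) G sub by auto
    qed (use r True sub e in auto)
   next
    case False
    show ?thesis
    proof (rule that(1)[of r])
     show "G y ~= None" if "y : ball x r" for y
     proof -
      have "kp y ~= 0" using r(3) False that by (cases "y = x") auto
      thus ?thesis using G subsetD[OF sub that] by simp
     qed
    qed (use r sub e in auto)
   qed
  qed
 qed
qed

lemma sphere_holomorphic_apply:
 assumes D: "open D" "D <= \<Lambda>" and zt: "zt holomorphic_on D"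
 shows "sphere_holomorphic D (%x. sph (f x) (zt x))"
 unfolding sphere_holomorphic_def
proof
 fix x assume x: "x : D"
 hence xL: "x : \<Lambda>" using D by blast
 show "EX e>0. EX kp. ball x e <= D & kp holomorphic_on ball x e &
  ((ALL y:ball x e. sph (f y) (zt y) = Some (kp y)) |
   (ALL y:ball x e. sph (f y) (zt y) = (if kp y = 0 then None else Some (inverse (kp y)))))"
 proof (cases "pole x (zt x)")
  case True
  obtain e where e: "chart (%x z. inverse (f x z)) x (zt x) e"
   "!!y z. y : ball x e ==> z : ball (zt x) e ==> pole y z \<longleftrightarrow> f y z = 0"
   by (rule pole_chart[OF xL True]) blast
  obtain d where d: "0 < d" "ball x d <= D" "ball x d <= ball x e" "zt ` ball x d <= ball (zt x) e"
   "(%x. inverse (f x (zt x))) holomorphic_on ball x d"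
   by (rule chart_compose[OF e(1) D(1) x zt refl]) blast
  have "sph (f y) (zt y) = (if inverse (f y (zt y)) = 0 then None else Some (inverse (inverse (f y (zt y)))))"
   if y: "y : ball x d" for y
  proof -
   have "zt y : ball (zt x) e" "y : ball x e" using d(3,4) y by blast+
   thus ?thesis using e(2)[of y "zt y"] by (simp add: sph_def)
  qed
  thus ?thesis using d(1,2,5) by blast
 next
  case False
  obtain e where e: "chart f x (zt x) e" "!!y z. y : ball x e ==> z : ball (zt x) e ==> ~ pole y z"
   by (rule finite_chart[OF xL False]) blast
  obtain d where d: "0 < d" "ball x d <= D" "ball x d <= ball x e" "zt ` ball x d <= ball (zt x) e"
   "(%x. f x (zt x)) holomorphic_on ball x d"
   by (rule chart_compose[OF e(1) D(1) x zt refl]) blast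
  have "sph (f y) (zt y) = Some (f y (zt y))" if y: "y : ball x d" for y
  proof -
   have "zt y : ball (zt x) e" "y : ball x e" using d(3,4) y by blast+
   thus ?thesis using e(2)[of y "zt y"] by (simp add: sph_def)
  qed
  thus ?thesis using d(1,2,5) by blast
 qed
qed

text \<open>Along suitable sequences tending to \<open>x1\<close> the next iterate has the limit v
  x1 + exp u, for many different values of exp u.\<close>

lemma no_continuous_image_of_pole:
 assumes x1: "x1 : \<Lambda>" and kp: "kp holomorphic_on ball x1 r" "0 < r" "kp x1 = 0"
  "!!x. x : ball x1 r - {x1} ==> kp x ~= 0"
  and G': "isCont (%x. stereo (G' x)) x1" "!!x. x : ball x1 r - {x1} ==> G' x = sph (f x) (inverse (kp x))"
 shows False
proof -
 obtain A where A: "!!u eps. Re u <= A ==> 0 < eps ==> EX x. x ~= x1 & dist x x1 < eps & x : ball x1 r &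
   ~ pole x (inverse (kp x)) & f x (inverse (kp x)) = v x + exp u"
  by (rule essential_singularity[OF x1 kp]) blast+
 have lim: "stereo (G' x1) = stereo (Some (v x1 + exp u))" if u: "Re u <= A" for u
 proof -
  have "ALL n. EX x. x ~= x1 & dist x x1 < inverse (real (Suc n)) & x : ball x1 r &
   ~ pole x (inverse (kp x)) & f x (inverse (kp x)) = v x + exp u"
   using A[OF u] by simp
  from choice[OF this] obtain X where X: "!!n. X n ~= x1 & dist (X n) x1 < inverse (real (Suc n)) & X n : ball x1 r &
   ~ pole (X n) (inverse (kp (X n))) & f (X n) (inverse (kp (X n))) = v (X n) + exp u" by blast
  have Xl: "X ----> x1"
  proof (rule metric_LIMSEQ_I)
   fix e :: real assume "0 < e"
   then obtain N where N: "inverse (real (Suc N)) < e" using reals_Archimedean by blast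
   have "dist (X n) x1 < e" if "n >= N" for n
   proof -
    have "dist (X n) x1 < inverse (real (Suc n))" using X by blast
    also have "... <= inverse (real (Suc N))" using that by (simp add: le_imp_inverse_le)
    finally show ?thesis using N by simp
   qed
   thus "EX N. ALL n>=N. dist (X n) x1 < e" by blast
  qed
  have eq: "stereo (G' (X n)) = stereo (Some (v (X n) + exp u))" for n
   using G'(2)[of "X n"] X[of n] by (simp add: sph_def)
  have "(%n. stereo (G' (X n))) ----> stereo (G' x1)" by (rule isCont_tendsto_compose[OF G'(1) Xl])
  moreover have "(%n. stereo (G' (X n))) ----> stereo (Some (v x1 + exp u))"
   unfolding eq by (intro stereo_Some_tendsto tendsto_intros isCont_tendsto_compose[OF v_isCont[OF x1] Xl])
  ultimately show ?thesis by (rule LIMSEQ_unique)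
 qed
 \<comment> \<open>Two exponents that differ by pi i give opposite exponentials.\<close>
 have "stereo (Some (v x1 + exp (of_real A))) = stereo (Some (v x1 + exp (of_real A + \<i> * of_real pi)))"
  using lim[of "of_real A"] lim[of "of_real A + \<i> * of_real pi"] by simp
 hence "exp (complex_of_real A) = exp (of_real A + \<i> * of_real pi)" by (simp only: stereo_injective option.inject add_left_cancel)
 thus False by (simp add: exp_add exp_pi_i')
qed

text \<open>Near each parameter \<open>G\<close> is finite, or identically infinite, or infinite
  only at that parameter. The last case is excluded by continuity of the next iterate, so finiteness
  is open and closed.\<close>

lemma never_infinite:
 assumes D: "open D" "connected D" "D <= \<Lambda>" and G: "sphere_holomorphic D G"
  and G': "continuous_on D (%x. stereo (G' x))" "!!x z. x : D ==> G x = Some z ==> G' x = sph (f x) z"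
  and y: "y : D" "G y ~= None" and x: "x : D"
 shows "G x ~= None"
proof (rule connected_induction_simple[where S = D and P = "%x. G x ~= None" and a = y and b = x])
 fix a assume a: "a : D"
 have aL: "a : \<Lambda>" using a D by blast
 have op: "openin (top_of_set D) (ball a e)" if "ball a e <= D" for e
  using that D(1) by (simp add: openin_open_eq)
 show "EX T. openin (top_of_set D) T & a : T & (ALL x:T. ALL y:T. G x ~= None --> G y ~= None)"
 proof (rule sphere_holomorphic_alternative[OF G a])
  fix e assume e: "e > 0" "ball a e <= D" "!!y. y : ball a e ==> G y ~= None"
  thus ?thesis using op[OF e(2)] by (intro exI[of _ "ball a e"]) auto
 next
  fix e assume e: "e > 0" "ball a e <= D" "!!y. y : ball a e ==> G y = None"
  thus ?thesis using op[OF e(2)] by (intro exI[of _ "ball a e"]) auto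
 next
  fix e kp assume e: "e > 0" "ball a e <= D" "kp holomorphic_on ball a e" "kp a = 0" "G a = None"
   "!!y. y : ball a e - {a} ==> kp y ~= 0 & G y = Some (inverse (kp y))"
  have False
  proof (rule no_continuous_image_of_pole[OF aL e(3,1,4), of G'])
   show "isCont (%x. stereo (G' x)) a" using G'(1) a D(1) by (simp add: continuous_on_eq_continuous_at)
   show "G' x = sph (f x) (inverse (kp x))" if "x : ball a e - {a}" for x
    using G'(2)[of x "inverse (kp x)"] e(2,6) that by blast
  qed (use e(6) in blast)
  thus ?thesis ..
 qed
qed (use D y x in auto)

lemma orbit_eq: "orbit (f x) z n = (if regular n x z then Some ((f x ^^ n) z) else None)"
proof (induction n)
 case 0 thus ?case by (simp add: orbit_def)
next
 case (Suc n)
 have "orbit (f x) z (Suc n) = Option.bind (orbit (f x) z n) (sph (f x))" by (simp add: orbit_def)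
 thus ?case unfolding Suc.IH by (auto simp: regular_Suc sph_def)
qed

lemma not_constant:
 assumes x: "x : \<Lambda>" and S: "open S" "S ~= {}"
 shows "EX z:S. f x z ~= c"
proof (rule ccontr)
 assume "~ ?thesis"
 hence eq: "!!z. z : S ==> f x z = c" by blast
 obtain z where z: "z : S" using S by blast
 have "\<forall>\<^sub>F w in at z. f x w = c"
  using eventually_at_in_open'[OF S(1) z] by eventually_elim (rule eq)
 hence "\<exists>\<^sub>F w in at z. f x w = c" by (simp add: eventually_frequently)
 from frequently_eq_meromorphic_imp_constant[OF this nicely[OF x] open_UNIV connected_UNIV UNIV_I UNIV_I]
 have fc: "f x = (%_. c)" by (intro ext)
 have "{z. pole x z} ~= {}" using infinite_poles[OF x] by (intro notI) simp
 then obtain p where "pole x p" by blast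
 hence "filterlim (%_. c) at_infinity (at p)" by (simp only: is_pole_def fc)
 thus False using not_tendsto_and_filterlim_at_infinity[OF at_neq_bot tendsto_const] by blast
qed

text \<open>By the open mapping theorem the image of a small disc off the poles is open, so the
  induction hypothesis applies to it. A point with a non-zero value is not a pole, since poles carry
  the value 0.\<close>

lemma generic_regular:
 assumes x: "x : \<Lambda>" and S: "open S" "S ~= {}"
 shows "EX w:S. regular n x w"
 using S
proof (induction n arbitrary: S)
 case 0 thus ?case by auto
next
 case (Suc n)
 obtain z where z: "z : S" "f x z ~= 0" using not_constant[OF x Suc.prems] by blast
 hence np: "~ pole x z" using zero_at_pole[OF x] by blast
 have "((%w. (x, w)) ---> (x, z)) (nhds z)" by (intro tendsto_Pair) (auto intro: filterlim_ident)
 from eventually_compose_filterlim[OF near_nonpole(1)[OF x np] this]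
 have "\<forall>\<^sub>F w in nhds z. ~ pole x w" by eventually_elim simp
 with eventually_nhds_in_open[OF Suc.prems(1) z(1)] have "\<forall>\<^sub>F w in nhds z. ~ pole x w & w : S"
  by eventually_elim simp
 then obtain r where r: "r > 0" "!!w. dist w z < r ==> ~ pole x w & w : S"
  unfolding eventually_nhds_metric by blast
 have "f x holomorphic_on ball z r" by (rule holomorphic_off_poles[OF x]) (use r in "auto simp: dist_commute")
 hence "open (f x ` ball z r)"
 proof (rule open_mapping_thm)
  show "~ f x constant_on ball z r"
   using not_constant[OF x open_ball, of z r] r(1) unfolding constant_on_def by (metis centre_in_ball empty_iff)
 qed auto
 moreover have "f x ` ball z r ~= {}" using r by simp
 ultimately obtain w where w: "w : f x ` ball z r" "regular n x w" using Suc.IH by blast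
 then obtain y where "y : ball z r" "w = f x y" by blast
 thus ?case using r(2)[of y] w(2) by (intro bexI[of _ y]) (auto simp: regular_Suc' dist_commute)
qed

section \<open>Parameters at which the free asymptotic value lands on a pole\<close>

text \<open>The virtual cycle parameters of order m + 2: a pole is met after \<open>m\<close> steps
  and infinity after m + 1, and infinity itself is the remaining point of the virtual cycle.\<close>

definition landing_set :: "nat => complex set" where
 "landing_set m = {x : \<Lambda>. regular m x (v x) & pole x ((f x ^^ m) (v x))}"

lemma landing_alternative:
 assumes x: "x : \<Lambda>" "regular m x (v x)"
 obtains e where "e > 0" "ball x e <= {x : \<Lambda>. regular m x (v x)}" "ball x e \<inter> landing_set m = {}"
 | e where "e > 0" "ball x e <= landing_set m"
 | e kp where "e > 0" "ball x e <= {x : \<Lambda>. regular m x (v x)}" "kp holomorphic_on ball x e" "kp x = 0" "x : landing_set m"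
   "!!y. y : ball x e - {x} ==> kp y ~= 0 & ~ pole y ((f y ^^ m) (v y)) & f y ((f y ^^ m) (v y)) = inverse (kp y)"
proof -
 let ?D = "{x : \<Lambda>. regular m x (v x)}"
 have D: "open ?D"
  unfolding open_subopen[of ?D]
 proof safe
  fix y assume "y : \<Lambda>" "regular m y (v y)"
  hence "\<forall>\<^sub>F x in nhds y. x : \<Lambda> & regular m x (v x)" using regular_along(1)[of y m v] v_isCont by blast
  thus "EX T. open T & y : T & T <= ?D" unfolding eventually_nhds by blast
 qed
 have h: "(%x. (f x ^^ m) (v x)) holomorphic_on ?D"
  by (rule iterate_parameter_holomorphic[OF D]) (auto intro: holomorphic_on_subset[OF v_holomorphic])
 have sh: "sphere_holomorphic ?D (%x. sph (f x) ((f x ^^ m) (v x)))"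
  by (rule sphere_holomorphic_apply[OF D _ h]) auto
 have xD: "x : ?D" using x by simp
 have L: "y : landing_set m \<longleftrightarrow> sph (f y) ((f y ^^ m) (v y)) = None" if "y : ?D" for y
  using that by (auto simp: landing_set_def sph_def)
 show ?thesis
 proof (rule sphere_holomorphic_alternative[OF sh xD])
  fix e assume e: "e > 0" "ball x e <= ?D" "!!y. y : ball x e ==> sph (f y) ((f y ^^ m) (v y)) ~= None"
  have "ball x e \<inter> landing_set m = {}" using e(3) L[OF subsetD[OF e(2)]] by blast
  thus ?thesis by (rule that(1)[OF e(1,2)])
 next
  fix e assume e: "e > 0" "ball x e <= ?D" "!!y. y : ball x e ==> sph (f y) ((f y ^^ m) (v y)) = None"
  have "ball x e <= landing_set m" using e(3) L[OF subsetD[OF e(2)]] by blast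
  thus ?thesis by (rule that(2)[OF e(1)])
 next
  fix e kp assume e: "e > 0" "ball x e <= ?D" "kp holomorphic_on ball x e" "kp x = 0" "sph (f x) ((f x ^^ m) (v x)) = None"
   "!!y. y : ball x e - {x} ==> kp y ~= 0 & sph (f y) ((f y ^^ m) (v y)) = Some (inverse (kp y))"
  show ?thesis
  proof (rule that(3)[OF e(1-4)])
   show "x : landing_set m" using L[OF xD] e(5) by simp
   show "kp y ~= 0 & ~ pole y ((f y ^^ m) (v y)) & f y ((f y ^^ m) (v y)) = inverse (kp y)"
    if "y : ball x e - {x}" for y using e(6)[OF that] by (auto simp: sph_def split: if_splits)
  qed
 qed
qed

lemma landing_first:
 assumes x: "x : \<Lambda>" and nr: "~ regular n x (v x)"
 shows "EX i<n. x : landing_set i"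
proof -
 let ?P = "%j. pole x ((f x ^^ j) (v x))"
 define i where "i = Least ?P"
 obtain j where j: "j < n" "?P j" using nr by (auto simp: regular_def)
 have "?P i" unfolding i_def by (rule LeastI[of ?P, OF j(2)])
 moreover have "i <= j" unfolding i_def by (rule Least_le[of ?P, OF j(2)])
 moreover have "regular i x (v x)" unfolding regular_def i_def using not_less_Least by blast
 ultimately show ?thesis using x j(1) by (intro exI[of _ i]) (auto simp: landing_set_def)
qed

text \<open>Take the first \<open>n\<close> with interior. Landing times below \<open>n\<close>
  occur at isolated parameters, so landing at time \<open>n\<close> spreads to all others by
  connectedness. If there are no earlier landings, all orbits of \<open>v\<close> end simultaneously
  and \<open>v\<close> is passive everywhere. If there is one, parameters near it have orbits that
  survive beyond time \<open>n\<close>.\<close>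

lemma landing_set_interior:
 "interior (landing_set m) = {}"
proof (rule ccontr)
 assume "interior (landing_set m) ~= {}"
 define n where "n = (LEAST m. interior (landing_set m) ~= {})"
 have n: "interior (landing_set n) ~= {}"
  unfolding n_def by (rule LeastI[of "%m. interior (landing_set m) ~= {}", OF \<open>interior (landing_set m) ~= {}\<close>])
 have less: "interior (landing_set i) = {}" if "i < n" for i
  using not_less_Least[of i "%m. interior (landing_set m) ~= {}"] that unfolding n_def by blast
 let ?D = "{x : \<Lambda>. regular n x (v x)}"
 have iso: "EX e kp. e > 0 & ball x e <= {x : \<Lambda>. regular i x (v x)} & kp holomorphic_on ball x e & kp x = 0 &
   (ALL y:ball x e - {x}. kp y ~= 0 & ~ pole y ((f y ^^ i) (v y)) & f y ((f y ^^ i) (v y)) = inverse (kp y))"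
  if i: "i < n" and x: "x : landing_set i" for i x
 proof -
  have xr: "x : \<Lambda>" "regular i x (v x)" using x by (auto simp: landing_set_def)
  show ?thesis
  proof (rule landing_alternative[OF xr])
   fix e assume "e > 0" "ball x e <= {x : \<Lambda>. regular i x (v x)}" "ball x e \<inter> landing_set i = {}"
   thus ?thesis using x centre_in_ball by blast
  next
   fix e assume "e > 0" "ball x e <= landing_set i"
   thus ?thesis using less[OF i] interior_maximal[OF _ open_ball] centre_in_ball by blast
  qed blast
 qed
 have cnt: "countable (landing_set i)" if i: "i < n" for i
 proof (rule countable_discrete)
  fix x assume x: "x : landing_set i"
  obtain e kp where e: "e > 0" "ALL y:ball x e - {x}. ~ pole y ((f y ^^ i) (v y))" using iso[OF i x] by blast
  hence "ball x e \<inter> landing_set i <= {x}" by (auto simp: landing_set_def)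
  thus "EX e>0. ball x e \<inter> landing_set i <= {x}" using e(1) by blast
 qed
 have Deq: "?D = \<Lambda> - (\<Union>i<n. landing_set i)"
  using landing_first by (auto simp: landing_set_def regular_def)
 \<comment> \<open>Removing a countable set from a connected open set of the plane leaves it
   connected.\<close>
 have conn: "connected ?D"
  unfolding Deq by (intro connected_open_diff_countable) (use connected_params open_params cnt in auto)
 obtain x2 r2 where x2: "r2 > 0" "ball x2 r2 <= landing_set n" using n by (meson ex_in_conv mem_interior)
 have "x2 : landing_set n" using x2 centre_in_ball by blast
 hence x2D: "x2 : ?D" by (simp add: landing_set_def)
 have all: "x : landing_set n" if x: "x : ?D" for x
 proof -
  have "EX r>0. ball x r <= landing_set n"
  proof (rule connected_induction_simple[where S = ?D and P = "%x. EX r>0. ball x r <= landing_set n" and a = x2 and b = x])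
   fix a assume a: "a : ?D"
   hence ar: "a : \<Lambda>" "regular n a (v a)" by auto
   have op: "openin (top_of_set ?D) (ball a e)" if "ball a e <= ?D" for e
    using that by (metis open_ball openin_open_Int inf.absorb2)
   have "EX e>0. ball a e <= ?D & (ball a e <= landing_set n | ball a e \<inter> landing_set n <= {a})"
   proof (rule landing_alternative[OF ar])
    fix e assume e: "e > 0" "ball a e <= landing_set n"
    moreover have "landing_set n <= ?D" by (auto simp: landing_set_def)
    ultimately show ?thesis by blast
   next
    fix e kp assume e: "e > 0" "ball a e <= ?D"
     "!!y. y : ball a e - {a} ==> kp y ~= 0 & ~ pole y ((f y ^^ n) (v y)) & f y ((f y ^^ n) (v y)) = inverse (kp y)"
    have "ball a e \<inter> landing_set n <= {a}" using e(3) unfolding landing_set_def by blast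
    thus ?thesis using e(1,2) by blast
   qed blast
   then obtain e where e: "e > 0" "ball a e <= ?D" "ball a e <= landing_set n | ball a e \<inter> landing_set n <= {a}" by blast
   show "EX T. openin (top_of_set ?D) T & a : T & (ALL x:T. ALL y:T. (EX r>0. ball x r <= landing_set n) --> (EX r>0. ball y r <= landing_set n))"
   proof (intro exI[of _ "ball a e"] conjI ballI impI)
    show "openin (top_of_set ?D) (ball a e)" by (rule op[OF e(2)])
    show "a : ball a e" using e(1) by simp
    fix x y assume xy: "x : ball a e" "y : ball a e" and "EX r>0. ball x r <= landing_set n"
    then obtain r where r: "r > 0" "ball x r <= landing_set n" by blast
    from e(3) show "EX r>0. ball y r <= landing_set n"
    proof
     assume "ball a e <= landing_set n"
     moreover have "EX s>0. ball y s <= ball a e" using xy(2) open_ball[of a e] unfolding open_contains_ball by blast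
     ultimately show ?thesis by blast
    next
     assume s: "ball a e \<inter> landing_set n <= {a}"
     have "open (ball x r \<inter> ball a e)" "x : ball x r \<inter> ball a e" using r(1) xy(1) by auto
     moreover have "ball x r \<inter> ball a e <= {a}" using s r(2) by blast
     ultimately show ?thesis using finite_subset[of _ "{a}"] finite_imp_not_open[of "ball x r \<inter> ball a e"] by blast
    qed
   qed
  qed (use conn x2D x x2 in blast)+
  thus ?thesis using centre_in_ball by blast
 qed
 show False
 proof (cases "?D = \<Lambda>")
  case True
  have reg: "regular m x (v x) \<longleftrightarrow> m <= n" if x: "x : \<Lambda>" for x m
  proof -
   have "x : landing_set n" using all True x by blast
   hence 1: "regular n x (v x)" "~ regular (Suc n) x (v x)" by (auto simp: landing_set_def regular_Suc)
   show ?thesis using regular_mono[OF 1(1), of m] regular_mono[of m x "v x" "Suc n"] 1(2) by (meson not_less_eq_eq)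
  qed
  have None: "orbit (f x) (v x) m = None" if "x : \<Lambda>" "m > n" for x m using reg[OF that(1), of m] that(2) by (simp add: orbit_eq)
  \<comment> \<open>All iterates after time \<open>n\<close> are constantly infinity, so the
    sequence counts as normal on the whole slice, contradicting \<open>active\<close>.\<close>
  have "normal_sequence_on \<Lambda> (%n x. orbit (f x) (v x) n)"
   unfolding normal_sequence_on_def
  proof (intro conjI allI impI)
   fix m
   show "continuous_on \<Lambda> (stereo \<circ> (%x. orbit (f x) (v x) m))"
   proof (cases "m <= n")
    case True
    have "(%x. (f x ^^ m) (v x)) holomorphic_on \<Lambda>"
     by (rule iterate_parameter_holomorphic[OF open_params order_refl v_holomorphic]) (use reg True in blast)
    from holomorphic_stereo[OF this] show ?thesis by (rule continuous_on_eq) (simp add: orbit_eq reg True)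
   next
    case False
    hence "continuous_on \<Lambda> (%x. stereo None)" "!!x. x : \<Lambda> ==> stereo None = (stereo \<circ> (%x. orbit (f x) (v x) m)) x"
     using None by auto
    thus ?thesis by (rule continuous_on_eq)
   qed
  next
   fix a :: "nat => nat" assume a: "strict_mono a"
   have "uniform_limit K (%j. stereo \<circ> (%x. orbit (f x) (v x) (a (j + Suc n)))) (%x. stereo None) sequentially"
    if K: "K <= \<Lambda>" for K
   proof (rule uniform_limitI)
    fix e :: real assume e: "e > 0"
    have "dist ((stereo \<circ> (%x. orbit (f x) (v x) (a (j + Suc n)))) x) (stereo None) < e" if "x : K" for j x
    proof -
     have "n < a (j + Suc n)" using seq_suble[OF a, of "j + Suc n"] by simp
     thus ?thesis using None[of x "a (j + Suc n)"] that K e by auto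
    qed
    thus "\<forall>\<^sub>F j in sequentially. ALL x:K. dist ((stereo \<circ> (%x. orbit (f x) (v x) (a (j + Suc n)))) x) (stereo None) < e"
     by simp
   qed
   moreover have "strict_mono (%j. j + Suc n)" by (simp add: strict_mono_def)
   ultimately show "EX b h. strict_mono b & (ALL K. compact K & K <= \<Lambda> -->
     uniform_limit K (%j. stereo \<circ> (%x. orbit (f x) (v x) (a (b j)))) h sequentially)"
    by (intro exI[of _ "%j. j + Suc n"] exI[of _ "%x. stereo None"]) blast
  qed
  hence "activity_locus \<Lambda> f v = {}" using open_params unfolding activity_locus_def by blast
  thus False using active by blast
 next
  case False
  then obtain y i where i: "i < n" "y : landing_set i" using landing_first by blast
  have yL: "y : \<Lambda>" using i(2) by (simp add: landing_set_def)
  obtain e kp where e: "e > 0" "ball y e <= {x : \<Lambda>. regular i x (v x)}" "kp holomorphic_on ball y e" "kp y = 0"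
   "!!x. x : ball y e - {y} ==> kp x ~= 0 & ~ pole x ((f x ^^ i) (v x)) & f x ((f x ^^ i) (v x)) = inverse (kp x)"
   using iso[OF i] by blast
  obtain A where A: "!!u eps. Re u <= A ==> 0 < eps ==> EX x. x ~= y & dist x y < eps & x : ball y e &
   ~ pole x (inverse (kp x)) & f x (inverse (kp x)) = v x + exp u"
   by (rule essential_singularity[OF yL e(3,1,4)]) (use e(5) in blast)+
  have "open (ball (v y) (exp A) - {v y})" by (intro open_Diff) auto
  moreover have "ball (v y) (exp A) - {v y} ~= {}" using exp_in_ball[of "of_real (A - 1)" A "v y"] by auto
  \<comment> \<open>A target near \<open>v y\<close> with \<open>n\<close> finite iterates. The
    essential singularity at the earlier landing \<open>y\<close> makes the orbit of
    \<open>v x\<close> hit v x + exp u, close to this target, so that it lives for i + 2 + n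
    steps.\<close>
  ultimately obtain w where w: "w : ball (v y) (exp A) - {v y}" "regular n y w" using generic_regular[OF yL] by blast
  define u where "u = Ln (w - v y)"
  have eu: "v y + exp u = w" using w(1) by (simp add: u_def)
  have "exp (Re u) = cmod (w - v y)" using w(1) by (simp add: u_def)
  also have "... < exp A" using w(1) by (simp add: dist_norm norm_minus_commute)
  finally have u: "Re u <= A" by simp
  have vt: "(v ---> v y) (nhds y)" using v_isCont[OF yL] by (simp add: isCont_def tendsto_at_iff_tendsto_nhds)
  have "((%x. (x, v x + exp u)) ---> (y, w)) (nhds y)"
   unfolding eu[symmetric] by (intro tendsto_intros vt filterlim_ident)
  from eventually_compose_filterlim[OF near_regular(1)[OF yL w(2)] this]
  obtain eps where eps: "eps > 0" "!!x. dist x y < eps ==> regular n x (v x + exp u)"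
   unfolding eventually_nhds_metric by auto
  obtain x where x: "x ~= y" "dist x y < eps" "x : ball y e" "~ pole x (inverse (kp x))" "f x (inverse (kp x)) = v x + exp u"
   using A[OF u eps(1)] by blast
  have x': "regular i x (v x)" "x : \<Lambda>" "~ pole x ((f x ^^ i) (v x))" "f x ((f x ^^ i) (v x)) = inverse (kp x)"
   using e(2,5) x(1,3) by auto
  have "regular 2 x ((f x ^^ i) (v x))"
   using x' x(4) by (simp add: numeral_2_eq_2 regular_Suc)
  hence r2: "regular (i + 2) x (v x)" using x'(1) by (simp only: regular_add)
  have "(f x ^^ (i + 2)) (v x) = v x + exp u" using x'(4) x(5) by (simp add: funpow_add[symmetric])
  hence big: "regular (i + 2 + n) x (v x)" using r2 eps(2)[OF x(2)] regular_add[of "i + 2" n x "v x"] by simp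
  have "regular n x (v x)" by (rule regular_mono[OF big]) simp
  hence "x : landing_set n" using all x'(2) by blast
  hence "~ regular (Suc n) x (v x)" by (auto simp: landing_set_def regular_Suc)
  thus False using regular_mono[OF big, of "Suc n"] by simp
 qed
qed

lemma isolated_landing:
 assumes "x : landing_set m"
 obtains e kp where "e > 0" "ball x e <= \<Lambda>" "!!y. y : ball x e ==> regular m y (v y)"
  "kp holomorphic_on ball x e" "kp x = 0" "!!y. y : ball x e - {x} ==> kp y ~= 0"
  "!!y. y : ball x e - {x} ==> ~ pole y ((f y ^^ m) (v y))"
  "!!y. y : ball x e - {x} ==> f y ((f y ^^ m) (v y)) = inverse (kp y)"
proof -
 have x: "x : \<Lambda>" "regular m x (v x)" using assms by (auto simp: landing_set_def)
 show ?thesis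
 proof (rule landing_alternative[OF x])
  fix e assume "e > 0" "ball x e \<inter> landing_set m = {}"
  thus ?thesis using assms centre_in_ball by blast
 next
  fix e assume "e > 0" "ball x e <= landing_set m"
  thus ?thesis using landing_set_interior[of m] interior_maximal[OF _ open_ball] centre_in_ball by blast
 next
  fix e kp assume e: "e > 0" "ball x e <= {x : \<Lambda>. regular m x (v x)}" "kp holomorphic_on ball x e" "kp x = 0"
   "!!y. y : ball x e - {x} ==> kp y ~= 0 & ~ pole y ((f y ^^ m) (v y)) & f y ((f y ^^ m) (v y)) = inverse (kp y)"
  show ?thesis by (rule that[OF e(1) _ _ e(3,4)]) (use e(2,5) in auto)
 qed
qed

end

section \<open>Virtual cycle parameters\<close>

context natural_slice
begin

section \<open>A connected set of parameters ending at a virtual cycle parameter\<close>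

text \<open>Take the parameters where 1/kp lies in the part of the tract over a small half-disc. A
  component of this set whose closure missed \<open>x1\<close> would carry a holomorphic function of
  modulus at most 1 on the frontier and more than 1 inside.\<close>

lemma asymptotic_component:
 assumes tr: "tract x1 rh A H" and kp: "kp holomorphic_on ball x1 r" "0 < r" "kp x1 = 0"
  "!!x. x : ball x1 r - {x1} ==> kp x ~= 0" and dl0: "0 < dl0"
 obtains S where "open S" "connected S" "x1 : closure S"
  "!!x. x : S ==> x ~= x1 & dist x x1 < dl0 & (EX u. Re u < - M & \<bar>Im u\<bar> < pi & inverse (kp x) = H x u)"
proof -
 define dl where "dl = min dl0 (min r rh) / 2"
 have dl: "0 < dl" "dl < dl0" "dl < r" "dl < rh" using dl0 kp(2) tractD(1)[OF tr] by (auto simp: dl_def)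
 have sub: "cball x1 dl <= ball x1 r" "cball x1 dl <= ball x1 rh" using dl by auto
 have ckp: "continuous_on (sphere x1 dl) kp"
  by (rule holomorphic_on_imp_continuous_on[OF holomorphic_on_subset[OF kp(1)]]) (use dl in auto)
 have "continuous_on (sphere x1 dl) (%x. cmod (kp x))" by (intro continuous_intros ckp)
 moreover have ne: "sphere x1 dl ~= {}" using dl(1) by simp
 ultimately obtain y0 where y0: "y0 : sphere x1 dl" "!!x. x : sphere x1 dl ==> cmod (kp y0) <= cmod (kp x)"
  using continuous_attains_inf[OF compact_sphere, of x1 dl "%x. cmod (kp x)"] by blast
 define m where "m = cmod (kp y0)"
 have m: "m > 0" using kp(4)[of y0] y0(1) dl by (auto simp: m_def)
 obtain M1 where M1: "!!x u. x : ball x1 rh ==> Re u <= A - 1 ==> cmod u > M1 ==> cmod (H x u) > 2 / m"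
  using tractD(10)[OF tr, of "2/m"] by blast
 define M' where "M' = max (max M M1) (max 0 (1 - A))"
 have M': "M <= M'" "M1 <= M'" "0 <= M'" "1 - A <= M'" by (auto simp: M'_def)
 have farD: "Re u <= A - 1" "Re u < A" "cmod u > M1" if "Re u < - M'" for u
  using that M' abs_Re_le_cmod[of u] by linarith+
 define c where "c x = inverse (kp x)" for x
 \<comment> \<open>When c x = H x u, this is exp u. Working with \<open>E\<close> keeps everything
   holomorphic in the parameter, without a choice of u.\<close>
 define E where "E x = f x (c x) - v x" for x
 define D0 where "D0 = ball x1 dl - {x1}"
 define N where "N = {x : D0. ~ pole x (c x)}"
 \<comment> \<open>The half-disc Re E > 0 is used so that the closure avoids the cut of
   \<open>Ln\<close> once E = 0 has been excluded.\<close>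
 define T where "T = {x : N. 0 < Re (E x) & cmod (E x) < exp (- M') & c x = H x (Ln (E x))}"
 have D0: "open D0" unfolding D0_def by (intro open_Diff) auto
 have D0L: "D0 <= \<Lambda>" using sub(2) tractD(2)[OF tr] ball_subset_cball[of x1 dl] unfolding D0_def by blast
 have D0rh: "x : ball x1 rh" "x : ball x1 r" "x ~= x1" if "x : D0" for x using that dl by (auto simp: D0_def)
 have ch: "c holomorphic_on D0" unfolding c_def
  by (intro holomorphic_intros holomorphic_on_subset[OF kp(1)]) (use D0rh kp(4) in auto)
 have cc: "isCont c x" if "x : D0" for x by (rule holomorphic_isCont[OF ch D0 that])
 have N: "open N"
  unfolding open_subopen[of N]
 proof
  fix x assume x: "x : N"
  hence xL: "x : \<Lambda>" and np: "~ pole x (c x)" and xD: "x : D0" using D0L by (auto simp: N_def)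
  have "((%y. (y, c y)) ---> (x, c x)) (nhds x)"
   using cc[OF xD] by (intro tendsto_Pair filterlim_ident) (simp add: isCont_def tendsto_at_iff_tendsto_nhds)
  from eventually_compose_filterlim[OF near_nonpole(1)[OF xL np] this] eventually_nhds_in_open[OF D0 xD]
  have "\<forall>\<^sub>F y in nhds x. y : N" by eventually_elim (simp add: N_def)
  thus "EX T. open T & x : T & T <= N" unfolding eventually_nhds by blast
 qed
 have NL: "N <= \<Lambda>" "N <= D0" using D0L by (auto simp: N_def)
 have Eh: "E holomorphic_on N"
  unfolding E_def
  by (intro holomorphic_on_diff holomorphic_apply(1)[OF N NL(1)] holomorphic_on_subset[OF ch NL(2)]
    holomorphic_on_subset[OF v_holomorphic NL(1)]) (simp add: N_def)
 have Ec: "isCont E x" if "x : N" for x by (rule holomorphic_isCont[OF Eh N that])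
 have Elim: "(E ---> E x) (nhds x)" if "x : N" for x
  using Ec[OF that] by (simp add: isCont_def tendsto_at_iff_tendsto_nhds)
 have ReLn: "Re (Ln (E x)) < - M'" if "cmod (E x) < exp (- M')" "E x ~= 0" for x
 proof -
  have "exp (ln (cmod (E x))) < exp (- M')" using that by simp
  hence "ln (cmod (E x)) < - M'" by (simp only: exp_less_cancel_iff)
  thus ?thesis using that(2) by simp
 qed
 have TD: "x : N" "x : D0" "E x ~= 0" "Re (Ln (E x)) < - M'" "\<bar>Im (Ln (E x))\<bar> < pi / 2" "c x = H x (Ln (E x))"
  "E x ~: \<real>\<^sub>\<le>\<^sub>0" if "x : T" for x
 proof -
  have x: "x : N" "0 < Re (E x)" "cmod (E x) < exp (- M')" "c x = H x (Ln (E x))" using that by (auto simp: T_def)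
  show E0: "E x ~= 0" using x(2) by auto
  show "x : N" "x : D0" "c x = H x (Ln (E x))" using x NL by auto
  show "Re (Ln (E x)) < - M'" by (rule ReLn[OF x(3) E0])
  show "\<bar>Im (Ln (E x))\<bar> < pi / 2" by (rule Re_Ln_pos_lt_imp[OF x(2)])
  show "E x ~: \<real>\<^sub>\<le>\<^sub>0" using x(2) by (auto simp: complex_nonpos_Reals_iff)
 qed
 have Hlim: "((%y. H y (Ln (E y))) ---> H x (Ln (E x))) (nhds x)"
  if "x : N" "E x ~: \<real>\<^sub>\<le>\<^sub>0" "Re (Ln (E x)) < A" for x
 proof -
  have "((%y. (y, Ln (E y))) ---> (x, Ln (E x))) (nhds x)"
   by (intro tendsto_Pair filterlim_ident tendsto_Ln Elim that)
  from filterlim_compose[OF tractD(8)[OF tr D0rh(1) that(3)] this] NL(2) that(1) show ?thesis by auto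
 qed
 have T: "open T"
  unfolding open_subopen[of T]
 proof
  fix x assume x: "x : T"
  note xD = TD[OF x]
  have xL: "x : \<Lambda>" using xD(1) NL by blast
  have uA: "Re (Ln (E x)) < A" by (rule farD(2)[OF xD(4)])
  have np: "~ pole x (c x)" "deriv (f x) (c x) ~= 0"
   using tractD(3,5)[OF tr D0rh(1)[OF xD(2)] uA] xD(6) by auto
  obtain e where e: "chart f x (c x) e" "!!y. y : ball x e ==> inj_on (f y) (ball (c x) e)"
   by (rule local_injectivity[OF xL np]) blast
  have e0: "e > 0" using e(1) by (simp add: chart_def)
  have "(c ---> c x) (nhds x)" using cc[OF xD(2)] by (simp add: isCont_def tendsto_at_iff_tendsto_nhds)
  hence ev1: "\<forall>\<^sub>F y in nhds x. c y : ball (c x) e" by (rule topological_tendstoD) (use e0 in auto)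
  have ev2: "\<forall>\<^sub>F y in nhds x. H y (Ln (E y)) : ball (c x) e"
   by (rule topological_tendstoD[OF Hlim[OF xD(1,7) uA]]) (use e0 xD(6) in auto)
  have ev3: "\<forall>\<^sub>F y in nhds x. 0 < Re (E y)"
   by (rule order_tendstoD(1)[OF tendsto_Re[OF Elim[OF xD(1)]]]) (use x in "auto simp: T_def")
  have ev4: "\<forall>\<^sub>F y in nhds x. cmod (E y) < exp (- M')"
   by (rule order_tendstoD(2)[OF tendsto_norm[OF Elim[OF xD(1)]]]) (use x in "auto simp: T_def")
  have ev5: "\<forall>\<^sub>F y in nhds x. y : ball x e" by (rule eventually_nhds_in_open) (use e0 in auto)
  from ev1 ev2 ev3 ev4 ev5 eventually_nhds_in_open[OF N xD(1)] have "\<forall>\<^sub>F y in nhds x. y : T"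
  proof eventually_elim
   case (elim y)
   have y0: "E y ~= 0" using elim(3) by auto
   have "Re (Ln (E y)) < A" by (rule farD(2)[OF ReLn[OF elim(4) y0]])
   hence "f y (H y (Ln (E y))) = v y + E y"
    using tractD(4)[OF tr D0rh(1), of y "Ln (E y)"] NL(2) elim(6) y0 by auto
   hence "c y = H y (Ln (E y))"
    by (intro inj_onD[OF e(2)[OF elim(5)] _ elim(1,2)]) (simp add: E_def)
   thus ?case using elim by (simp add: T_def)
  qed
  thus "EX U. open U & x : U & U <= T" unfolding eventually_nhds by blast
 qed
 obtain M2 where M2: "!!u. Re u <= A - 1 ==> cmod u > M2 ==>
   EX x. x ~= x1 & dist x x1 < dl & x : ball x1 r & x : ball x1 rh & inverse (kp x) = H x u"
  by (rule tract_hits_pole[OF tr kp dl(1)]) blast+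
 \<comment> \<open>The real point u = - L makes \<open>T\<close> non-empty: 1/kp meets H x u there,
   with E positive.\<close>
 define L where "L = max M2 M' + 1"
 have "Re (of_real (- L) :: complex) < - M'" by (simp add: L_def)
 note Lf = farD[OF this]
 have "cmod (complex_of_real (- L)) = L" using M'(3) unfolding norm_of_real by (simp add: L_def)
 hence "cmod (complex_of_real (- L)) > M2" by (simp add: L_def)
 then obtain y where y: "y ~= x1" "dist y x1 < dl" "y : ball x1 rh" "c y = H y (of_real (- L))"
  using M2[OF Lf(1)] by (auto simp: c_def)
 have yD: "y : D0" using y by (simp add: D0_def dist_commute)
 have Ey: "E y = of_real (exp (- L))" using tractD(4)[OF tr y(3) Lf(2)] y(4) unfolding E_def by (simp add: exp_of_real[symmetric])
 have "Ln (E y) = of_real (- L)" unfolding Ey by (simp only: exp_of_real[symmetric]) simp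
 moreover have "~ pole y (c y)" using tractD(3)[OF tr y(3) Lf(2)] y(4) by simp
 ultimately have yT: "y : T" using yD y(4) by (simp add: T_def N_def Ey L_def)
 define S where "S = connected_component_set T y"
 have S: "open S" "connected S" "y : S" "S <= T"
  using open_connected_component[OF T] yT by (auto simp: S_def connected_component_subset)
 have "x1 : closure S"
 proof (rule ccontr)
  assume x1n: "x1 ~: closure S"
  have cl: "x : N" "E x ~: \<real>\<^sub>\<le>\<^sub>0" "0 <= Re (E x)" "cmod (E x) <= exp (- M')" "c x = H x (Ln (E x)) | cmod (E x) = exp (- M')"
   if x: "x : closure S" for x
  proof -
   obtain X where X: "!!n. X n : S" "X ----> x" using x unfolding closure_sequential by blast
   have XT: "X n : T" for n using X(1) S(4) by blast
   have xne: "x ~= x1" using x x1n by blast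
   have "S <= cball x1 dl" using S(4) by (auto simp: T_def N_def D0_def)
   hence xc: "x : cball x1 dl" using x closure_minimal[OF _ closed_cball] by blast
   have xrh: "x : ball x1 rh" "x : ball x1 r" using xc sub by blast+
   have xL: "x : \<Lambda>" using xrh(1) tractD(2)[OF tr] by blast
   have "isCont kp x" by (rule holomorphic_isCont[OF kp(1) open_ball xrh(2)])
   moreover have k0: "kp x ~= 0" using kp(4) xrh(2) xne by blast
   ultimately have "isCont c x" unfolding c_def by (intro continuous_intros)
   hence clim: "(%n. c (X n)) ----> c x" using X(2) by (rule isCont_tendsto_compose)
   define u where "u n = Ln (E (X n))" for n
   have u: "Re (u n) < - M'" "c (X n) = H (X n) (u n)" "exp (u n) = E (X n)" "X n : ball x1 rh" for n
    using TD(2,3,4,6)[OF XT[of n]] D0rh(1) by (auto simp: u_def)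
   \<comment> \<open>In the tract |c| is at least 2/m, while on the outer circle it is at most 1/m;
     so the closure of \<open>S\<close> stays off that circle.\<close>
   have clow: "cmod (c x) >= 2 / m"
   proof (rule tendsto_lowerbound[OF tendsto_norm[OF clim]])
    have "2/m <= cmod (c (X n))" for n using M1[OF u(4)[of n] farD(1,3)[OF u(1)[of n]]] u(2)[of n] by simp
    thus "\<forall>\<^sub>F n in sequentially. 2 / m <= cmod (c (X n))" by simp
   qed simp
   have "x ~: sphere x1 dl"
   proof
    assume "x : sphere x1 dl"
    hence "m <= cmod (kp x)" using y0(2) by (simp add: m_def)
    hence "inverse (cmod (kp x)) <= inverse m" using m by (intro le_imp_inverse_le)
    hence "cmod (c x) <= 1/m" unfolding c_def norm_inverse by (simp only: inverse_eq_divide)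
    thus False using clow m by (simp add: field_simps)
   qed
   hence xD: "x : D0" using xc xne by (auto simp: D0_def)
   have En: "cmod (E (X n)) <= exp (- M')" for n using XT[of n] by (simp add: T_def)
   have "seq_compact (cball (0::complex) (exp (- M')))" by (rule compact_imp_seq_compact) simp
   moreover have "ALL n. E (X n) : cball 0 (exp (- M'))" using En by simp
   ultimately obtain E0 q where q: "strict_mono (q :: nat => nat)" "((%n. E (X n)) \<circ> q) ----> E0"
    by (rule seq_compactE)
   have Xq: "(%n. X (q n)) ----> x" "(%n. c (X (q n))) ----> c x"
    using LIMSEQ_subseq_LIMSEQ[OF X(2) q(1)] LIMSEQ_subseq_LIMSEQ[OF clim q(1)] by (simp_all add: o_def)
   have "(%n. v (X (q n)) + E (X (q n))) ----> v x + E0"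
    using q(2) by (intro tendsto_add isCont_tendsto_compose[OF v_isCont[OF xL] Xq(1)]) (simp add: o_def)
   hence "(%n. f (X (q n)) (c (X (q n)))) ----> v x + E0" by (simp add: E_def)
   moreover have "~ pole (X n) (c (X n))" for n using XT[of n] unfolding T_def N_def by blast
   ultimately have np: "~ pole x (c x)"
    by (intro limit_value(1)[OF xL Xq sequentially_bot]) auto
   thus xN: "x : N" using xD by (simp add: N_def)
   have EL: "(%n. E (X n)) ----> E x" by (rule isCont_tendsto_compose[OF Ec[OF xN] X(2)])
   show "0 <= Re (E x)"
    by (rule tendsto_lowerbound[OF tendsto_Re[OF EL]]) (use XT in "auto simp: T_def less_imp_le")
   show up: "cmod (E x) <= exp (- M')" by (rule tendsto_upperbound[OF tendsto_norm[OF EL]]) (use En in auto)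
   \<comment> \<open>Away from \<open>x1\<close> the values of \<open>c\<close> stay bounded, so the
     points u stay bounded by uniform escape; hence exp u, and with it \<open>E\<close>, does not
     tend to 0.\<close>
   have "EX M3. ALL y:ball x1 rh. ALL u. Re u <= A - 1 & cmod u > M3 --> cmod (H y u) > cmod (c x) + 1" by (rule tractD(10)[OF tr])
   then obtain M3 where M3: "!!y u. y : ball x1 rh ==> Re u <= A - 1 ==> cmod u > M3 ==> cmod (H y u) > cmod (c x) + 1"
    by blast
   have "\<forall>\<^sub>F n in sequentially. cmod (c (X n)) < cmod (c x) + 1"
    by (rule order_tendstoD(2)[OF tendsto_norm[OF clim]]) simp
   hence "\<forall>\<^sub>F n in sequentially. exp (- M3) <= cmod (E (X n))"
   proof eventually_elim
    case (elim n)
    hence "cmod (u n) <= M3" using M3[OF u(4)[of n] farD(1)[OF u(1)[of n]]] u(2)[of n] by fastforce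
    hence "- M3 <= Re (u n)" using abs_Re_le_cmod[of "u n"] by linarith
    thus ?case using u(3)[of n, symmetric] by simp
   qed
   hence "exp (- M3) <= cmod (E x)" by (intro tendsto_lowerbound[OF tendsto_norm[OF EL]]) auto
   hence E0: "E x ~= 0" using exp_gt_zero[of "- M3"] by auto
   show nr: "E x ~: \<real>\<^sub>\<le>\<^sub>0"
    using \<open>0 <= Re (E x)\<close> E0 by (auto simp: complex_nonpos_Reals_iff complex_eq_iff)
   show "c x = H x (Ln (E x)) | cmod (E x) = exp (- M')"
   proof (cases "cmod (E x) = exp (- M')")
    case False
    hence "Re (Ln (E x)) < - M'" using up by (intro ReLn E0) simp
    hence uA: "Re (Ln (E x)) < A" by (rule farD(2))
    have "(%n. H (X n) (Ln (E (X n)))) ----> H x (Ln (E x))"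
     by (rule filterlim_compose[OF Hlim[OF xN nr uA] X(2)])
    hence "(%n. c (X n)) ----> H x (Ln (E x))" using u(2) by (simp add: u_def)
    thus ?thesis using LIMSEQ_unique[OF clim] by blast
   qed simp
  qed
  \<comment> \<open>The exponent has real part Re E * (exp (- M') / |E|^2 - exp M'): positive inside
    the half-disc and zero on both parts of its boundary, the diameter and the half-circle.\<close>
  define G where "G x = exp (of_real (exp (- M')) / E x - of_real (exp M') * E x)" for x
  have ReG: "Re (of_real (exp (- M')) / E x - of_real (exp M') * E x) =
    Re (E x) * (exp (- M') / (cmod (E x))\<^sup>2 - exp M')" for x
   by (simp add: Re_divide cmod_power2 algebra_simps)
  have Gh: "G holomorphic_on {x : N. E x ~= 0}" unfolding G_def
   by (intro holomorphic_intros holomorphic_on_subset[OF Eh]) auto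
  have clN: "closure S <= {x : N. E x ~= 0}" using cl(1,2) by fastforce
  have "cmod (G y) <= 1"
  proof (rule maximum_modulus_frontier[of G S])
   show "G holomorphic_on interior S"
    by (rule holomorphic_on_subset[OF Gh]) (use clN closure_subset interior_subset in blast)
   show "continuous_on (closure S) G"
    by (rule continuous_on_subset[OF holomorphic_on_imp_continuous_on[OF Gh] clN])
   show "bounded S" by (rule bounded_subset[OF bounded_ball[of x1 dl]]) (use S(4) in "auto simp: T_def N_def D0_def")
   fix x assume "x : frontier S"
   hence x: "x : closure S" "x ~: S" using S(1) by (auto simp: frontier_def interior_open)
   have "Re (E x) = 0 | cmod (E x) = exp (- M')"
   proof (rule ccontr)
    assume a: "~ ?thesis"
    hence "0 < Re (E x)" "cmod (E x) < exp (- M')" "c x = H x (Ln (E x))"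
     using cl(3,4,5)[OF x(1)] by auto
    hence xT: "x : T" using cl(1)[OF x(1)] by (simp add: T_def)
    have "connected (insert x S)"
     by (rule connected_intermediate_closure[OF S(2)]) (use x closure_subset in auto)
    hence "insert x S <= connected_component_set T y"
     by (intro connected_component_maximal) (use S(3,4) xT in auto)
    thus False using x(2) by (simp add: S_def)
   qed
   hence "Re (E x) * (exp (- M') / (cmod (E x))\<^sup>2 - exp M') = 0"
   proof
    assume "cmod (E x) = exp (- M')"
    hence "exp (- M') / (cmod (E x))\<^sup>2 = exp M'" by (simp add: power2_eq_square exp_minus inverse_eq_divide)
    thus ?thesis by simp
   qed simp
   thus "cmod (G x) <= 1" unfolding G_def norm_exp_eq_Re ReG by (simp only: exp_zero)
  qed (rule S(3))
  moreover have "cmod (G y) > 1"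
  proof -
   have "0 < Re (E y)" "cmod (E y) < exp (- M')" using yT by (auto simp: T_def)
   moreover have "0 < cmod (E y)" using TD(3)[OF yT] by simp
   ultimately have "(cmod (E y))\<^sup>2 * exp M' < (exp (- M'))\<^sup>2 * exp M'" by (intro mult_strict_right_mono power_strict_mono) auto
   also have "... = exp (- M')" by (simp add: power2_eq_square exp_minus)
   finally have "exp M' < exp (- M') / (cmod (E y))\<^sup>2" using \<open>0 < cmod (E y)\<close> by (simp add: field_simps)
   hence "0 < Re (E y) * (exp (- M') / (cmod (E y))\<^sup>2 - exp M')" using \<open>0 < Re (E y)\<close> by simp
   thus ?thesis unfolding G_def norm_exp_eq_Re ReG by simp
  qed
  ultimately show False by simp
 qed
 moreover have "x ~= x1 & dist x x1 < dl0 & (EX u. Re u < - M & \<bar>Im u\<bar> < pi & inverse (kp x) = H x u)" if "x : S" for x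
 proof -
  have xT: "x : T" using that S(4) by blast
  note xD = TD[OF xT]
  have "Re (Ln (E x)) < - M" using xD(4) M'(1) by linarith
  moreover have "\<bar>Im (Ln (E x))\<bar> < pi" using xD(5) pi_gt_zero by linarith
  moreover have "x ~= x1" "dist x x1 < dl0" using xD(2) dl(2) by (auto simp: D0_def dist_commute)
  ultimately show ?thesis using xD(6) by (auto simp: c_def)
 qed
 ultimately show ?thesis using that[OF S(1,2)] by blast
qed

section \<open>The attracting cycle with a point near infinity\<close>

lemma tract_deriv:
 assumes tr: "tract x1 rh A H" and x: "x : ball x1 rh" and u: "Re u < A"
 shows "deriv (H x) u = exp u / deriv (f x) (H x u)"
proof -
 have op: "open {u. Re u < A}" by (simp add: open_halfspace_Re_lt)
 have dH: "(H x has_field_derivative deriv (H x) u) (at u)"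
  by (rule holomorphic_derivI[OF tractD(6)[OF tr x] op]) (use u in simp)
 have "f x field_differentiable at (H x u)"
  by (rule differentiable_at_nonpole[OF _ tractD(3)[OF tr x u]]) (use x tractD(2)[OF tr] in blast)
 hence "(f x has_field_derivative deriv (f x) (H x u)) (at (H x u))" by (simp add: DERIV_deriv_iff_field_differentiable)
 from DERIV_chain2[OF this dH]
 have 1: "((%u. f x (H x u)) has_field_derivative deriv (f x) (H x u) * deriv (H x) u) (at u)" .
 have "((%u. f x (H x u)) has_field_derivative exp u) (at u)"
 proof (rule has_field_derivative_transform_within_open[OF _ op])
  show "((%u. v x + exp u) has_field_derivative exp u) (at u)" by (auto intro!: derivative_eq_intros)
  show "v x + exp w = f x (H x w)" if "w : {u. Re u < A}" for w using tractD(4)[OF tr x, of w] that by simp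
 qed (use u in simp)
 from DERIV_unique[OF 1 this] show ?thesis using tractD(5)[OF tr x u] by (simp add: field_simps)
qed

text \<open>
  Near \<open>v x\<close> the map \<open>f x ^^ (m + 1)\<close> is \<open>1 / g\<close> with \<open>g\<close> Lipschitz, so it distorts a disk of
  radius \<open>4 exp (Re u)\<close> to size \<open>exp (Re u) * |H x u|\<^sup>2\<close>. By the distortion theorem in the half-plane,
  \<open>|H x u|\<close> and \<open>1 / |deriv (H x) u|\<close> grow slower than \<open>exp (|Re u| / 4)\<close>, so by Bloch's lemma the image lies in
  \<open>H x\<close> of the unit disk about \<open>u\<close>, which \<open>f x\<close> maps back into the disk.
\<close>

lemma virtual_parameter_attracts:
 assumes x0: "x0 : landing_set m" and tr: "tract x0 rh A H"
 obtains M dl where "0 < dl" "dl <= rh"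
  "!!x u. x ~= x0 ==> dist x x0 < dl ==> Re u < - M ==> \<bar>Im u\<bar> < pi ==>
   ~ pole x ((f x ^^ m) (v x)) ==> f x ((f x ^^ m) (v x)) = H x u ==>
   EX C \<mu>. has_multiplier (f x) (m + 2) C \<mu> & cmod \<mu> < 1 & v x : basin (f x) C & (EX z:C. cmod z > R)"
proof -
 have xL: "x0 : \<Lambda>" and reg0: "regular m x0 (v x0)" and pole: "pole x0 ((f x0 ^^ m) (v x0))"
  using x0 by (auto simp: landing_set_def)
 let ?a = "v x0" and ?p = "%j. (f x0 ^^ j) (v x0)"
 obtain et where et: "et > 0" "!!p q. p : ?p ` {..m} ==> q : ?p ` {..m} ==> p ~= q ==> ball p et \<inter> ball q et = {}"
  by (rule finite_separation[of "?p ` {..m}"]) auto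
 \<comment> \<open>A repetition would let the orbit skip a loop and meet the pole before time
   \<open>m\<close>.\<close>
 have distinct: "?p i ~= ?p j" if ij: "i < j" "j <= m" for i j
 proof
  assume eq: "?p i = ?p j"
  have "?p (m - j + i) = (f x0 ^^ (m - j)) (?p i)" by (simp add: funpow_add)
  also have "... = ?p (m - j + j)" unfolding eq by (simp add: funpow_add)
  also have "... = ?p m" using ij by simp
  finally have "pole x0 (?p (m - j + i))" using pole by simp
  thus False using reg0 ij unfolding regular_def by auto
 qed
 \<comment> \<open>Larger than all points in the neighbourhoods of the finite orbit, so that the
   last set \<open>W (m + 1)\<close>, a neighbourhood of infinity, is disjoint from the
   others.\<close>
 define R' where "R' = max (max R 1) (Max ((%j. cmod (?p j) + et) ` {..m}))"
 have R': "R <= R'" "1 <= R'" "j <= m ==> cmod (?p j) + et <= R'" for j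
  unfolding R'_def by (auto intro!: max.coboundedI2 Max_ge)
 define W where "W j = (if j <= m then ball (?p j) et else {z. R' < cmod z})" for j
 have Wb: "cmod z < R'" if "z : ball (?p j) et" "j <= m" for z j
 proof -
  have "cmod z <= cmod (?p j) + cmod (z - ?p j)" using norm_triangle_sub[of z "?p j"] by simp
  thus ?thesis using R'(3)[OF that(2)] that(1) by (simp add: dist_norm norm_minus_commute)
 qed
 have Wdisj: "W i \<inter> W j = {}" if "i < m + 2" "j < m + 2" "i ~= j" for i j
 proof -
  have *: "W i \<inter> W j = {}" if "i < j" "j < m + 2" for i j
  proof (cases "j <= m")
   case True
   hence "?p i : ?p ` {..m}" "?p j : ?p ` {..m}" using that by auto
   thus ?thesis using et(2) distinct[OF that(1) True] True that(1) by (simp add: W_def)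
  next
   case False
   thus ?thesis using Wb[of _ i] that by (fastforce simp: W_def)
  qed
  show ?thesis using *[of i j] *[of j i] that by (metis Int_commute nat_neq_iff)
 qed
 obtain e where e: "chart (%x z. inverse (f x z)) x0 (?p m) e"
  "!!x z. x : ball x0 e ==> z : ball (?p m) e ==> pole x z \<longleftrightarrow> f x z = 0"
  by (rule pole_chart[OF xL pole]) blast
 have e0: "e > 0" using e(1) by (simp add: chart_def)
 obtain B where B: "!!x z. x : ball x0 e ==> z : ball (?p m) e ==> cmod (inverse (f x z)) <= B"
  using e(1) unfolding chart_def by blast
 have ghol: "(%z. inverse (f x z)) holomorphic_on ball (?p m) e" if "x : ball x0 e" for x
  using e(1) that unfolding chart_def by blast
 have "\<forall>\<^sub>F p in nhds (x0, ?a). fst p : \<Lambda> & regular m (fst p) (snd p)" by (rule near_regular(1)[OF xL reg0])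
 moreover have "\<forall>\<^sub>F p in nhds (x0, ?a). (f (fst p) ^^ m) (snd p) : ball (?p m) e"
  by (rule topological_tendstoD[OF near_regular(2)[OF xL reg0]]) (use e0 in auto)
 moreover have "\<forall>\<^sub>F p in nhds (x0, ?a). ALL j:{..m}. (f (fst p) ^^ j) (snd p) : ball (?p j) et"
 proof (intro eventually_ball_finite ballI)
  fix j assume "j : {..m}"
  hence r: "regular j x0 ?a" using regular_mono[OF reg0] by simp
  show "\<forall>\<^sub>F p in nhds (x0, ?a). (f (fst p) ^^ j) (snd p) : ball (?p j) et"
   by (rule topological_tendstoD[OF near_regular(2)[OF xL r]]) (use et in auto)
 qed simp
 ultimately have "\<forall>\<^sub>F p in nhds (x0, ?a). fst p : \<Lambda> & regular m (fst p) (snd p) &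
   (f (fst p) ^^ m) (snd p) : ball (?p m) e & (ALL j:{..m}. (f (fst p) ^^ j) (snd p) : ball (?p j) et)"
  by eventually_elim simp
 then obtain P1 P2 where P12: "\<forall>\<^sub>F x in nhds x0. P1 x" "\<forall>\<^sub>F w in nhds ?a. P2 w"
   "!!x w. P1 x ==> P2 w ==> x : \<Lambda> & regular m x w & (f x ^^ m) w : ball (?p m) e & (ALL j:{..m}. (f x ^^ j) w : ball (?p j) et)"
  unfolding nhds_prod eventually_prod_filter by auto
 obtain dl1 where dl1: "dl1 > 0" "!!x. dist x x0 < dl1 ==> P1 x" using P12(1) unfolding eventually_nhds_metric by blast
 obtain r2 where r2: "r2 > 0" "!!w. dist w ?a < r2 ==> P2 w" using P12(2) unfolding eventually_nhds_metric by blast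
 define r where "r = r2 / 2"
 have r: "r > 0" using r2 by (simp add: r_def)
 define K where "K = \<bar>B\<bar> / r + 1"
 have K: "K > 0" using r by (simp add: K_def add_nonneg_pos)
 define g where "g x w = inverse (f x ((f x ^^ m) w))" for x w
 have near: "x : \<Lambda>" "regular m x w" "(f x ^^ m) w : ball (?p m) e" "j <= m ==> (f x ^^ j) w : ball (?p j) et"
  if "dist x x0 < dl1" "dist w ?a < r2" for x w j
  using P12(3)[OF dl1(2)[OF that(1)] r2(2)[OF that(2)]] by auto
 have Lip: "cmod (g x w - g x w') <= K * cmod (w - w')"
  if x: "dist x x0 < dl1" "dist x x0 < e" and w: "dist w ?a < r" "dist w' ?a < r" for x w w'
 proof -
  have xe: "x : ball x0 e" using x(2) by (simp add: dist_commute)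
  have "cmod (g x w - g x w') <= B / r * cmod (w - w')"
  proof (rule lipschitz_of_bound[OF _ r])
   have "(f x ^^ m) holomorphic_on ball ?a (2 * r)"
    by (rule iterate_holomorphic) (use near[OF x(1)] r r2(1) in "auto simp: r_def dist_commute intro: near(1)[OF x(1), of ?a]")
   moreover have "(f x ^^ m) ` ball ?a (2 * r) <= ball (?p m) e"
   proof (rule image_subsetI)
    fix w assume "w : ball ?a (2 * r)"
    thus "(f x ^^ m) w : ball (?p m) e" by (intro near(3)[OF x(1)]) (simp add: r_def dist_commute)
   qed
   ultimately have "((%z. inverse (f x z)) \<circ> (f x ^^ m)) holomorphic_on ball ?a (2 * r)"
    by (rule holomorphic_on_compose_gen[OF _ ghol[OF xe]])
   moreover have "g x = (%z. inverse (f x z)) \<circ> (f x ^^ m)" by (simp add: fun_eq_iff g_def)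
   ultimately show "g x holomorphic_on ball ?a (2 * r)" by simp
   show "cmod (g x z) <= B" if "z : ball ?a (2 * r)" for z
    unfolding g_def by (rule B[OF xe near(3)[OF x(1)]]) (use that in "simp add: r_def dist_commute")
  qed (use w in "auto simp: dist_commute")
  also have "... <= K * cmod (w - w')"
   unfolding K_def by (intro mult_right_mono) (use r in "auto simp: divide_right_mono add_increasing2")
  finally show ?thesis .
 qed
 \<comment> \<open>With this rate the quotient of the squared upper bound \<open>hi t\<close> by the
   lower bound \<open>lo t\<close> is of order t^2 exp (3t/8), which loses against the factor exp (-
   t).\<close>
 define \<tau> :: real where "\<tau> = 1/8"
 define A0 where "A0 = A - distortion_const / \<tau> - 1"
 define b where "b = complex_of_real A0"
 have dpos: "0 < distortion_const / \<tau>" using distortion_const_pos by (simp add: \<tau>_def)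
 have bA: "Re b <= A - distortion_const / \<tau>" "Re b < A" using dpos by (simp_all add: b_def A0_def)
 have rh: "rh > 0" "x0 : ball x0 rh" using tractD(1)[OF tr] by auto
 have Brh: "ball x0 rh <= \<Lambda>" by (rule tractD(2)[OF tr])
 have Hb: "(%x. H x b) holomorphic_on ball x0 rh" by (rule tractD(9)[OF tr bA(2)])
 have Db: "(%x. deriv (H x) b) holomorphic_on ball x0 rh"
 proof (rule holomorphic_transform)
  show "(%x. exp b / deriv (f x) (H x b)) holomorphic_on ball x0 rh"
   by (intro holomorphic_intros holomorphic_apply(2)[OF open_ball Brh Hb]) (use tractD(3,5)[OF tr _ bA(2)] in auto)
 qed (use tract_deriv[OF tr _ bA(2)] in simp)
 define d0 where "d0 = cmod (deriv (H x0) b)"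
 have d0: "d0 > 0" using tract_deriv[OF tr rh(2) bA(2)] tractD(5)[OF tr rh(2) bA(2)] by (simp add: d0_def)
 define h1 where "h1 = cmod (H x0 b) + 1"
 have h1: "h1 > 0" by (simp add: h1_def add_nonneg_pos)
 have "isCont (%x. H x b) x0" "isCont (%x. deriv (H x) b) x0" "isCont v x0"
  using holomorphic_isCont[OF Hb open_ball rh(2)] holomorphic_isCont[OF Db open_ball rh(2)] v_isCont[OF xL] by auto
 hence lims: "((%x. cmod (H x b)) ---> cmod (H x0 b)) (nhds x0)" "((%x. cmod (deriv (H x) b)) ---> d0) (nhds x0)"
  "(v ---> ?a) (nhds x0)"
  unfolding d0_def isCont_def
  by (auto intro!: tendsto_norm simp: tendsto_at_iff_tendsto_nhds[of "%x. H x b"]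
    tendsto_at_iff_tendsto_nhds[of "%x. deriv (H x) b"] tendsto_at_iff_tendsto_nhds[of v])
 have "\<forall>\<^sub>F x in nhds x0. cmod (H x b) < h1 & cmod (deriv (H x) b) < 2 * d0 & d0 / 2 < cmod (deriv (H x) b) & dist (v x) ?a < r / 2"
  by (intro eventually_conj order_tendstoD(2)[OF lims(1)] order_tendstoD[OF lims(2)] tendstoD[OF lims(3)])
   (use d0 r in "auto simp: h1_def")
 then obtain dl2 where dl2: "dl2 > 0" "!!x. dist x x0 < dl2 ==> cmod (H x b) < h1 & cmod (deriv (H x) b) < 2 * d0 &
   d0 / 2 < cmod (deriv (H x) b) & dist (v x) ?a < r / 2"
  unfolding eventually_nhds_metric by blast
 define dl where "dl = min (min dl1 dl2) (min e rh)"
 have dl: "0 < dl" "dl <= dl1" "dl <= dl2" "dl <= e" "dl <= rh" using dl1 dl2 e0 rh by (auto simp: dl_def)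
 define hi where "hi t = h1 + 2 * d0 * exp ((t + 4) / 8) * (t + 4)" for t :: real
 define lo where "lo t = d0 / 2 * exp (- (t + 4) / 8)" for t :: real
 \<comment> \<open>The constant of Bloch's lemma.\<close>
 define \<theta> :: real where "\<theta> = 3 - 2 * sqrt 2"
 have "sqrt 2 < sqrt ((3/2)\<^sup>2)" unfolding real_sqrt_less_iff by (simp add: power2_eq_square)
 hence \<theta>: "\<theta> > 0" by (simp add: \<theta>_def)
 have "((%t. 8 * K * exp (A0 - t) * (hi t)\<^sup>2 / lo t) ---> 0) at_top"
  unfolding hi_def lo_def using d0 h1 K by real_asymp
 hence t1: "\<forall>\<^sub>F t in at_top. 8 * K * exp (A0 - t) * (hi t)\<^sup>2 / lo t < \<theta>" using \<theta> by (rule order_tendstoD(2))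
 have "((%t. 4 * K * exp (A0 - t) * hi t) ---> 0) at_top"
  unfolding hi_def using d0 h1 K by real_asymp
 hence t2: "\<forall>\<^sub>F t in at_top. 4 * K * exp (A0 - t) * hi t < 1/2" by (rule order_tendstoD(2)) simp
 have "((%t. 4 * exp (A0 - t)) ---> 0) at_top" by real_asymp
 hence t3: "\<forall>\<^sub>F t in at_top. 4 * exp (A0 - t) < r / 2" by (rule order_tendstoD(2)) (use r in simp)
 from t1 t2 t3 eventually_ge_at_top[of 2]
 have "\<forall>\<^sub>F t in at_top. 8 * K * exp (A0 - t) * (hi t)\<^sup>2 / lo t < \<theta> & 4 * K * exp (A0 - t) * hi t < 1/2 & 4 * exp (A0 - t) < r / 2 & 2 <= t"
  by eventually_elim simp
 then obtain t0 where t0: "!!t. t >= t0 ==> 8 * K * exp (A0 - t) * (hi t)\<^sup>2 / lo t < \<theta> & 4 * K * exp (A0 - t) * hi t < 1/2 &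
   4 * exp (A0 - t) < r / 2 & 2 <= t" unfolding eventually_at_top_linorder by blast
 have "EX M. ALL y:ball x0 rh. ALL u. Re u <= A - 1 & cmod u > M --> cmod (H y u) > 2 * R'" by (rule tractD(10)[OF tr])
 then obtain Me where Me: "!!y u. y : ball x0 rh ==> Re u <= A - 1 ==> cmod u > Me ==> cmod (H y u) > 2 * R'" by blast
 define M where "M = max Me (max t0 2 - A0)"
 show ?thesis
 proof (rule that[OF dl(1,5)])
  fix x u assume xne: "x ~= x0" and xdl: "dist x x0 < dl" and u: "Re u < - M" "\<bar>Im u\<bar> < pi"
   and np: "~ pole x ((f x ^^ m) (v x))" and c: "f x ((f x ^^ m) (v x)) = H x u"
  have xd: "dist x x0 < dl1" "dist x x0 < dl2" "dist x x0 < e" "x : ball x0 rh" "x : \<Lambda>"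
   using xdl dl Brh by (auto simp: dist_commute)
  define t where "t = A0 - Re u"
  have t: "t >= t0" "t >= 2" "Re u = A0 - t" using u(1) by (auto simp: t_def M_def)
  note T = t0[OF t(1)]
  have uA: "Re u <= A - 1" "Re u < A" "Re u <= Re b" "Re (u + 1) <= Re b" "Re (u + 1) <= A - distortion_const / \<tau>"
   using t(2,3) dpos by (simp_all add: A0_def b_def)
  have "cmod (u - b) <= \<bar>Re (u - b)\<bar> + \<bar>Im (u - b)\<bar>" by (rule cmod_le)
  also have "... <= t + 4" using u(2) t(2,3) pi_less_4 by (simp add: b_def)
  finally have ub: "cmod (u - b) <= t + 4" .
  note Hx = tractD(6,7)[OF tr xd(4)]
  have Hu: "cmod (H x u) <= hi t"
  proof -
   have "cmod (H x u) <= cmod (H x b) + cmod (H x u - H x b)" by (rule norm_triangle_sub)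
   also have "cmod (H x u - H x b) <= cmod (deriv (H x) b) * exp (\<tau> * cmod (u - b)) * cmod (u - b)"
    by (rule halfplane_growth[OF Hx _ bA(1) uA(3)]) (simp add: \<tau>_def)
   also have "... <= 2 * d0 * exp ((t + 4) / 8) * (t + 4)"
    by (intro mult_mono) (use dl2(2)[OF xd(2)] ub d0 in "auto simp: \<tau>_def")
   finally show ?thesis using dl2(2)[OF xd(2)] by (simp add: hi_def)
  qed
  have lo: "lo t <= cmod (deriv (H x) u)"
  proof -
   have "lo t <= cmod (deriv (H x) b) * exp (- \<tau> * cmod (u - b))"
    unfolding lo_def by (intro mult_mono) (use dl2(2)[OF xd(2)] ub d0 in "auto simp: \<tau>_def")
   also have "... <= cmod (deriv (H x) u)" by (rule halfplane_distortion(2)[OF Hx _ bA(1) uA(3)]) (simp add: \<tau>_def)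
   finally show ?thesis .
  qed
  have lo0: "lo t > 0" using d0 by (simp add: lo_def)
  \<comment> \<open>The return lands at distance exp (Re u') from \<open>v x\<close> with |u' - u| <
    1, hence at most 3 exp (Re u): strictly inside the disc.\<close>
  define eps where "eps = 4 * exp (Re u)"
  have eps: "eps > 0" "eps < r / 2" using T by (auto simp: eps_def t(3))
  let ?c = "H x u"
  have "cmod u > Me" using u(1) abs_Re_le_cmod[of u] by (auto simp: M_def)
  hence cbig: "cmod ?c > 2 * R'" by (rule Me[OF xd(4) uA(1)])
  hence c0: "cmod ?c > 0" using R'(2) by linarith
  have hit0: "0 <= hi t" using Hu norm_ge_zero order_trans by blast
  have K1: "K * eps * cmod ?c < 1/2"
  proof -
   have "K * eps * cmod ?c <= K * eps * hi t" using Hu K eps(1) by (intro mult_left_mono) auto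
   also have "... = 4 * K * exp (A0 - t) * hi t" by (simp add: eps_def t(3))
   finally show ?thesis using T by linarith
  qed
  have K2: "2 * K * eps * (cmod ?c)\<^sup>2 < \<theta> * cmod (deriv (H x) u)"
  proof -
   have "2 * K * eps * (cmod ?c)\<^sup>2 <= 2 * K * eps * (hi t)\<^sup>2"
    using Hu K eps(1) hit0 by (intro mult_left_mono power_mono) auto
   also have "... = 8 * K * exp (A0 - t) * (hi t)\<^sup>2" by (simp add: eps_def t(3))
   also have "... < \<theta> * lo t" using T lo0 by (simp add: pos_divide_less_eq)
   also have "... <= \<theta> * cmod (deriv (H x) u)" using lo \<theta> by simp
   finally show ?thesis .
  qed
  have ub1: "{w. Re w < A} \<supseteq> cball u 1"
  proof
   fix w assume "w : cball u 1"
   hence "\<bar>Re (w - u)\<bar> <= 1" using abs_Re_le_cmod[of "w - u"] by (simp add: dist_norm norm_minus_commute)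
   thus "w : {w. Re w < A}" using t(2,3) dpos by (simp add: A0_def)
  qed
  have bloch: "ball ?c (\<theta> * 1 * cmod (deriv (H x) u)) <= H x ` ball u 1"
   unfolding \<theta>_def
  proof (rule Bloch_lemma)
   show "H x holomorphic_on cball u 1" by (rule holomorphic_on_subset[OF Hx(1) ub1])
   fix w assume w: "w : ball u 1"
   hence "\<bar>Re (w - u)\<bar> <= 1" using abs_Re_le_cmod[of "w - u"] by (simp add: dist_norm norm_minus_commute)
   hence wR: "Re w <= Re (u + 1)" by simp
   have "cmod (w - (u + 1)) <= cmod (w - u) + cmod (1 :: complex)" using norm_triangle_ineq4[of "w - u" 1] by (simp add: algebra_simps)
   hence w2: "cmod (w - (u + 1)) <= 2" using w by (simp add: dist_norm norm_minus_commute)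
   have \<tau>0: "0 < \<tau>" by (simp add: \<tau>_def)
   \<comment> \<open>The distortion estimate compares a point only with base points to its right, so
     both \<open>w\<close> and \<open>u\<close> are compared with u + 1; the total factor is exp
     (1/4 + 1/8) <= 2.\<close>
   have "cmod (deriv (H x) w) <= cmod (deriv (H x) (u + 1)) * exp (\<tau> * cmod (w - (u + 1)))"
    by (rule halfplane_distortion(1)[OF Hx \<tau>0 uA(5) wR])
   also have "... <= cmod (deriv (H x) (u + 1)) * exp (1/4)" using w2 by (intro mult_left_mono) (auto simp: \<tau>_def)
   also have "... = exp (3/8) * (cmod (deriv (H x) (u + 1)) * exp (- (1/8)))" by (simp add: exp_add[symmetric])
   also have "... <= exp (3/8) * cmod (deriv (H x) u)"
   proof (rule mult_left_mono)
    have "cmod (deriv (H x) (u + 1)) * exp (- \<tau> * cmod (u - (u + 1))) <= cmod (deriv (H x) u)"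
     by (rule halfplane_distortion(2)[OF Hx \<tau>0 uA(5)]) simp
    thus "cmod (deriv (H x) (u + 1)) * exp (- (1/8)) <= cmod (deriv (H x) u)" by (simp add: \<tau>_def)
   qed simp
   also have "... <= 2 * cmod (deriv (H x) u)"
    using exp_bound[of "3/8"] by (intro mult_right_mono) (simp_all add: power2_eq_square)
   finally show "cmod (deriv (H x) w) <= 2 * cmod (deriv (H x) u)" .
  qed simp
  have va: "dist (v x) ?a < r / 2" using dl2(2)[OF xd(2)] by blast
  have g0: "g x (v x) = inverse ?c" by (simp add: g_def c)
  have trap: "trap (f x) (m + 2) (v x) eps W"
   unfolding trap_def
  proof (intro conjI ballI allI impI)
   fix w assume "w : cball (v x) eps"
   hence weps: "cmod (w - v x) <= eps" by (simp add: dist_norm norm_minus_commute)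
   have wr: "dist w ?a < r"
    using dist_triangle[of w ?a "v x"] weps va eps(2) by (simp add: dist_norm)
   have wr2: "dist w ?a < r2" using wr r by (simp add: r_def)
   have "cmod (g x w - inverse ?c) <= K * cmod (w - v x)"
    unfolding g0[symmetric] by (rule Lip[OF xd(1,3) wr]) (use va r in simp)
   also have "... <= K * eps" using weps K by simp
   finally have gd: "cmod (g x w - inverse ?c) <= K * eps" .
   have Kc: "K * eps < inverse (cmod ?c) / 2" using K1 c0 by (simp add: field_simps)
   have "inverse (cmod ?c) - cmod (g x w) <= cmod (inverse ?c - g x w)"
    using norm_triangle_ineq2[of "inverse ?c" "g x w"] by (simp add: norm_inverse)
   hence glow: "inverse (cmod ?c) / 2 < cmod (g x w)" using gd Kc by (simp add: norm_minus_commute)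
   have "cmod (g x w) <= cmod (inverse ?c) + cmod (g x w - inverse ?c)" by (rule norm_triangle_sub)
   moreover have "inverse (cmod ?c) > 0" using c0 by simp
   ultimately have gup: "cmod (g x w) < 2 * inverse (cmod ?c)" using gd Kc unfolding norm_inverse by linarith
   have gpos: "cmod (g x w) > 0" using glow c0 by (metis half_gt_zero less_trans positive_imp_inverse_positive)
   have fm: "~ pole x ((f x ^^ m) w)"
    using e(2)[of x "(f x ^^ m) w"] near(3)[OF xd(1) wr2] xd(3) gpos by (auto simp: g_def dist_commute)
   have fg: "(f x ^^ (m + 1)) w = inverse (g x w)" by (simp add: g_def)
   have "cmod (inverse (g x w) - ?c) = cmod (g x w - inverse ?c) * cmod ?c / cmod (g x w)"
   proof -
    have "inverse (g x w) - ?c = - (g x w - inverse ?c) * ?c / g x w" using gpos c0 by (simp add: field_simps)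
    thus ?thesis by (simp add: norm_mult norm_divide norm_minus_commute)
   qed
   also have "... <= K * eps * cmod ?c / (inverse (cmod ?c) / 2)"
    using gd glow c0 K eps(1) by (intro frac_le mult_right_mono) auto
   also have "... = 2 * K * eps * (cmod ?c)\<^sup>2" using c0 by (simp add: field_simps power2_eq_square)
   also have "... < \<theta> * cmod (deriv (H x) u)" by (rule K2)
   finally have "inverse (g x w) : ball ?c (\<theta> * 1 * cmod (deriv (H x) u))" by (simp add: dist_norm norm_minus_commute)
   then obtain u' where u': "u' : ball u 1" "inverse (g x w) = H x u'" using bloch by blast
   have "u' : cball u 1" using u'(1) by simp
   hence u'A: "Re u' < A" using ub1 by blast
   have f2: "~ pole x ((f x ^^ (m + 1)) w)" "f x ((f x ^^ (m + 1)) w) = v x + exp u'"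
    unfolding fg u'(2) by (rule tractD(3,4)[OF tr xd(4) u'A])+
   have big: "R' < cmod ((f x ^^ (m + 1)) w)"
   proof -
    have "inverse (2 * inverse (cmod ?c)) < inverse (cmod (g x w))" using gup gpos by (intro less_imp_inverse_less)
    thus ?thesis unfolding fg norm_inverse using cbig by simp
   qed
   { fix j assume "j < m + 2"
    then consider "j < m" | "j = m" | "j = m + 1" by linarith
    thus "~ pole x ((f x ^^ j) w)"
     using near(2)[OF xd(1) wr2] fm f2(1) by cases (auto simp: regular_def)
   }
   { fix j assume "j < m + 2"
    thus "(f x ^^ j) w : W j"
     using near(4)[OF xd(1) wr2, of j] big by (cases "j <= m") (auto simp: W_def le_Suc_eq not_le less_Suc_eq)
   }
   have "\<bar>Re (u' - u)\<bar> <= 1" using u'(1) abs_Re_le_cmod[of "u' - u"] by (simp add: dist_norm norm_minus_commute)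
   hence "exp (Re u') <= exp (Re u + 1)" by simp
   also have "... <= exp (Re u) * 3" unfolding exp_add by (intro mult_left_mono exp_le) simp
   also have "... < eps" by (simp add: eps_def)
   finally show "(f x ^^ (m + 2)) w : ball (v x) eps" using f2(2) by (simp add: dist_norm)
  qed (use eps in auto)
  obtain z \<mu> where z: "cmod \<mu> < 1" "has_multiplier (f x) (m + 2) ((%j. (f x ^^ j) z) ` {..<m + 2}) \<mu>"
   "ball (v x) eps <= basin (f x) ((%j. (f x ^^ j) z) ` {..<m + 2})" "!!j. j < m + 2 ==> (f x ^^ j) z : W j"
   by (rule trap_cycle[OF xd(5) trap Wdisj]) blast+
  have "cmod ((f x ^^ (m + 1)) z) > R" using z(4)[of "m + 1"] R'(1) by (simp add: W_def)
  moreover have "(f x ^^ (m + 1)) z : (%j. (f x ^^ j) z) ` {..<m + 2}" by (rule imageI) simp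
  moreover have "v x : basin (f x) ((%j. (f x ^^ j) z) ` {..<m + 2})" using z(3) eps(1) by auto
  ultimately show "EX C \<mu>. has_multiplier (f x) (m + 2) C \<mu> & cmod \<mu> < 1 & v x : basin (f x) C & (EX z:C. cmod z > R)"
   using z(1,2) by blast
 qed
qed

end

section \<open>Attractors and stability\<close>

context meromorphic_family
begin

section \<open>Attractors and their persistence\<close>

definition attractors :: "complex => complex set set" where
 "attractors x = {C. EX k \<mu>. has_multiplier (f x) k C \<mu> & cmod \<mu> < 1}"

lemma attractors_eq:
 "attractors x = {C. EX k. attracting_cycle (f x) k C | superattracting_cycle (f x) k C}"
 unfolding attractors_def attracting_cycle_def superattracting_cycle_def by fastforce

lemma multiplier_unique:
 assumes "has_multiplier (f x) k C \<mu>" "has_multiplier (f x) k' C \<mu>'"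
 shows "k = k'" "\<mu> = \<mu>'"
proof -
 have c: "cycle (f x) k C" "cycle (f x) k' C" using assms by (auto simp: has_multiplier_def)
 then obtain z where z: "z : C" unfolding cycle_def by force
 thus k: "k = k'" using cycle_unique(2)[OF c] by blast
 show "\<mu> = \<mu>'" using assms z k unfolding has_multiplier_def by auto
qed

text \<open>The fixed point found by \<open>trap_cycle\<close> is \<open>c\<close> itself, because
  the orbit of \<open>c\<close> under the k-th iterate is constant; hence the disc lies in the basin
  of \<open>C\<close> and not of some other cycle.\<close>

lemma attractor_trap:
 assumes x: "x : \<Lambda>" and hm: "has_multiplier (f x) k C \<mu>" "cmod \<mu> < 1" and c: "c : C" and et: "et > 0"
  and sep: "!!p q. p : C ==> q : C ==> p ~= q ==> ball p et \<inter> ball q et = {}"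
 obtains r where "0 < r" "r <= et" "trap (f x) k c r (%j. ball ((f x ^^ j) c) et)" "ball c r <= basin (f x) C"
  "!!i j. i < k ==> j < k ==> i ~= j ==> ball ((f x ^^ i) c) et \<inter> ball ((f x ^^ j) c) et = {}"
proof -
 have cyc: "cycle (f x) k C" using hm by (simp add: has_multiplier_def)
 note co = cycle_orbit[OF cyc c]
 obtain r where r: "0 < r" "r <= et" "trap (f x) k c r (%j. ball ((f x ^^ j) c) et)"
  by (rule multiplier_trap[OF x hm c et])
 have disj: "ball ((f x ^^ i) c) et \<inter> ball ((f x ^^ j) c) et = {}" if "i < k" "j < k" "i ~= j" for i j
 proof (rule sep)
  show "(f x ^^ i) c : C" "(f x ^^ j) c : C" using co(2) by auto
  show "(f x ^^ i) c ~= (f x ^^ j) c" using inj_onD[OF co(4), of i j] that by auto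
 qed
 obtain z where z: "ball c r <= basin (f x) ((%j. (f x ^^ j) z) ` {..<k})"
  "!!w. w : cball c r ==> (%n. (f x ^^ (k * n)) w) ----> z"
  by (rule trap_cycle[OF x r(3) disj]) blast+
 have "(f x ^^ (k * n)) c = c" for n
  using co(1) by (induction n) (simp_all add: funpow_add)
 hence "z = c" using z(2)[of c] r(1) LIMSEQ_unique[of "%n. c" z c] by simp
 hence "ball c r <= basin (f x) C" using z(1) co(3) by simp
 thus ?thesis using that r disj by blast
qed

lemma cycle_in_basin:
 assumes "x : \<Lambda>" "has_multiplier (f x) k C \<mu>" "cmod \<mu> < 1"
 shows "C <= basin (f x) C"
proof
 fix c assume c: "c : C"
 have "finite C" using cycle_orbit(5)[of "f x" k C c] assms(2) c by (simp add: has_multiplier_def)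
 then obtain et where et: "et > 0" "!!p q. p : C ==> q : C ==> p ~= q ==> ball p et \<inter> ball q et = {}"
  by (rule finite_separation) blast
 obtain r where "0 < r" "ball c r <= basin (f x) C" by (rule attractor_trap[OF assms c et]) blast
 thus "c : basin (f x) C" by auto
qed

text \<open>A trap about the cycle persists, and each of the finitely many attracted values enters
  it after finitely many steps, which also persists.\<close>

lemma cycle_continues:
 assumes x1: "x1 : \<Lambda>" and hm: "has_multiplier (f x1) k C \<mu>" "cmod \<mu> < 1" and et: "et > 0"
  and sep: "!!p q. p : C ==> q : C ==> p ~= q ==> ball p et \<inter> ball q et = {}"
  and TT: "finite TT" "!!t. t : TT ==> isCont t x1"
 shows "\<forall>\<^sub>F x in nhds x1. EX C' \<mu>'. has_multiplier (f x) k C' \<mu>' & cmod \<mu>' < 1 & (ALL z:C'. EX p:C. z : ball p et) &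
  (ALL t:TT. t x1 : basin (f x1) C --> t x : basin (f x) C')"
proof -
 have cyc: "cycle (f x1) k C" using hm by (simp add: has_multiplier_def)
 then obtain c where c: "c : C" unfolding cycle_def by force
 note co = cycle_orbit[OF cyc c]
 obtain r where r: "0 < r" "trap (f x1) k c r (%j. ball ((f x1 ^^ j) c) et)"
  "!!i j. i < k ==> j < k ==> i ~= j ==> ball ((f x1 ^^ i) c) et \<inter> ball ((f x1 ^^ j) c) et = {}"
  by (rule attractor_trap[OF x1 hm c et sep]) blast+
 have ev1: "\<forall>\<^sub>F x in nhds x1. x : \<Lambda> & trap (f x) k c r (%j. ball ((f x1 ^^ j) c) et)"
  by (rule trap_persists[OF x1 r(2)]) simp
 have "\<forall>\<^sub>F x in nhds x1. ALL t:TT. t x1 : basin (f x1) C --> (EX n. regular n x (t x) & (f x ^^ n) (t x) : ball c r)"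
 proof (intro eventually_ball_finite TT(1) ballI)
  fix t assume t: "t : TT"
  show "\<forall>\<^sub>F x in nhds x1. t x1 : basin (f x1) C --> (EX n. regular n x (t x) & (f x ^^ n) (t x) : ball c r)"
  proof (cases "t x1 : basin (f x1) C")
   case True
   obtain n where n: "(f x1 ^^ n) (t x1) : ball c r" by (rule basin_enters_ball[OF x1 cyc c True r(1)])
   have reg: "regular n x1 (t x1)" using basin_no_pole[OF True] by (simp add: regular_def)
   have "\<forall>\<^sub>F x in nhds x1. (f x ^^ n) (t x) : ball c r"
    by (rule topological_tendstoD[OF regular_along(2)[OF x1 reg TT(2)[OF t]] open_ball n])
   with regular_along(1)[OF x1 reg TT(2)[OF t]] show ?thesis by eventually_elim blast
  qed simp
 qed
 with ev1 show ?thesis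
 proof eventually_elim
  case (elim x)
  hence x: "x : \<Lambda>" and tr: "trap (f x) k c r (%j. ball ((f x1 ^^ j) c) et)" by auto
  obtain z \<mu>' where z: "cmod \<mu>' < 1" "has_multiplier (f x) k ((%j. (f x ^^ j) z) ` {..<k}) \<mu>'"
   "ball c r <= basin (f x) ((%j. (f x ^^ j) z) ` {..<k})" "!!j. j < k ==> (f x ^^ j) z : ball ((f x1 ^^ j) c) et"
   by (rule trap_cycle[OF x tr r(3)]) blast+
  show ?case
  proof (intro exI conjI)
   show "has_multiplier (f x) k ((%j. (f x ^^ j) z) ` {..<k}) \<mu>'" "cmod \<mu>' < 1" using z by auto
   show "ALL z:(%j. (f x ^^ j) z) ` {..<k}. EX p:C. z : ball p et" using z(4) co(2) by fast
   show "ALL t:TT. t x1 : basin (f x1) C --> t x : basin (f x) ((%j. (f x ^^ j) z) ` {..<k})"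
    using elim z(3) basin_backward[OF x] by blast
  qed
 qed
qed

end

context natural_slice
begin

section \<open>Capture of singular values\<close>

definition singular_functions :: "(complex => complex) set" where
 "singular_functions = insert v (s ` {1..<N})"

lemma singular_functions_finite: "finite singular_functions"
 by (simp add: singular_functions_def)

lemma singular_functions_isCont: "x : \<Lambda> ==> t : singular_functions ==> isCont t x"
 using v_isCont s_isCont by (auto simp: singular_functions_def)

text \<open>The multiplier is a product of derivatives, so the cycle contains a critical point. Its
  critical value is dynamically fixed and lies on the cycle too.\<close>

lemma superattracting_captures:
 assumes x: "x : \<Lambda>" and hm: "has_multiplier (f x) k C 0"
 shows "EX i:F. s i x : basin (f x) C"
proof -
 have cyc: "cycle (f x) k C" using hm by (simp add: has_multiplier_def)
 then obtain c where c: "c : C" unfolding cycle_def by force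
 note co = cycle_orbit[OF cyc c]
 have np: "~ pole x z" if "z : C" for z using cyc that by (simp add: cycle_def)
 have "(f x ^^ j) c : C" for j using co(2) by auto
 hence "regular k x c" using np by (simp add: regular_def)
 hence "(\<Prod>j<k. deriv (f x) ((f x ^^ j) c)) = 0"
  using deriv_iterate[OF x, of k c] hm c by (simp add: has_multiplier_def)
 then obtain j where j: "deriv (f x) ((f x ^^ j) c) = 0" by auto
 obtain i where i: "i : F" "f x ((f x ^^ j) c) = s i x"
  using critical_cases[OF x np j] \<open>(f x ^^ j) c : C\<close> by blast
 have "f x ((f x ^^ j) c) = (f x ^^ Suc j) c" by simp
 also have "... : C" using co(2) by blast
 also have "C <= basin (f x) C" by (rule cycle_in_basin[OF x hm]) simp
 finally show ?thesis using i by auto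
qed

text \<open>Otherwise all inverse branches of the iterates along the cycle extend to a fixed disk; they omit the
  poles, so they form a normal family, but their derivatives at the cycle are unbounded.\<close>

lemma attracting_captures:
 assumes x: "x : \<Lambda>" and hm: "has_multiplier (f x) k C \<mu>" and \<mu>: "\<mu> ~= 0" "cmod \<mu> < 1"
 shows "EX t:singular_functions. t x : basin (f x) C & (ALL n. (f x ^^ n) (t x) ~: C)"
proof (rule ccontr)
 assume neg: "~ ?thesis"
 have cyc: "cycle (f x) k C" using hm by (simp add: has_multiplier_def)
 then obtain c where c: "c : C" unfolding cycle_def by force
 note co = cycle_orbit[OF cyc c]
 have np: "~ pole x z" if "z : C" for z using cyc that by (simp add: cycle_def)
 have inv: "(f x ^^ n) z : C" if "z : C" for z n using cycle_orbit(2)[OF cyc that] by auto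
 have regC: "regular n x z" if "z : C" for z n using np inv[OF that] by (simp add: regular_def)
 have dz: "deriv (f x) z ~= 0" if z: "z : C" for z
 proof -
  have "(\<Prod>j<k. deriv (f x) ((f x ^^ j) z)) = \<mu>"
   using deriv_iterate[OF x regC[OF z], of k] hm z by (simp add: has_multiplier_def)
  hence "(\<Prod>j<k. deriv (f x) ((f x ^^ j) z)) ~= 0" using \<mu> by simp
  hence "ALL j:{..<k}. deriv (f x) ((f x ^^ j) z) ~= 0" by (subst (asm) prod_zero_iff) auto
  moreover have "0 : {..<k}" using co(7) by simp
  ultimately have "deriv (f x) ((f x ^^ 0) z) ~= 0" by blast
  thus ?thesis by simp
 qed
 obtain et0 where et0: "et0 > 0" "!!p q. p : C ==> q : C ==> p ~= q ==> ball p et0 \<inter> ball q et0 = {}"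
  by (rule finite_separation[OF co(5)]) blast
 have "\<forall>\<^sub>F w in nhds c. regular k x w" by (rule iterate_tendsto(1)[OF x regC[OF c]])
 then obtain r1 where r1: "r1 > 0" "!!w. dist w c < r1 ==> regular k x w" unfolding eventually_nhds_metric by blast
 have fk: "(f x ^^ k) holomorphic_on ball c r1" by (rule iterate_holomorphic[OF x]) (use r1 in "auto simp: dist_commute")
 have dk: "deriv (f x ^^ k) c = \<mu>" using hm c by (simp add: has_multiplier_def)
 obtain r2 where r2: "r2 > 0" "inj_on (f x ^^ k) (ball c r2)"
  by (rule has_complex_derivative_locally_injective[OF fk, of c]) (use r1 \<mu> dk in auto)
 define et where "et = min et0 r2"
 have et: "et > 0" using et0 r2 by (simp add: et_def)
 have sep: "ball p et \<inter> ball q et = {}" if "p : C" "q : C" "p ~= q" for p q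
  using et0(2)[OF that] by (auto simp: et_def)
 obtain r where r: "0 < r" "r <= et" "trap (f x) k c r (%j. ball ((f x ^^ j) c) et)" "ball c r <= basin (f x) C"
  by (rule attractor_trap[OF x hm \<mu>(2) c et sep]) blast+
 have ck: "(f x ^^ (k * n)) z = z" if "z : C" for z n
  using cycle_orbit(1)[OF cyc that] by (induction n) (simp_all add: funpow_add)
 \<comment> \<open>In the disc about \<open>c\<close> only \<open>c\<close> itself ever lands on the
   cycle: the k-th iterate is injective there, and no other point of the cycle is near.\<close>
 have only: "w = c" if w: "w : ball c r" and l: "(f x ^^ n) w : C" for w n
 proof -
  have "n <= k * n" using co(7) by simp
  hence "(f x ^^ (k * n)) w = (f x ^^ (k * n - n + n)) w" by simp
  also have "... = (f x ^^ (k * n - n)) ((f x ^^ n) w)" unfolding funpow_add o_def ..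
  finally have "(f x ^^ (k * n)) w = (f x ^^ (k * n - n)) ((f x ^^ n) w)" .
  hence inC: "(f x ^^ (k * n)) w : C" using inv[OF l] by simp
  have wc: "w : cball c r" using w by simp
  have ball: "(f x ^^ (k * i)) w : ball c r" for i
   using trap_iterates(2)[OF r(3) wc, of i] w by (cases i) auto
  have "(f x ^^ (k * n)) w = c"
  proof (rule ccontr)
   assume "~ ?thesis"
   hence "ball ((f x ^^ (k * n)) w) et \<inter> ball c et = {}" by (rule sep[OF inC c])
   moreover have "(f x ^^ (k * n)) w : ball c et" using ball[of n] r(2) by auto
   ultimately show False using et centre_in_ball by blast
  qed
  thus "w = c"
  proof (induction n)
   case (Suc n)
   have "(f x ^^ (k * n)) w = c"
   proof (rule inj_onD[OF r2(2)])
    have "(f x ^^ k) ((f x ^^ (k * n)) w) = (f x ^^ (k * Suc n)) w" by (simp add: funpow_add)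
    thus "(f x ^^ k) ((f x ^^ (k * n)) w) = (f x ^^ k) c" using Suc.prems co(1) by simp
    show "(f x ^^ (k * n)) w : ball c r2" using ball[of n] r(2) by (auto simp: et_def)
   qed (use r2 in simp)
   thus ?case by (rule Suc.IH)
  qed simp
 qed
 \<comment> \<open>If a branch met a singular value, that value would be attracted to
   \<open>C\<close>, so by the assumption its orbit would land on \<open>C\<close>; then
   \<open>w\<close> would land as well, which only the centre does. So the next branch exists by
   \<open>lift_ball\<close>.\<close>
 have lift: "EX H. H holomorphic_on ball c r & H c : C & (ALL w:ball c r. regular n x (H w) & (f x ^^ n) (H w) = w)" for n
 proof (induction n)
  case 0
  show ?case by (rule exI[of _ "%w. w"]) (use c in "auto intro!: holomorphic_intros")
 next
  case (Suc n)
  then obtain H where H: "H holomorphic_on ball c r" "H c : C" "!!w. w : ball c r ==> regular n x (H w) & (f x ^^ n) (H w) = w"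
   by blast
  define p where "p = (f x ^^ (k - 1)) (H c)"
  have p: "p : C" using inv[OF H(2)] by (simp add: p_def)
  have "f x p = (f x ^^ k) (H c)" using co(7) by (cases k) (simp_all add: p_def)
  hence fp: "f x p = H c" using cycle_orbit(1)[OF cyc H(2)] by simp
  have ur: "unramified x (H w)" if w: "w : ball c r - {c}" for w
  proof -
   have nosing: "H w ~= t x" if t: "t : singular_functions" for t
   proof
    assume eq: "H w = t x"
    have "(f x ^^ n) (t x) = w" "regular n x (t x)" using H(3)[of w] w eq by auto
    hence "t x : basin (f x) C" using basin_backward[OF x] r(4) w by blast
    then obtain l where l: "(f x ^^ l) (t x) : C" using neg t by blast
    have "(f x ^^ l) w = (f x ^^ n) ((f x ^^ l) (t x))"
     using \<open>(f x ^^ n) (t x) = w\<close> by (metis add.commute comp_apply funpow_add)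
    hence "(f x ^^ l) w : C" using inv[OF l] by simp
    thus False using only w by blast
   qed
   show ?thesis
   proof (rule unramifiedI[OF x])
    show "H w ~= v x" by (rule nosing) (simp add: singular_functions_def)
    show "H w ~= s i x" if "i : {1..<N}" for i by (rule nosing) (use that in "simp add: singular_functions_def")
   qed
  qed
  obtain G where G: "lift_on x (ball c r) H G" "G c = p"
   by (rule lift_ball[OF x r(1) H(1) np[OF p] fp dz[OF p] ur])
  have "regular (Suc n) x (G w) & (f x ^^ Suc n) (G w) = w" if w: "w : ball c r" for w
   using G(1) H(3)[OF w] w by (simp add: lift_on_def regular_Suc' funpow_Suc_right del: funpow.simps)
  thus ?case using G p by (intro exI[of _ G]) (auto simp: lift_on_def)
 qed
 obtain \<pi>0 \<pi>1 where \<pi>: "pole x (\<pi>0 x)" "pole x (\<pi>1 x)" "\<pi>0 x ~= \<pi>1 x"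
  using pole_functions x by blast
 \<comment> \<open>After an affine normalization the two omitted poles are 0 and 1. \<open>R\<close>
   is the normalized value at the centre, the same for all branches that fix \<open>c\<close>, so
   Schottky's bound \<open>B\<close> is uniform in n.\<close>
 define R where "R = cmod ((c - \<pi>0 x) / (\<pi>1 x - \<pi>0 x))"
 define B where "B = exp (pi * exp (pi * (2 + 2 * R + 12 * (1/2) / (1 - 1/2))))"
 define B' where "B' = B * cmod (\<pi>1 x - \<pi>0 x) + cmod (\<pi>0 x)"
 \<comment> \<open>The branch inverts the kn-th iterate, so its derivative at \<open>c\<close> is
   the inverse of the n-th power of the multiplier; uniform bounds on the branches limit its
   size.\<close>
 have bound: "1 <= B' / (r / 4) * cmod \<mu> ^ n" if n: "n >= 1" for n
 proof -
  obtain H where H: "H holomorphic_on ball c r" "H c : C" "!!w. w : ball c r ==> regular (k * n) x (H w) & (f x ^^ (k * n)) (H w) = w"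
   using lift[of "k * n"] by blast
  have Hc: "H c = c" using H(3)[of c] r(1) ck[OF H(2)] by simp
  have nopole: "~ pole x (H w)" if "w : ball c r" for w
  proof -
   have "0 < k * n" using n co(7) by simp
   hence "~ pole x ((f x ^^ 0) (H w))" using H(3)[OF that] unfolding regular_def by blast
   thus ?thesis by simp
  qed
  define ph where "ph z = (H (c + of_real (r/2) * z) - \<pi>0 x) / (\<pi>1 x - \<pi>0 x)" for z
  have inb: "c + of_real (r/2) * z : ball c r" if "z : cball 0 1" for z
  proof -
   have "r/2 * cmod z <= r/2 * 1" using that r(1) by (intro mult_left_mono) auto
   thus ?thesis using r(1) by (simp add: dist_norm norm_mult)
  qed
  have "(H \<circ> (%z. c + of_real (r/2) * z)) holomorphic_on cball 0 1"
   by (rule holomorphic_on_compose_gen[OF _ H(1)]) (use inb in "auto intro!: holomorphic_intros")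
  hence "(%z. H (c + of_real (r/2) * z)) holomorphic_on cball 0 1" by (simp add: o_def)
  hence phh: "ph holomorphic_on cball 0 1" unfolding ph_def by (intro holomorphic_intros) (use \<pi>(3) in auto)
  have omit: "~ (ph z = 0 | ph z = 1)" if "z : cball 0 1" for z
  proof -
   have "H (c + of_real (r/2) * z) ~= \<pi>0 x" "H (c + of_real (r/2) * z) ~= \<pi>1 x"
    using nopole[OF inb[OF that]] \<pi> by metis+
   thus ?thesis using \<pi>(3) by (simp add: ph_def)
  qed
  have "cmod (ph 0) <= R" using Hc by (simp add: ph_def R_def)
  hence phB: "cmod (ph z) <= B" if "cmod z <= 1/2" for z
   unfolding B_def using Schottky[OF phh _ omit, of R "1/2" z] that by simp
  have "cmod (H w) <= B'" if w: "w : ball c (r/4)" for w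
  proof -
   define z where "z = (w - c) / of_real (r/2)"
   have "cmod z = cmod (w - c) / \<bar>r/2\<bar>" unfolding z_def norm_divide norm_of_real ..
   also have "... <= 1/2" using w r(1) by (simp add: dist_norm norm_minus_commute field_simps)
   finally have "cmod z <= 1/2" .
   hence "cmod (ph z) <= B" by (rule phB)
   moreover have "complex_of_real (r/2) * z = w - c" unfolding z_def times_divide_eq_right using r(1) by (intro nonzero_mult_div_cancel_left) simp
   hence "c + of_real (r/2) * z = w" by (metis add_diff_cancel_left' add.commute diff_add_cancel)
   hence "H w = ph z * (\<pi>1 x - \<pi>0 x) + \<pi>0 x" using \<pi>(3) by (simp add: ph_def)
   hence "cmod (H w) <= cmod (ph z) * cmod (\<pi>1 x - \<pi>0 x) + cmod (\<pi>0 x)"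
    by (metis norm_mult norm_triangle_ineq)
   ultimately show ?thesis unfolding B'_def by (smt (verit) mult_right_mono norm_ge_zero)
  qed
  hence dH: "cmod (deriv H c) <= B' / (r / 4)"
   by (intro deriv_le_of_bound[of H]) (use r(1) in "auto intro!: holomorphic_on_subset[OF H(1)]")
  have "((f x ^^ k) field_differentiable at c)"
   by (rule holomorphic_on_imp_differentiable_at[OF fk]) (use r1 in auto)
  hence "(((f x ^^ k) ^^ n) has_field_derivative (deriv (f x ^^ k) c) ^ n) (at c)"
   by (rule funpow_deriv_fixed_point) (rule co(1))
  hence d1: "((f x ^^ (k * n)) has_field_derivative \<mu> ^ n) (at (H c))" by (simp add: dk Hc funpow_mult)
  have d2: "(H has_field_derivative deriv H c) (at c)" by (rule holomorphic_derivI[OF H(1) open_ball]) (use r(1) in simp)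
  have "((%w. (f x ^^ (k * n)) (H w)) has_field_derivative \<mu> ^ n * deriv H c) (at c)" by (rule DERIV_chain2[OF d1 d2])
  moreover have "((%w. (f x ^^ (k * n)) (H w)) has_field_derivative 1) (at c)"
   by (rule has_field_derivative_transform_within_open[OF DERIV_ident open_ball, of _ c r]) (use r(1) H(3) in auto)
  ultimately have "\<mu> ^ n * deriv H c = 1" by (rule DERIV_unique)
  hence "1 = cmod \<mu> ^ n * cmod (deriv H c)" by (metis norm_mult norm_one norm_power)
  also have "... <= cmod \<mu> ^ n * (B' / (r / 4))" using dH by (intro mult_left_mono) auto
  finally show ?thesis by (simp add: mult.commute)
 qed
 have "(%n. B' / (r / 4) * cmod \<mu> ^ n) ----> B' / (r / 4) * 0"
  by (intro tendsto_intros LIMSEQ_power_zero) (use \<mu> in simp)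
 hence "\<forall>\<^sub>F n in sequentially. B' / (r / 4) * cmod \<mu> ^ n < 1" by (rule order_tendstoD(2)) simp
 then obtain n where "n >= 1" "B' / (r / 4) * cmod \<mu> ^ n < 1"
  using eventually_happens'[OF sequentially_bot eventually_conj[OF _ eventually_ge_at_top[of 1]]] by blast
 thus False using bound[of n] by simp
qed

lemma attractor_captures:
 assumes x: "x : \<Lambda>" and C: "C : attractors x"
 shows "EX t:singular_functions. t x : basin (f x) C & ((EX i:F. t = s i) | (ALL n. (f x ^^ n) (t x) ~: C))"
proof -
 obtain k \<mu> where hm: "has_multiplier (f x) k C \<mu>" "cmod \<mu> < 1" using C by (auto simp: attractors_def)
 show ?thesis
 proof (cases "\<mu> = 0")
  case True
  then obtain i where "i : F" "s i x : basin (f x) C" using superattracting_captures[OF x] hm(1) by blast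
  thus ?thesis using F_subset by (auto simp: singular_functions_def)
 qed (use attracting_captures[OF x hm(1) _ hm(2)] in blast)
qed

lemma attractors_basin_unique:
 assumes "C : attractors x" "C' : attractors x" "z : basin (f x) C" "z : basin (f x) C'"
 shows "C = C'"
 using assms basin_unique unfolding attractors_def has_multiplier_def by blast

lemma attractors_finite:
 assumes x: "x : \<Lambda>"
 shows "finite (attractors x)"
proof -
 have "ALL C:attractors x. EX t. t : singular_functions & t x : basin (f x) C" using attractor_captures[OF x] by blast
 from bchoice[OF this] obtain t where t: "!!C. C : attractors x ==> t C : singular_functions & t C x : basin (f x) C" by blast
 have "inj_on t (attractors x)" by (rule inj_onI) (metis t attractors_basin_unique)
 moreover have "t ` attractors x <= singular_functions" using t by blast
 ultimately show ?thesis using inj_on_finite[OF _ _ singular_functions_finite] by blast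
qed

text \<open>The multiplier of the cycle of a fixed value is constant. If it has modulus below 1 at
  one parameter, it is not of the parabolic kind anywhere.\<close>

lemma fixed_value_attracted:
 assumes i: "i : F" and x: "x : \<Lambda>" "C : attractors x" "s i x : basin (f x) C" and y: "y : \<Lambda>"
 shows "EX C':attractors y. s i y : basin (f y) C'"
proof -
 obtain k \<mu> where kF: "ALL x:\<Lambda>. EX C. has_multiplier (f x) k C \<mu> & s i x : basin (f x) C" using F_cycles[OF i] by blast
 obtain C1 where C1: "has_multiplier (f x) k C1 \<mu>" "s i x : basin (f x) C1" using kF x(1) by blast
 obtain l m where hm: "has_multiplier (f x) l C m" "cmod m < 1" using x(2) by (auto simp: attractors_def)
 have "C = C1" using basin_unique[of "f x" l C k C1] hm(1) C1 x(3) by (simp add: has_multiplier_def)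
 hence "cmod \<mu> < 1" using multiplier_unique(2)[OF hm(1)] C1(1) hm(2) by blast
 thus ?thesis using kF y unfolding attractors_def by blast
qed

section \<open>Continuation of attractors and J-stability\<close>

text \<open>The map follows each attractor of \<open>x1\<close>, with its period and its captured
  singular values. The parameter \<open>x\<close> may have further attractors; J-stability is what
  makes the map onto.\<close>

definition continuation :: "real => complex => complex => (complex set => complex set) => bool" where
 "continuation eps x1 x \<Phi> \<longleftrightarrow> x : \<Lambda> & inj_on \<Phi> (attractors x1) & (ALL C:attractors x1.
  (EX k \<mu> \<mu>'. has_multiplier (f x1) k C \<mu> & has_multiplier (f x) k (\<Phi> C) \<mu>' & cmod \<mu>' < 1) &
  (ALL z:\<Phi> C. EX p:C. z : ball p eps) &
  (ALL t:singular_functions. t x1 : basin (f x1) C --> t x : basin (f x) (\<Phi> C)))"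

lemma continuationD:
 assumes "continuation eps x1 x \<Phi>"
 shows "x : \<Lambda>" "inj_on \<Phi> (attractors x1)"
  and "C : attractors x1 ==> has_multiplier (f x1) k C \<mu> ==> EX \<mu>'. has_multiplier (f x) k (\<Phi> C) \<mu>' & cmod \<mu>' < 1"
  and "C : attractors x1 ==> \<Phi> C : attractors x"
  and "C : attractors x1 ==> z : \<Phi> C ==> EX p:C. z : ball p eps"
  and "C : attractors x1 ==> t : singular_functions ==> t x1 : basin (f x1) C ==> t x : basin (f x) (\<Phi> C)"
proof -
 note \<Phi> = assms[unfolded continuation_def]
 show "x : \<Lambda>" "inj_on \<Phi> (attractors x1)" using \<Phi> by auto
 assume "C : attractors x1"
 with \<Phi> have C: "(EX k \<mu> \<mu>'. has_multiplier (f x1) k C \<mu> & has_multiplier (f x) k (\<Phi> C) \<mu>' & cmod \<mu>' < 1) &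
  (ALL z:\<Phi> C. EX p:C. z : ball p eps) &
  (ALL t:singular_functions. t x1 : basin (f x1) C --> t x : basin (f x) (\<Phi> C))" by blast
 thus "\<Phi> C : attractors x" unfolding attractors_def by (elim conjE exE) blast
 show "EX \<mu>'. has_multiplier (f x) k (\<Phi> C) \<mu>' & cmod \<mu>' < 1" if "has_multiplier (f x1) k C \<mu>"
  using conjunct1[OF C] multiplier_unique(1)[OF that] by blast
 show "EX p:C. z : ball p eps" if "z : \<Phi> C" using C that by blast
 show "t x : basin (f x) (\<Phi> C)" if "t : singular_functions" "t x1 : basin (f x1) C" using C that by blast
qed

lemma continuation_exists:
 assumes x1: "x1 : \<Lambda>" and eps: "eps > 0"
 shows "\<forall>\<^sub>F x in nhds x1. EX \<Phi>. continuation eps x1 x \<Phi>"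
proof -
 let ?A = "attractors x1" and ?Q = "%et x C C'. (EX k \<mu> \<mu>'. has_multiplier (f x1) k C \<mu> & has_multiplier (f x) k C' \<mu>' & cmod \<mu>' < 1) &
  (ALL z:C'. EX p:C. z : ball p et) & (ALL t:singular_functions. t x1 : basin (f x1) C --> t x : basin (f x) C')"
 have "finite C" if "C : ?A" for C
  using that unfolding attractors_def has_multiplier_def cycle_def by blast
 hence "finite (\<Union>?A)" using attractors_finite[OF x1] by blast
 then obtain et0 where et0: "et0 > 0" "!!p q. p : \<Union>?A ==> q : \<Union>?A ==> p ~= q ==> ball p et0 \<inter> ball q et0 = {}"
  by (rule finite_separation) blast
 define et where "et = min et0 eps"
 have et: "et > 0" using et0 eps by (simp add: et_def)
 have sub: "ball p et <= ball p et0" "ball p et <= ball p eps" for p :: complex by (auto simp: et_def)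
 have sep: "ball p et \<inter> ball q et = {}" if "p : \<Union>?A" "q : \<Union>?A" "p ~= q" for p q
  using et0(2)[OF that] sub(1)[of p] sub(1)[of q] by blast
 have "\<forall>\<^sub>F x in nhds x1. ALL C:?A. EX C'. ?Q et x C C'"
 proof (intro eventually_ball_finite attractors_finite[OF x1] ballI)
  fix C assume C: "C : ?A"
  then obtain k \<mu> where hm: "has_multiplier (f x1) k C \<mu>" "cmod \<mu> < 1" by (auto simp: attractors_def)
  have "\<forall>\<^sub>F x in nhds x1. EX C' \<mu>'. has_multiplier (f x) k C' \<mu>' & cmod \<mu>' < 1 & (ALL z:C'. EX p:C. z : ball p et) &
   (ALL t:singular_functions. t x1 : basin (f x1) C --> t x : basin (f x) C')"
   by (rule cycle_continues[OF x1 hm et _ singular_functions_finite singular_functions_isCont[OF x1]]) (use sep C in blast)+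
  thus "\<forall>\<^sub>F x in nhds x1. EX C'. ?Q et x C C'" by eventually_elim (use hm(1) in blast)
 qed
 with eventually_nhds_in_open[OF open_params x1] show ?thesis
 proof eventually_elim
  case (elim x)
  from bchoice[OF elim(2)] obtain \<Phi> where \<Phi>0: "ALL C:?A. ?Q et x C (\<Phi> C)" by (rule exE)
  note \<Phi> = bspec[OF \<Phi>0]
  have "inj_on \<Phi> ?A"
  proof (rule inj_onI)
   fix C1 C2 assume C: "C1 : ?A" "C2 : ?A" "\<Phi> C1 = \<Phi> C2"
   obtain k1 k2 where cyc: "cycle (f x1) k1 C1" "cycle (f x1) k2 C2" and "EX k. cycle (f x) k (\<Phi> C1)"
    using conjunct1[OF \<Phi>[OF C(1)]] conjunct1[OF \<Phi>[OF C(2)]] unfolding has_multiplier_def by blast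
   then obtain z where z: "z : \<Phi> C1" unfolding cycle_def by force
   obtain p q where pq: "p : C1" "q : C2" "z : ball p et \<inter> ball q et"
    using \<Phi>[OF C(1)] \<Phi>[OF C(2)] z C(3) by blast
   hence "p = q" using sep[of p q] C by blast
   thus "C1 = C2" using cycle_unique(1)[OF cyc] pq by blast
  qed
  moreover have "?Q eps x C (\<Phi> C)" if "C : ?A" for C using \<Phi>[OF that] sub(2) by blast
  ultimately show ?case unfolding continuation_def using elim(1) by blast
 qed
qed

lemma J_stable_iff:
 "J_stable \<Lambda> f x1 \<longleftrightarrow> (EX U n. open U & x1 : U & U <= \<Lambda> & (ALL x:U. finite (attractors x) & card (attractors x) = n))"
 unfolding J_stable_def Let_def attractors_eq ..

text \<open>An attractor at \<open>x\<close> captures a singular value. If that value was attracted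
  to some cycle at \<open>x1\<close> already, the attractor is the continuation of that cycle; so no
  new ones appear. For dynamically fixed values this holds by constancy of the multiplier, for the
  others it is the assumption.\<close>

lemma J_stableI:
 assumes x1: "x1 : \<Lambda>"
  and closed: "!!t. t : singular_functions - s ` F ==> \<forall>\<^sub>F x in nhds x1. ALL C:attractors x.
    t x : basin (f x) C & (ALL n. (f x ^^ n) (t x) ~: C) --> (EX C1:attractors x1. t x1 : basin (f x1) C1)"
 shows "J_stable \<Lambda> f x1"
proof -
 have "\<forall>\<^sub>F x in nhds x1. ALL t:singular_functions - s ` F. ALL C:attractors x.
    t x : basin (f x) C & (ALL n. (f x ^^ n) (t x) ~: C) --> (EX C1:attractors x1. t x1 : basin (f x1) C1)"
  by (intro eventually_ball_finite ballI closed) (auto simp: singular_functions_finite)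
 with continuation_exists[OF x1 zero_less_one]
 have "\<forall>\<^sub>F x in nhds x1. x : \<Lambda> & card (attractors x) = card (attractors x1)"
 proof eventually_elim
  case (elim x)
  obtain \<Phi> where "continuation 1 x1 x \<Phi>" using elim(1) by (rule exE)
  note \<Phi> = continuationD[OF this]
  have "attractors x = \<Phi> ` attractors x1"
  proof
   show "\<Phi> ` attractors x1 <= attractors x" using \<Phi>(4) by blast
   show "attractors x <= \<Phi> ` attractors x1"
   proof
    fix C assume C: "C : attractors x"
    obtain t where t: "t : singular_functions" "t x : basin (f x) C" "(EX i:F. t = s i) | (ALL n. (f x ^^ n) (t x) ~: C)"
     using attractor_captures[OF \<Phi>(1) C] by blast
    have "EX C1:attractors x1. t x1 : basin (f x1) C1"
    proof (cases "t : s ` F")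
     case True
     thus ?thesis using fixed_value_attracted[OF _ \<Phi>(1) C _ x1] t(2) by blast
    next
     case False
     thus ?thesis using bspec[OF bspec[OF elim(2), of t] C] t by blast
    qed
    then obtain C1 where C1: "C1 : attractors x1" "t x1 : basin (f x1) C1" by blast
    have "C = \<Phi> C1" by (rule attractors_basin_unique[OF C \<Phi>(4)[OF C1(1)] t(2) \<Phi>(6)[OF C1(1) t(1) C1(2)]])
    thus "C : \<Phi> ` attractors x1" using C1(1) by blast
   qed
  qed
  thus ?case using card_image[OF \<Phi>(2)] \<Phi>(1) by simp
 qed
 then obtain U where "open U" "x1 : U" "ALL x:U. x : \<Lambda> & card (attractors x) = card (attractors x1)"
  unfolding eventually_nhds by blast
 thus ?thesis unfolding J_stable_iff using attractors_finite by blast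
qed

lemma J_stable_continuation:
 assumes x1: "x1 : \<Lambda>" and J: "J_stable \<Lambda> f x1" and eps: "eps > 0"
 shows "\<forall>\<^sub>F x in nhds x1. EX \<Phi>. continuation eps x1 x \<Phi> & attractors x = \<Phi> ` attractors x1"
proof -
 obtain U n where U: "open U" "x1 : U" "!!x. x : U ==> finite (attractors x) & card (attractors x) = n"
  using J unfolding J_stable_iff by blast
 from continuation_exists[OF x1 eps] eventually_nhds_in_open[OF U(1,2)] show ?thesis
 proof eventually_elim
  case (elim x)
  obtain \<Phi> where c: "continuation eps x1 x \<Phi>" using elim(1) by (rule exE)
  have "\<Phi> ` attractors x1 = attractors x"
   by (rule card_subset_eq) (use continuationD(4)[OF c] U(3)[OF elim(2)] U(3)[OF U(2)] card_image[OF continuationD(2)[OF c]] in auto)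
  thus ?case using c by (intro exI[of _ \<Phi>]) simp
 qed
qed

end

section \<open>Normality\<close>

text \<open>Stereographic projection in homogeneous coordinates: the point a / b, or infinity when b
  = 0. It is continuous wherever (a, b) is non-zero, without a case distinction.\<close>

definition hstereo :: "complex => complex => complex \<times> real" where
 "hstereo a b = ((2 / ((cmod a)\<^sup>2 + (cmod b)\<^sup>2)) *\<^sub>R (a * cnj b),
  ((cmod a)\<^sup>2 - (cmod b)\<^sup>2) / ((cmod a)\<^sup>2 + (cmod b)\<^sup>2))"

lemma hstereo_finite: "b ~= 0 ==> hstereo a b = stereo (Some (a / b))"
proof -
 assume b: "b ~= 0"
 have 1: "a / b = (1 / (cmod b)\<^sup>2) *\<^sub>R (a * cnj b)"
  by (subst complex_div_cnj) (simp add: scaleR_conv_of_real)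
 have 2: "(cmod (a / b))\<^sup>2 = (cmod a)\<^sup>2 / (cmod b)\<^sup>2" by (simp add: norm_divide power_divide)
 have b2: "(cmod b)\<^sup>2 > 0" using b by simp
 have pos: "(cmod a)\<^sup>2 + (cmod b)\<^sup>2 > 0" using b2 by (simp add: add_nonneg_pos)
 have "2 / (1 + (cmod a)\<^sup>2 / (cmod b)\<^sup>2) * (1 / (cmod b)\<^sup>2) = 2 / ((cmod a)\<^sup>2 + (cmod b)\<^sup>2)"
  using b2 pos by (simp add: field_simps)
 moreover have "((cmod a)\<^sup>2 / (cmod b)\<^sup>2 - 1) / ((cmod a)\<^sup>2 / (cmod b)\<^sup>2 + 1) = ((cmod a)\<^sup>2 - (cmod b)\<^sup>2) / ((cmod a)\<^sup>2 + (cmod b)\<^sup>2)"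
  using b2 pos by (simp add: divide_simps)
 ultimately show ?thesis unfolding hstereo_def stereo.simps 2 unfolding 1 scaleR_scaleR by (simp only:)
qed

lemma hstereo_continuous:
 assumes "continuous_on S a" "continuous_on S b" "!!p. p : S ==> a p ~= 0 | b p ~= 0"
 shows "continuous_on S (%p. hstereo (a p) (b p))"
 unfolding hstereo_def by (intro continuous_intros assms) (use assms(3) in "auto simp: sum_power2_eq_zero_iff")

lemma uniform_limit_compose_parameter:
 fixes \<psi> :: "nat => complex => complex" and \<tau> :: "complex \<times> complex => 'a::metric_space"
 assumes K: "compact K" and \<tau>: "continuous_on (K \<times> UNIV) \<tau>" and ul: "uniform_limit K \<psi> g sequentially"
  and g: "continuous_on K g"
 shows "uniform_limit K (%n y. \<tau> (y, \<psi> n y)) (%y. \<tau> (y, g y)) sequentially"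
proof -
 have "bounded (g ` K)" by (intro compact_imp_bounded compact_continuous_image g K)
 then obtain R where R: "!!y. y : K ==> cmod (g y) <= R" unfolding bounded_iff by blast
 let ?U = "K \<times> cball (0::complex) (R + 1)"
 have "uniform_limit K (%n y. \<tau> (y, \<psi> n y)) (\<tau> \<circ> (%y. (y, g y))) sequentially"
 proof (rule uniform_limit_compose[where g = "%n y. (y, \<psi> n y)" and U = ?U])
  show "uniform_limit K (%n y. (y, \<psi> n y)) (%y. (y, g y)) sequentially"
   using ul unfolding uniform_limit_iff by (simp add: dist_Pair_Pair)
  show "uniformly_continuous_on ?U \<tau>"
   by (intro compact_uniformly_continuous continuous_on_subset[OF \<tau>] compact_Times K compact_cball) auto
  have "\<forall>\<^sub>F n in sequentially. ALL y:K. dist (\<psi> n y) (g y) < 1" using ul by (rule uniform_limitD) simp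
  thus "\<forall>\<^sub>F n in sequentially. (%y. (y, \<psi> n y)) ` K <= ?U"
  proof eventually_elim
   case (elim n)
   have "cmod (\<psi> n y) <= R + 1" if "y : K" for y
    using R[OF that] bspec[OF elim that] norm_triangle_sub[of "\<psi> n y" "g y"] by (simp add: dist_norm)
   thus ?case by auto
  qed
  show "(%y. (y, g y)) ` K <= ?U" using R by force
 qed
 thus ?thesis by (simp add: o_def)
qed

lemma strict_mono_infinite:
 assumes "infinite (S :: nat set)"
 obtains r :: "nat => nat" where "strict_mono r" "!!n. r n : S"
 using infinite_enumerate[OF assms] by blast

lemma LIMSEQ_by_subsequences:
 fixes X :: "nat => 'a::metric_space"
 assumes "!!a :: nat => nat. strict_mono a ==> EX b :: nat => nat. strict_mono b & (%n. X (a (b n))) ----> L"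
 shows "X ----> L"
proof (rule tendstoI, rule ccontr)
 fix e :: real assume e: "e > 0" and "~ (\<forall>\<^sub>F n in sequentially. dist (X n) L < e)"
 hence "infinite {n. ~ dist (X n) L < e}" by (simp flip: cofinite_eq_sequentially add: eventually_cofinite)
 then obtain a :: "nat => nat" where a: "strict_mono a" "!!n. a n : {n. ~ dist (X n) L < e}"
  by (rule strict_mono_infinite) blast
 obtain b where "(%n. X (a (b n))) ----> L" using assms[OF a(1)] by blast
 hence "\<forall>\<^sub>F n in sequentially. dist (X (a (b n))) L < e" using e by (rule tendstoD)
 thus False using a(2) eventually_happens'[OF sequentially_bot] by blast
qed

text \<open>A limit below the north pole stays below it nearby, so late members of the sequence are
  uniformly bounded there, and \<open>pointwise_limit_holomorphic\<close> applies.\<close>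

lemma stereo_limit_finite:
 assumes x: "0 < e" and h: "!!n y. n >= n0 ==> h n holomorphic_on ball x e"
  and ul: "uniform_limit (ball x e) (%n y. stereo (Some (h n y))) L sequentially"
  and L: "snd (L x) < 1"
 obtains d kp where "0 < d" "d <= e" "kp holomorphic_on ball x d" "!!y. y : ball x d ==> L y = stereo (Some (kp y))"
proof -
 let ?g = "%n y. stereo (Some (h n y))"
 have xe: "x : ball x e" using x by simp
 have "\<forall>\<^sub>F n in sequentially. continuous_on (ball x e) (?g n)"
  unfolding eventually_sequentially using holomorphic_stereo[OF h] by blast
 hence Lc: "continuous_on (ball x e) L" by (rule uniform_limit_theorem[OF _ ul]) simp
 define eps where "eps = (1 - snd (L x)) / 4"
 have eps: "eps > 0" using L by (simp add: eps_def)
 obtain d0 where d0: "d0 > 0" "!!y. y : ball x e ==> dist y x < d0 ==> dist (L y) (L x) < eps"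
  using Lc xe eps unfolding continuous_on_iff by blast
 define d where "d = min d0 e"
 have d: "0 < d" "d <= e" "!!y. y : ball x d ==> dist (L y) (L x) < eps" "ball x d <= ball x e"
  using d0 x by (auto simp: d_def dist_commute)
 obtain n1 where n1: "!!n y. n >= n1 ==> y : ball x e ==> dist (?g n y) (L y) < eps"
  using uniform_limitD[OF ul eps] unfolding eventually_sequentially by blast
 define \<beta> where "\<beta> = (1 + snd (L x)) / 2"
 have \<beta>: "\<beta> < 1" using L by (simp add: \<beta>_def)
 have Lb: "snd (L y) < \<beta>" if "y : ball x d" for y
  using dist_snd_le[of "L y" "L x"] d(3)[OF that] eps by (simp add: dist_real_def \<beta>_def eps_def abs_if field_simps split: if_splits)
 have hb: "cmod (h n y) <= sqrt ((1 + \<beta>) / (1 - \<beta>))" if n: "n >= n1" and y: "y : ball x d" for n y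
 proof -
  have "\<bar>snd (?g n y) - snd (L y)\<bar> < eps" "\<bar>snd (L y) - snd (L x)\<bar> < eps"
   using dist_snd_le[of "?g n y" "L y"] n1[OF n] d(4) y dist_snd_le[of "L y" "L x"] d(3)[OF y]
   unfolding dist_real_def by (meson le_less_trans subsetD)+
  moreover have "\<beta> = snd (L x) + 2 * eps" by (simp add: \<beta>_def eps_def field_simps)
  ultimately have "snd (?g n y) < \<beta>" by linarith
  hence "(cmod (h n y))\<^sup>2 - 1 < \<beta> * ((cmod (h n y))\<^sup>2 + 1)" by (simp add: divide_less_eq add_nonneg_pos)
  hence "(cmod (h n y))\<^sup>2 * (1 - \<beta>) < 1 + \<beta>" by (simp add: algebra_simps)
  hence "(cmod (h n y))\<^sup>2 <= (1 + \<beta>) / (1 - \<beta>)" using \<beta> by (simp add: field_simps)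
  thus ?thesis by (rule real_le_rsqrt)
 qed
 define kp where "kp y = (1 / (1 - snd (L y))) *\<^sub>R fst (L y)" for y
 have lim: "(%n. h n y) ----> kp y" if y: "y : ball x d" for y
 proof -
  have l: "(%n. ?g n y) ----> L y" using tendsto_uniform_limitI[OF ul] y d(4) by blast
  have "(%n. (1 / (1 - snd (?g n y))) *\<^sub>R fst (?g n y)) ----> kp y"
   unfolding kp_def by (intro tendsto_intros l) (use Lb[OF y] \<beta> in simp)
  thus ?thesis by (simp only: stereo_Some_inverse(2))
 qed
 show ?thesis
 proof (rule that[OF d(1,2)])
  show "kp holomorphic_on ball x d"
  proof (rule pointwise_limit_holomorphic[of _ "%m. h (m + max n0 n1)"])
   show "h (m + max n0 n1) holomorphic_on ball x d" for m
    by (rule holomorphic_on_subset[OF h d(4)]) simp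
   show "EX B. ALL n. ALL z:K. cmod (h (n + max n0 n1) z) <= B" if "K <= ball x d" for K
    by (intro exI allI ballI) (rule hb, use that in auto)
   show "(%m. h (m + max n0 n1) z) ----> kp z" if "z : ball x d" for z
    by (rule LIMSEQ_ignore_initial_segment[OF lim[OF that]])
  qed auto
  fix y assume y: "y : ball x d"
  have "(%n. ?g n y) ----> stereo (Some (kp y))" by (rule stereo_Some_tendsto[OF lim[OF y]])
  moreover have "(%n. ?g n y) ----> L y" using tendsto_uniform_limitI[OF ul] y d(4) by blast
  ultimately show "L y = stereo (Some (kp y))" by (rule LIMSEQ_unique[symmetric])
 qed
qed

text \<open>The isometry of the sphere that corresponds to taking reciprocals.\<close>

definition sphere_flip :: "complex \<times> real => complex \<times> real" where
 "sphere_flip p = (cnj (fst p), - snd p)"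

lemma sphere_flip: "sphere_flip (sphere_flip p) = p" "dist (sphere_flip p) (sphere_flip q) = dist p q"
 by (auto simp: sphere_flip_def dist_prod_def dist_norm power2_commute complex_cnj_diff[symmetric] simp del: complex_cnj_diff)

lemma stereo_inverse: "z ~= 0 ==> stereo (Some (inverse z)) = sphere_flip (stereo (Some z))"
 using hstereo_finite[of z 1] hstereo_finite[of "1" z]
 by (simp add: hstereo_def sphere_flip_def inverse_eq_divide add.commute minus_divide_left)

lemma sphere_holomorphic_cases:
 "stereo (if z = 0 then None else Some (inverse z)) = sphere_flip (stereo (Some z))"
 by (cases "z = 0") (simp_all add: stereo_inverse del: stereo.simps(2), simp add: sphere_flip_def)

context natural_slice
begin

text \<open>Where the limit is finite the functions converge locally as holomorphic functions; where
  it is infinite their reciprocals do, as the functions eventually have no zeros nearby.\<close>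

lemma sphere_limit:
 assumes D: "open D" and h: "!!n. h n holomorphic_on D"
  and ul: "!!K. compact K ==> K <= D ==> uniform_limit K (%n y. stereo (Some (h n y))) L sequentially"
 obtains G where "!!y. y : D ==> L y = stereo (G y)" "sphere_holomorphic D G" "continuous_on D L"
proof -
 have loc: "EX d>0. EX kp. ball x d <= D & kp holomorphic_on ball x d & ((ALL y:ball x d. L y = stereo (Some (kp y))) |
   (ALL y:ball x d. L y = stereo (if kp y = 0 then None else Some (inverse (kp y)))))" if x: "x : D" for x
 proof -
  obtain e where e: "e > 0" "cball x e <= D" using D x open_contains_cball by blast
  have sub: "ball x e <= cball x e" by auto
  have ule: "uniform_limit (ball x e) (%n y. stereo (Some (h n y))) L sequentially"
   using ul[OF compact_cball e(2)] sub by (rule uniform_limit_on_subset)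
  have hh: "h n holomorphic_on ball x e" for n using h e(2) sub by (meson holomorphic_on_subset)
  show ?thesis
  proof (cases "snd (L x) < 1")
   case True
   obtain d kp where "0 < d" "d <= e" "kp holomorphic_on ball x d" "!!y. y : ball x d ==> L y = stereo (Some (kp y))"
    by (rule stereo_limit_finite[OF e(1) hh ule True]) blast
   moreover have "ball x d <= D" using calculation(2) e(2) by auto
   ultimately show ?thesis by blast
  next
   case False
   have "continuous_on (ball x e) L"
    by (rule uniform_limit_theorem[OF _ ule]) (use holomorphic_stereo[OF hh] in simp_all)
   then obtain d0 where d0: "d0 > 0" "!!y. y : ball x e ==> dist y x < d0 ==> dist (L y) (L x) < 1/2"
    unfolding continuous_on_iff using e(1) by (metis centre_in_ball half_gt_zero zero_less_one)
   define d1 where "d1 = min d0 e"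
   have d1: "d1 > 0" "ball x d1 <= ball x e" using d0 e(1) by (auto simp: d1_def)
   obtain n0 where n0: "!!n y. n >= n0 ==> y : ball x e ==> dist (stereo (Some (h n y))) (L y) < 1/2"
    using uniform_limitD[OF ule half_gt_zero[OF zero_less_one]] unfolding eventually_sequentially by blast
   have ne: "h n y ~= 0" if "n >= n0" "y : ball x d1" for n y
   proof
    assume "h n y = 0"
    hence "snd (stereo (Some (h n y))) = -1" by simp
    moreover have "dist y x < d0" "y : ball x e" using that(2) d1(2) by (auto simp: d1_def dist_commute)
    hence "\<bar>snd (stereo (Some (h n y))) - snd (L y)\<bar> < 1/2" "\<bar>snd (L y) - snd (L x)\<bar> < 1/2"
     using le_less_trans[OF dist_snd_le n0[OF that(1)]] le_less_trans[OF dist_snd_le d0(2)] unfolding dist_real_def by blast+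
    ultimately show False using False by linarith
   qed
   have ul': "uniform_limit (ball x d1) (%n y. stereo (Some (inverse (h n y)))) (sphere_flip \<circ> L) sequentially"
   proof (rule uniform_limitI)
    fix eps :: real assume "0 < eps"
    from uniform_limitD[OF ule this] eventually_ge_at_top[of n0]
    show "\<forall>\<^sub>F n in sequentially. ALL y:ball x d1. dist (stereo (Some (inverse (h n y)))) ((sphere_flip \<circ> L) y) < eps"
     by eventually_elim (use ne d1(2) in "auto simp: stereo_inverse sphere_flip simp del: stereo.simps")
   qed
   have ih: "(%y. inverse (h n y)) holomorphic_on ball x d1" if "n >= n0" for n
    by (intro holomorphic_intros holomorphic_on_subset[OF hh d1(2)] ne[OF that])
   obtain d kp where d: "0 < d" "d <= d1" "kp holomorphic_on ball x d" "!!y. y : ball x d ==> (sphere_flip \<circ> L) y = stereo (Some (kp y))"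
    by (rule stereo_limit_finite[OF d1(1) ih ul']) (use False in "auto simp: sphere_flip_def simp del: stereo.simps")
   have "L y = stereo (if kp y = 0 then None else Some (inverse (kp y)))" if "y : ball x d" for y
    unfolding sphere_holomorphic_cases d(4)[OF that, symmetric] by (simp add: sphere_flip)
   moreover have "ball x d <= D" using d(2) d1(2) sub e(2) by (meson order_trans subset_ball)
   ultimately show ?thesis using d(1,3) by blast
  qed
 qed
 define G where "G y = (SOME g. L y = stereo g)" for y
 have G: "L y = stereo (G y)" if "y : D" for y
 proof -
  have "EX g. L y = stereo g" using loc[OF that] centre_in_ball by blast
  thus ?thesis unfolding G_def by (rule someI_ex)
 qed
 have "sphere_holomorphic D G"
  unfolding sphere_holomorphic_def
 proof
  fix x assume x: "x : D"
  obtain d kp where d: "d > 0" "ball x d <= D" "kp holomorphic_on ball x d" and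
   alt: "(ALL y:ball x d. L y = stereo (Some (kp y))) | (ALL y:ball x d. L y = stereo (if kp y = 0 then None else Some (inverse (kp y))))"
   using loc[OF x] by blast
  have "G y = g" if "y : ball x d" "L y = stereo g" for y g
   using G[of y] d(2) that by (metis subsetD stereo_injective)
  thus "EX e>0. EX kp. ball x e <= D & kp holomorphic_on ball x e &
  ((ALL y:ball x e. G y = Some (kp y)) | (ALL y:ball x e. G y = (if kp y = 0 then None else Some (inverse (kp y)))))"
   using d alt by blast
 qed
 moreover have "continuous_on D L"
 proof (rule continuous_at_imp_continuous_on, rule ballI)
  fix x assume x: "x : D"
  obtain e where e: "e > 0" "cball x e <= D" using D x open_contains_cball by blast
  have "continuous_on (cball x e) L"
   by (rule uniform_limit_theorem[OF _ ul[OF compact_cball e(2)]])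
    (use holomorphic_stereo[OF holomorphic_on_subset[OF h e(2)]] in simp_all)
  thus "isCont L x" by (rule continuous_on_interior) (use e(1) in simp)
 qed
 ultimately show ?thesis using that G by blast
qed

lemma sphere_holomorphic_finite:
 assumes G: "sphere_holomorphic D G" "open D" and fin: "!!x. x : D ==> G x ~= None"
 shows "(%x. the (G x)) holomorphic_on D"
 unfolding holomorphic_on_def
proof
 fix x assume x: "x : D"
 obtain e kp where e: "e > 0" "ball x e <= D" and kp: "kp holomorphic_on ball x e"
  and alt: "(ALL y:ball x e. G y = Some (kp y)) |
   (ALL y:ball x e. G y = (if kp y = 0 then None else Some (inverse (kp y))))"
  using G(1) x unfolding sphere_holomorphic_def by blast
 have "(%x. the (G x)) holomorphic_on ball x e"
  using alt
 proof
  assume "ALL y:ball x e. G y = Some (kp y)"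
  thus ?thesis by (intro holomorphic_transform[OF kp]) simp
 next
  assume a: "ALL y:ball x e. G y = (if kp y = 0 then None else Some (inverse (kp y)))"
  have nz: "kp y ~= 0" if "y : ball x e" for y
   using bspec[OF a that] fin[OF subsetD[OF e(2) that]] by (metis (full_types))
  have "(%y. inverse (kp y)) holomorphic_on ball x e" by (intro holomorphic_intros kp nz)
  thus ?thesis by (rule holomorphic_transform) (use a nz in simp)
 qed
 thus "(%x. the (G x)) field_differentiable at x within D"
  using e(1) holomorphic_on_imp_differentiable_at field_differentiable_at_within by (metis centre_in_ball open_ball)
qed

section \<open>Montel's theorem with moving omitted values\<close>

text \<open>An orbit that never lands on a pole omits infinity and the two poles
  \<open>\<pi>0\<close> and \<open>\<pi>1\<close> at every step. As these move holomorphically, a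
  parameter-dependent affine change makes the omitted values 0, 1 and infinity.\<close>

lemma passive_if_never_landing:
 assumes D: "open D" "D <= \<Lambda>" "x : D" and reg: "!!y n. y : D ==> regular n y (v y)"
 shows "x ~: activity_locus \<Lambda> f v"
proof -
 obtain \<pi>0 \<pi>1 where \<pi>: "\<pi>0 holomorphic_on \<Lambda>" "\<pi>1 holomorphic_on \<Lambda>"
  "!!x. x : \<Lambda> ==> pole x (\<pi>0 x) & pole x (\<pi>1 x) & \<pi>0 x ~= \<pi>1 x"
  using pole_functions by blast
 obtain e where e: "e > 0" "ball x e <= D" using D open_contains_ball by blast
 let ?U = "ball x e"
 have UL: "y : \<Lambda>" if "y : ?U" for y using that e(2) D(2) by blast
 define h where "h n y = (f y ^^ n) (v y)" for n y
 have hh: "h n holomorphic_on ?U" for n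
  unfolding h_def by (rule iterate_parameter_holomorphic[OF open_ball _ holomorphic_on_subset[OF v_holomorphic]]) (use UL reg e(2) in auto)
 have orb: "orbit (f y) (v y) n = Some (h n y)" if "y : ?U" for n y
  using reg[of y n] e(2) that by (auto simp: orbit_eq h_def)
 have np: "~ pole y (h n y)" if "y : ?U" for n y
  using reg[of y "Suc n"] e(2) that by (auto simp: regular_Suc h_def)
 define dl where "dl y = \<pi>1 y - \<pi>0 y" for y
 have dl: "dl holomorphic_on ?U" "\<pi>0 holomorphic_on ?U" "!!y. y : ?U ==> dl y ~= 0"
 proof -
  show "dl holomorphic_on ?U" "\<pi>0 holomorphic_on ?U"
   unfolding dl_def by (auto intro!: holomorphic_intros holomorphic_on_subset[OF \<pi>(1)] holomorphic_on_subset[OF \<pi>(2)] UL)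
  show "dl y ~= 0" if "y : ?U" for y using \<pi>(3)[OF UL[OF that]] by (auto simp: dl_def)
 qed
 define ph where "ph n y = (h n y - \<pi>0 y) / dl y" for n y
 have phh: "ph n holomorphic_on ?U" for n unfolding ph_def by (intro holomorphic_intros hh dl)
 have omit: "ph n y ~= 0" "ph n y ~= 1" if "y : ?U" for n y
  using np[OF that, of n] \<pi>(3)[OF UL[OF that]] dl(3)[OF that] by (auto simp: ph_def dl_def)
 have hph: "h n y = ph n y * dl y + \<pi>0 y" if "y : ?U" for n y using dl(3)[OF that] by (simp add: ph_def)
 have sub: "EX b L. strict_mono b & (ALL K. compact K & K <= ?U --> uniform_limit K (%n. stereo \<circ> (%y. orbit (f y) (v y) (a (b n)))) L sequentially)"
  if a: "strict_mono a" for a :: "nat => nat"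
 proof -
  \<comment> \<open>The normal family theorem needs a bound at one point. Infinitely many of the
    functions, or of their reciprocals, are at most 1 in modulus at the centre.\<close>
  define \<psi> where "\<psi> i n = (if i then ph (a n) else (%y. inverse (ph (a n) y)))" for i n
  have "EX i. infinite {n. cmod (\<psi> i n x) <= 1}"
  proof (rule ccontr)
   assume "~ ?thesis"
   hence "finite ({n. cmod (\<psi> True n x) <= 1} \<union> {n. cmod (\<psi> False n x) <= 1})" by simp
   moreover have "{n. cmod (\<psi> True n x) <= 1} \<union> {n. cmod (\<psi> False n x) <= 1} = UNIV"
    by (auto simp: \<psi>_def norm_inverse inverse_le_1_iff)
   ultimately show False by simp
  qed
  then obtain i where i: "infinite {n. cmod (\<psi> i n x) <= 1}" by blast
  obtain q :: "nat => nat" where q: "strict_mono q" "!!n. q n : {n. cmod (\<psi> i n x) <= 1}" by (rule strict_mono_infinite[OF i]) blast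
  let ?Y = "range (%n. \<psi> i (q n))"
  have Yh: "g holomorphic_on ?U" if "g : ?Y" for g
   using that phh omit by (cases i) (auto simp: \<psi>_def intro!: holomorphic_intros)
  have Y01: "g z ~= 0 & g z ~= 1" if "g : ?Y" "z : ?U" for g z
   using that(1) omit[OF that(2)] by (cases i) (auto simp: \<psi>_def)
  have bd: "EX B. ALL g:?Y. ALL z:K. cmod (g z) <= B" if K: "compact K" "K <= ?U" for K
  proof (rule GPicard3[where S = ?U and X = ?Y and Y = ?Y and w = x and K = K])
   show "h holomorphic_on ?U" if "h : ?Y" for h by (rule Yh[OF that])
   show "h z ~= 0 & h z ~= 1" if "h : ?Y" "z : ?U" for h z by (rule Y01[OF that])
   show "cmod (h x) <= 1" if "h : ?Y" for h using that q(2) by auto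
   show ?thesis if "!!h z. h : ?Y ==> z : K ==> cmod (h z) <= B" for B using that by blast
  qed (use K e(1) in auto)
  obtain g r where g: "g holomorphic_on ?U" "strict_mono (r :: nat => nat)"
   "!!K. compact K ==> K <= ?U ==> uniform_limit K ((%n. \<psi> i (q n)) \<circ> r) g sequentially"
   by (rule Montel[OF open_ball Yh bd order_refl]) blast+
  \<comment> \<open>Undoes the normalization in homogeneous coordinates, so that reciprocals tending
    to 0 do no harm; both coordinates never vanish together, because the two poles are
    distinct.\<close>
  define \<tau> where "\<tau> p = (if i then hstereo (snd p * dl (fst p) + \<pi>0 (fst p)) 1
    else hstereo (dl (fst p) + snd p * \<pi>0 (fst p)) (snd p))" for p
  have \<tau>eq: "\<tau> (y, \<psi> i (q n) y) = stereo (orbit (f y) (v y) (a (q n)))" if y: "y : ?U" for n y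
  proof (cases i)
   case True
   thus ?thesis unfolding orb[OF y] hph[OF y] by (simp add: \<tau>_def \<psi>_def hstereo_finite del: stereo.simps)
  next
   case False
   have "ph (a (q n)) y ~= 0" by (rule omit(1)[OF y])
   moreover have "(dl y + inverse p * \<pi>0 y) / inverse p = p * dl y + \<pi>0 y" if "p ~= 0" for p
    using that by (simp add: field_simps)
   ultimately show ?thesis unfolding orb[OF y] hph[OF y] using False by (simp add: \<tau>_def \<psi>_def hstereo_finite del: stereo.simps)
  qed
  have "uniform_limit K (%n. stereo \<circ> (%y. orbit (f y) (v y) (a ((q \<circ> r) n)))) (%y. \<tau> (y, g y)) sequentially"
   if K: "compact K" "K <= ?U" for K
  proof -
   have c: "continuous_on K dl" "continuous_on K \<pi>0" "continuous_on K g"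
    using dl g(1) K(2) by (meson continuous_on_subset holomorphic_on_imp_continuous_on)+
   have "continuous_on (K \<times> UNIV) (%p :: complex \<times> complex. dl (fst p))" "continuous_on (K \<times> UNIV) (%p :: complex \<times> complex. \<pi>0 (fst p))"
    by (auto intro!: continuous_on_compose2[OF c(1)] continuous_on_compose2[OF c(2)] continuous_intros)
   hence "continuous_on (K \<times> UNIV) \<tau>"
    unfolding \<tau>_def by (cases i) (auto intro!: hstereo_continuous continuous_intros dest: dl(3)[OF subsetD[OF K(2)]])
   hence "uniform_limit K (%n y. \<tau> (y, ((%n. \<psi> i (q n)) \<circ> r) n y)) (%y. \<tau> (y, g y)) sequentially"
    by (rule uniform_limit_compose_parameter[OF K(1) _ g(3)[OF K] c(3)])
   thus ?thesis
    by (rule uniform_limit_cong'[THEN iffD1, rotated 2]) (use \<tau>eq K(2) in auto)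
  qed
  moreover have "strict_mono (q \<circ> r)" by (rule strict_mono_o[OF q(1) g(2)])
  ultimately show ?thesis by blast
 qed
 have "continuous_on ?U (stereo \<circ> (%y. orbit (f y) (v y) n))" for n
 proof -
  from holomorphic_stereo[OF hh[of n]] show ?thesis by (rule continuous_on_eq) (simp add: orb del: stereo.simps)
 qed
 hence "normal_sequence_on ?U (%n y. orbit (f y) (v y) n)" unfolding normal_sequence_on_def using sub by blast
 moreover have "?U <= \<Lambda>" using UL by blast
 ultimately show ?thesis using e(1) unfolding activity_locus_def by (auto intro!: exI[of _ ?U])
qed

end

context meromorphic_family
begin

section \<open>Limits of passive attracted orbits\<close>

text \<open>The minimal period may be a proper divisor of \<open>k\<close>; the derivative of the
  k-th iterate is then a power of the true multiplier.\<close>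

lemma periodic_point_cycle:
 assumes x: "x : \<Lambda>" and reg: "regular k x z" and per: "(f x ^^ k) z = z" and k: "k >= 1"
 obtains k' q C \<mu> where "has_multiplier (f x) k' C \<mu>" "z : C" "k = k' * q" "deriv (f x ^^ k) z = \<mu> ^ q"
proof -
 let ?P = "%l. l >= 1 & (f x ^^ l) z = z"
 define l where "l = Least ?P"
 have l: "l >= 1" "(f x ^^ l) z = z" using LeastI[of ?P k] per k by (simp_all add: l_def)
 have min: "l <= i" if "i >= 1" "(f x ^^ i) z = z" for i unfolding l_def using that by (intro Least_le) simp
 have mult: "(f x ^^ (l * n)) z = z" for n
  using l(2) by (induction n) (simp_all add: funpow_add)
 have md: "(f x ^^ i) z = (f x ^^ (i mod l)) z" for i
 proof -
  have "(f x ^^ i) z = (f x ^^ (i mod l + l * (i div l))) z" by simp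
  also have "... = (f x ^^ (i mod l)) z" unfolding funpow_add o_def mult ..
  finally show ?thesis .
 qed
 have "k mod l = 0"
 proof (rule ccontr)
  assume "k mod l ~= 0"
  hence "l <= k mod l" using min[of "k mod l"] md[of k] per by simp
  moreover have "k mod l < l" using l(1) by simp
  ultimately show False by linarith
 qed
 hence kl: "k = l * (k div l)" by (simp add: minus_mod_eq_mult_div[symmetric])
 have regk: "regular (k * n) x z" for n
 proof (induction n)
  case (Suc n)
  have "(f x ^^ (k * n)) z = z" using per by (induction n) (simp_all add: funpow_add)
  thus ?case using Suc reg by (simp add: regular_add add.commute[of k])
 qed simp
 have rall: "regular n x z" for n by (rule regular_mono[OF regk[of n]]) (use k in simp)
 have np: "~ pole x ((f x ^^ j) z)" for j using rall[of "Suc j"] by (simp add: regular_Suc)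
 define C where "C = (%j. (f x ^^ j) z) ` {..<l}"
 have inj: "(f x ^^ i) z ~= (f x ^^ j) z" if "i < j" "j < l" for i j
 proof
  assume eq: "(f x ^^ i) z = (f x ^^ j) z"
  have "(f x ^^ (l - j + i)) z = (f x ^^ (l - j + j)) z" unfolding funpow_add o_def eq ..
  also have "... = z" using that l(2) by simp
  finally have "l <= l - j + i" using that by (intro min) auto
  thus False using that by simp
 qed
 have cyc: "cycle (f x) l C"
  unfolding cycle_def C_def using l np inj
  by (auto intro!: exI[of _ z] inj_onI) (metis linorder_neqE_nat)
 have dmult: "deriv (f x ^^ l) ((f x ^^ j) z) = deriv (f x ^^ l) z" for j
 proof -
  have "regular l x ((f x ^^ j) z)" using rall[of "j + l"] by (simp add: regular_add)
  hence "deriv (f x ^^ l) ((f x ^^ j) z) = (\<Prod>i<l. deriv (f x) ((f x ^^ (i + j)) z))"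
   by (simp add: deriv_iterate[OF x] funpow_add)
  also have "... = (\<Prod>i<l. deriv (f x) ((f x ^^ i) z))"
   by (rule prod_periodic_shift[of "%i. deriv (f x) ((f x ^^ i) z)"]) (simp add: funpow_add l(2))
  finally show ?thesis by (simp add: deriv_iterate[OF x rall])
 qed
 have "((f x ^^ l) has_field_derivative deriv (f x ^^ l) z) (at z)"
  unfolding deriv_iterate[OF x rall] by (rule iterate_differentiable[OF x rall])
 hence "(((f x ^^ l) ^^ (k div l)) has_field_derivative (deriv (f x ^^ l) z) ^ (k div l)) (at z)"
  by (intro funpow_deriv_fixed_point l(2)) (auto simp: field_differentiable_def)
 hence "deriv (f x ^^ k) z = (deriv (f x ^^ l) z) ^ (k div l)"
  unfolding funpow_mult kl[symmetric] by (rule DERIV_imp_deriv)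
 moreover have "has_multiplier (f x) l C (deriv (f x ^^ l) z)"
  unfolding has_multiplier_def using cyc dmult by (auto simp: C_def)
 moreover have "(f x ^^ 0) z : C" unfolding C_def using l(1) by (intro imageI) simp
 ultimately show ?thesis using that kl by simp
qed

lemma attracted_limit_in_cycle:
 assumes cyc: "cycle (f x) k C" and t: "t : basin (f x) C" and lim: "(%m. (f x ^^ (k * m)) t) ----> Z"
 shows "Z : C"
proof -
 obtain c where c: "c : C" using cyc unfolding cycle_def by force
 note co = cycle_orbit[OF cyc c]
 have "((%m. infdist ((f x ^^ (k * m)) t) C) ---> infdist Z C) sequentially" by (rule tendsto_infdist[OF lim])
 moreover have "((%m. infdist ((f x ^^ (k * m)) t) C) ---> 0) sequentially"
 proof (rule tendstoI)
  fix e :: real assume "e > 0"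
  then obtain n0 where n0: "!!n. n >= n0 ==> infdist ((f x ^^ n) t) C < e"
   using basin_converges[OF t] unfolding eventually_sequentially by blast
  have "dist (infdist ((f x ^^ (k * m)) t) C) 0 < e" if "m >= n0" for m
  proof -
   have "n0 <= k * m" using mult_le_mono[OF co(7) that] by simp
   thus ?thesis using n0[of "k * m"] by (simp add: infdist_nonneg)
  qed
  thus "\<forall>\<^sub>F m in sequentially. dist (infdist ((f x ^^ (k * m)) t) C) 0 < e" unfolding eventually_sequentially by blast
 qed
 ultimately have "infdist Z C = 0" by (rule LIMSEQ_unique)
 thus ?thesis using in_closed_iff_infdist_zero[OF finite_imp_closed[OF co(5)], of Z] c by blast
qed

lemma attracted_converges:
 assumes x: "x2 : \<Lambda>" and hm: "has_multiplier (f x2) k C \<mu>" "cmod \<mu> < 1" and b: "t x2 : basin (f x2) C" and t: "isCont t x2"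
 shows "\<forall>\<^sub>F y in nhds x2. ALL i. convergent (%m. (f y ^^ (k * m + i)) (t y))"
proof -
 have cyc: "cycle (f x2) k C" using hm by (simp add: has_multiplier_def)
 obtain c where c: "c : C" using cyc unfolding cycle_def by force
 note co = cycle_orbit[OF cyc c]
 obtain et where et: "et > 0" "!!p q. p : C ==> q : C ==> p ~= q ==> ball p et \<inter> ball q et = {}"
  by (rule finite_separation[OF co(5)]) blast
 obtain r where r: "0 < r" "trap (f x2) k c r (%j. ball ((f x2 ^^ j) c) et)"
  "!!i j. i < k ==> j < k ==> i ~= j ==> ball ((f x2 ^^ i) c) et \<inter> ball ((f x2 ^^ j) c) et = {}"
  by (rule attractor_trap[OF x hm c et]) blast+
 obtain n where n: "(f x2 ^^ n) (t x2) : ball c r" by (rule basin_enters_ball[OF x cyc c b r(1)])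
 have reg: "regular n x2 (t x2)" using basin_no_pole[OF b] by (simp add: regular_def)
 have "\<forall>\<^sub>F y in nhds x2. (f y ^^ n) (t y) : ball c r"
  by (rule topological_tendstoD[OF regular_along(2)[OF x reg t] open_ball n])
 moreover have "\<forall>\<^sub>F y in nhds x2. y : \<Lambda> & trap (f y) k c r (%j. ball ((f x2 ^^ j) c) et)"
  by (rule trap_persists[OF x r(2)]) simp
 ultimately show ?thesis
 proof eventually_elim
  case (elim y)
  hence y: "y : \<Lambda>" and tr: "trap (f y) k c r (%j. ball ((f x2 ^^ j) c) et)" by auto
  obtain z where z: "z : ball c r" "!!w. w : cball c r ==> (%n. (f y ^^ (k * n)) w) ----> z"
   by (rule trap_cycle[OF y tr r(3)]) blast+
  show ?case
  proof
   fix i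
   define j where "j = k * n - n + i"
   have "regular j y z" by (rule trap_iterates(3)[OF tr]) (use z(1) in simp)
   hence "((f y ^^ j) ---> (f y ^^ j) z) (nhds z)" by (rule iterate_tendsto(2)[OF y])
   moreover have "(%m. (f y ^^ (k * m)) ((f y ^^ n) (t y))) ----> z" by (rule z(2)) (use elim in simp)
   ultimately have l: "(%m. (f y ^^ j) ((f y ^^ (k * m)) ((f y ^^ n) (t y)))) ----> (f y ^^ j) z" by (rule filterlim_compose)
   have "(f y ^^ j) ((f y ^^ (k * m)) ((f y ^^ n) (t y))) = (f y ^^ (k * (m + n) + i)) (t y)" for m
   proof -
    have "n <= k * n" using mult_le_mono1[OF co(7), of n] by simp
    hence "j + (k * m + n) = k * (m + n) + i" unfolding j_def add_mult_distrib2 by linarith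
    thus ?thesis by (metis comp_apply funpow_add)
   qed
   hence "(%m. (f y ^^ (k * (m + n) + i)) (t y)) ----> (f y ^^ j) z" using l by simp
   thus "convergent (%m. (f y ^^ (k * m + i)) (t y))"
    by (intro convergentI) (rule LIMSEQ_offset[of "%m. (f y ^^ (k * m + i)) (t y)" n])
  qed
 qed
qed

end

context natural_slice
begin

text \<open>The limit functions exist near the parameter \<open>x2\<close>; by normality they extend to all of \<open>D\<close>, first as maps into the
  sphere. They never take the value infinity, as the next limit function would have an essential singularity there.\<close>

lemma passive_limits:
 assumes D: "open D" "connected D" "D <= \<Lambda>" and t: "t holomorphic_on \<Lambda>"
  and normal: "normal_sequence_on D (%n x. orbit (f x) (t x) n)"
  and x2: "x2 : D" "has_multiplier (f x2) k C \<mu>" "cmod \<mu> < 1" "t x2 : basin (f x2) C"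
 obtains Z where "!!i. Z i holomorphic_on D" "!!n x. x : D ==> regular n x (t x)"
  "!!i x. x : D ==> (%m. (f x ^^ (k * m + i)) (t x)) ----> Z i x"
proof -
 have x2L: "x2 : \<Lambda>" using x2(1) D(3) by blast
 have k: "k >= 1" using x2(2) by (simp add: has_multiplier_def cycle_def)
 have tD: "t holomorphic_on D" by (rule holomorphic_on_subset[OF t D(3)])
 have sc: "continuous_on D (%x. stereo (orbit (f x) (t x) n))" for n
  using normal unfolding normal_sequence_on_def by (simp add: o_def)
 have orb_Suc: "orbit (f x) z (Suc n) = Option.bind (orbit (f x) z n) (sph (f x))" for x z n by (simp add: orbit_def)
 have reg: "ALL x:D. regular n x (t x)" for n
 proof (induction n)
  case (Suc n)
  let ?G = "%x. sph (f x) ((f x ^^ n) (t x))"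
  have GO: "?G x = orbit (f x) (t x) (Suc n)" if "x : D" for x
   using Suc that by (simp add: orbit_eq regular_Suc sph_def)
  have "(%x. (f x ^^ n) (t x)) holomorphic_on D"
   by (rule iterate_parameter_holomorphic[OF D(1,3) tD]) (use Suc in blast)
  hence sh: "sphere_holomorphic D ?G" by (rule sphere_holomorphic_apply[OF D(1,3)])
  \<comment> \<open>The iterate after this one is continuous by normality and plays the part of the
    continuous image.\<close>
  have "?G x ~= None" if x: "x : D" for x
  proof (rule never_infinite[OF D sh sc[of "Suc (Suc n)"] _ x2(1) _ x])
   show "orbit (f x) (t x) (Suc (Suc n)) = sph (f x) z" if "x : D" "?G x = Some z" for x z
    using orb_Suc[of x "t x" "Suc n"] GO[OF that(1)] that(2) by (metis bind.bind_lunit)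
   show "?G x2 ~= None" using basin_no_pole[OF x2(4)] by (simp add: sph_def)
  qed
  hence "~ pole x ((f x ^^ n) (t x))" if "x : D" for x using that unfolding sph_def by metis
  thus ?case using Suc by (simp add: regular_Suc)
 qed simp
 have np: "~ pole x ((f x ^^ n) (t x))" if "x : D" for n x using bspec[OF reg[of "Suc n"] that] by (simp add: regular_Suc)
 define h where "h n x = (f x ^^ n) (t x)" for n x
 have hh: "h n holomorphic_on D" for n
  unfolding h_def by (rule iterate_parameter_holomorphic[OF D(1,3) tD]) (use reg in blast)
 have orb: "orbit (f x) (t x) n = Some (h n x)" if "x : D" for n x
  using reg that by (simp add: orbit_eq h_def)
 have sub: "EX b L. strict_mono b & (ALL K. compact K --> K <= D --> uniform_limit K (%n y. stereo (Some (h (a (b n)) y))) L sequentially)"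
  if a: "strict_mono a" for a :: "nat => nat"
 proof -
  obtain b L where b: "strict_mono b" "!!K. compact K & K <= D -->
    uniform_limit K (%n. stereo \<circ> (%x. orbit (f x) (t x) (a (b n)))) L sequentially"
   using normal a unfolding normal_sequence_on_def by blast
  have "uniform_limit K (%n y. stereo (Some (h (a (b n)) y))) L sequentially" if K: "compact K" "K <= D" for K
  proof -
   have "uniform_limit K (%n. stereo \<circ> (%x. orbit (f x) (t x) (a (b n)))) L sequentially" using b(2) K by blast
   thus ?thesis
    by (rule uniform_limit_cong'[THEN iffD1, rotated 2]) (use orb K(2) in "auto simp del: stereo.simps")
  qed
  thus ?thesis using b(1) by blast
 qed
 obtain T where T: "open T" "x2 : T" "T <= D" "!!y i. y : T ==> convergent (%m. h (k * m + i) y)"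
 proof -
  have "isCont t x2" by (rule holomorphic_isCont[OF t open_params x2L])
  from attracted_converges[OF x2L x2(2-4) this]
  obtain T0 where "open T0" "x2 : T0" "!!y i. y : T0 ==> convergent (%m. h (k * m + i) y)"
   unfolding eventually_nhds h_def by blast
  thus thesis using D(1) x2(1) by (intro that[of "T0 \<inter> D"]) auto
 qed
 define W where "W i y = lim (%m. h (k * m + i) y)" for i y
 have W: "(%m. h (k * m + i) y) ----> W i y" if "y : T" for i y
  using T(4)[OF that] by (simp add: W_def convergent_LIMSEQ_iff)
 \<comment> \<open>A first subsequence gives a limit of the chosen iterates, a further one a limit
   of the iterates one step later. The second limit is the image of the first and
   continuous.\<close>
 have ext: "EX b Z. strict_mono b & Z holomorphic_on D & (ALL x:D. (%n. h (k * a (b n) + i) x) ----> Z x)"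
  if a: "strict_mono a" for a :: "nat => nat" and i
 proof -
  have a0: "strict_mono (%n. k * a n + i)" using a k by (simp add: strict_mono_def)
  obtain b0 L0 where b0: "strict_mono b0" "!!K. compact K ==> K <= D ==>
    uniform_limit K (%n y. stereo (Some (h (k * a (b0 n) + i) y))) L0 sequentially"
   using sub[OF a0] by blast
  have a1: "strict_mono (%n. Suc (k * a (b0 n) + i))" using a k b0(1) by (simp add: strict_mono_def)
  obtain b1 L1 where b1: "strict_mono b1" "!!K. compact K ==> K <= D ==>
    uniform_limit K (%n y. stereo (Some (h (Suc (k * a (b0 (b1 n)) + i)) y))) L1 sequentially"
   using sub[OF a1] by blast
  obtain G0 where G0: "!!y. y : D ==> L0 y = stereo (G0 y)" "sphere_holomorphic D G0"
   by (rule sphere_limit[OF D(1) hh b0(2)]) blast+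
  obtain G1 where G1: "!!y. y : D ==> L1 y = stereo (G1 y)" "continuous_on D L1"
   by (rule sphere_limit[OF D(1) hh b1(2)]) blast+
  have lim0: "(%n. stereo (Some (h (k * a (b0 n) + i) y))) ----> stereo (G0 y)" if "y : D" for y
   using tendsto_uniform_limitI[OF b0(2)[of "{y}"], of y] G0(1)[OF that] that by simp
  have lim1: "(%n. stereo (Some (h (Suc (k * a (b0 (b1 n)) + i)) y))) ----> stereo (G1 y)" if "y : D" for y
   using tendsto_uniform_limitI[OF b1(2)[of "{y}"], of y] G1(1)[OF that] that by simp
  have fin: "G0 x ~= None" if x: "x : D" for x
  proof (rule never_infinite[OF D G0(2) _ _ x2(1) _ x])
   show "continuous_on D (%x. stereo (G1 x))" using G1(2) by (rule continuous_on_eq) (rule G1(1))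
   show "G1 y = sph (f y) z" if y: "y : D" and z: "G0 y = Some z" for y z
   proof -
    have yL: "y : \<Lambda>" using y D(3) by blast
    have "(%n. h (k * a (b0 n) + i) y) ----> z" using stereo_tendsto_Some(2)[OF lim0[OF y, unfolded z]] by simp
    hence hz: "(%n. h (k * a (b0 (b1 n)) + i) y) ----> z" using LIMSEQ_subseq_LIMSEQ[OF _ b1(1)] by (force simp: o_def)
    have fh: "f y (h n y) = h (Suc n) y" for n by (simp add: h_def)
    have "(%n. stereo (Some (h (Suc (k * a (b0 (b1 n)) + i)) y))) ----> stereo (sph (f y) z)"
    proof (cases "pole y z")
     case False
     have "((%w. (y, w)) ---> (y, z)) (nhds z)" by (intro tendsto_Pair tendsto_const filterlim_ident)
     from filterlim_compose[OF near_nonpole(2)[OF yL False] this] have "((%w. f y w) ---> f y z) (nhds z)" by simp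
     from filterlim_compose[OF this hz] show ?thesis using False unfolding fh by (simp add: sph_def stereo_Some_tendsto del: stereo.simps)
    next
     case True
     have pr: "((%n. (y, h (k * a (b0 (b1 n)) + i) y)) ---> (y, z)) sequentially" by (intro tendsto_Pair tendsto_const hz)
     have i0: "(%n. inverse (h (Suc (k * a (b0 (b1 n)) + i)) y)) ----> 0"
      using filterlim_compose[OF near_pole(2)[OF yL True] pr] by (simp add: fh)
     have "\<forall>\<^sub>F n in sequentially. h (Suc (k * a (b0 (b1 n)) + i)) y ~= 0"
      using eventually_compose_filterlim[OF near_pole(1)[OF yL True] pr]
      by eventually_elim (use np[OF y] in "simp add: fh h_def")
     hence ev: "\<forall>\<^sub>F n in sequentially. sphere_flip (stereo (Some (inverse (h (Suc (k * a (b0 (b1 n)) + i)) y)))) =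
       stereo (Some (h (Suc (k * a (b0 (b1 n)) + i)) y))"
      by eventually_elim (simp add: stereo_inverse sphere_flip del: stereo.simps)
     have "(%n. sphere_flip (stereo (Some (inverse (h (Suc (k * a (b0 (b1 n)) + i)) y))))) ----> sphere_flip (stereo (Some 0))"
      using stereo_Some_tendsto[OF i0] unfolding tendsto_iff sphere_flip(2) .
     moreover have "sphere_flip (stereo (Some 0)) = stereo (sph (f y) z)" using True by (simp add: sph_def sphere_flip_def)
     ultimately show ?thesis using Lim_transform_eventually[OF _ ev] by simp
    qed
    from LIMSEQ_unique[OF lim1[OF y] this] show ?thesis by (simp only: stereo_injective)
   qed
   have "strict_mono (a \<circ> b0)" using strict_mono_o[OF a b0(1)] .
   from LIMSEQ_subseq_LIMSEQ[OF W[OF T(2), of i] this]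
   have "(%n. h (k * a (b0 n) + i) x2) ----> W i x2" by (simp add: o_def)
   from LIMSEQ_unique[OF lim0[OF x2(1)] stereo_Some_tendsto[OF this]] show "G0 x2 ~= None" by (auto simp only: stereo_injective)
  qed
  define Z where "Z x = the (G0 x)" for x
  have "Z holomorphic_on D" unfolding Z_def by (rule sphere_holomorphic_finite[OF G0(2) D(1) fin])
  moreover have "(%n. h (k * a (b0 n) + i) x) ----> Z x" if x: "x : D" for x
  proof -
   have "G0 x = Some (Z x)" using fin[OF x] by (simp add: Z_def)
   thus ?thesis using stereo_tendsto_Some(2)[of "%n. Some (h (k * a (b0 n) + i) x)"] lim0[OF x] by simp
  qed
  ultimately show ?thesis using b0(1) by blast
 qed
 have "EX Z. Z holomorphic_on D & (ALL x:D. (%m. h (k * m + i) x) ----> Z x)" for i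
 proof -
  have ZW: "Z y = W i y" if Z: "ALL x:D. (%n. h (k * a (b n) + i) x) ----> Z x" and ab: "strict_mono a" "strict_mono b" and y: "y : T"
   for a b :: "nat => nat" and Z y
  proof -
   have "y : D" using y T(3) by blast
   moreover have "(%n. h (k * a (b n) + i) y) ----> W i y"
    using LIMSEQ_subseq_LIMSEQ[OF W[OF y] strict_mono_o[OF ab]] by (simp add: o_def)
   ultimately show ?thesis using Z LIMSEQ_unique by blast
  qed
  obtain b Z where Z: "strict_mono b" "Z holomorphic_on D" "ALL x:D. (%n. h (k * id (b n) + i) x) ----> Z x"
   using ext[of id i] by (auto simp: strict_mono_id)
  \<comment> \<open>Any subsequential limit agrees with the known limit \<open>W i\<close> on the
    open set \<open>T\<close> near \<open>x2\<close>, hence with \<open>Z\<close> on all of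
    \<open>D\<close> by the identity theorem.\<close>
  have "(%m. h (k * m + i) x) ----> Z x" if x: "x : D" for x
  proof (rule LIMSEQ_by_subsequences)
   fix a :: "nat => nat" assume a: "strict_mono a"
   obtain b' Z' where Z': "strict_mono b'" "Z' holomorphic_on D" "ALL x:D. (%n. h (k * a (b' n) + i) x) ----> Z' x"
    using ext[OF a, of i] by blast
   have "Z x = Z' x"
   proof (rule analytic_continuation_open[of T D Z Z'])
    show "Z z = Z' z" if "z : T" for z
     using ZW[OF Z(3) strict_mono_id Z(1) that] ZW[OF Z'(3) a Z'(1) that] by simp
   qed (use T D Z(2) Z'(2) x in auto)
   thus "EX b. strict_mono b & (%n. h (k * a (b n) + i) x) ----> Z x" using Z'(1,3) x by auto
  qed
  thus ?thesis using Z(2) by blast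
 qed
 then obtain Z where "!!i. Z i holomorphic_on D & (ALL x:D. (%m. h (k * m + i) x) ----> Z i x)" by metis
 thus ?thesis using that[of Z] reg by (auto simp: h_def)
qed

text \<open>The limits over the residue classes mod k are permuted by the map, so \<open>Z 0\<close>
  is fixed by the k-th iterate, and the derivative there is a product of holomorphic functions of
  the parameter.\<close>

lemma passive_cycle:
 assumes D: "open D" "connected D" "D <= \<Lambda>" and t: "t holomorphic_on \<Lambda>"
  and normal: "normal_sequence_on D (%n x. orbit (f x) (t x) n)"
  and x2: "x2 : D" "has_multiplier (f x2) k C \<mu>" "cmod \<mu> < 1" "t x2 : basin (f x2) C"
 obtains Z where "Z holomorphic_on D" "!!n x. x : D ==> regular n x (t x)" "!!n x. x : D ==> regular n x (Z x)"
  "!!x. x : D ==> (f x ^^ k) (Z x) = Z x" "!!x. x : D ==> (%m. (f x ^^ (k * m)) (t x)) ----> Z x"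
  "(%x. deriv (f x ^^ k) (Z x)) holomorphic_on D"
proof -
 obtain Z where Z: "!!i. Z i holomorphic_on D" "!!n x. x : D ==> regular n x (t x)"
  "!!i x. x : D ==> (%m. (f x ^^ (k * m + i)) (t x)) ----> Z i x"
  by (rule passive_limits[OF D t normal x2]) blast
 have step: "~ pole x (Z i x) & f x (Z i x) = Z (Suc i) x" if x: "x : D" for i x
 proof -
  have "~ pole x ((f x ^^ n) (t x))" for n using Z(2)[OF x, of "Suc n"] by (simp add: regular_Suc)
  thus ?thesis
   using limit_value[OF _ tendsto_const Z(3)[OF x, of i] sequentially_bot, of x "Z (Suc i) x"] Z(3)[OF x, of "Suc i"] x D(3) by auto
 qed
 have it: "(f x ^^ i) (Z 0 x) = Z i x" if "x : D" for i x using step[OF that] by (induction i) auto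
 have reg: "regular n x (Z 0 x)" if "x : D" for n x using it[OF that] step[OF that] by (simp add: regular_def)
 show ?thesis
 proof (rule that[of "Z 0"])
  show "Z 0 holomorphic_on D" by (rule Z(1))
  show "(%m. (f x ^^ (k * m)) (t x)) ----> Z 0 x" if "x : D" for x using Z(3)[OF that, of 0] by simp
  show "(f x ^^ k) (Z 0 x) = Z 0 x" if x: "x : D" for x
  proof -
   have "(%m. (f x ^^ (k * Suc m)) (t x)) ----> Z 0 x" using LIMSEQ_Suc[OF Z(3)[OF x, of 0]] by simp
   moreover have "(%m. (f x ^^ (k * Suc m)) (t x)) ----> Z k x" using Z(3)[OF x, of k] by (simp add: add.commute)
   ultimately show ?thesis unfolding it[OF x] using LIMSEQ_unique by blast
  qed
  have "(%x. \<Prod>j<k. deriv (f x) (Z j x)) holomorphic_on D"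
   by (intro holomorphic_on_prod holomorphic_apply(2)[OF D(1,3)] Z(1)) (use step in blast)
  thus "(%x. deriv (f x ^^ k) (Z 0 x)) holomorphic_on D"
   by (rule holomorphic_transform) (use deriv_iterate[OF _ reg] it D(3) in auto)
 qed (use Z(2) reg in auto)
qed

lemma passive_ball:
 assumes "x1 : \<Lambda>" "x1 ~: activity_locus \<Lambda> f t"
 obtains d where "d > 0" "ball x1 d <= \<Lambda>" "normal_sequence_on (ball x1 d) (%n x. orbit (f x) (t x) n)"
proof -
 obtain U where U: "open U" "x1 : U" "U <= \<Lambda>" "normal_sequence_on U (%n x. orbit (f x) (t x) n)"
  using assms unfolding activity_locus_def by blast
 then obtain d where d: "d > 0" "ball x1 d <= U" using open_contains_ball by blast
 have "normal_sequence_on (ball x1 d) (%n x. orbit (f x) (t x) n)"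
  using U(4) d(2) continuous_on_subset unfolding normal_sequence_on_def by (meson subset_trans)
 thus ?thesis using that d U(3) by blast
qed

lemma attracted_of_limit:
 assumes x: "x : \<Lambda>" and reg: "!!n. regular n x w" and lim: "(%m. (f x ^^ (k * m)) w) ----> Z"
  and C: "C : attractors x" "Z : C"
 shows "w : basin (f x) C"
proof -
 have "Z : basin (f x) C" using C cycle_in_basin[OF x] unfolding attractors_def by blast
 then obtain U where U: "open U" "Z : U" "U <= basin (f x) C" unfolding basin_def by blast
 have "\<forall>\<^sub>F m in sequentially. (f x ^^ (k * m)) w : U" by (rule topological_tendstoD[OF lim U(1,2)])
 then obtain m where "(f x ^^ (k * m)) w : U" using eventually_happens'[OF sequentially_bot] by blast
 thus ?thesis using basin_backward[OF x reg] U(3) by blast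
qed

end

lemma zeros_countable:
 assumes g: "g holomorphic_on D" and D: "open D" "connected D" and ne: "y : D" "g y ~= (0::complex)"
 shows "countable {x : D. g x = 0}"
proof (rule countable_discrete)
 fix x assume x: "x : {x : D. g x = 0}"
 obtain r where "0 < r" "ball x r <= D" "!!z. z : ball x r - {x} ==> g z ~= 0"
  by (rule isolated_zeros[OF g D _ _ ne, of x]) (use x in auto)
 thus "EX e>0. ball x e \<inter> {x : D. g x = 0} <= {x}" by blast
qed

text \<open>Near a repelling fixed point distances to it do not decrease, so a convergent orbit must
  already have arrived.\<close>

lemma repelling_lands:
 fixes ph :: "complex => complex"
 assumes d: "(ph has_field_derivative l) (at z)" "ph z = z" "cmod l > 1"
  and w: "!!m. w (Suc m) = ph (w m)" "w ----> z"
 shows "EX m. w m = z"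
proof -
 have "((%y. (ph y - z) / (y - z)) ---> l) (at z)" using d(1,2) by (simp add: has_field_derivative_iff)
 hence "\<forall>\<^sub>F y in at z. 1 < cmod ((ph y - z) / (y - z))" using d(3) by (intro order_tendstoD(1)[OF tendsto_norm])
 hence "\<forall>\<^sub>F y in nhds z. y ~= z --> 1 < cmod ((ph y - z) / (y - z))" by (simp add: eventually_at_filter)
 hence "\<forall>\<^sub>F y in nhds z. dist y z <= dist (ph y) z"
  by eventually_elim (use d(2) in "auto simp: dist_norm norm_divide divide_simps split: if_splits")
 from eventually_compose_filterlim[OF this w(2)]
 obtain M where M: "!!m. m >= M ==> dist (w m) z <= dist (w (Suc m)) z" unfolding eventually_sequentially w(1) by blast
 have "dist (w M) z <= dist (w (M + n)) z" for n
  by (induction n) (use M[of "M + _"] order_trans in fastforce)+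
 moreover have "(%n. dist (w (M + n)) z) ----> dist z z"
  using LIMSEQ_ignore_initial_segment[OF w(2), of M] by (intro tendsto_dist) (simp_all add: add.commute)
 ultimately have "dist (w M) z <= dist z z" by (intro LIMSEQ_le_const) auto
 thus ?thesis by auto
qed

context natural_slice
begin

text \<open>The limit of the orbit continues the cycle of \<open>x2\<close> to \<open>x1\<close> as
  a periodic point with multiplier \<open>m x\<close> holomorphic in \<open>x\<close>. It cannot
  become repelling, since the orbit still converges to it without landing identically. So |m| <= 1
  on the disc, and the maximum principle makes it less than 1, as it is at
  \<open>x2\<close>.\<close>

lemma attraction_closed:
 assumes x1: "x1 : \<Lambda>" and t: "t holomorphic_on \<Lambda>" "x1 ~: activity_locus \<Lambda> f t"
 shows "\<forall>\<^sub>F x in nhds x1. ALL C:attractors x. t x : basin (f x) C & (ALL n. (f x ^^ n) (t x) ~: C) -->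
  (EX C1:attractors x1. t x1 : basin (f x1) C1)"
proof -
 obtain d where d: "d > 0" "ball x1 d <= \<Lambda>" "normal_sequence_on (ball x1 d) (%n x. orbit (f x) (t x) n)"
  by (rule passive_ball[OF x1 t(2)]) blast
 let ?D = "ball x1 d"
 have "EX C1:attractors x1. t x1 : basin (f x1) C1"
  if x2: "x2 : ?D" and C: "C : attractors x2" and b: "t x2 : basin (f x2) C" and nl: "!!n. (f x2 ^^ n) (t x2) ~: C" for x2 C
 proof -
  obtain k \<mu> where hm: "has_multiplier (f x2) k C \<mu>" "cmod \<mu> < 1" using C by (auto simp: attractors_def)
  obtain Z where Z: "Z holomorphic_on ?D" "!!n x. x : ?D ==> regular n x (t x)" "!!n x. x : ?D ==> regular n x (Z x)"
   "!!x. x : ?D ==> (f x ^^ k) (Z x) = Z x" "!!x. x : ?D ==> (%m. (f x ^^ (k * m)) (t x)) ----> Z x"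
   "(%x. deriv (f x ^^ k) (Z x)) holomorphic_on ?D"
   by (rule passive_cycle[OF open_ball connected_ball d(2) t(1) d(3) x2 hm b]) blast
  define m where "m x = deriv (f x ^^ k) (Z x)" for x
  have mh: "m holomorphic_on ?D" using Z(6) by (simp add: m_def[abs_def])
  have cyc: "cycle (f x2) k C" using hm by (simp add: has_multiplier_def)
  have k: "k >= 1" using cyc by (simp add: cycle_def)
  have ZC: "Z x2 : C" by (rule attracted_limit_in_cycle[OF cyc b Z(5)[OF x2]])
  have mx2: "cmod (m x2) < 1" using hm ZC by (simp add: m_def has_multiplier_def)
  have le1: "cmod (m x) <= 1" if x: "x : ?D" for x
  proof (rule ccontr)
   assume "~ cmod (m x) <= 1"
   moreover have "isCont m x" by (rule holomorphic_isCont[OF mh open_ball x])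
   hence "(m ---> m x) (nhds x)" by (simp add: isCont_def tendsto_at_iff_tendsto_nhds)
   ultimately have "\<forall>\<^sub>F y in nhds x. 1 < cmod (m y)" by (intro order_tendstoD(1)[OF tendsto_norm]) auto
   with eventually_nhds_in_open[OF open_ball x] have "\<forall>\<^sub>F y in nhds x. y : ?D & 1 < cmod (m y)" by eventually_elim simp
   then obtain r where r: "r > 0" "!!y. dist y x < r ==> y : ?D & 1 < cmod (m y)" unfolding eventually_nhds_metric by blast
   have "EX n. (f y ^^ (k * n)) (t y) = Z y" if y: "y : ball x r" for y
   proof (rule repelling_lands[where ph = "f y ^^ k" and l = "m y"])
    have yD: "y : ?D" "1 < cmod (m y)" using r(2)[of y] y by (auto simp: dist_commute)
    hence yL: "y : \<Lambda>" using d(2) by blast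
    show "((f y ^^ k) has_field_derivative m y) (at (Z y))"
     unfolding m_def deriv_iterate[OF yL Z(3)[OF yD(1)]] by (rule iterate_differentiable[OF yL Z(3)[OF yD(1)]])
    show "(f y ^^ k) (Z y) = Z y" "(%n. (f y ^^ (k * n)) (t y)) ----> Z y" "1 < cmod (m y)" using Z(4,5) yD by auto
    show "(f y ^^ (k * Suc n)) (t y) = (f y ^^ k) ((f y ^^ (k * n)) (t y))" for n by (simp add: funpow_add)
   qed
   hence sub: "ball x r <= (\<Union>n. {y : ?D. (f y ^^ (k * n)) (t y) - Z y = 0})" using r(2) by (auto simp: dist_commute)
   \<comment> \<open>Landing times are integers, so one of them occurs for uncountably many
     parameters; by the identity theorem it occurs for all, including \<open>x2\<close>, where
     landing is excluded.\<close>
   have "EX n. uncountable {y : ?D. (f y ^^ (k * n)) (t y) - Z y = 0}"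
   proof (rule ccontr)
    assume "~ ?thesis"
    hence "countable (\<Union>n. {y : ?D. (f y ^^ (k * n)) (t y) - Z y = 0})" by (intro countable_UN) auto
    from countable_subset[OF sub this] show False using uncountable_ball[OF r(1), of x] by contradiction
   qed
   then obtain n where n: "uncountable {y : ?D. (f y ^^ (k * n)) (t y) - Z y = 0}" by (rule exE)
   have "(%y. (f y ^^ (k * n)) (t y) - Z y) holomorphic_on ?D"
    by (intro holomorphic_intros Z(1) iterate_parameter_holomorphic[OF open_ball d(2)] holomorphic_on_subset[OF t(1) d(2)] Z(2))
   from zeros_countable[OF this open_ball connected_ball x2] n have "(f x2 ^^ (k * n)) (t x2) = Z x2" by auto
   thus False using nl ZC by metis
  qed
  have x1D: "x1 : ?D" using d(1) by simp
  have "cmod (m x1) < 1"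
  proof (rule ccontr)
   assume "~ cmod (m x1) < 1"
   hence "cmod (m x1) = 1" using le1[OF x1D] by simp
   hence "m constant_on ?D"
    by (intro maximum_modulus_principle[OF mh open_ball connected_ball open_ball order_refl x1D]) (use le1 in auto)
   thus False using mx2 \<open>cmod (m x1) = 1\<close> x1D x2 unfolding constant_on_def by force
  qed
  \<comment> \<open>At \<open>x1\<close> the period may have dropped, so the bound is first known
    for a power of the multiplier.\<close>
  moreover obtain k' q C1 \<mu>1 where C1: "has_multiplier (f x1) k' C1 \<mu>1" "Z x1 : C1" "k = k' * q" "deriv (f x1 ^^ k) (Z x1) = \<mu>1 ^ q"
   by (rule periodic_point_cycle[OF x1 Z(3)[OF x1D] Z(4)[OF x1D] k])
  ultimately have "cmod \<mu>1 ^ q < 1" by (simp add: m_def norm_power)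
  hence "cmod \<mu>1 < 1" using one_le_power[of "cmod \<mu>1" q] by linarith
  hence C1a: "C1 : attractors x1" using C1(1) by (auto simp: attractors_def)
  thus ?thesis using attracted_of_limit[OF x1 Z(2)[OF x1D] Z(5)[OF x1D] C1a C1(2)] by blast
 qed
 note closed = this
 have "\<forall>\<^sub>F x in nhds x1. x : ?D" by (rule eventually_nhds_in_open) (use d(1) in auto)
 thus ?thesis by eventually_elim (use closed in blast)
qed

end

section \<open>Shell components\<close>

context natural_slice
begin

section \<open>Parameters in shell components\<close>

definition good :: "nat => complex => bool" where
 "good k x \<longleftrightarrow> (EX C. attracted_away_from_fixed f s v F x k C)"

lemma goodI:
 assumes x: "x : \<Lambda>" and hm: "has_multiplier (f x) k C \<mu>" "cmod \<mu> < 1" and v: "v x : basin (f x) C"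
  and F: "!!i. i : F ==> s i x ~: basin (f x) C"
 shows "good k x"
proof -
 have "\<mu> ~= 0" using superattracting_captures[OF x] hm(1) F by blast
 thus ?thesis unfolding good_def attracted_away_from_fixed_def attracting_cycle_def using hm v F by auto
qed

lemma goodD:
 assumes "good k x"
 obtains C \<mu> where "has_multiplier (f x) k C \<mu>" "cmod \<mu> < 1" "v x : basin (f x) C" "!!i. i : F ==> s i x ~: basin (f x) C"
  "C : attractors x" "attracting_cycle (f x) k C"
 using assms unfolding good_def attracted_away_from_fixed_def attracting_cycle_def attractors_def by blast

lemma good_regular: "good k x ==> regular n x (v x)"
 using goodD[of k x] basin_no_pole unfolding regular_def by metis

lemma singular_function_memb: "v : singular_functions" "i : F ==> s i : singular_functions"
 using F_subset by (auto simp: singular_functions_def)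

lemma fixed_value_attractor_persists:
 assumes i: "i : F" and x1: "x1 : \<Lambda>" and c: "continuation eps x1 x \<Phi>" and C': "C' : attractors x" "s i x : basin (f x) C'"
 shows "EX C1:attractors x1. s i x1 : basin (f x1) C1 & C' = \<Phi> C1"
proof -
 note \<Phi> = continuationD[OF c]
 obtain C1 where C1: "C1 : attractors x1" "s i x1 : basin (f x1) C1" using fixed_value_attracted[OF i \<Phi>(1) C' x1] by blast
 have "C' = \<Phi> C1"
  by (rule attractors_basin_unique[OF C'(1) \<Phi>(4)[OF C1(1)] C'(2) \<Phi>(6)[OF C1(1) singular_function_memb(2)[OF i] C1(2)]])
 thus ?thesis using C1 by blast
qed

text \<open>The cycle and its capture of \<open>v\<close> continue. A fixed value in its basin would
  come from an attractor of \<open>x1\<close>, which by injectivity of the continuation is the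
  original cycle.\<close>

lemma good_open:
 assumes x1: "x1 : \<Lambda>" and g: "good k x1"
 shows "\<forall>\<^sub>F x in nhds x1. good k x"
proof -
 obtain C \<mu> where C: "has_multiplier (f x1) k C \<mu>" "cmod \<mu> < 1" "v x1 : basin (f x1) C"
   "!!i. i : F ==> s i x1 ~: basin (f x1) C" "C : attractors x1"
  by (rule goodD[OF g]) blast
 show ?thesis using continuation_exists[OF x1 zero_less_one]
 proof eventually_elim
  case (elim x)
  then obtain \<Phi> where c: "continuation 1 x1 x \<Phi>" by (rule exE)
  note \<Phi> = continuationD[OF c]
  obtain \<mu>' where hm: "has_multiplier (f x) k (\<Phi> C) \<mu>'" "cmod \<mu>' < 1" using \<Phi>(3)[OF C(5,1)] by blast
  show ?case
  proof (rule goodI[OF \<Phi>(1) hm])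
   show "v x : basin (f x) (\<Phi> C)" by (rule \<Phi>(6)[OF C(5) singular_function_memb(1) C(3)])
   fix i assume i: "i : F"
   show "s i x ~: basin (f x) (\<Phi> C)"
   proof
    assume "s i x : basin (f x) (\<Phi> C)"
    then obtain C1 where C1: "C1 : attractors x1" "s i x1 : basin (f x1) C1" "\<Phi> C = \<Phi> C1"
     using fixed_value_attractor_persists[OF i x1 c \<Phi>(4)[OF C(5)]] by blast
    hence "C = C1" using inj_onD[OF \<Phi>(2)] C(5) by blast
    thus False using C(4)[OF i] C1(2) by blast
   qed
  qed
 qed
qed

lemma good_passive:
 assumes x1: "x1 : \<Lambda>" and g: "good k x1"
 shows "x1 ~: activity_locus \<Lambda> f v"
proof -
 have "\<forall>\<^sub>F x in nhds x1. good k x & x : \<Lambda>"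
  using good_open[OF x1 g] eventually_nhds_in_open[OF open_params x1] by eventually_elim simp
 then obtain U where U: "open U" "x1 : U" "!!x. x : U ==> good k x & x : \<Lambda>" unfolding eventually_nhds by blast
 show ?thesis by (rule passive_if_never_landing[OF U(1) _ U(2)]) (use U(3) good_regular in blast)+
qed

text \<open>Nearby parameters are good, so \<open>v\<close> never lands and is passive;
  \<open>control\<close> makes the other values that are not fixed passive as well, and passive
  values gain no new attractors.\<close>

lemma good_J_stable:
 assumes x1: "x1 : \<Lambda>" and g: "good k x1"
 shows "J_stable \<Lambda> f x1"
proof (rule J_stableI[OF x1])
 fix t assume "t : singular_functions - s ` F"
 then consider "t = v" | j where "t = s j" "j : {1..<N} - F" unfolding singular_functions_def by blast
 hence "t holomorphic_on \<Lambda> & x1 ~: activity_locus \<Lambda> f t"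
 proof cases
  case 1 thus ?thesis using v_holomorphic good_passive[OF x1 g] by simp
 next
  case 2
  thus ?thesis using s_holomorphic control good_passive[OF x1 g] by blast
 qed
 thus "\<forall>\<^sub>F x in nhds x1. ALL C:attractors x. t x : basin (f x) C & (ALL n. (f x ^^ n) (t x) ~: C) -->
   (EX C1:attractors x1. t x1 : basin (f x1) C1)"
  using attraction_closed[OF x1] by blast
qed

lemma attractors_bounded:
 assumes x1: "x1 : \<Lambda>"
 obtains R where "!!C p z. C : attractors x1 ==> p : C ==> z : ball p 1 ==> cmod z <= R"
proof -
 have "finite C" if "C : attractors x1" for C
  using that unfolding attractors_def has_multiplier_def cycle_def by blast
 hence "finite (\<Union>(attractors x1))" using attractors_finite[OF x1] by blast
 hence "bounded (\<Union>(attractors x1))" by (rule finite_imp_bounded)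
 then obtain B where B: "ALL p:\<Union>(attractors x1). cmod p <= B" unfolding bounded_iff by (rule exE)
 show ?thesis
 proof (rule that[of "B + 1"])
  fix C p z assume p: "C : attractors x1" "p : C" "z : ball p (1::real)"
  hence "cmod p <= B" using bspec[OF B UnionI[OF p(1,2)]] by simp
  moreover have "cmod (z - p) <= 1" using p(3) by (simp add: dist_norm norm_minus_commute)
  ultimately show "cmod z <= B + 1" using norm_triangle_sub[of z p] by linarith
 qed
qed

text \<open>\<open>R1\<close> bounds all continuations of attractors of \<open>x0\<close>. The new
  cycle has a point beyond it, so it is no such continuation and attracts no fixed value.\<close>

lemma landing_near_good:
 assumes x0: "x0 : landing_set m" and dl: "dl > 0"
 obtains S where "open S" "connected S" "x0 : closure S"
  "!!x. x : S ==> x : \<Lambda> & dist x x0 < dl & good (m + 2) x & (EX C:attractors x. EX z:C. cmod z > R)"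
proof -
 have x0L: "x0 : \<Lambda>" using x0 by (simp add: landing_set_def)
 obtain e kp where e: "e > 0" "ball x0 e <= \<Lambda>" "kp holomorphic_on ball x0 e" "kp x0 = 0" "!!y. y : ball x0 e - {x0} ==> kp y ~= 0"
  "!!y. y : ball x0 e - {x0} ==> ~ pole y ((f y ^^ m) (v y))"
  "!!y. y : ball x0 e - {x0} ==> f y ((f y ^^ m) (v y)) = inverse (kp y)"
  by (rule isolated_landing[OF x0]) blast
 obtain rh A H where tr: "tract x0 rh A H" by (rule tract_exists[OF x0L])
 obtain R1 where R1: "!!C p z. C : attractors x0 ==> p : C ==> z : ball p 1 ==> cmod z <= R1"
  by (rule attractors_bounded[OF x0L]) blast
 obtain M dl1 where M: "0 < dl1" "!!x u. x ~= x0 ==> dist x x0 < dl1 ==> Re u < - M ==> \<bar>Im u\<bar> < pi ==>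
   ~ pole x ((f x ^^ m) (v x)) ==> f x ((f x ^^ m) (v x)) = H x u ==>
   EX C \<mu>. has_multiplier (f x) (m + 2) C \<mu> & cmod \<mu> < 1 & v x : basin (f x) C & (EX z:C. cmod z > max R R1)"
  by (rule virtual_parameter_attracts[OF x0 tr]) blast
 obtain dl2 where dl2: "dl2 > 0" "!!x. dist x x0 < dl2 ==> EX \<Phi>. continuation 1 x0 x \<Phi>"
  using continuation_exists[OF x0L zero_less_one] unfolding eventually_nhds_metric by blast
 define dl3 where "dl3 = min (min dl dl1) (min dl2 e)"
 have dl3: "dl3 > 0" using dl M(1) dl2(1) e(1) by (simp add: dl3_def)
 obtain S where S: "open S" "connected S" "x0 : closure S"
  "!!x. x : S ==> x ~= x0 & dist x x0 < dl3 & (EX u. Re u < - M & \<bar>Im u\<bar> < pi & inverse (kp x) = H x u)"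
  by (rule asymptotic_component[OF tr e(3,1,4,5) dl3]) blast+
 show ?thesis
 proof (rule that[OF S(1-3)])
  fix x assume "x : S"
  then obtain u where x: "x ~= x0" "dist x x0 < dl3" and u: "Re u < - M" "\<bar>Im u\<bar> < pi" "inverse (kp x) = H x u" using S(4) by blast
  have xd: "dist x x0 < dl" "dist x x0 < dl1" "dist x x0 < dl2" "x : ball x0 e - {x0}"
   using x by (auto simp: dl3_def dist_commute)
  obtain \<Phi> where c: "continuation 1 x0 x \<Phi>" using dl2(2)[OF xd(3)] by (rule exE)
  note \<Phi> = continuationD[OF c]
  note xL = \<Phi>(1)
  obtain C \<mu> z where C: "has_multiplier (f x) (m + 2) C \<mu>" "cmod \<mu> < 1" "v x : basin (f x) C" "z : C" "cmod z > max R R1"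
   using M(2)[OF x(1) xd(2) u(1,2) e(6)[OF xd(4)]] e(7)[OF xd(4)] u(3) by auto
  have Ca: "C : attractors x" using C(1,2) by (auto simp: attractors_def)
  have "good (m + 2) x"
  proof (rule goodI[OF xL C(1-3)])
   fix i assume i: "i : F"
   show "s i x ~: basin (f x) C"
   proof
    assume "s i x : basin (f x) C"
    then obtain C1 where C1: "C1 : attractors x0" "C = \<Phi> C1"
     using fixed_value_attractor_persists[OF i x0L c Ca] by blast
    then obtain p where "p : C1" "z : ball p 1" using \<Phi>(5)[OF C1(1)] C(4) by blast
    thus False using R1[OF C1(1)] C(5) by fastforce
   qed
  qed
  thus "x : \<Lambda> & dist x x0 < dl & good (m + 2) x & (EX C:attractors x. EX z:C. cmod z > R)"
   using xL xd(1) Ca C(4,5) by auto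
 qed
qed

text \<open>An active parameter has landings arbitrarily near, hence nearby attractors with points
  beyond any bound. At a J-stable parameter all nearby attractors are continuations and remain
  bounded.\<close>

lemma J_stable_passive:
 assumes x1: "x1 : \<Lambda>" and J: "J_stable \<Lambda> f x1"
 shows "x1 ~: activity_locus \<Lambda> f v"
proof
 assume act: "x1 : activity_locus \<Lambda> f v"
 obtain R where R: "!!C p z. C : attractors x1 ==> p : C ==> z : ball p 1 ==> cmod z <= R"
  by (rule attractors_bounded[OF x1]) blast
 obtain d where d: "d > 0" "!!x. dist x x1 < d ==> EX \<Phi>. continuation 1 x1 x \<Phi> & attractors x = \<Phi> ` attractors x1"
  using J_stable_continuation[OF x1 J zero_less_one] unfolding eventually_nhds_metric by blast
 have dL: "ball x1 d <= \<Lambda>" using d(2) continuationD(1) by (metis dist_commute mem_ball subsetI)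
 have "EX y:ball x1 d. EX n. ~ regular n y (v y)"
 proof (rule ccontr)
  assume "~ ?thesis"
  hence "x1 ~: activity_locus \<Lambda> f v"
   by (intro passive_if_never_landing[OF open_ball dL]) (use d(1) in auto)
  thus False using act by blast
 qed
 then obtain y n where y: "y : ball x1 d" "~ regular n y (v y)" by blast
 then obtain m where m: "y : landing_set m" using landing_first[of y n] dL by blast
 have dy: "d - dist x1 y > 0" using y(1) by simp
 obtain S where S: "y : closure S"
  "!!x. x : S ==> x : \<Lambda> & dist x y < d - dist x1 y & good (m + 2) x & (EX C:attractors x. EX z:C. cmod z > R)"
  by (rule landing_near_good[OF m dy, of R]) blast
 then obtain x where "x : S" by fastforce
 then obtain C z where x: "dist x y < d - dist x1 y" "C : attractors x" "z : C" "cmod z > R" using S(2) by blast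
 have "dist x x1 < d" using x(1) dist_triangle[of x x1 y] by (simp add: dist_commute)
 then obtain \<Phi> where \<Phi>: "continuation 1 x1 x \<Phi>" "attractors x = \<Phi> ` attractors x1" using d(2) by blast
 then obtain C1 where "C1 : attractors x1" "C = \<Phi> C1" using x(2) by blast
 thus False using continuationD(5)[OF \<Phi>(1), of C1 z] R[of C1 _ z] x(3,4) by force
qed

text \<open>By passivity the limit point \<open>Z\<close> of the orbit of \<open>v\<close> extends
  holomorphically to \<open>x1\<close>. J-stability places it near the attractors of
  \<open>x1\<close> along good parameters, and finitely many cycles form a closed set, so it lies on
  one of them.\<close>

lemma good_closed:
 assumes x1: "x1 : \<Lambda>" and J: "J_stable \<Lambda> f x1" and fr: "\<exists>\<^sub>F x in nhds x1. good k x"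
 shows "good k x1"
proof -
 obtain d where d: "d > 0" "ball x1 d <= \<Lambda>" "normal_sequence_on (ball x1 d) (%n x. orbit (f x) (v x) n)"
  by (rule passive_ball[OF x1 J_stable_passive[OF x1 J]]) blast
 let ?D = "ball x1 d"
 have x1D: "x1 : ?D" using d(1) by simp
 have evD: "\<forall>\<^sub>F x in nhds x1. x : ?D" by (rule eventually_nhds_in_open[OF open_ball x1D])
 obtain x2 where x2: "x2 : ?D" "good k x2" using frequently_ex[OF frequently_eventually_conj[OF fr evD]] by blast
 obtain C \<mu> where C: "has_multiplier (f x2) k C \<mu>" "cmod \<mu> < 1" "v x2 : basin (f x2) C" by (rule goodD[OF x2(2)]) blast
 obtain Z where Z: "Z holomorphic_on ?D" "!!n x. x : ?D ==> regular n x (v x)"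
  "!!x. x : ?D ==> (%m. (f x ^^ (k * m)) (v x)) ----> Z x"
  by (rule passive_cycle[OF open_ball connected_ball d(2) v_holomorphic d(3) x2(1) C]) blast
 have inC: "EX C:attractors x. Z x : C" if x: "x : ?D" "good k x" for x
 proof -
  obtain C \<mu> where C: "has_multiplier (f x) k C \<mu>" "v x : basin (f x) C" "C : attractors x" by (rule goodD[OF x(2)]) blast
  thus ?thesis using attracted_limit_in_cycle[OF _ C(2) Z(3)[OF x(1)]] unfolding has_multiplier_def by blast
 qed
 have "(Z ---> Z x1) (nhds x1)"
  using holomorphic_isCont[OF Z(1) open_ball x1D] by (simp add: isCont_def tendsto_at_iff_tendsto_nhds)
 note Zl = tendstoD[OF this]
 let ?P = "\<Union>(attractors x1)"
 have near: "EX p:?P. dist (Z x1) p < eps" if eps: "eps > 0" for eps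
 proof -
  have eps2: "eps/2 > 0" using eps by simp
  obtain x where x: "good k x" "x : ?D" "dist (Z x) (Z x1) < eps/2"
   "EX \<Phi>. continuation (eps/2) x1 x \<Phi> & attractors x = \<Phi> ` attractors x1"
   using frequently_ex[OF frequently_eventually_conj[OF fr eventually_conj[OF evD
    eventually_conj[OF Zl[OF eps2] J_stable_continuation[OF x1 J eps2]]]]] by blast
  obtain C where "C : attractors x" "Z x : C" using inC[OF x(2,1)] by blast
  moreover obtain \<Phi> where \<Phi>: "continuation (eps/2) x1 x \<Phi>" "attractors x = \<Phi> ` attractors x1" using x(4) by blast
  ultimately obtain C1 where C1: "C1 : attractors x1" "Z x : \<Phi> C1" by blast
  obtain p where p: "p : C1" "Z x : ball p (eps/2)" using continuationD(5)[OF \<Phi>(1) C1] by blast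
  hence "dist (Z x1) p < eps" using x(3) dist_triangle_half_r[of "Z x" "Z x1" eps p] by (simp add: dist_commute)
  thus ?thesis using p C1(1) by blast
 qed
 have "finite C" if "C : attractors x1" for C
  using that unfolding attractors_def has_multiplier_def cycle_def by blast
 hence "finite ?P" using attractors_finite[OF x1] by blast
 hence "closed ?P" by (rule finite_imp_closed)
 moreover have "Z x1 : closure ?P" unfolding closure_approachable using near by (metis dist_commute)
 ultimately obtain C1 where C1: "C1 : attractors x1" "Z x1 : C1" by auto
 have vb: "v x1 : basin (f x1) C1" by (rule attracted_of_limit[OF x1 Z(2)[OF x1D] Z(3)[OF x1D] C1])
 obtain l m where hm: "has_multiplier (f x1) l C1 m" "cmod m < 1" using C1(1) by (auto simp: attractors_def)
 \<comment> \<open>One good parameter close to \<open>x1\<close> suffices to identify the period and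
   to exclude the fixed values: its cycle is the continuation of the one found.\<close>
 obtain x \<Phi> where x: "good k x" and c: "continuation 1 x1 x \<Phi>"
  using frequently_ex[OF frequently_eventually_conj[OF fr continuation_exists[OF x1 zero_less_one]]] by (elim exE conjE)
 note \<Phi> = continuationD[OF c]
 obtain C' \<mu>' where C': "has_multiplier (f x) k C' \<mu>'" "v x : basin (f x) C'" "!!i. i : F ==> s i x ~: basin (f x) C'" "C' : attractors x"
  by (rule goodD[OF x]) blast
 have "v x : basin (f x) (\<Phi> C1)" by (rule \<Phi>(6)[OF C1(1) singular_function_memb(1) vb])
 hence eq: "C' = \<Phi> C1" by (rule attractors_basin_unique[OF C'(4) \<Phi>(4)[OF C1(1)] C'(2)])
 obtain m' where "has_multiplier (f x) l (\<Phi> C1) m'" using \<Phi>(3)[OF C1(1) hm(1)] by blast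
 hence "l = k" using multiplier_unique(1)[OF C'(1)[unfolded eq]] by metis
 show ?thesis
 proof (rule goodI[OF x1 hm(1)[unfolded \<open>l = k\<close>] hm(2) vb])
  fix i assume i: "i : F"
  show "s i x1 ~: basin (f x1) C1"
  proof
   assume "s i x1 : basin (f x1) C1"
   hence "s i x : basin (f x) (\<Phi> C1)" by (rule \<Phi>(6)[OF C1(1) singular_function_memb(2)[OF i]])
   thus False using C'(3)[OF i] eq by blast
  qed
 qed
qed

text \<open>The connected set \<open>S\<close> lies in one stable component, in which being good is
  open and closed. The parameter \<open>x0\<close> is in its closure but not in it, for good
  parameters never land on a pole.\<close>

lemma landing_boundary:
 assumes x0: "x0 : landing_set m"
 shows "(EX \<Omega>. shell_component \<Lambda> f s v F (m + 2) \<Omega> & x0 : frontier \<Omega>) &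
    (ALL U. open U & x0 : U --> (EX x:U \<inter> \<Lambda>. EX C. attracting_cycle (f x) (m + 2) C))"
proof -
 obtain S where S: "connected S" "x0 : closure S" "!!x. x : S ==> x : \<Lambda> & good (m + 2) x"
  by (rule landing_near_good[OF x0 zero_less_one]) blast
 let ?J = "\<Lambda> - bifurcation_locus \<Lambda> f"
 have J: "x : ?J \<longleftrightarrow> x : \<Lambda> & J_stable \<Lambda> f x" for x by (auto simp: bifurcation_locus_def)
 have SJ: "S <= ?J" using S(3) good_J_stable J by blast
 obtain y where y: "y : S" using S(2) by fastforce
 define \<Omega> where "\<Omega> = connected_component_set ?J y"
 have yJ: "y : ?J" using SJ y by blast
 have \<Omega>: "\<Omega> : components ?J" unfolding \<Omega>_def by (rule componentsI[OF yJ])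
 have S\<Omega>: "S <= \<Omega>" unfolding \<Omega>_def by (rule connected_component_maximal[OF y S(1) SJ])
 have \<Omega>J: "\<Omega> <= ?J" unfolding \<Omega>_def by (rule connected_component_subset)
 have good: "good (m + 2) x" if x: "x : \<Omega>" for x
 proof (rule connected_induction_simple[where S = \<Omega> and P = "good (m + 2)" and a = y and b = x])
  show "connected \<Omega>" by (simp add: \<Omega>_def)
  fix a assume a: "a : \<Omega>"
  hence aJ: "a : \<Lambda>" "J_stable \<Lambda> f a" using \<Omega>J J by blast+
  have "EX T. open T & a : T & (ALL x:T. ALL y:T. good (m + 2) x --> good (m + 2) y)"
  proof (cases "good (m + 2) a")
   case True
   from good_open[OF aJ(1) True] obtain T where "open T" "a : T" "ALL x:T. good (m + 2) x"
    unfolding eventually_nhds by (elim exE conjE)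
   thus ?thesis by (intro exI[of _ T]) simp
  next
   case False
   hence "~ (\<exists>\<^sub>F x in nhds a. good (m + 2) x)" using good_closed[OF aJ] by blast
   hence "\<forall>\<^sub>F x in nhds a. ~ good (m + 2) x" by (simp add: frequently_def)
   then obtain T where "open T" "a : T" "ALL x:T. ~ good (m + 2) x" unfolding eventually_nhds by (elim exE conjE)
   thus ?thesis by (intro exI[of _ T]) simp
  qed
  then obtain T where T: "open T" "a : T" "ALL x:T. ALL y:T. good (m + 2) x --> good (m + 2) y" by (elim exE conjE)
  show "EX T. openin (top_of_set \<Omega>) T & a : T & (ALL x:T. ALL y:T. good (m + 2) x --> good (m + 2) y)"
   by (intro exI[of _ "\<Omega> \<inter> T"]) (use T a in auto)
 qed (use x y S\<Omega> S(3) in auto)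
 have "x0 ~: \<Omega>"
 proof
  assume "x0 : \<Omega>"
  hence "regular (Suc m) x0 (v x0)" using good_regular[OF good] by blast
  thus False using x0 by (simp add: landing_set_def regular_Suc)
 qed
 moreover have "x0 : closure \<Omega>" using S(2) closure_mono[OF S\<Omega>] by blast
 ultimately have "x0 : frontier \<Omega>" using interior_subset by (auto simp: frontier_def)
 moreover have "shell_component \<Lambda> f s v F (m + 2) \<Omega>"
  unfolding shell_component_def using \<Omega> good unfolding good_def by blast
 moreover have "EX x:U \<inter> \<Lambda>. EX C. attracting_cycle (f x) (m + 2) C" if U: "open U" "x0 : U" for U
 proof -
  obtain x where x: "x : S" "x : U" using S(2) U by (meson closure_iff_nhds_not_empty disjoint_iff order_refl)
  thus ?thesis using S(3)[OF x(1)] unfolding good_def attracted_away_from_fixed_def by blast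
 qed
 ultimately show ?thesis by blast
qed

end

section \<open>Deduction of the theorem from the definition of the slice\<close>

lemma natural_sliceI:
 assumes slice: "dynamically_natural_slice p q r \<Lambda> f N s v F"
 shows "natural_slice \<Lambda> f N s v F"
proof -
 have fam: "open \<Lambda>" "(- \<Lambda>) sparse_in UNIV" "holomorphic_family \<Lambda> f"
  and sv: "slice_singular_values \<Lambda> f N s v" and po: "slice_poles \<Lambda> f" and fv: "slice_fixed_values \<Lambda> f N s v F"
  using slice unfolding dynamically_natural_slice_def slice_conditions_def slice_family_def by auto
 obtain a b where vab: "!!x. x : \<Lambda> ==> v x = a * x + b" using sv unfolding slice_singular_values_def by blast
 have sing: "Some w : singular_values (f x) ==> w = v x | (EX i:{1..<N}. w = s i x)" if "x : \<Lambda>" for x w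
 proof -
  assume "Some w : singular_values (f x)"
  hence "w : {w. Some w : singular_values (f x)}" by simp
  also have "... = insert (v x) ((%i. s i x) ` {1..<N})" using sv that unfolding slice_singular_values_def by blast
  finally show ?thesis by auto
 qed
 obtain \<pi> :: "int => complex => complex" where \<pi>: "!!i. \<pi> i holomorphic_on \<Lambda>"
  "!!x. x : \<Lambda> ==> bij_betw (%i. \<pi> i x) UNIV {z. is_pole (f x) z}" using po unfolding slice_poles_def by blast
 show ?thesis
 proof unfold_locales
  show "open \<Lambda>" "holomorphic_family \<Lambda> f" by fact+
  \<comment> \<open>The slice is the plane minus a sparse set of punctures, and such a set does not
    disconnect the plane.\<close>
  have "connected (UNIV - (- \<Lambda>))" using sparse_imp_connected[OF _ connected_UNIV open_UNIV fam(2)] by simp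
  thus "connected \<Lambda>" by (simp add: Diff_eq)
  show "v holomorphic_on \<Lambda>"
   by (rule holomorphic_transform[of "%x. a * x + b"]) (use vab in "auto intro!: holomorphic_intros")
  show "s i holomorphic_on \<Lambda>" if "i : {1..<N}" for i using sv that unfolding slice_singular_values_def by blast
  show "activity_locus \<Lambda> f v ~= {}" using sv unfolding slice_singular_values_def by blast
  show "F <= {1..<N}" using fv unfolding slice_fixed_values_def by blast
  show "activity_locus \<Lambda> f (s j) <= activity_locus \<Lambda> f v" if "j : {1..<N} - F" for j
   using fv that unfolding slice_fixed_values_def by blast
  show "EX k \<mu>. (cmod \<mu> < 1 | (EX n>=1. \<mu> ^ n = 1)) & (ALL x:\<Lambda>. EX C. has_multiplier (f x) k C \<mu> & s i x : basin (f x) C)"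
   if "i : F" for i using fv that unfolding slice_fixed_values_def by blast
  fix x assume x: "x : \<Lambda>"
  show "Some (v x) : asymptotic_values (f x)" using sv x unfolding slice_singular_values_def by blast
  show "w = v x | (EX i:{1..<N}. w = s i x)" if "Some w : asymptotic_values (f x)" for w
   by (rule sing[OF x]) (use that in "simp add: singular_values_def")
  show "s i x ~= v x" if "i : {1..<N}" for i
  proof -
   have "v x ~: (%i. s i x) ` {1..<N}" using sv x unfolding slice_singular_values_def by blast
   thus ?thesis using that by force
  qed
  show "EX i:F. f x z = s i x" if "~ is_pole (f x) z" "deriv (f x) z = 0" for z
  proof -
   have "sph (f x) z : critical_values (f x)" using that by (auto simp: critical_values_def critical_point_def)
   hence "Some (f x z) : critical_values (f x)" using that by (simp add: sph_def)
   thus ?thesis using fv x unfolding slice_fixed_values_def by blast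
  qed
  show "infinite {z. is_pole (f x) z}" using bij_betw_finite[OF \<pi>(2)[OF x]] infinite_UNIV_int by blast
 next
  show "EX \<pi>0 \<pi>1. \<pi>0 holomorphic_on \<Lambda> & \<pi>1 holomorphic_on \<Lambda> &
    (ALL x:\<Lambda>. is_pole (f x) (\<pi>0 x) & is_pole (f x) (\<pi>1 x) & \<pi>0 x ~= \<pi>1 x)"
  proof (rule exI[of _ "\<pi> 0"], rule exI[of _ "\<pi> 1"], intro conjI ballI \<pi>(1))
   fix x assume x: "x : \<Lambda>"
   show "is_pole (f x) (\<pi> 0 x)" "is_pole (f x) (\<pi> 1 x)" using bij_betwE[OF \<pi>(2)[OF x]] by auto
   show "\<pi> 0 x ~= \<pi> 1 x" using inj_onD[OF bij_betw_imp_inj_on[OF \<pi>(2)[OF x]], of 0 1] by auto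
  qed
 qed
qed

theorem theoremB:
  fixes p q r N k :: nat
    and \<Lambda> :: "complex set"
    and f :: "complex \<Rightarrow> complex \<Rightarrow> complex"
    and s :: "nat \<Rightarrow> complex \<Rightarrow> complex"
    and v :: "complex \<Rightarrow> complex"
    and F :: "nat set"
    and x\<^sub>0 :: complex
  assumes "p \<ge> 1" and "q \<ge> 1" and "r \<ge> 2"
    and "dynamically_natural_slice p q r \<Lambda> f N s v F"
    and "virtual_cycle_parameter \<Lambda> f v k x\<^sub>0"
  shows "(\<exists>\<Omega>. shell_component \<Lambda> f s v F k \<Omega> \<and> x\<^sub>0 \<in> frontier \<Omega>) \<and>
         (\<forall>U. open U \<and> x\<^sub>0 \<in> U \<longrightarrow> (\<exists>x\<in>U \<inter> \<Lambda>. \<exists>C. attracting_cycle (f x) k C))"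
proof -
 interpret natural_slice \<Lambda> f N s v F by (rule natural_sliceI[OF assms(4)])
 obtain a :: "nat => complex option" where k: "k >= 2" and x0: "x\<^sub>0 : \<Lambda>" and a: "a 0 = None" "a 1 = Some (v x\<^sub>0)"
  "!!i. i : {1..k - 1} ==> EX z. a i = Some z & sph (f x\<^sub>0) z = a ((i + 1) mod k)"
  using assms(5) unfolding virtual_cycle_parameter_def by blast
 \<comment> \<open>The points of the virtual cycle are numbered from 1, so \<open>a (j + 1)\<close>
   is the j-th iterate of \<open>v\<close>; all of these up to index k - 1 are finite.\<close>
 have orbit: "j + 1 < k --> regular j x\<^sub>0 (v x\<^sub>0) & a (j + 1) = Some ((f x\<^sub>0 ^^ j) (v x\<^sub>0))" for j
 proof (induction j)
  case (Suc j)
  show ?case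
  proof
   assume j: "Suc j + 1 < k"
   hence IH: "regular j x\<^sub>0 (v x\<^sub>0)" "a (j + 1) = Some ((f x\<^sub>0 ^^ j) (v x\<^sub>0))" using Suc by auto
   have s: "sph (f x\<^sub>0) ((f x\<^sub>0 ^^ j) (v x\<^sub>0)) = a (j + 2)" using a(3)[of "j + 1"] IH(2) j by auto
   have "j + 2 : {1..k - 1}" using j by simp
   hence "a (j + 2) ~= None" using a(3) by fastforce
   thus "regular (Suc j) x\<^sub>0 (v x\<^sub>0) & a (Suc j + 1) = Some ((f x\<^sub>0 ^^ Suc j) (v x\<^sub>0))"
    using s IH(1) by (auto simp: regular_Suc sph_def split: if_splits)
  qed
 qed (use a in simp)
 \<comment> \<open>The last finite point is a (k - 1), the m-th iterate; its image has index k mod k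
   = 0 and is infinity, so the point is a pole.\<close>
 define m where "m = k - 2"
 have km: "k = m + 2" using k by (simp add: m_def)
 have "regular m x\<^sub>0 (v x\<^sub>0)" "a (m + 1) = Some ((f x\<^sub>0 ^^ m) (v x\<^sub>0))" using orbit[of m] km by auto
 moreover have "sph (f x\<^sub>0) ((f x\<^sub>0 ^^ m) (v x\<^sub>0)) = None"
  using a(1) a(3)[of "m + 1"] \<open>a (m + 1) = _\<close> km by auto
 ultimately have "x\<^sub>0 : landing_set m" using x0 by (auto simp: landing_set_def sph_def split: if_splits)
 from landing_boundary[OF this] show ?thesis unfolding km .
qed

end
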